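(* Suppose Assumption (A) of the context is satisfied with constants $K_0,K_1,K_2>0$ sufficiently large, and let $\Pi$ be a prior on $\mathbf F$ such that $\mathbf F_I:=(F_m)_{m\in I}$ and $\bar{\mathbf F}_I:=(F_m)_{m\notin I}$ are independent for all $I\subseteq\mathbb{Z}_+$. Then there are constants $c_0,c_1,c_2,\delta_0>0$ such that for all $0<\delta\le\delta_0$, for all $\frac{512\,c_0\delta}{1+512\,c_0\delta}<\alpha\le\frac12$, and for all nonempty $I\subseteq\mathbb{Z}_+$, $$\mathbb{E}_L\Pi(\mathscr C_*\cap\mathscr S_I\mid X_1,\dots,X_n)\le\Bigg\{\frac{3\big(\exp\{-c_2n\mathcal E_I^2+c_12^{J_0}|I|\}\big)^{\alpha}}{(1-e^{-c_2n\mathcal E_I^2})^{2\alpha}}\Big(\frac{\Pi(\mathcal A_I)}{\Pi(\tilde{\mathcal A}_I)}\Big)^{1-\alpha}\Bigg\}^{\frac1{1+2\delta}},$$ where $S_{\mathbf F_I}:=\sum_{m\in I}F_m$, $\mathcal E_I:=\inf\{\mathbb{E}_L[S_{\mathbf F_I}^2]^{1/2}:\mathbf F\in\mathscr S_I\}$, $\mathcal A_I:=\{\mathbf F_I:\|F_m\|_2>H_I(m)\ \forall m\in I\}$ and $\tilde{\mathcal A}_I:=\{\mathbf F_I:\mathbb{E}_L[S_{\mathbf F_I}^2]\le\delta^2\mathcal E_I^2,\ \|S_{\mathbf F_I}\|_\infty\le\delta\}$; provided that $\Pi(\tilde{\mathcal A}_I)>0$ and $\mathcal E_I>0$ for all nonempty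 $I\subseteq\mathbb{Z}_+$.
   Context: Wavelets: $\{\varphi_{j,k}:(j,k)\in\mathcal V\}$, $\mathcal V\subseteq\mathbb{Z}_+^2$, is the $S$-regular orthonormal boundary-corrected Cohen–Daubechies–Vial wavelet basis of $L^2([0,1])$, $j$ the level; $\langle f,g\rangle=\int_0^1fg$. For $s>0$, $\|f\|_{\infty,\infty,s}:=\sup_{(j,k)\in\mathcal V}2^{j(s+1/2)}|\langle f,\varphi_{j,k}\rangle|$, and $\Sigma(R,s)$ is the set of uniformly continuous $L:[0,1]\to\mathbb{R}$ with $\|L\|_{\infty,\infty,s}\le R$ and $\int_0^1e^L=1$. $p_L=e^L$, $P_L$ its distribution. Parameterization: fix $R>0$, $0<s\le S$ and $L\in\Sigma(R,s)$. Fix an integer $J_0$, chosen large enough that $\langle1,\varphi_{j,k}\rangle=0$ for $j>J_0$. $B_0:=\{(j,k)\in\mathcal V:j\le J_0\}$; $\psi:\mathbb{N}\to\mathcal V\setminus B_0$ is the lexicographic enumeration; for $m\ge1$, $B_m:=\{\psi(m)\}$ and $J_m$ is the level of $\psi(m)$ (for $m=0$, $J_m$ is $J_0$). $\mathbb{E}_L$ is expectation under $P_L$, or under i.i.d. $X_1,\dots,X_n\sim P_L$. $\mathcal F_m:=\mathrm{span}\{\varphi_{j,k}-\mathbb{E}_L[\varphi_{j,k}]:(j,k)\in B_m\}$, $\mathcal F:=\prod_{m\ge0}\mathcal F_m$. The parameter is $\mathbf F=(F_m)_{m\ge0}\in\mathcal F$ with $\mathbb{E}_L[\exp\{\sum_mF_m\}]<\infty$,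 and its log-density is $L_{\mathbf F}:=L+\sum_mF_m-\log\mathbb{E}_L[\exp\{\sum_mF_m\}]$. A prior $\Pi$ is a probability measure on such parameters; $\Pi(A\mid X_1,\dots,X_n)=\int_A\prod_ie^{L_{\mathbf F}(X_i)}\Pi(d\mathbf F)/\int\prod_ie^{L_{\mathbf F}(X_i)}\Pi(d\mathbf F)$; $\Pi$ also denotes the induced laws of $\mathbf F_I$, $\bar{\mathbf F}_I$. For infinite $I$, $\mathbb{E}_L[S_{\mathbf F_I}^2]=+\infty$ if the series does not converge in $L^2(P_L)$. Sets: $0<\delta\le1$, $\mathscr C_*:=\{\mathbf F\in\mathcal F:\sup_{x\in[0,1]}\sum_{m\ge0}|F_m(x)|\le\delta\}$. For $I\subseteq\mathbb{Z}_+$, $\mathscr S_I:=\{\mathbf F\in\mathcal F:\|F_m\|_2>H_I(m)\ \forall m\in I,\ \|F_m\|_2\le H_I(m)\ \forall m\notin I\}$. Here $\Gamma,\gamma>0$, $\xi>1$, $\varepsilon_n^*(s)=(\log(n)/n)^{s/(2s+1)}$; $j_n$ is an integer with $\gamma2^{-(j_n+1)(s+1/2)}<\Gamma\sqrt{\log(n)/n}\le\gamma2^{-j_n(s+1/2)}$ if $s>1/2$, and $\gamma2^{-(j_n+1)(s+1/2)}<\Gamma2^{-j_n/2}\varepsilon_n^*(s)\le\gamma2^{-j_n(s+1/2)}$ if $0<s\le1/2$; $\rho_m=\sqrt{\log(n)/n}$ if $s>1/2$, $\rho_m=2^{-J_m/2}\varepsilon_n^*(s)$ if $0<s\le1/2$;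 $H_I(m)=\Gamma\xi^{-\mathbf 1_{0\in I}\mathbf 1_{m\ne0}}\rho_m$ if $J_m\le j_n$, $H_I(m)=\gamma2^{-J_m(s+1/2)}$ if $J_m>j_n$. Assumption (A), with constants $K_0,\dots,K_4>0$ depending solely on $(R,s)$: (1) $J_0\ge K_0\max\{1,\log(1/\delta),\log\gamma\}$; (2) $\log n\ge K_1\max\{2^{J_0},\delta^{-2},\log\Gamma,\log\gamma,\log\xi\}$; (3) $\xi\ge K_2\delta^{-1}\max\{1,\gamma\}2^{J_0}$; (4) $\gamma\ge K_3\max\{1,\delta^{-1}\}$; (5) $\Gamma\ge\max\{\gamma,K_42^{J_0},K_4\xi\}$. Constants in the conclusion may depend on $R,s$ and the wavelet basis, but not on $n$, $I$, $\alpha$, $\delta,J_0,\Gamma,\gamma,\xi$ nor on $L\in\Sigma(R,s)$. *)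

theory Defs
  imports "HOL-Probability.Probability"
begin

section \<open>Wavelets on the unit interval (Cohen, Daubechies and Vial)\<close>

definition unit_leb :: "real measure" where
  "unit_leb = restrict_space lborel {0..1}"

definition ip :: "(real \<Rightarrow> real) \<Rightarrow> (real \<Rightarrow> real) \<Rightarrow> real" where
  "ip f g = (LINT x|unit_leb. f x * g x)"

definition norm2 :: "(real \<Rightarrow> real) \<Rightarrow> real" where
  "norm2 f = sqrt (ip f f)"

definition times_cont_diff :: "nat \<Rightarrow> (real \<Rightarrow> real) \<Rightarrow> bool" where
  "times_cont_diff S f \<longleftrightarrow>
     (\<forall>i<S. \<forall>x. (deriv ^^ i) f field_differentiable (at x)) \<and>
     continuous_on UNIV ((deriv ^^ S) f)"

text \<open>The Daubechies scaling function \<open>\<phi>\<close> and wavelet \<open>\<psi>\<close> with \<open>N\<close> vanishing moments and filter \<open>h\<close>,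
  shifted so that both supports are \<open>[1 - N, N]\<close>. The condition on alternating moments of \<open>h\<close> says
  that \<open>\<psi>\<close> has \<open>N\<close> vanishing moments.\<close>

definition daubechies :: "nat \<Rightarrow> (int \<Rightarrow> real) \<Rightarrow> (real \<Rightarrow> real) \<Rightarrow> (real \<Rightarrow> real) \<Rightarrow> bool" where
  "daubechies N h \<phi> \<psi> \<longleftrightarrow>
     (\<forall>n. n \<notin> {1 - int N..int N} \<longrightarrow> h n = 0) \<and>
     (\<Sum>n\<in>{1 - int N..int N}. h n) = sqrt 2 \<and>
     (\<forall>k. (\<Sum>n\<in>{1 - int N..int N}. h n * h (n + 2 * k)) = of_bool (k = 0)) \<and>
     (\<forall>p<N. (\<Sum>n\<in>{1 - int N..int N}. (-1) powi n * of_int n ^ p * h n) = 0) \<and>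
     (\<forall>x. x \<notin> {1 - real N..real N} \<longrightarrow> \<phi> x = 0) \<and>
     (LINT x|lborel. \<phi> x) = 1 \<and>
     (\<forall>k::int. (LINT x|lborel. \<phi> x * \<phi> (x - of_int k)) = of_bool (k = 0)) \<and>
     (\<forall>x. \<phi> x = sqrt 2 * (\<Sum>n\<in>{1 - int N..int N}. h n * \<phi> (2 * x - of_int n))) \<and>
     (\<forall>x. \<psi> x = sqrt 2 * (\<Sum>n\<in>{1 - int N..int N}. (-1) powi n * h (1 - n) * \<phi> (2 * x - of_int n)))"

text \<open>The functions on the half-line that are orthonormalized into the edge scaling functions; together
  with the interior translates \<open>\<phi>(\<cdot> - m)\<close>, \<open>m \<ge> N\<close>, they generate the polynomials of degree
  less than \<open>N\<close>. The support of the \<open>k\<close>-th one is \<open>[0, 2N - 1 - k]\<close>.\<close>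

definition edge_seed :: "nat \<Rightarrow> (real \<Rightarrow> real) \<Rightarrow> nat \<Rightarrow> real \<Rightarrow> real" where
  "edge_seed N \<phi> k x = (\<Sum>n\<le>2 * N - 2. real (n choose k) * \<phi> (x + real n - real N + 1))"

text \<open>Edge scaling functions \<open>\<phi>e k\<close> and edge wavelets \<open>\<psi>e k\<close>, \<open>k < N\<close>, on the half-line \<open>[0,\<infinity>)\<close>.
  The first clause together with orthonormality says that the \<open>\<phi>e k\<close> are, up to sign, the Gram-Schmidt
  orthonormalization of the seeds, started from the seed with the shortest support. The
  \<open>\<psi>e k\<close> lie in the half-line multiresolution space of level 1 and are orthogonal to the one of
  level 0 and to the interior wavelets; both \<open>\<phi>e k\<close> and \<open>\<psi>e k\<close> are supported in \<open>[0, N + k]\<close>.\<close>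

definition cdv_edge ::
  "nat \<Rightarrow> (real \<Rightarrow> real) \<Rightarrow> (real \<Rightarrow> real) \<Rightarrow> (nat \<Rightarrow> real \<Rightarrow> real) \<Rightarrow> (nat \<Rightarrow> real \<Rightarrow> real) \<Rightarrow> bool" where
  "cdv_edge N \<phi> \<psi> \<phi>e \<psi>e \<longleftrightarrow>
     (\<forall>k<N. \<exists>c. \<forall>x\<ge>0. \<phi>e k x = (\<Sum>i\<in>{N - 1 - k..<N}. c i * edge_seed N \<phi> i x)) \<and>
     (\<forall>k<N. \<forall>l<N. (LINT x:{0..}|lborel. \<phi>e k x * \<phi>e l x) = of_bool (k = l)) \<and>
     (\<forall>k<N. \<exists>a b. \<forall>x\<ge>0. \<psi>e k x = (\<Sum>l<N. a l * \<phi>e l (2 * x))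
                                 + (\<Sum>m\<in>{N..N + 2 * k}. b m * \<phi> (2 * x - real m))) \<and>
     (\<forall>k<N. \<forall>l<N. (LINT x:{0..}|lborel. \<psi>e k x * \<psi>e l x) = of_bool (k = l)) \<and>
     (\<forall>k<N. \<forall>l<N. (LINT x:{0..}|lborel. \<psi>e k x * \<phi>e l x) = 0) \<and>
     (\<forall>k<N. \<forall>m\<ge>N. (LINT x:{0..}|lborel. \<psi>e k x * \<phi> (x - real m)) = 0) \<and>
     (\<forall>k<N. \<forall>m\<ge>N. (LINT x:{0..}|lborel. \<psi>e k x * \<psi> (x - real m)) = 0)"

text \<open>The \<open>2 ^ j\<close> functions of resolution \<open>j\<close> on the unit interval: \<open>N\<close> left-edge functions, the
  interior dilated translates of \<open>f\<close>, and \<open>N\<close> right-edge functions. The right-edge functions are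
  reflected left-edge functions of the reflected pair \<open>\<phi>(1 - \<cdot>)\<close>, \<open>\<psi>(1 - \<cdot>)\<close>.\<close>

definition cdv_level ::
  "nat \<Rightarrow> (real \<Rightarrow> real) \<Rightarrow> (nat \<Rightarrow> real \<Rightarrow> real) \<Rightarrow> (nat \<Rightarrow> real \<Rightarrow> real) \<Rightarrow> nat \<Rightarrow> nat \<Rightarrow> real \<Rightarrow> real" where
  "cdv_level N f fl fr j k x = 2 powr (real j / 2) *
     (if k < N then fl k (2 ^ j * x)
      else if k < 2 ^ j - N then f (2 ^ j * x - real k)
      else fr (2 ^ j - 1 - k) (2 ^ j * (1 - x)))"

text \<open>\<open>l0\<close> is the coarsest level. It carries the \<open>2 ^ l0\<close> scaling functions of resolution \<open>l0\<close>
  (indices \<open>k < 2 ^ l0\<close>) followed by the \<open>2 ^ l0\<close> wavelets of resolution \<open>l0\<close>.\<close>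

definition wav_index :: "nat \<Rightarrow> (nat \<times> nat) set" where
  "wav_index l0 = {(j, k). j \<ge> l0 \<and> k < (if j = l0 then 2 ^ (l0 + 1) else 2 ^ j)}"

text \<open>The last two clauses (orthonormal basis of \<open>L\<^sup>2([0,1])\<close>) hold for every system built in this way,
  by a theorem of Cohen, Daubechies and Vial.\<close>

definition cdv_basis :: "nat \<Rightarrow> nat \<Rightarrow> (nat \<times> nat \<Rightarrow> real \<Rightarrow> real) \<Rightarrow> bool" where
  "cdv_basis S l0 w \<longleftrightarrow>
     (\<exists>N h \<phi> \<psi> \<phi>l \<psi>l \<phi>r \<psi>r.
        0 < N \<and> S \<le> N \<and> 2 * N \<le> 2 ^ l0 \<and>
        daubechies N h \<phi> \<psi> \<and> times_cont_diff S \<phi> \<and>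
        cdv_edge N \<phi> \<psi> \<phi>l \<psi>l \<and>
        cdv_edge N (\<lambda>x. \<phi> (1 - x)) (\<lambda>x. \<psi> (1 - x)) \<phi>r \<psi>r \<and>
        (\<forall>k<2 ^ l0. \<forall>x\<in>{0..1}. w (l0, k) x = cdv_level N \<phi> \<phi>l \<phi>r l0 k x) \<and>
        (\<forall>k<2 ^ l0. \<forall>x\<in>{0..1}. w (l0, 2 ^ l0 + k) x = cdv_level N \<psi> \<psi>l \<psi>r l0 k x) \<and>
        (\<forall>j>l0. \<forall>k<2 ^ j. \<forall>x\<in>{0..1}. w (j, k) x = cdv_level N \<psi> \<psi>l \<psi>r j k x)) \<and>
     (\<forall>u\<in>wav_index l0. \<forall>v\<in>wav_index l0. ip (w u) (w v) = of_bool (u = v)) \<and>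
     (\<forall>f\<in>borel_measurable unit_leb. integrable unit_leb (\<lambda>x. (f x)\<^sup>2) \<longrightarrow>
        (\<forall>v\<in>wav_index l0. ip f (w v) = 0) \<longrightarrow> (AE x in unit_leb. f x = 0))"

section \<open>The class of log-densities\<close>

definition wav_norm :: "nat \<Rightarrow> (nat \<times> nat \<Rightarrow> real \<Rightarrow> real) \<Rightarrow> real \<Rightarrow> (real \<Rightarrow> real) \<Rightarrow> ereal" where
  "wav_norm l0 w s f =
     (SUP (j, k)\<in>wav_index l0. ereal (2 powr (real j * (s + 1/2)) * \<bar>ip f (w (j, k))\<bar>))"

definition Sigma_class ::
  "nat \<Rightarrow> (nat \<times> nat \<Rightarrow> real \<Rightarrow> real) \<Rightarrow> real \<Rightarrow> real \<Rightarrow> (real \<Rightarrow> real) set" where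
  "Sigma_class l0 w R s =
     {L. uniformly_continuous_on {0..1} L \<and> wav_norm l0 w s L \<le> ereal R \<and>
         (LINT x|unit_leb. exp (L x)) = 1}"

definition P :: "(real \<Rightarrow> real) \<Rightarrow> real measure" where
  "P L = density unit_leb (\<lambda>x. ennreal (exp (L x)))"

definition EL :: "(real \<Rightarrow> real) \<Rightarrow> (real \<Rightarrow> real) \<Rightarrow> real" where
  "EL L f = (LINT x|P L. f x)"

section \<open>Parameterization\<close>

definition lex_enum :: "nat \<Rightarrow> nat \<Rightarrow> (nat \<Rightarrow> nat \<times> nat) \<Rightarrow> bool" where
  "lex_enum l0 J0 e \<longleftrightarrow>
     bij_betw e {1..} {(j, k) \<in> wav_index l0. J0 < j} \<and>
     (\<forall>m\<ge>1. \<forall>m'>m. fst (e m) < fst (e m') \<or> (fst (e m) = fst (e m') \<and> snd (e m) < snd (e m')))"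

definition block :: "nat \<Rightarrow> nat \<Rightarrow> (nat \<Rightarrow> nat \<times> nat) \<Rightarrow> nat \<Rightarrow> (nat \<times> nat) set" where
  "block l0 J0 e m = (if m = 0 then {(j, k) \<in> wav_index l0. j \<le> J0} else {e m})"

definition level :: "nat \<Rightarrow> (nat \<Rightarrow> nat \<times> nat) \<Rightarrow> nat \<Rightarrow> nat" where
  "level J0 e m = (if m = 0 then J0 else fst (e m))"

text \<open>Elements of the spans are functions on \<open>[0,1]\<close>, encoded by \<^const>\<open>restrict\<close>. The \<open>\<sigma>\<close>-algebra
  generated by the point evaluations is the Borel \<open>\<sigma>\<close>-algebra of the finite-dimensional span.\<close>

definition block_space ::
  "(nat \<times> nat \<Rightarrow> real \<Rightarrow> real) \<Rightarrow> (real \<Rightarrow> real) \<Rightarrow> (nat \<times> nat) set \<Rightarrow> (real \<Rightarrow> real) measure" where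
  "block_space w L B = restrict_space (\<Pi>\<^sub>M x\<in>{0..1}. borel)
     {\<lambda>x\<in>{0..1}. (\<Sum>v\<in>B. a v * (w v x - EL L (w v))) | a. True}"

definition param_space ::
  "(nat \<times> nat \<Rightarrow> real \<Rightarrow> real) \<Rightarrow> (real \<Rightarrow> real) \<Rightarrow> (nat \<Rightarrow> (nat \<times> nat) set) \<Rightarrow> (nat \<Rightarrow> real \<Rightarrow> real) measure" where
  "param_space w L B = (\<Pi>\<^sub>M m\<in>UNIV. block_space w L (B m))"

text \<open>The sequences \<open>F\<close> for which \<open>\<Sum>\<^sub>m F\<^sub>m\<close> makes sense almost everywhere and has a finite exponential moment.\<close>

definition admissible ::
  "(nat \<times> nat \<Rightarrow> real \<Rightarrow> real) \<Rightarrow> (real \<Rightarrow> real) \<Rightarrow> (nat \<Rightarrow> (nat \<times> nat) set) \<Rightarrow> (nat \<Rightarrow> real \<Rightarrow> real) set" where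
  "admissible w L B = {F \<in> space (param_space w L B).
     (AE x in P L. summable (\<lambda>m. F m x)) \<and>
     (\<integral>\<^sup>+ x. ennreal (exp (\<Sum>m. F m x)) \<partial>P L) < \<infinity>}"

definition is_prior ::
  "(nat \<times> nat \<Rightarrow> real \<Rightarrow> real) \<Rightarrow> (real \<Rightarrow> real) \<Rightarrow> (nat \<Rightarrow> (nat \<times> nat) set) \<Rightarrow> (nat \<Rightarrow> real \<Rightarrow> real) measure \<Rightarrow> bool" where
  "is_prior w L B \<Pi>0 \<longleftrightarrow> prob_space \<Pi>0 \<and>
     space \<Pi>0 = admissible w L B \<and>
     sets \<Pi>0 = sets (restrict_space (param_space w L B) (admissible w L B))"

definition indep_blocks ::
  "(nat \<times> nat \<Rightarrow> real \<Rightarrow> real) \<Rightarrow> (real \<Rightarrow> real) \<Rightarrow> (nat \<Rightarrow> (nat \<times> nat) set) \<Rightarrow> (nat \<Rightarrow> real \<Rightarrow> real) measure \<Rightarrow> bool" where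
  "indep_blocks w L B \<Pi>0 \<longleftrightarrow> (\<forall>I. prob_space.indep_var \<Pi>0
     (\<Pi>\<^sub>M m\<in>I. block_space w L (B m)) (\<lambda>F. restrict F I)
     (\<Pi>\<^sub>M m\<in>- I. block_space w L (B m)) (\<lambda>F. restrict F (- I)))"

definition log_density :: "(real \<Rightarrow> real) \<Rightarrow> (nat \<Rightarrow> real \<Rightarrow> real) \<Rightarrow> real \<Rightarrow> real" where
  "log_density L F x = L x + (\<Sum>m. F m x) - ln (EL L (\<lambda>y. exp (\<Sum>m. F m y)))"

definition likelihood :: "nat \<Rightarrow> (real \<Rightarrow> real) \<Rightarrow> (nat \<Rightarrow> real) \<Rightarrow> (nat \<Rightarrow> real \<Rightarrow> real) \<Rightarrow> real" where
  "likelihood n L X F = (\<Prod>i<n. exp (log_density L F (X i)))"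

definition posterior ::
  "nat \<Rightarrow> (real \<Rightarrow> real) \<Rightarrow> (nat \<Rightarrow> real \<Rightarrow> real) measure \<Rightarrow> (nat \<Rightarrow> real \<Rightarrow> real) set \<Rightarrow> (nat \<Rightarrow> real) \<Rightarrow> ennreal" where
  "posterior n L \<Pi>0 A X =
     (\<integral>\<^sup>+ F. indicator A F * ennreal (likelihood n L X F) \<partial>\<Pi>0) /
     (\<integral>\<^sup>+ F. ennreal (likelihood n L X F) \<partial>\<Pi>0)"

definition mean_posterior ::
  "nat \<Rightarrow> (real \<Rightarrow> real) \<Rightarrow> (nat \<Rightarrow> real \<Rightarrow> real) measure \<Rightarrow> (nat \<Rightarrow> real \<Rightarrow> real) set \<Rightarrow> ennreal" where
  "mean_posterior n L \<Pi>0 A = (\<integral>\<^sup>+ X. posterior n L \<Pi>0 A X \<partial>(\<Pi>\<^sub>M i\<in>{..<n}. P L))"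

section \<open>Thresholds and sets of parameters\<close>

definition eps_star :: "nat \<Rightarrow> real \<Rightarrow> real" where
  "eps_star n s = (ln (real n) / real n) powr (s / (2 * s + 1))"

text \<open>\<open>\<rho>\<^sub>m\<close> is \<open>rate n s J\<^sub>m\<close>, and \<open>rate n s j\<^sub>n\<close> is the quantity in the definition of \<open>j\<^sub>n\<close>.\<close>

definition rate :: "nat \<Rightarrow> real \<Rightarrow> int \<Rightarrow> real" where
  "rate n s j = (if s > 1/2 then sqrt (ln (real n) / real n)
                 else 2 powr (- of_int j / 2) * eps_star n s)"

definition is_jn :: "real \<Rightarrow> real \<Rightarrow> nat \<Rightarrow> real \<Rightarrow> int \<Rightarrow> bool" where
  "is_jn \<Gamma> \<gamma> n s jn \<longleftrightarrow>
     \<gamma> * 2 powr (- (of_int jn + 1) * (s + 1/2)) < \<Gamma> * rate n s jn \<and>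
     \<Gamma> * rate n s jn \<le> \<gamma> * 2 powr (- of_int jn * (s + 1/2))"

definition threshold ::
  "real \<Rightarrow> real \<Rightarrow> real \<Rightarrow> nat \<Rightarrow> real \<Rightarrow> int \<Rightarrow> (nat \<Rightarrow> nat) \<Rightarrow> nat set \<Rightarrow> nat \<Rightarrow> real" where
  "threshold \<Gamma> \<gamma> \<xi> n s jn J I m =
     (if int (J m) \<le> jn
      then \<Gamma> * (if 0 \<in> I \<and> m \<noteq> 0 then 1 / \<xi> else 1) * rate n s (int (J m))
      else \<gamma> * 2 powr (- real (J m) * (s + 1/2)))"

definition C_star ::
  "(nat \<times> nat \<Rightarrow> real \<Rightarrow> real) \<Rightarrow> (real \<Rightarrow> real) \<Rightarrow> (nat \<Rightarrow> (nat \<times> nat) set) \<Rightarrow> real \<Rightarrow> (nat \<Rightarrow> real \<Rightarrow> real) set" where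
  "C_star w L B \<delta> = {F \<in> space (param_space w L B).
     (SUP x\<in>{0..1}. \<Sum>m. ennreal \<bar>F m x\<bar>) \<le> ennreal \<delta>}"

definition S_set ::
  "(nat \<times> nat \<Rightarrow> real \<Rightarrow> real) \<Rightarrow> (real \<Rightarrow> real) \<Rightarrow> (nat \<Rightarrow> (nat \<times> nat) set) \<Rightarrow> (nat set \<Rightarrow> nat \<Rightarrow> real)
     \<Rightarrow> nat set \<Rightarrow> (nat \<Rightarrow> real \<Rightarrow> real) set" where
  "S_set w L B H I = {F \<in> space (param_space w L B).
     (\<forall>m\<in>I. norm2 (F m) > H I m) \<and> (\<forall>m. m \<notin> I \<longrightarrow> norm2 (F m) \<le> H I m)}"

text \<open>\<open>g\<close> is (a version of) the sum in \<open>L\<^sup>2(P\<^sub>L)\<close> of the series of the \<open>F m\<close>, \<open>m \<in> I\<close>. Versions agree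
  almost everywhere, so both infima below are over at most one value; if the series does not
  converge they are the infimum of the empty set, which is \<open>\<infinity>\<close>. For finite \<open>I\<close> they are the second
  moment and the sup norm of the finite sum.\<close>

definition series_sum :: "(real \<Rightarrow> real) \<Rightarrow> nat set \<Rightarrow> (nat \<Rightarrow> real \<Rightarrow> real) \<Rightarrow> (real \<Rightarrow> real) \<Rightarrow> bool" where
  "series_sum L I F g \<longleftrightarrow> g \<in> borel_measurable (P L) \<and>
     (\<lambda>M. \<integral>\<^sup>+ x. ennreal (((\<Sum>m\<in>I \<inter> {..<M}. F m x) - g x)\<^sup>2) \<partial>P L) \<longlonglongrightarrow> 0"

definition second_moment :: "(real \<Rightarrow> real) \<Rightarrow> nat set \<Rightarrow> (nat \<Rightarrow> real \<Rightarrow> real) \<Rightarrow> ennreal" where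
  "second_moment L I F = (INF g\<in>{g. series_sum L I F g}. \<integral>\<^sup>+ x. ennreal ((g x)\<^sup>2) \<partial>P L)"

definition sup_norm :: "(real \<Rightarrow> real) \<Rightarrow> nat set \<Rightarrow> (nat \<Rightarrow> real \<Rightarrow> real) \<Rightarrow> ereal" where
  "sup_norm L I F = (INF g\<in>{g. series_sum L I F g}. esssup (P L) (\<lambda>x. ereal \<bar>g x\<bar>))"

text \<open>Powers with positive exponent, and the exponential, on the extended half-line and line.\<close>

definition epowr :: "ennreal \<Rightarrow> real \<Rightarrow> ennreal" where
  "epowr x a = (if x = \<infinity> then \<infinity> else ennreal (enn2real x powr a))"

definition eexp :: "ereal \<Rightarrow> ennreal" where
  "eexp x = (case x of ereal r \<Rightarrow> ennreal (exp r) | PInfty \<Rightarrow> \<infinity> | MInfty \<Rightarrow> 0)"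

definition E_inf ::
  "(nat \<times> nat \<Rightarrow> real \<Rightarrow> real) \<Rightarrow> (real \<Rightarrow> real) \<Rightarrow> (nat \<Rightarrow> (nat \<times> nat) set) \<Rightarrow> (nat set \<Rightarrow> nat \<Rightarrow> real)
     \<Rightarrow> nat set \<Rightarrow> ennreal" where
  "E_inf w L B H I = (INF F\<in>S_set w L B H I. epowr (second_moment L I F) (1/2))"

text \<open>The events of \<open>\<A>\<^sub>I\<close> and \<open>\<A>\<close>-tilde only involve the coordinates in \<open>I\<close>; they are written as
  cylinder sets, so that their prior probability is that of the induced law of \<open>F\<^sub>I\<close>.\<close>

definition A_event ::
  "(nat \<Rightarrow> real \<Rightarrow> real) measure \<Rightarrow> (nat set \<Rightarrow> nat \<Rightarrow> real) \<Rightarrow> nat set \<Rightarrow> (nat \<Rightarrow> real \<Rightarrow> real) set" where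
  "A_event \<Pi>0 H I = {F \<in> space \<Pi>0. \<forall>m\<in>I. norm2 (F m) > H I m}"

definition A_tilde_event ::
  "(nat \<times> nat \<Rightarrow> real \<Rightarrow> real) \<Rightarrow> (real \<Rightarrow> real) \<Rightarrow> (nat \<Rightarrow> (nat \<times> nat) set) \<Rightarrow> (nat \<Rightarrow> real \<Rightarrow> real) measure
     \<Rightarrow> (nat set \<Rightarrow> nat \<Rightarrow> real) \<Rightarrow> real \<Rightarrow> nat set \<Rightarrow> (nat \<Rightarrow> real \<Rightarrow> real) set" where
  "A_tilde_event w L B \<Pi>0 H \<delta> I = {F \<in> space \<Pi>0.
     second_moment L I F \<le> ennreal (\<delta>\<^sup>2) * (E_inf w L B H I)\<^sup>2 \<and> sup_norm L I F \<le> ereal \<delta>}"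

definition assumption_A ::
  "real \<Rightarrow> real \<Rightarrow> real \<Rightarrow> real \<Rightarrow> real \<Rightarrow> nat \<Rightarrow> nat \<Rightarrow> real \<Rightarrow> real \<Rightarrow> real \<Rightarrow> real \<Rightarrow> bool" where
  "assumption_A K0 K1 K2 K3 K4 J0 n \<delta> \<Gamma> \<gamma> \<xi> \<longleftrightarrow>
     real J0 \<ge> K0 * Max {1, ln (1 / \<delta>), ln \<gamma>} \<and>
     ln (real n) \<ge> K1 * Max {2 ^ J0, 1 / \<delta>\<^sup>2, ln \<Gamma>, ln \<gamma>, ln \<xi>} \<and>
     \<xi> \<ge> K2 * (1 / \<delta>) * max 1 \<gamma> * 2 ^ J0 \<and>
     \<gamma> \<ge> K3 * max 1 (1 / \<delta>) \<and>
     \<Gamma> \<ge> Max {\<gamma>, K4 * 2 ^ J0, K4 * \<xi>}"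

section \<open>The bound\<close>

text \<open>\<open>E\<close> is \<open>\<E>\<^sub>I\<close>, \<open>N\<close> is \<open>|I|\<close> and \<open>r\<close> is the ratio of prior probabilities. The value is \<open>\<infinity>\<close> for infinite \<open>I\<close>
  unless \<open>r = 0\<close>.\<close>

definition post_bound ::
  "real \<Rightarrow> real \<Rightarrow> nat \<Rightarrow> nat \<Rightarrow> real \<Rightarrow> real \<Rightarrow> ennreal \<Rightarrow> ennreal \<Rightarrow> ennreal \<Rightarrow> ennreal" where
  "post_bound c1 c2 n J0 \<delta> \<alpha> E N r =
     epowr (3 * epowr (eexp (- enn2ereal (ennreal (c2 * real n) * E\<^sup>2) + enn2ereal (ennreal (c1 * 2 ^ J0) * N))) \<alpha>
              / epowr (1 - eexp (- enn2ereal (ennreal (c2 * real n) * E\<^sup>2))) (2 * \<alpha>)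
            * epowr r (1 - \<alpha>))
       (1 / (1 + 2 * \<delta>))"

end

theory Submission
  imports Defs
begin

text \<open>On the event in question the total perturbation splits into an active part \<open>S\<close>, the sum over \<open>I\<close>, and an
  inactive part that is small in sup norm and has small coefficients. Because a product of two centred wavelets and a
  Hoelder density is nearly orthogonal, the inactive part changes the normalizing constant of the active part
  only by a fraction \<open>O(\<delta>)\<close> of \<open>n Q + |I|\<close>, where \<open>Q\<close> is the second moment of \<open>S\<close>. Up to that error the likelihood
  is a product of a function of the active and a function of the inactive coordinates; by independence
  the inactive factor cancels from the posterior. Jensen's inequality bounds the denominator from below by the likelihood at the
  conditional mean \<open>T\<close> of \<open>S\<close> on the event in the denominator, and the numerator becomes an integral of
  \<open>h = exp (\<Sum>(S - T)(X i) - n bb Q)\<close> with \<open>bb\<close> slightly below one half. Writing \<open>h = h\<^bsup>1-b\<^esup> h\<^bsup>b\<^esup>\<close>, the first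
  factor has expectation at most 1 and the second one is bounded by a power of the supremum of \<open>\<surd>h\<close> over the
  finite-dimensional active space. As the posterior is at most 1 it may be raised to the power \<open>1 - \<alpha>\<close>, and Hoelder's inequality
  combines the two. For infinite \<open>I\<close> the bound is infinite unless the numerator vanishes.\<close>

section \<open>Size, Lipschitz constant and support of the boundary-corrected wavelets\<close>

text \<open>The obstacle is that the inactive part is small in sup norm (at most
  \<open>\<delta>\<close>) while its Hoelder constant is only of order \<open>\<gamma>\<close>. Near
  orthogonality of two centred wavelets against a Hoelder weight therefore carries a factor
  \<open>\<gamma>\<close> that has to be turned into \<open>\<delta>\<close>. For an active block
  above \<open>J0\<close> the decay in its level does this, if \<open>J0\<close> is large; for an
  active block 0 it is the factor \<open>1 / \<xi>\<close> in the other thresholds; for levels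
  beyond \<open>jn\<close> it is a power of \<open>n\<close>. The conditions of Assumption (A) come
  from these three cases. The resulting bias is \<open>O(\<delta>)\<close> times the sum over active
  blocks of \<open>norm2 (F m) * (H I m + 1 / sqrt n)\<close>; the squared thresholds are absorbed
  by the second moment, and the squares of \<open>1 / sqrt n\<close> add up to
  \<open>|I| / n\<close>. The lower bound on \<open>\<alpha>\<close> has its origin in
  \<open>bb < 1/2\<close>: the mean of the power \<open>1 - b\<close> of \<open>h\<close> is at most
  1 only if \<open>b\<close> exceeds a multiple of \<open>\<delta>\<close>, and the final Hoelder
  inequality forces \<open>b\<close> to be comparable to \<open>\<alpha>\<close>.\<close>

definition tame :: "(real \<Rightarrow> real) \<Rightarrow> bool" where
  "tame f \<longleftrightarrow> (\<exists>C\<ge>0. \<exists>A\<ge>0. (\<forall>x\<ge>0. \<forall>y\<ge>0. \<bar>f x - f y\<bar> \<le> C * \<bar>x - y\<bar>) \<and> (\<forall>x\<ge>A. f x = 0))"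

lemma tame_cong:
  assumes "tame f" "\<And>x. x \<ge> 0 \<Longrightarrow> g x = f x"
  shows "tame g"
proof -
  obtain C A where f: "C \<ge> 0" "A \<ge> 0" "\<And>x y. x \<ge> 0 \<Longrightarrow> y \<ge> 0 \<Longrightarrow> \<bar>f x - f y\<bar> \<le> C * \<bar>x - y\<bar>" "\<And>x. x \<ge> A \<Longrightarrow> f x = 0"
    using assms(1) unfolding tame_def by blast
  show ?thesis unfolding tame_def
    using f assms(2) by (intro exI[of _ C] conjI exI[of _ A]) auto
qed

lemma tame_zero: "tame (\<lambda>x. 0)"
  unfolding tame_def by (intro exI[of _ 0]) auto

lemma tame_add:
  assumes "tame f" "tame g"
  shows "tame (\<lambda>x. f x + g x)"
proof -
  obtain C A where f: "C \<ge> 0" "A \<ge> 0" "\<And>x y. x \<ge> 0 \<Longrightarrow> y \<ge> 0 \<Longrightarrow> \<bar>f x - f y\<bar> \<le> C * \<bar>x - y\<bar>" "\<And>x. x \<ge> A \<Longrightarrow> f x = 0"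
    using assms(1) unfolding tame_def by blast
  obtain D B where g: "D \<ge> 0" "B \<ge> 0" "\<And>x y. x \<ge> 0 \<Longrightarrow> y \<ge> 0 \<Longrightarrow> \<bar>g x - g y\<bar> \<le> D * \<bar>x - y\<bar>" "\<And>x. x \<ge> B \<Longrightarrow> g x = 0"
    using assms(2) unfolding tame_def by blast
  have "\<bar>f x + g x - (f y + g y)\<bar> \<le> (C + D) * \<bar>x - y\<bar>" if "x \<ge> 0" "y \<ge> 0" for x y
    using f(3)[OF that] g(3)[OF that] by (simp add: algebra_simps abs_if split: if_splits)
  then show ?thesis unfolding tame_def using f g
    by (intro exI[of _ "C + D"] conjI exI[of _ "max A B"]) auto
qed

lemma tame_cmult:
  assumes "tame f"
  shows "tame (\<lambda>x. c * f x)"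
proof -
  obtain C A where f: "C \<ge> 0" "A \<ge> 0" "\<And>x y. x \<ge> 0 \<Longrightarrow> y \<ge> 0 \<Longrightarrow> \<bar>f x - f y\<bar> \<le> C * \<bar>x - y\<bar>" "\<And>x. x \<ge> A \<Longrightarrow> f x = 0"
    using assms(1) unfolding tame_def by blast
  have "\<bar>c * f x - c * f y\<bar> \<le> (\<bar>c\<bar> * C) * \<bar>x - y\<bar>" if "x \<ge> 0" "y \<ge> 0" for x y
    using mult_left_mono[OF f(3)[OF that], of "\<bar>c\<bar>"]
    unfolding right_diff_distrib[symmetric] abs_mult by (simp add: mult.assoc)
  then show ?thesis unfolding tame_def using f
    by (intro exI[of _ "\<bar>c\<bar> * C"] conjI exI[of _ A]) auto
qed

lemma tame_sum:
  assumes "\<And>i. i \<in> K \<Longrightarrow> tame (f i)"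
  shows "tame (\<lambda>x. \<Sum>i\<in>K. f i x)"
  using assms by (induction K rule: infinite_finite_induct) (auto intro: tame_zero tame_add)

lemma tame_scale:
  assumes "tame f"
  shows "tame (\<lambda>x. f (2 * x))"
proof -
  obtain C A where f: "C \<ge> 0" "A \<ge> 0" "\<And>x y. x \<ge> 0 \<Longrightarrow> y \<ge> 0 \<Longrightarrow> \<bar>f x - f y\<bar> \<le> C * \<bar>x - y\<bar>" "\<And>x. x \<ge> A \<Longrightarrow> f x = 0"
    using assms(1) unfolding tame_def by blast
  have "\<bar>f (2 * x) - f (2 * y)\<bar> \<le> (2 * C) * \<bar>x - y\<bar>" if "x \<ge> 0" "y \<ge> 0" for x y
  proof -
    have "\<bar>2 * x - 2 * y\<bar> = 2 * \<bar>x - y\<bar>" by (simp add: abs_if)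
    then show ?thesis using f(3)[of "2 * x" "2 * y"] that by simp
  qed
  then show ?thesis unfolding tame_def using f
    by (intro exI[of _ "2 * C"] conjI exI[of _ A]) auto
qed

definition lip_supp :: "nat \<Rightarrow> (real \<Rightarrow> real) \<Rightarrow> bool" where
  "lip_supp N f \<longleftrightarrow> (\<exists>C\<ge>0. \<forall>x y. \<bar>f x - f y\<bar> \<le> C * \<bar>x - y\<bar>) \<and> (\<forall>x. x \<notin> {1 - real N..real N} \<longrightarrow> f x = 0)"

lemma tame_affine:
  assumes "lip_supp N f" "a > 0"
  shows "tame (\<lambda>x. f (a * x + c))"
proof -
  obtain C where C: "C \<ge> 0" "\<And>x y. \<bar>f x - f y\<bar> \<le> C * \<bar>x - y\<bar>" "\<And>x. x \<notin> {1 - real N..real N} \<Longrightarrow> f x = 0"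
    using assms(1) unfolding lip_supp_def by blast
  have 1: "\<bar>f (a * x + c) - f (a * y + c)\<bar> \<le> (C * a) * \<bar>x - y\<bar>" for x y
  proof -
    have "\<bar>(a * x + c) - (a * y + c)\<bar> = a * \<bar>x - y\<bar>"
      using assms(2) abs_mult[of a "x - y"] by (simp add: right_diff_distrib)
    then show ?thesis using C(2)[of "a * x + c" "a * y + c"] by (simp add: mult.assoc)
  qed
  have 2: "f (a * x + c) = 0" if "x \<ge> (\<bar>c\<bar> + real N + 1) / a" for x
  proof (rule C(3))
    have "\<bar>c\<bar> + real N + 1 \<le> a * x" using that assms(2) by (simp add: divide_le_eq mult.commute)
    then show "a * x + c \<notin> {1 - real N..real N}" by auto
  qed
  show ?thesis unfolding tame_def using 1 2 C(1) assms(2)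
    by (intro exI[of _ "C * a"] conjI exI[of _ "(\<bar>c\<bar> + real N + 1) / a"]) auto
qed

text \<open>Edge functions are finite combinations of translates and dilates of
  \<open>\<phi>\<close>, first through the seeds, then through the \<open>\<phi>e\<close> of the
  next finer scale, and \<open>tame\<close> is closed under these operations. It constrains
  nonnegative arguments only, because \<open>cdv_edge\<close> prescribes the edge functions on the
  half-line alone.\<close>

lemma tame_cdv_edge:
  assumes "lip_supp N \<phi>" "cdv_edge N \<phi> \<psi> \<phi>e \<psi>e" "k < N"
  shows "tame (\<phi>e k)" "tame (\<psi>e k)"
proof -
  have seed: "tame (edge_seed N \<phi> i)" for i
  proof -
    have "tame (\<lambda>x. \<phi> (x + real n - real N + 1))" for n
      using tame_affine[OF assms(1), of 1 "real n - real N + 1"] by (simp add: add_diff_eq add.assoc[symmetric])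
    then show ?thesis unfolding edge_seed_def by (intro tame_sum tame_cmult)
  qed
  have e: "tame (\<phi>e k)" if kN: "k < N" for k
  proof -
    have "\<forall>k<N. \<exists>c. \<forall>x\<ge>0. \<phi>e k x = (\<Sum>i\<in>{N - 1 - k..<N}. c i * edge_seed N \<phi> i x)"
      using assms(2) unfolding cdv_edge_def by (elim conjE)
    then obtain c where "\<forall>x\<ge>0. \<phi>e k x = (\<Sum>i\<in>{N - 1 - k..<N}. c i * edge_seed N \<phi> i x)"
      using kN by meson
    then show ?thesis
      by (intro tame_cong[OF tame_sum[OF tame_cmult[OF seed]]]) auto
  qed
  show "tame (\<phi>e k)" using e assms(3) by simp
  obtain a b where ab: "\<forall>x\<ge>0. \<psi>e k x = (\<Sum>l<N. a l * \<phi>e l (2 * x))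
                                 + (\<Sum>m\<in>{N..N + 2 * k}. b m * \<phi> (2 * x - real m))"
  proof -
    have "\<forall>k<N. \<exists>a b. \<forall>x\<ge>0. \<psi>e k x = (\<Sum>l<N. a l * \<phi>e l (2 * x))
                                 + (\<Sum>m\<in>{N..N + 2 * k}. b m * \<phi> (2 * x - real m))"
      using assms(2) unfolding cdv_edge_def by (elim conjE)
    then show thesis using that assms(3) by meson
  qed
  have "tame (\<lambda>x. (\<Sum>l<N. a l * \<phi>e l (2 * x)) + (\<Sum>m\<in>{N..N + 2 * k}. b m * \<phi> (2 * x - real m)))"
  proof (intro tame_add tame_sum tame_cmult tame_scale)
    show "tame (\<phi>e l)" if "l \<in> {..<N}" for l using e that by simp
    show "tame (\<lambda>x. \<phi> (x - real m))" for m using tame_affine[OF assms(1), of 1 "- real m"] by simp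
  qed
  then show "tame (\<psi>e k)"
    by (rule tame_cong) (use ab in auto)
qed

lemma lip_supp_bound:
  assumes "lip_supp N f"
  shows "\<exists>C\<ge>0. \<forall>x. \<bar>f x\<bar> \<le> C"
proof -
  obtain C where C: "C \<ge> 0" "\<And>x y. \<bar>f x - f y\<bar> \<le> C * \<bar>x - y\<bar>" "\<And>x. x \<notin> {1 - real N..real N} \<Longrightarrow> f x = 0"
    using assms(1) unfolding lip_supp_def by blast
  have "\<bar>f x\<bar> \<le> C * (2 * real N + 1)" for x
  proof (cases "x \<in> {1 - real N..real N}")
    case True
    have "\<bar>f x - f (real N + 1)\<bar> \<le> C * \<bar>x - (real N + 1)\<bar>" by (rule C(2))
    also have "\<dots> \<le> C * (2 * real N + 1)" using True C(1) by (intro mult_left_mono) auto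
    finally show ?thesis using C(3)[of "real N + 1"] by simp
  qed (use C in auto)
  then show ?thesis using C(1) by (intro exI[of _ "C * (2 * real N + 1)"]) auto
qed

lemma tame_bound:
  assumes "tame f"
  shows "\<exists>C\<ge>0. \<forall>x\<ge>0. \<bar>f x\<bar> \<le> C"
proof -
  obtain C A where f: "C \<ge> 0" "A \<ge> 0" "\<And>x y. x \<ge> 0 \<Longrightarrow> y \<ge> 0 \<Longrightarrow> \<bar>f x - f y\<bar> \<le> C * \<bar>x - y\<bar>" "\<And>x. x \<ge> A \<Longrightarrow> f x = 0"
    using assms(1) unfolding tame_def by blast
  have "\<bar>f x\<bar> \<le> C * A" if "x \<ge> 0" for x
  proof (cases "x \<ge> A")
    case False
    have "\<bar>f x - f A\<bar> \<le> C * \<bar>x - A\<bar>" using f(3)[OF that f(2)] .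
    also have "\<dots> \<le> C * A" using False that f by (intro mult_left_mono) auto
    finally show ?thesis using f(2,4) by simp
  qed (use f in auto)
  then show ?thesis using f by (intro exI[of _ "C * A"]) auto
qed

text \<open>Compact support makes the continuous derivative bounded, and the mean value theorem
  gives the Lipschitz constant. The theorem's \<open>0 < s\<close> and \<open>s \<le> real S\<close>
  with natural \<open>S\<close> supply \<open>S \<ge> 1\<close>.\<close>

lemma lip_supp_smooth:
  assumes "times_cont_diff S \<phi>" "S \<ge> 1" "\<And>x. x \<notin> {1 - real N..real N} \<Longrightarrow> \<phi> x = 0"
  shows "lip_supp N \<phi>"
proof -
  have d: "\<phi> field_differentiable (at x)" for x
    using assms(1,2) unfolding times_cont_diff_def by (metis One_nat_def Suc_le_eq funpow_0)
  have "continuous_on UNIV (deriv \<phi>)"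
  proof (cases "S = 1")
    case True then show ?thesis using assms(1) by (simp add: times_cont_diff_def)
  next
    case False
    then have "1 < S" using assms(2) by simp
    then have "\<And>x. (deriv ^^ 1) \<phi> field_differentiable (at x)"
      using assms(1) unfolding times_cont_diff_def by blast
    then show ?thesis
      by (intro continuous_at_imp_continuous_on) (auto intro: field_differentiable_imp_continuous_at)
  qed
  then have "continuous_on {1 - real N..real N} (deriv \<phi>)" by (rule continuous_on_subset) auto
  then have "bounded (deriv \<phi> ` {1 - real N..real N})"
    by (intro compact_imp_bounded compact_continuous_image) auto
  then obtain C where C: "\<And>x. x \<in> {1 - real N..real N} \<Longrightarrow> \<bar>deriv \<phi> x\<bar> \<le> C" "C > 0"
    unfolding bounded_pos real_norm_def by blast
  have C': "\<bar>deriv \<phi> x\<bar> \<le> C" for x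
  proof (cases "x \<in> {1 - real N..real N}")
    case False
    have "open (- {1 - real N..real N})" by auto
    then have "eventually (\<lambda>y. y \<in> - {1 - real N..real N}) (nhds x)"
      using False by (intro eventually_nhds_in_open) auto
    then have "eventually (\<lambda>y. \<phi> y = 0) (nhds x)" by eventually_elim (use assms(3) in auto)
    then have "deriv \<phi> x = deriv (\<lambda>_. 0) x" by (intro deriv_cong_ev) auto
    then show ?thesis using C(2) by simp
  qed (use C in auto)
  have "\<bar>\<phi> x - \<phi> y\<bar> \<le> C * \<bar>x - y\<bar>" for x y
    using field_differentiable_bound[of UNIV \<phi> "deriv \<phi>" C x y] d C'
    by (auto simp: DERIV_deriv_iff_field_differentiable)
  then show ?thesis unfolding lip_supp_def using C(2) assms(3) by (intro conjI exI[of _ C]) auto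
qed

lemma lip_supp_wavelet:
  assumes "daubechies N h \<phi> \<psi>" "lip_supp N \<phi>"
  shows "lip_supp N \<psi>"
proof -
  obtain C where C: "C \<ge> 0" "\<And>x y. \<bar>\<phi> x - \<phi> y\<bar> \<le> C * \<bar>x - y\<bar>" "\<And>x. x \<notin> {1 - real N..real N} \<Longrightarrow> \<phi> x = 0"
    using assms(2) unfolding lip_supp_def by blast
  define a where "a n = sqrt 2 * ((-1) powi n * h (1 - n))" for n :: int
  have psi: "\<psi> x = (\<Sum>n\<in>{1 - int N..int N}. a n * \<phi> (2 * x - of_int n))" for x
  proof -
    have "\<psi> x = sqrt 2 * (\<Sum>n\<in>{1 - int N..int N}. (-1) powi n * h (1 - n) * \<phi> (2 * x - of_int n))"
      using assms(1) unfolding daubechies_def by blast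
    then show ?thesis unfolding a_def by (simp add: sum_distrib_left mult.assoc)
  qed
  have "\<bar>\<psi> x - \<psi> y\<bar> \<le> (\<Sum>n\<in>{1 - int N..int N}. \<bar>a n\<bar> * (2 * C)) * \<bar>x - y\<bar>" for x y
  proof -
    have "\<bar>\<psi> x - \<psi> y\<bar> = \<bar>\<Sum>n\<in>{1 - int N..int N}. a n * (\<phi> (2 * x - of_int n) - \<phi> (2 * y - of_int n))\<bar>"
      unfolding psi by (simp add: right_diff_distrib sum_subtractf)
    also have "\<dots> \<le> (\<Sum>n\<in>{1 - int N..int N}. \<bar>a n * (\<phi> (2 * x - of_int n) - \<phi> (2 * y - of_int n))\<bar>)"
      by (rule sum_abs)
    also have "\<dots> \<le> (\<Sum>n\<in>{1 - int N..int N}. \<bar>a n\<bar> * (2 * C * \<bar>x - y\<bar>))"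
    proof (rule sum_mono)
      fix n :: int
      have "\<bar>2 * x - of_int n - (2 * y - of_int n)\<bar> = 2 * \<bar>x - y\<bar>" by (simp add: abs_if)
      then have "\<bar>\<phi> (2 * x - of_int n) - \<phi> (2 * y - of_int n)\<bar> \<le> 2 * C * \<bar>x - y\<bar>"
        using C(2)[of "2 * x - of_int n" "2 * y - of_int n"] by simp
      then show "\<bar>a n * (\<phi> (2 * x - of_int n) - \<phi> (2 * y - of_int n))\<bar> \<le> \<bar>a n\<bar> * (2 * C * \<bar>x - y\<bar>)"
        unfolding abs_mult by (intro mult_left_mono) auto
    qed
    finally show ?thesis by (simp add: sum_distrib_right mult.assoc)
  qed
  moreover have "\<psi> x = 0" if "x \<notin> {1 - real N..real N}" for x
    unfolding psi
  proof (rule sum.neutral, rule ballI)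
    fix n assume n: "n \<in> {1 - int N..int N}"
    then have "1 - real N \<le> real_of_int n \<and> real_of_int n \<le> real N"
      by auto
    \<comment> \<open>If both \<open>n\<close> and \<open>2 * x - n\<close> were in
      \<open>[1 - N, N]\<close>, then \<open>2 * x\<close> would lie in
      \<open>[2 - 2 * N, 2 * N]\<close>: with this normalization the filter reproduces the support
      of \<open>\<phi>\<close>.\<close>
    then have "2 * x - of_int n \<notin> {1 - real N..real N}" using that by auto
    then show "a n * \<phi> (2 * x - of_int n) = 0" using C(3) by simp
  qed
  moreover have "(\<Sum>n\<in>{1 - int N..int N}. \<bar>a n\<bar> * (2 * C)) \<ge> 0"
    using C(1) by (intro sum_nonneg) auto
  ultimately show ?thesis unfolding lip_supp_def by blast
qed

text \<open>Amplitude, Lipschitz constant and location of an \<open>L2\<close>-normalized function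
  of scale \<open>2 ^ -j\<close> near \<open>k / 2 ^ j\<close>, all with one constant. The location
  bound is what limits the number of overlapping functions within a level.\<close>

definition scaled :: "real \<Rightarrow> nat \<Rightarrow> nat \<Rightarrow> (real \<Rightarrow> real) \<Rightarrow> bool" where
  "scaled M j k f \<longleftrightarrow> (\<forall>x\<in>{0..1}. \<bar>f x\<bar> \<le> M * 2 powr (real j / 2) \<and>
     (\<forall>y\<in>{0..1}. \<bar>f x - f y\<bar> \<le> M * 2 powr (real j / 2) * 2 ^ j * \<bar>x - y\<bar>) \<and>
     (f x \<noteq> 0 \<longrightarrow> \<bar>2 ^ j * x - real k\<bar> \<le> M))"

lemma scaled_mono:
  assumes "scaled M j k f" "M \<le> M'" shows "scaled M' j k f"
proof -
  have "M * 2 powr (real j / 2) \<le> M' * 2 powr (real j / 2)" using assms by (intro mult_right_mono) auto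
  moreover have "M * 2 powr (real j / 2) * 2 ^ j * \<bar>x - y\<bar> \<le> M' * 2 powr (real j / 2) * 2 ^ j * \<bar>x - y\<bar>" for x y :: real
    using assms by (intro mult_right_mono) auto
  ultimately show ?thesis using assms unfolding scaled_def by (meson order.trans)
qed

lemma scaled_cong:
  assumes "\<And>x. x \<in> {0..1} \<Longrightarrow> g x = f x" "scaled M j k f" shows "scaled M j k g"
  using assms unfolding scaled_def by simp

lemma scaled_interior:
  assumes "lip_supp N f"
  shows "\<exists>M. \<forall>j k. scaled M j k (\<lambda>x. 2 powr (real j / 2) * f (2 ^ j * x - real k))"
proof -
  obtain C where C: "C \<ge> 0" "\<And>x y. \<bar>f x - f y\<bar> \<le> C * \<bar>x - y\<bar>" "\<And>x. x \<notin> {1 - real N..real N} \<Longrightarrow> f x = 0"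
    using assms unfolding lip_supp_def by blast
  obtain D where D: "D \<ge> 0" "\<And>x. \<bar>f x\<bar> \<le> D" using lip_supp_bound[OF assms] by blast
  have "scaled (C + D + real N + 1) j k (\<lambda>x. 2 powr (real j / 2) * f (2 ^ j * x - real k))" for j k
    unfolding scaled_def
  proof (intro ballI conjI impI)
    fix x y :: real
    have "\<bar>f (2 ^ j * x - real k)\<bar> \<le> C + D + real N + 1" using D(2)[of "2 ^ j * x - real k"] C(1) by linarith
    then show "\<bar>2 powr (real j / 2) * f (2 ^ j * x - real k)\<bar> \<le> (C + D + real N + 1) * 2 powr (real j / 2)"
      by (simp add: abs_mult)
    have "\<bar>f (2 ^ j * x - real k) - f (2 ^ j * y - real k)\<bar> \<le> C * \<bar>2 ^ j * (x - y)\<bar>"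
      using C(2)[of "2 ^ j * x - real k" "2 ^ j * y - real k"] by (simp add: algebra_simps)
    also have "\<dots> = C * (2 ^ j * \<bar>x - y\<bar>)" by (simp add: abs_mult)
    also have "\<dots> \<le> (C + D + real N + 1) * (2 ^ j * \<bar>x - y\<bar>)"
      using D by (intro mult_right_mono) auto
    finally have "\<bar>2 powr (real j / 2)\<bar> * \<bar>f (2 ^ j * x - real k) - f (2 ^ j * y - real k)\<bar>
       \<le> \<bar>2 powr (real j / 2)\<bar> * ((C + D + real N + 1) * (2 ^ j * \<bar>x - y\<bar>))" by (intro mult_left_mono) auto
    then show "\<bar>2 powr (real j / 2) * f (2 ^ j * x - real k) - 2 powr (real j / 2) * f (2 ^ j * y - real k)\<bar>
         \<le> (C + D + real N + 1) * 2 powr (real j / 2) * 2 ^ j * \<bar>x - y\<bar>"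
      unfolding abs_mult[symmetric] right_diff_distrib by (simp add: mult_ac)
  next
    fix x :: real assume "2 powr (real j / 2) * f (2 ^ j * x - real k) \<noteq> 0"
    then have "2 ^ j * x - real k \<in> {1 - real N..real N}" using C(3) by fastforce
    then show "\<bar>2 ^ j * x - real k\<bar> \<le> C + D + real N + 1" using C D by auto
  qed
  then show ?thesis by blast
qed

lemma scaled_left:
  assumes "tame f"
  shows "\<exists>M. \<forall>j k. k < N \<longrightarrow> scaled M j k (\<lambda>x. 2 powr (real j / 2) * f (2 ^ j * x))"
proof -
  obtain C A where C: "C \<ge> 0" "A \<ge> 0" "\<And>x y. x \<ge> 0 \<Longrightarrow> y \<ge> 0 \<Longrightarrow> \<bar>f x - f y\<bar> \<le> C * \<bar>x - y\<bar>" "\<And>x. x \<ge> A \<Longrightarrow> f x = 0"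
    using assms(1) unfolding tame_def by blast
  obtain D where D: "D \<ge> 0" "\<And>x. x \<ge> 0 \<Longrightarrow> \<bar>f x\<bar> \<le> D" using tame_bound[OF assms] by blast
  have "scaled (C + D + A + real N) j k (\<lambda>x. 2 powr (real j / 2) * f (2 ^ j * x))" if "k < N" for j k
    unfolding scaled_def
  proof (intro ballI conjI impI)
    fix x y :: real assume x: "x \<in> {0..1}" and y: "y \<in> {0..1}"
    have "\<bar>f (2 ^ j * x) - f (2 ^ j * y)\<bar> \<le> C * \<bar>2 ^ j * (x - y)\<bar>"
      using C(3)[of "2 ^ j * x" "2 ^ j * y"] x y by (simp add: algebra_simps)
    also have "\<dots> = C * (2 ^ j * \<bar>x - y\<bar>)" by (simp add: abs_mult)
    also have "\<dots> \<le> (C + D + A + real N) * (2 ^ j * \<bar>x - y\<bar>)"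
      using D C by (intro mult_right_mono) auto
    finally have "\<bar>2 powr (real j / 2)\<bar> * \<bar>f (2 ^ j * x) - f (2 ^ j * y)\<bar>
       \<le> \<bar>2 powr (real j / 2)\<bar> * ((C + D + A + real N) * (2 ^ j * \<bar>x - y\<bar>))" by (intro mult_left_mono) auto
    then show "\<bar>2 powr (real j / 2) * f (2 ^ j * x) - 2 powr (real j / 2) * f (2 ^ j * y)\<bar>
         \<le> (C + D + A + real N) * 2 powr (real j / 2) * 2 ^ j * \<bar>x - y\<bar>"
      unfolding abs_mult[symmetric] right_diff_distrib by (simp add: mult_ac)
  next
    fix x :: real assume x: "x \<in> {0..1}"
    then have "\<bar>f (2 ^ j * x)\<bar> \<le> D" using D(2) by simp
    then have "\<bar>f (2 ^ j * x)\<bar> \<le> C + D + A + real N" using C by linarith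
    then show "\<bar>2 powr (real j / 2) * f (2 ^ j * x)\<bar> \<le> (C + D + A + real N) * 2 powr (real j / 2)"
      by (simp add: abs_mult)
    assume "2 powr (real j / 2) * f (2 ^ j * x) \<noteq> 0"
    then have "2 ^ j * x \<le> A" using C(4)[of "2 ^ j * x"] by (cases "2 ^ j * x \<le> A") auto
    moreover have "0 \<le> 2 ^ j * x" using x by simp
    ultimately show "\<bar>2 ^ j * x - real k\<bar> \<le> C + D + A + real N" using C D that by linarith
  qed
  then show ?thesis by blast
qed

text \<open>Reflection leads back to the left edge with index \<open>2 ^ j - 1 - k\<close>, which is
  below \<open>N\<close>; the off-by-one in that index costs the summand 1 in
  \<open>\<bar>M\<bar> + 1\<close>.\<close>

lemma scaled_right:
  assumes "tame f"
  shows "\<exists>M. \<forall>j k. k < 2 ^ j \<longrightarrow> 2 ^ j - N \<le> k \<longrightarrow> scaled M j k (\<lambda>x. 2 powr (real j / 2) * f (2 ^ j * (1 - x)))"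
proof -
  obtain M where M: "\<And>j k. k < N \<Longrightarrow> scaled M j k (\<lambda>x. 2 powr (real j / 2) * f (2 ^ j * x))"
    using scaled_left[OF assms] by blast
  have "scaled (\<bar>M\<bar> + 1) j k (\<lambda>x. 2 powr (real j / 2) * f (2 ^ j * (1 - x)))" if "k < 2 ^ j" "2 ^ j - N \<le> k" for j k
  proof -
    have kk: "2 ^ j - 1 - k < N" using that by linarith
    from scaled_mono[OF M[OF kk, of j], of "\<bar>M\<bar> + 1"]
    have s: "scaled (\<bar>M\<bar>+1) j (2 ^ j - 1 - k) (\<lambda>x. 2 powr (real j / 2) * f (2 ^ j * x))" by simp
    have r: "real (2 ^ j - 1 - k) = 2 ^ j - 1 - real k" using that by (simp add: of_nat_diff)
    show ?thesis unfolding scaled_def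
    proof (intro ballI conjI impI)
      fix x y :: real assume x: "x \<in> {0..1}" "y \<in> {0..1}"
      then have x': "1 - x \<in> {0..1}" "1 - y \<in> {0..1}" by auto
      show "\<bar>2 powr (real j / 2) * f (2 ^ j * (1 - x)) - 2 powr (real j / 2) * f (2 ^ j * (1 - y))\<bar>
           \<le> (\<bar>M\<bar> + 1) * 2 powr (real j / 2) * 2 ^ j * \<bar>x - y\<bar>"
      proof -
        have "\<bar>(1 - x) - (1 - y)\<bar> = \<bar>x - y\<bar>" by linarith
        then show ?thesis using s x' unfolding scaled_def by metis
      qed
    next
      fix x :: real assume x: "x \<in> {0..1}"
      then have x': "1 - x \<in> {0..1}" by auto
      then show "\<bar>2 powr (real j / 2) * f (2 ^ j * (1 - x))\<bar> \<le> (\<bar>M\<bar> + 1) * 2 powr (real j / 2)"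
        using s unfolding scaled_def by blast
      assume "2 powr (real j / 2) * f (2 ^ j * (1 - x)) \<noteq> 0"
      with M[OF kk, of j] x' have "\<bar>2 ^ j * (1 - x) - (2 ^ j - 1 - real k)\<bar> \<le> M"
        unfolding scaled_def r by blast
      then show "\<bar>2 ^ j * x - real k\<bar> \<le> \<bar>M\<bar> + 1" by (simp add: algebra_simps)
    qed
  qed
  then show ?thesis by blast
qed

lemma uniform_bound:
  fixes P :: "nat \<Rightarrow> real \<Rightarrow> bool"
  assumes "\<And>k. k < N \<Longrightarrow> \<exists>M. P k M" "\<And>k M M'. P k M \<Longrightarrow> M \<le> M' \<Longrightarrow> P k M'"
  shows "\<exists>M. \<forall>k<N. P k M"
  using assms(1)
proof (induction N)
  case (Suc N)
  then obtain M M' where "\<forall>k<N. P k M" "P N M'" by (meson less_Suc_eq)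
  then have "\<forall>k<Suc N. P k (max M M')" using assms(2) by (metis less_Suc_eq max.cobounded1 max.cobounded2)
  then show ?case by blast
qed simp

lemma scaled_level:
  assumes f: "lip_supp N f" and fl: "\<And>k. k < N \<Longrightarrow> tame (fl k)" and fr: "\<And>k. k < N \<Longrightarrow> tame (fr k)"
  shows "\<exists>M. \<forall>j k. 2 * N \<le> 2 ^ j \<longrightarrow> k < 2 ^ j \<longrightarrow> scaled M j k (cdv_level N f fl fr j k)"
proof -
  obtain M1 where M1: "\<And>j k. scaled M1 j k (\<lambda>x. 2 powr (real j / 2) * f (2 ^ j * x - real k))"
    using scaled_interior[OF f] by blast
  have "\<exists>M. \<forall>i<N. \<forall>j k. k < N \<longrightarrow> scaled M j k (\<lambda>x. 2 powr (real j / 2) * fl i (2 ^ j * x))"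
    by (rule uniform_bound, use scaled_left[OF fl] in blast) (use scaled_mono in blast)
  then obtain M2 where M2: "\<And>i j k. i < N \<Longrightarrow> k < N \<Longrightarrow> scaled M2 j k (\<lambda>x. 2 powr (real j / 2) * fl i (2 ^ j * x))"
    by blast
  have "\<exists>M. \<forall>i<N. \<forall>j k. k < 2 ^ j \<longrightarrow> 2 ^ j - N \<le> k \<longrightarrow> scaled M j k (\<lambda>x. 2 powr (real j / 2) * fr i (2 ^ j * (1 - x)))"
    by (rule uniform_bound, use scaled_right[OF fr] in blast) (use scaled_mono in blast)
  then obtain M3 where M3: "\<And>i j k. i < N \<Longrightarrow> k < 2 ^ j \<Longrightarrow> 2 ^ j - N \<le> k \<Longrightarrow> scaled M3 j k (\<lambda>x. 2 powr (real j / 2) * fr i (2 ^ j * (1 - x)))"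
    by blast
  have "scaled (max M1 (max M2 M3)) j k (cdv_level N f fl fr j k)" if "2 * N \<le> 2 ^ j" "k < 2 ^ j" for j k
  proof -
    consider "k < N" | "\<not> k < N" "k < 2 ^ j - N" | "\<not> k < N" "\<not> k < 2 ^ j - N" by blast
    then show ?thesis
    proof cases
      case 1 then show ?thesis
        by (intro scaled_cong[OF _ scaled_mono[OF M2[OF 1 1, of j]]]) (auto simp: cdv_level_def)
    next
      case 2 then show ?thesis
        by (intro scaled_cong[OF _ scaled_mono[OF M1[of j k]]]) (auto simp: cdv_level_def)
    next
      case 3
      then have "2 ^ j - 1 - k < N" using that by linarith
      then have "scaled M3 j k (\<lambda>x. 2 powr (real j / 2) * fr (2 ^ j - 1 - k) (2 ^ j * (1 - x)))"
        using M3[of "2 ^ j - 1 - k" k j] that(2) 3(2) by linarith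
      from scaled_mono[OF this, of "max M1 (max M2 M3)"] show ?thesis
        by (rule scaled_cong[rotated]) (use 3 in \<open>auto simp: cdv_level_def\<close>)
    qed
  qed
  then show ?thesis by blast
qed

text \<open>Everything used later about the Cohen-Daubechies-Vial system; its construction is left
  behind here. As \<open>M\<close> is the same for all levels, later constants depend on the basis
  through \<open>M\<close> only.\<close>

locale wavelets =
  fixes l0 :: nat and w :: "nat \<times> nat \<Rightarrow> real \<Rightarrow> real" and M :: real
  assumes M: "M \<ge> 1"
    and scaled: "(j, k) \<in> wav_index l0 \<Longrightarrow> scaled M j k (w (j, k))"
    and orth: "u \<in> wav_index l0 \<Longrightarrow> v \<in> wav_index l0 \<Longrightarrow> ip (w u) (w v) = of_bool (u = v)"
    and complete: "f \<in> borel_measurable unit_leb \<Longrightarrow> integrable unit_leb (\<lambda>x. (f x)\<^sup>2) \<Longrightarrow>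
        (\<And>v. v \<in> wav_index l0 \<Longrightarrow> ip f (w v) = 0) \<Longrightarrow> AE x in unit_leb. f x = 0"

lemma cdv_basis_wavelets:
  assumes "cdv_basis S l0 w" "S \<ge> 1"
  shows "\<exists>M. wavelets l0 w M"
proof -
  from assms(1) obtain N h \<phi> \<psi> \<phi>l \<psi>l \<phi>r \<psi>r where
    N: "0 < N" "S \<le> N" "2 * N \<le> 2 ^ l0" and
    D: "daubechies N h \<phi> \<psi>" "times_cont_diff S \<phi>" "cdv_edge N \<phi> \<psi> \<phi>l \<psi>l"
       "cdv_edge N (\<lambda>x. \<phi> (1 - x)) (\<lambda>x. \<psi> (1 - x)) \<phi>r \<psi>r" and
    w: "\<forall>k<2 ^ l0. \<forall>x\<in>{0..1}. w (l0, k) x = cdv_level N \<phi> \<phi>l \<phi>r l0 k x"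
       "\<forall>k<2 ^ l0. \<forall>x\<in>{0..1}. w (l0, 2 ^ l0 + k) x = cdv_level N \<psi> \<psi>l \<psi>r l0 k x"
       "\<forall>j>l0. \<forall>k<2 ^ j. \<forall>x\<in>{0..1}. w (j, k) x = cdv_level N \<psi> \<psi>l \<psi>r j k x"
    unfolding cdv_basis_def by (elim conjE exE) (rule that; assumption)
  have phi: "lip_supp N \<phi>"
    using lip_supp_smooth[OF D(2) assms(2)] D(1) unfolding daubechies_def by blast
  have psi: "lip_supp N \<psi>" by (rule lip_supp_wavelet[OF D(1) phi])
  have phi': "lip_supp N (\<lambda>x. \<phi> (1 - x))"
  proof -
    obtain C where C: "C \<ge> 0" "\<And>x y. \<bar>\<phi> x - \<phi> y\<bar> \<le> C * \<bar>x - y\<bar>" "\<And>x. x \<notin> {1 - real N..real N} \<Longrightarrow> \<phi> x = 0"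
      using phi unfolding lip_supp_def by blast
    have "\<bar>\<phi> (1 - x) - \<phi> (1 - y)\<bar> \<le> C * \<bar>x - y\<bar>" for x y
      using C(2)[of "1 - x" "1 - y"] by (simp add: abs_minus_commute)
    moreover have "\<phi> (1 - x) = 0" if "x \<notin> {1 - real N..real N}" for x
      using C(3)[of "1 - x"] that by auto
    ultimately show ?thesis unfolding lip_supp_def using C(1) by blast
  qed
  obtain M1 where M1: "\<And>j k. 2 * N \<le> 2 ^ j \<Longrightarrow> k < 2 ^ j \<Longrightarrow> scaled M1 j k (cdv_level N \<phi> \<phi>l \<phi>r j k)"
  proof -
    have "\<exists>M. \<forall>j k. 2 * N \<le> 2 ^ j \<longrightarrow> k < 2 ^ j \<longrightarrow> scaled M j k (cdv_level N \<phi> \<phi>l \<phi>r j k)"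
      by (rule scaled_level[OF phi]) (fact tame_cdv_edge(1)[OF phi D(3)] tame_cdv_edge(1)[OF phi' D(4)])+
    then show thesis using that by blast
  qed
  obtain M2 where M2: "\<And>j k. 2 * N \<le> 2 ^ j \<Longrightarrow> k < 2 ^ j \<Longrightarrow> scaled M2 j k (cdv_level N \<psi> \<psi>l \<psi>r j k)"
  proof -
    have "\<exists>M. \<forall>j k. 2 * N \<le> 2 ^ j \<longrightarrow> k < 2 ^ j \<longrightarrow> scaled M j k (cdv_level N \<psi> \<psi>l \<psi>r j k)"
      by (rule scaled_level[OF psi]) (fact tame_cdv_edge(2)[OF phi D(3)] tame_cdv_edge(2)[OF phi' D(4)])+
    then show thesis using that by blast
  qed
  \<comment> \<open>The summand \<open>2 ^ (l0 + 1)\<close> makes the location bound trivial at the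
    coarsest level, where the indices of the wavelets are shifted by \<open>2 ^ l0\<close> behind
    those of the scaling functions.\<close>
  define M where "M = \<bar>M1\<bar> + \<bar>M2\<bar> + 2 ^ (l0 + 1) + 1"
  have "0 \<le> (2::real) ^ (l0 + 1)" by simp
  then have p: "M1 \<le> M" "M2 \<le> M" unfolding M_def by linarith+
  have "scaled M j k (w (j, k))" if jk: "(j, k) \<in> wav_index l0" for j k
  proof -
    consider "j > l0" "k < 2 ^ j" | "j = l0" "k < 2 ^ l0" | k' where "j = l0" "k = 2 ^ l0 + k'" "k' < 2 ^ l0"
    proof -
      have "j \<ge> l0" "j = l0 \<Longrightarrow> k < 2 ^ l0 + 2 ^ l0" "j \<noteq> l0 \<Longrightarrow> k < 2 ^ j"
        using jk by (auto simp: wav_index_def split: if_splits)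
      then show ?thesis using that
        by (metis add_diff_inverse_nat le_neq_implies_less nat_add_left_cancel_less)
    qed
    then show ?thesis
    proof cases
      case 1
      have "(2::nat) ^ l0 \<le> 2 ^ j" using 1 by (intro power_increasing) auto
      then have "2 * N \<le> 2 ^ j" using N by linarith
      from scaled_mono[OF M2[OF this 1(2)], of M] show ?thesis
        by (rule scaled_cong[rotated]) (use w(3) 1 p in auto)
    next
      case 2
      from scaled_mono[OF M1[OF N(3) 2(2)], of M] show ?thesis
        unfolding 2(1) by (rule scaled_cong[rotated]) (use w(1) 2 p in auto)
    next
      case 3
      from scaled_mono[OF M2[OF N(3) 3(3)], of M] have "scaled M l0 k' (w (l0, k))"
        by (rule scaled_cong[rotated]) (use w(2) 3 p in auto)
      moreover have "\<bar>2 ^ l0 * x - real k\<bar> \<le> M" if "x \<in> {0..1}" for x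
      proof -
        have "0 \<le> 2 ^ l0 * x" "2 ^ l0 * x \<le> 2 ^ l0" using that by (auto simp: mult_left_le)
        moreover have "real k \<le> 2 ^ l0 + 2 ^ l0" using 3
          by (metis add_left_mono less_imp_le of_nat_add of_nat_le_iff of_nat_numeral of_nat_power)
        moreover have "M \<ge> 2 ^ l0 + 2 ^ l0" unfolding M_def by simp
        ultimately show ?thesis by linarith
      qed
      ultimately show ?thesis using 3(1) unfolding scaled_def by blast
    qed
  qed
  moreover have "M \<ge> 1" by (simp add: M_def)
  ultimately have "wavelets l0 w M"
    using assms(1) unfolding wavelets_def cdv_basis_def by (intro conjI allI impI) blast+
  then show ?thesis by blast
qed

section \<open>Wavelet coefficients\<close>

lemma space_unit_leb [simp]: "space unit_leb = {0..1}"
  by (simp add: unit_leb_def space_restrict_space)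

lemma sets_unit_leb: "sets unit_leb = sets (restrict_space borel {0..1})"
  by (auto simp: unit_leb_def sets_restrict_space)

lemma prob_space_unit_leb: "prob_space unit_leb"
  by (rule prob_spaceI) (simp add: unit_leb_def space_restrict_space emeasure_restrict_space)

interpretation unit_leb: prob_space unit_leb
  by (rule prob_space_unit_leb)

lemma measurable_unit_leb_cont:
  assumes "continuous_on {0..1::real} f"
  shows "f \<in> borel_measurable unit_leb"
  using borel_measurable_continuous_on_restrict[OF assms] measurable_cong_sets[OF sets_unit_leb refl]
  by blast

lemma integrable_unit_leb_bounded:
  fixes f :: "real \<Rightarrow> real"
  assumes "f \<in> borel_measurable unit_leb" "\<And>x. x \<in> {0..1} \<Longrightarrow> \<bar>f x\<bar> \<le> B"
  shows "integrable unit_leb f"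
  by (rule unit_leb.integrable_const_bound[where B = B]) (use assms in auto)

lemma integral_unit_leb_mono:
  fixes f :: "real \<Rightarrow> real"
  assumes "integrable unit_leb f" "integrable unit_leb g" "\<And>x. x \<in> {0..1} \<Longrightarrow> f x \<le> g x"
  shows "(LINT x|unit_leb. f x) \<le> (LINT x|unit_leb. g x)"
  using assms by (intro integral_mono) auto

lemma emeasure_unit_leb_interval:
  assumes "0 \<le> a" "a \<le> b" "b \<le> 1"
  shows "emeasure unit_leb {a..b} = ennreal (b - a)"
  using assms by (simp add: unit_leb_def emeasure_restrict_space)

text \<open>By continuity a strict violation at one point spreads to an interval of positive length.
  This later turns essential bounds on active sums into pointwise ones.\<close>

lemma AE_unit_leb_continuous_nonneg:
  fixes f :: "real \<Rightarrow> real"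
  assumes "AE x in unit_leb. f x \<ge> 0" "continuous_on {0..1} f" "x0 \<in> {0..1}"
  shows "f x0 \<ge> 0"
proof (rule ccontr)
  assume "\<not> f x0 \<ge> 0"
  then have "f x0 < 0" by simp
  with assms(2,3) obtain e where e: "e > 0" "\<And>x. x \<in> {0..1} \<Longrightarrow> dist x x0 < e \<Longrightarrow> dist (f x) (f x0) < - f x0"
    unfolding continuous_on_iff by (metis neg_0_less_iff_less)
  define a b where "a = max 0 (x0 - e / 2)" and "b = min 1 (x0 + e / 2)"
  have ab: "0 \<le> a" "a < b" "b \<le> 1" using assms(3) e(1) by (auto simp: a_def b_def)
  have neg: "f x < 0" if "x \<in> {a..b}" for x
  proof -
    have "x \<in> {0..1}" "dist x x0 < e" using that assms(3) e(1) by (auto simp: a_def b_def dist_real_def)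
    from e(2)[OF this] show ?thesis by (auto simp: dist_real_def)
  qed
  obtain N where N: "{x \<in> space unit_leb. \<not> f x \<ge> 0} \<subseteq> N" "N \<in> sets unit_leb" "emeasure unit_leb N = 0"
    using assms(1) by (elim AE_E)
  have "emeasure unit_leb {a..b} \<le> emeasure unit_leb N"
  proof (rule emeasure_mono)
    show "{a..b} \<subseteq> N" using N(1) neg ab by force
  qed (rule N)
  then show False using N(3) emeasure_unit_leb_interval[of a b] ab by simp
qed

lemma AE_unit_leb_continuous_eq:
  fixes f :: "real \<Rightarrow> real"
  assumes "AE x in unit_leb. f x = g x" "continuous_on {0..1} f" "continuous_on {0..1} g" "x \<in> {0..1}"
  shows "f x = g x"
proof -
  have "- \<bar>f x - g x\<bar> \<ge> 0"
    by (rule AE_unit_leb_continuous_nonneg[OF _ _ assms(4)])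
       (use assms in \<open>auto intro!: continuous_intros elim!: AE_mp\<close>)
  then show ?thesis by simp
qed

section \<open>Hoelder functions and geometric sums over levels\<close>

definition holder :: "real \<Rightarrow> real \<Rightarrow> (real \<Rightarrow> real) \<Rightarrow> bool" where
  "holder \<sigma> A f \<longleftrightarrow> (\<forall>x\<in>{0..1}. \<forall>y\<in>{0..1}. \<bar>f x - f y\<bar> \<le> A * \<bar>x - y\<bar> powr \<sigma>)"

lemma holder_continuous:
  assumes "holder \<sigma> A f" "\<sigma> > 0"
  shows "continuous_on {0..1} f"
  unfolding continuous_on_def
proof
  fix x :: real assume x: "x \<in> {0..1}"
  have "((\<lambda>y. f y - f x) \<longlongrightarrow> 0) (at x within {0..1})"
  proof (rule Lim_null_comparison)
    show "eventually (\<lambda>y. norm (f y - f x) \<le> A * \<bar>y - x\<bar> powr \<sigma>) (at x within {0..1})"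
      using assms(1) x unfolding holder_def eventually_at_filter by auto
    have "((\<lambda>y. \<bar>y - x\<bar> powr \<sigma>) \<longlongrightarrow> \<bar>x - x\<bar> powr \<sigma>) (at x within {0..1})"
    proof (rule tendsto_powr2)
      show "((\<lambda>y. \<bar>y - x\<bar>) \<longlongrightarrow> \<bar>x - x\<bar>) (at x within {0..1})" by (intro tendsto_intros)
    qed (use assms(2) in \<open>auto intro!: always_eventually\<close>)
    then have "((\<lambda>y. A * \<bar>y - x\<bar> powr \<sigma>) \<longlongrightarrow> A * \<bar>x - x\<bar> powr \<sigma>) (at x within {0..1})"
      by (intro tendsto_mult tendsto_const)
    then show "((\<lambda>y. A * \<bar>y - x\<bar> powr \<sigma>) \<longlongrightarrow> 0) (at x within {0..1})" using assms(2) by simp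
  qed
  then show "(f \<longlongrightarrow> f x) (at x within {0..1})" by (simp add: LIM_zero_iff)
qed

lemmas holder_measurable = measurable_unit_leb_cont[OF holder_continuous]

text \<open>The sum of the geometric series with ratio \<open>2 powr (- c)\<close>.\<close>

definition geo :: "real \<Rightarrow> real" where "geo c = 1 / (1 - 2 powr (- c))"

lemma two_powr_less_one: "c > 0 \<Longrightarrow> 2 powr (- c :: real) < 1"
  using powr_less_mono[of "- c" 0 2] by simp

lemma geo_pos: "c > 0 \<Longrightarrow> geo c \<ge> 1"
  using two_powr_less_one[of c] by (simp add: geo_def)

lemma sum_powr_decreasing:
  assumes "c > 0"
  shows "(\<Sum>i\<in>{a..<b::nat}. 2 powr (- c * real i)) \<le> geo c * 2 powr (- c * real a)"
proof (cases "a \<le> b")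
  case True
  define q where "q = 2 powr (- c)"
  have q: "0 < q" "q < 1" using assms by (auto simp: q_def two_powr_less_one)
  have e: "2 powr (- c * real i) = q ^ i" for i
    by (simp add: q_def powr_powr powr_realpow[symmetric] del: powr_realpow)
  have "(\<Sum>i\<in>{a..<b}. q ^ i) = (q ^ a - q ^ b) / (1 - q)"
  proof -
    have "(\<Sum>i\<in>{a..<b}. q ^ i) * (1 - q) = q ^ a - q ^ b"
      using True
    proof (induction b rule: dec_induct)
      case (step n)
      then have "(\<Sum>i\<in>{a..<Suc n}. q ^ i) * (1 - q) = (\<Sum>i\<in>{a..<n}. q ^ i) * (1 - q) + q ^ n * (1 - q)"
        by (simp add: distrib_right)
      then show ?case using step.IH by (simp add: algebra_simps)
    qed simp
    then show ?thesis using q by (simp add: field_simps)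
  qed
  also have "\<dots> \<le> q ^ a / (1 - q)" using q by (intro divide_right_mono) auto
  finally show ?thesis unfolding e by (simp add: geo_def q_def)
qed (use geo_pos[OF assms] in auto)

lemma sum_powr_increasing:
  assumes "c > 0"
  shows "(\<Sum>i\<in>{a..<b::nat}. 2 powr (c * real i)) \<le> geo c * 2 powr (c * (real b - 1))"
proof (cases "a < b")
  case True
  then have "(\<Sum>i\<in>{a..<b}. 2 powr (c * real i)) = (\<Sum>i\<in>{a..<b}. 2 powr (c * real (a + b - 1 - i)))"
    by (intro sum.reindex_bij_witness[of _ "\<lambda>i. a + b - 1 - i" "\<lambda>i. a + b - 1 - i"]) auto
  also have "\<dots> = (\<Sum>i\<in>{a..<b}. 2 powr (c * (real (a + b) - 1)) * 2 powr (- c * real i))"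
    by (intro sum.cong) (auto simp: powr_add[symmetric] of_nat_diff algebra_simps)
  also have "\<dots> \<le> 2 powr (c * (real (a + b) - 1)) * (geo c * 2 powr (- c * real a))"
    unfolding sum_distrib_left[symmetric]
    by (intro mult_left_mono sum_powr_decreasing assms) auto
  also have "\<dots> = geo c * 2 powr (c * (real b - 1))"
    by (simp add: powr_add[symmetric] algebra_simps)
  finally show ?thesis .
qed (use geo_pos[OF assms] in auto)

lemmas powr_combine = powr_add[symmetric] algebra_simps diff_divide_distrib add_divide_distrib minus_diff_commute

section \<open>Overlap, integrals and oscillation of wavelets\<close>

context wavelets begin

abbreviation lev :: "nat \<Rightarrow> (nat \<times> nat) set" where "lev i \<equiv> {v \<in> wav_index l0. fst v = i}"

lemma w_abs: "(j, k) \<in> wav_index l0 \<Longrightarrow> x \<in> {0..1} \<Longrightarrow> \<bar>w (j, k) x\<bar> \<le> M * 2 powr (real j / 2)"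
  and w_lip: "(j, k) \<in> wav_index l0 \<Longrightarrow> x \<in> {0..1} \<Longrightarrow> y \<in> {0..1} \<Longrightarrow>
     \<bar>w (j, k) x - w (j, k) y\<bar> \<le> M * 2 powr (real j / 2) * 2 ^ j * \<bar>x - y\<bar>"
  and w_supp: "(j, k) \<in> wav_index l0 \<Longrightarrow> x \<in> {0..1} \<Longrightarrow> w (j, k) x \<noteq> 0 \<Longrightarrow> \<bar>2 ^ j * x - real k\<bar> \<le> M"
  using scaled unfolding scaled_def by blast+

lemma w_continuous:
  assumes "v \<in> wav_index l0" shows "continuous_on {0..1} (w v)"
proof -
  obtain j k where v: "v = (j, k)" by force
  have "holder 1 (M * 2 powr (real j / 2) * 2 ^ j) (w v)"
    unfolding holder_def using w_lip assms unfolding v by auto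
  then show ?thesis by (rule holder_continuous) simp
qed

lemma w_measurable: "v \<in> wav_index l0 \<Longrightarrow> w v \<in> borel_measurable unit_leb"
  by (rule measurable_unit_leb_cont[OF w_continuous])

lemma w_bounded: "v \<in> wav_index l0 \<Longrightarrow> x \<in> {0..1} \<Longrightarrow> \<bar>w v x\<bar> \<le> M * 2 powr (real (fst v) / 2)"
  using w_abs by (cases v) auto

lemma finite_level: "finite (lev i)" "card (lev i) \<le> 2 ^ (i + 1)"
proof -
  have s: "lev i \<subseteq> {i} \<times> {..<2 ^ (i + 1)}"
    by (auto simp: wav_index_def split: if_splits)
  then show "finite (lev i)" by (rule finite_subset) auto
  have "card ({i} \<times> {..<2 ^ (i + 1) :: nat}) = 2 ^ (i + 1)" by (simp add: card_cartesian_product)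
  then show "card (lev i) \<le> 2 ^ (i + 1)"
    using card_mono[OF _ s] by simp
qed

text \<open>The centre is a point where the wavelet does not vanish, rather than
  \<open>k / 2 ^ j\<close>, so that it lies in the unit interval, where Hoelder bounds
  apply.\<close>

lemma w_near:
  assumes "(j, k) \<in> wav_index l0"
  obtains c where "c \<in> {0..1}" "\<And>x. x \<in> {0..1} \<Longrightarrow> w (j, k) x \<noteq> 0 \<Longrightarrow> \<bar>x - c\<bar> \<le> 2 * M * 2 powr (- real j)"
proof (cases "\<exists>c\<in>{0..1}. w (j, k) c \<noteq> 0")
  case True
  then obtain c where c: "c \<in> {0..1}" "w (j, k) c \<noteq> 0" by blast
  have "\<bar>x - c\<bar> \<le> 2 * M * 2 powr (- real j)" if "x \<in> {0..1}" "w (j, k) x \<noteq> 0" for x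
  proof -
    have "\<bar>2 ^ j * x - 2 ^ j * c\<bar> \<le> 2 * M" using w_supp[OF assms that] w_supp[OF assms c] by linarith
    moreover have "2 ^ j * \<bar>x - c\<bar> = \<bar>2 ^ j * x - 2 ^ j * c\<bar>"
      using abs_mult[of "2 ^ j" "x - c"] by (simp add: right_diff_distrib)
    ultimately have "2 ^ j * \<bar>x - c\<bar> \<le> 2 * M" by simp
    then show ?thesis by (simp add: powr_minus powr_realpow field_simps)
  qed
  then show thesis using that c by blast
next
  case False
  then show thesis using that[of 0] by auto
qed

text \<open>A wavelet that is nonzero at \<open>x\<close> has its index within \<open>M\<close> of
  \<open>2 ^ i * x\<close>, and there are at most \<open>2 * M + 1 \<le> 3 * M\<close> such
  integers.\<close>

lemma card_active:
  assumes "K \<subseteq> lev i" "x \<in> {0..1}"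
  shows "real (card {v \<in> K. w v x \<noteq> 0}) \<le> 3 * M"
proof -
  define S where "S = {\<lceil>2 ^ i * x - M\<rceil>..\<lfloor>2 ^ i * x + M\<rfloor>}"
  have "(\<lambda>v. int (snd v)) ` {v \<in> K. w v x \<noteq> 0} \<subseteq> S"
  proof safe
    fix j k assume v: "(j, k) \<in> K" "w (j, k) x \<noteq> 0"
    then have "j = i" "(j, k) \<in> wav_index l0" using assms(1) by auto
    with w_supp[OF this(2) assms(2) v(2)] have "\<bar>2 ^ i * x - real k\<bar> \<le> M" by simp
    then show "int (snd (j, k)) \<in> S" unfolding S_def by (auto simp: ceiling_le_iff le_floor_iff)
  qed
  moreover have "inj_on (\<lambda>v. int (snd v)) {v \<in> K. w v x \<noteq> 0}"
  proof (rule inj_onI)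
    fix u v assume "u \<in> {v \<in> K. w v x \<noteq> 0}" "v \<in> {v \<in> K. w v x \<noteq> 0}" "int (snd u) = int (snd v)"
    moreover from this have "fst u = i" "fst v = i" using assms(1) by auto
    ultimately show "u = v" by (simp add: prod_eq_iff)
  qed
  ultimately have "card {v \<in> K. w v x \<noteq> 0} \<le> card S"
    by (intro card_inj_on_le[where f = "\<lambda>v. int (snd v)"]) (auto simp: S_def)
  moreover have "real (card S) \<le> 2 * M + 1"
  proof -
    have "card S = nat (\<lfloor>2 ^ i * x + M\<rfloor> - \<lceil>2 ^ i * x - M\<rceil> + 1)" by (simp add: S_def)
    moreover have "real_of_int (\<lfloor>2 ^ i * x + M\<rfloor> - \<lceil>2 ^ i * x - M\<rceil> + 1) \<le> 2 * M + 1"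
      using of_int_floor_le[of "2 ^ i * x + M"] le_of_int_ceiling[of "2 ^ i * x - M"]
      unfolding of_int_add of_int_diff of_int_1 by linarith
    ultimately show ?thesis using M by (cases "\<lfloor>2 ^ i * x + M\<rfloor> - \<lceil>2 ^ i * x - M\<rceil> + 1 \<ge> 0") auto
  qed
  ultimately show ?thesis using M by linarith
qed

lemma sum_abs_w:
  assumes "K \<subseteq> lev i" "x \<in> {0..1}"
  shows "(\<Sum>v\<in>K. \<bar>w v x\<bar>) \<le> 3 * M\<^sup>2 * 2 powr (real i / 2)"
proof -
  have fin: "finite K" using assms(1) finite_level(1) finite_subset by blast
  have "(\<Sum>v\<in>K. \<bar>w v x\<bar>) = (\<Sum>v\<in>{v \<in> K. w v x \<noteq> 0}. \<bar>w v x\<bar>)"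
    by (rule sum.mono_neutral_right) (use fin in auto)
  also have "\<dots> \<le> real (card {v \<in> K. w v x \<noteq> 0}) * (M * 2 powr (real i / 2))"
    by (rule sum_bounded_above) (use assms w_bounded in auto)
  also have "\<dots> \<le> (3 * M) * (M * 2 powr (real i / 2))"
    using card_active[OF assms] M by (intro mult_right_mono) auto
  finally show ?thesis by (simp add: power2_eq_square)
qed

lemma integral_abs_w:
  assumes "(j, k) \<in> wav_index l0"
  shows "(LINT x|unit_leb. \<bar>w (j, k) x\<bar>) \<le> 4 * M\<^sup>2 * 2 powr (- real j / 2)"
proof -
  obtain c where c: "c \<in> {0..1}" "\<And>x. x \<in> {0..1} \<Longrightarrow> w (j, k) x \<noteq> 0 \<Longrightarrow> \<bar>x - c\<bar> \<le> 2 * M * 2 powr (- real j)"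
    using w_near[OF assms] by blast
  define r where "r = 2 * M * 2 powr (- real j)"
  have r: "r \<ge> 0" using M by (simp add: r_def)
  define a b where "a = max 0 (c - r)" and "b = min 1 (c + r)"
  have ab: "0 \<le> a" "a \<le> b" "b \<le> 1" "b - a \<le> 2 * r" using c(1) r by (auto simp: a_def b_def)
  have S: "{a..b} \<in> sets unit_leb"
    using ab by (auto simp: sets_unit_leb sets_restrict_space intro!: image_eqI[of _ _ "{a..b}"])
  have "(LINT x|unit_leb. \<bar>w (j, k) x\<bar>) \<le> (LINT x|unit_leb. (M * 2 powr (real j / 2)) * indicator {a..b} x)"
  proof (rule integral_unit_leb_mono)
    show "integrable unit_leb (\<lambda>x. \<bar>w (j, k) x\<bar>)"
      using w_measurable[OF assms] w_abs[OF assms] by (intro integrable_unit_leb_bounded) auto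
    show "integrable unit_leb (\<lambda>x. (M * 2 powr (real j / 2)) * indicator {a..b} x)"
      using S by (intro integrable_mult_right integrable_real_indicator) (auto simp: unit_leb.emeasure_eq_measure)
    fix x :: real assume x: "x \<in> {0..1}"
    show "\<bar>w (j, k) x\<bar> \<le> (M * 2 powr (real j / 2)) * indicator {a..b} x"
    proof (cases "w (j, k) x = 0")
      case False
      then have "x \<in> {a..b}" using c(2)[OF x] x by (auto simp: a_def b_def r_def)
      then show ?thesis using w_abs[OF assms x] by simp
    qed (use M in simp)
  qed
  also have "\<dots> = (M * 2 powr (real j / 2)) * (b - a)"
    using S ab emeasure_unit_leb_interval[OF ab(1,2,3)] by (simp add: measure_def)
  also have "\<dots> \<le> (M * 2 powr (real j / 2)) * (2 * r)"
    using ab(4) M by (intro mult_left_mono) auto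
  also have "\<dots> = 4 * M\<^sup>2 * (2 powr (real j / 2) * 2 powr (- real j))"
    by (simp add: r_def power2_eq_square)
  also have "2 powr (real j / 2) * 2 powr (- real j) = 2 powr (- real j / 2)"
    by (simp add: powr_add[symmetric])
  finally show ?thesis .
qed

text \<open>Since \<open>w * u\<close> integrates to zero, \<open>G\<close> may be replaced by
  \<open>G - G c\<close>, and on the support of the wavelet a Hoelder function differs from its
  value at \<open>c\<close> by at most \<open>A * (2 * M / 2 ^ j) powr \<sigma>\<close>. The factor
  \<open>u\<close> will be the constant 1, another wavelet, or a function of block 0.\<close>

lemma oscillation:
  assumes v: "(j, k) \<in> wav_index l0" and u: "u \<in> borel_measurable unit_leb" "\<And>x. x \<in> {0..1} \<Longrightarrow> \<bar>u x\<bar> \<le> D"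
    and orth: "(LINT x|unit_leb. w (j, k) x * u x) = 0"
    and G: "holder \<sigma> A G" "0 < \<sigma>" "\<sigma> \<le> 1" "A \<ge> 0" "\<And>x. x \<in> {0..1} \<Longrightarrow> \<bar>G x\<bar> \<le> B"
  shows "\<bar>LINT x|unit_leb. w (j, k) x * u x * G x\<bar>
           \<le> 2 * M * A * 2 powr (- \<sigma> * real j) * (LINT x|unit_leb. \<bar>w (j, k) x\<bar> * \<bar>u x\<bar>)"
proof -
  obtain c where c: "c \<in> {0..1}" "\<And>x. x \<in> {0..1} \<Longrightarrow> w (j, k) x \<noteq> 0 \<Longrightarrow> \<bar>x - c\<bar> \<le> 2 * M * 2 powr (- real j)"
    using w_near[OF v] by blast
  note [measurable] = w_measurable[OF v] u(1) holder_measurable[OF G(1,2)]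
  have bd: "\<bar>w (j, k) x * u x\<bar> \<le> M * 2 powr (real j / 2) * D" if "x \<in> {0..1}" for x
    unfolding abs_mult using w_abs[OF v that] u(2)[OF that] M by (intro mult_mono) auto
  have i1: "integrable unit_leb (\<lambda>x. w (j, k) x * u x)"
    by (rule integrable_unit_leb_bounded[OF _ bd]) auto
  have i2: "integrable unit_leb (\<lambda>x. w (j, k) x * u x * G x)"
  proof (rule integrable_unit_leb_bounded)
    fix x :: real assume x: "x \<in> {0..1}"
    show "\<bar>w (j, k) x * u x * G x\<bar> \<le> M * 2 powr (real j / 2) * D * B"
      unfolding abs_mult[of _ "G x"] using bd[OF x] G(5)[OF x] abs_ge_zero[of "w (j, k) x * u x"]
      by (intro mult_mono) (auto intro: order_trans)
  qed auto
  have "\<bar>LINT x|unit_leb. w (j, k) x * u x * G x\<bar> = \<bar>LINT x|unit_leb. w (j, k) x * u x * G x - G c * (w (j, k) x * u x)\<bar>"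
    using i1 i2 orth by simp
  also have "\<dots> \<le> (LINT x|unit_leb. \<bar>w (j, k) x * u x * G x - G c * (w (j, k) x * u x)\<bar>)"
    by (rule integral_abs_bound)
  also have "\<dots> \<le> (LINT x|unit_leb. (2 * M * A * 2 powr (- \<sigma> * real j)) * (\<bar>w (j, k) x\<bar> * \<bar>u x\<bar>))"
  proof (rule integral_unit_leb_mono)
    show "integrable unit_leb (\<lambda>x. \<bar>w (j, k) x * u x * G x - G c * (w (j, k) x * u x)\<bar>)"
      using i1 i2 by auto
    show "integrable unit_leb (\<lambda>x. (2 * M * A * 2 powr (- \<sigma> * real j)) * (\<bar>w (j, k) x\<bar> * \<bar>u x\<bar>))"
      using i1 unfolding abs_mult[symmetric] by auto
    fix x :: real assume x: "x \<in> {0..1}"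
    have "\<bar>w (j, k) x * u x\<bar> * \<bar>G x - G c\<bar> \<le> \<bar>w (j, k) x * u x\<bar> * (2 * M * A * 2 powr (- \<sigma> * real j))"
    proof (cases "w (j, k) x = 0")
      case False
      have "\<bar>G x - G c\<bar> \<le> A * \<bar>x - c\<bar> powr \<sigma>" using G(1) x c(1) unfolding holder_def by blast
      also have "\<dots> \<le> A * ((2 * M) * 2 powr (- \<sigma> * real j))"
      proof (rule mult_left_mono)
        have "\<bar>x - c\<bar> powr \<sigma> \<le> (2 * M * 2 powr (- real j)) powr \<sigma>"
          using c(2)[OF x False] G by (intro powr_mono2) auto
        also have "\<dots> = (2 * M) powr \<sigma> * 2 powr (- \<sigma> * real j)"
          using M by (simp add: powr_mult powr_powr mult.commute)
        also have "\<dots> \<le> (2 * M) * 2 powr (- \<sigma> * real j)"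
          using M G(3) powr_mono[of \<sigma> 1 "2 * M"] by (intro mult_right_mono) auto
        finally show "\<bar>x - c\<bar> powr \<sigma> \<le> (2 * M) * 2 powr (- \<sigma> * real j)" .
      qed (rule G)
      finally have "\<bar>G x - G c\<bar> \<le> 2 * M * A * 2 powr (- \<sigma> * real j)"
        by (simp add: mult_ac)
      then show ?thesis by (intro mult_left_mono) auto
    qed simp
    moreover have "w (j, k) x * u x * G x - G c * (w (j, k) x * u x) = (w (j, k) x * u x) * (G x - G c)"
      by (simp add: algebra_simps)
    ultimately show "\<bar>w (j, k) x * u x * G x - G c * (w (j, k) x * u x)\<bar>
        \<le> (2 * M * A * 2 powr (- \<sigma> * real j)) * (\<bar>w (j, k) x\<bar> * \<bar>u x\<bar>)"
      by (simp add: abs_mult mult_ac)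
  qed
  finally show ?thesis by simp
qed

end

text \<open>Two geometric series: the levels coarser and those finer than the distance of two
  points.\<close>

definition geo2 :: "real \<Rightarrow> real" where "geo2 \<sigma> = geo (1 - \<sigma>) + geo \<sigma>"

text \<open>The two terms of the minimum cross at \<open>2 ^ i * h = 1\<close>. Up to that level the
  Lipschitz bound grows like \<open>2 powr ((1 - \<sigma>) * i)\<close>, beyond it the size bound
  decays like \<open>2 powr (- \<sigma> * i)\<close>; both series are dominated by their value near
  the crossing level \<open>i0\<close>.\<close>

lemma sum_powr_min:
  assumes "0 < \<sigma>" "\<sigma> < 1" "0 \<le> h" "h \<le> 1"
  shows "(\<Sum>i<n. 2 powr (- \<sigma> * real i) * min 1 (2 ^ i * h)) \<le> geo2 \<sigma> * h powr \<sigma>"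
proof (cases "h = 0")
  case False
  then have h: "h > 0" using assms by simp
  define i0 where "i0 = nat \<lfloor>- log 2 h\<rfloor>"
  have lg: "- log 2 h \<ge> 0" using h assms by (simp add: log_le_zero_cancel_iff)
  then have i0: "real i0 \<le> - log 2 h" "- log 2 h < real i0 + 1"
    by (auto simp: i0_def)
  have "(\<Sum>i<n. 2 powr (- \<sigma> * real i) * min 1 (2 ^ i * h))
     \<le> (\<Sum>i\<in>{0..<i0 + 1} \<union> {i0 + 1..<n}. 2 powr (- \<sigma> * real i) * min 1 (2 ^ i * h))"
    using h by (intro sum_mono2) auto
  also have "\<dots> = (\<Sum>i\<in>{0..<i0 + 1}. 2 powr (- \<sigma> * real i) * min 1 (2 ^ i * h)) + (\<Sum>i\<in>{i0 + 1..<n}. 2 powr (- \<sigma> * real i) * min 1 (2 ^ i * h))"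
    by (intro sum.union_disjoint) auto
  also have "\<dots> \<le> (\<Sum>i\<in>{0..<i0 + 1}. 2 powr ((1 - \<sigma>) * real i) * h) + (\<Sum>i\<in>{i0 + 1..<n}. 2 powr (- \<sigma> * real i))"
  proof (intro add_mono sum_mono)
    fix i
    have "2 powr (- \<sigma> * real i) * min 1 (2 ^ i * h) \<le> 2 powr (- \<sigma> * real i) * (2 powr (real i) * h)"
      by (intro mult_left_mono) (auto simp: powr_realpow)
    also have "\<dots> = 2 powr ((1 - \<sigma>) * real i) * h" by (simp add: powr_add[symmetric] algebra_simps)
    finally show "2 powr (- \<sigma> * real i) * min 1 (2 ^ i * h) \<le> 2 powr ((1 - \<sigma>) * real i) * h" .
    have "2 powr (- \<sigma> * real i) * min 1 (2 ^ i * h) \<le> 2 powr (- \<sigma> * real i) * 1"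
      by (intro mult_left_mono) auto
    then show "2 powr (- \<sigma> * real i) * min 1 (2 ^ i * h) \<le> 2 powr (- \<sigma> * real i)" by simp
  qed
  also have "\<dots> \<le> geo (1 - \<sigma>) * 2 powr ((1 - \<sigma>) * real i0) * h + geo \<sigma> * 2 powr (- \<sigma> * (real i0 + 1))"
  proof (rule add_mono)
    show "(\<Sum>i\<in>{0..<i0 + 1}. 2 powr ((1 - \<sigma>) * real i) * h) \<le> geo (1 - \<sigma>) * 2 powr ((1 - \<sigma>) * real i0) * h"
      unfolding sum_distrib_right[symmetric] using sum_powr_increasing[of "1 - \<sigma>" 0 "i0 + 1"] assms h
      by (intro mult_right_mono) auto
    show "(\<Sum>i\<in>{i0 + 1..<n}. 2 powr (- \<sigma> * real i)) \<le> geo \<sigma> * 2 powr (- \<sigma> * (real i0 + 1))"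
      using sum_powr_decreasing[OF assms(1), of "i0 + 1" n] by (simp add: add.commute)
  qed
  also have "\<dots> \<le> geo (1 - \<sigma>) * h powr \<sigma> + geo \<sigma> * h powr \<sigma>"
  proof (rule add_mono)
    have "2 powr ((1 - \<sigma>) * real i0) \<le> 2 powr ((1 - \<sigma>) * (- log 2 h))"
      using i0 assms by (intro powr_mono mult_left_mono) auto
    also have "\<dots> = (2 powr (log 2 h)) powr (\<sigma> - 1)" by (simp add: powr_powr algebra_simps)
    also have "\<dots> = h powr (\<sigma> - 1)" using h by simp
    finally have "2 powr ((1 - \<sigma>) * real i0) * h \<le> h powr (\<sigma> - 1) * h powr 1"
      using h by (simp add: mult_right_mono)
    then have "2 powr ((1 - \<sigma>) * real i0) * h \<le> h powr \<sigma>" by (simp only: powr_add[symmetric]) simp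
    then show "geo (1 - \<sigma>) * 2 powr ((1 - \<sigma>) * real i0) * h \<le> geo (1 - \<sigma>) * h powr \<sigma>"
      using geo_pos[of "1 - \<sigma>"] assms by (simp add: mult.assoc mult_left_mono)
    have "2 powr (- \<sigma> * (real i0 + 1)) \<le> 2 powr (\<sigma> * log 2 h)"
      using i0 assms mult_left_mono[of "- log 2 h" "real i0 + 1" \<sigma>] by (intro powr_mono) auto
    also have "\<dots> = (2 powr (log 2 h)) powr \<sigma>" by (simp add: powr_powr mult.commute)
    also have "\<dots> = h powr \<sigma>" using h by simp
    finally show "geo \<sigma> * 2 powr (- \<sigma> * (real i0 + 1)) \<le> geo \<sigma> * h powr \<sigma>"
      using geo_pos[of \<sigma>] assms by (intro mult_left_mono) auto
  qed
  finally show ?thesis by (simp add: geo2_def distrib_right)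
qed simp

lemma sum_levels:
  fixes f :: "nat \<times> 'a \<Rightarrow> real"
  assumes "finite V" "\<And>v. v \<in> V \<Longrightarrow> fst v < n"
  shows "(\<Sum>v\<in>V. f v) = (\<Sum>i<n. \<Sum>v\<in>{v \<in> V. fst v = i}. f v)"
  using sum.group[of V "{..<n}" fst f] assms by (simp add: image_subset_iff)

lemma finite_bounded_level:
  assumes "finite V" obtains n where "\<And>v. v \<in> V \<Longrightarrow> fst v < (n::nat)"
proof
  show "fst v < Suc (Max (fst ` V))" if "v \<in> V" for v using that assms by (simp add: le_imp_less_Suc)
qed

context wavelets begin

text \<open>At each level at most \<open>6 * M\<close> wavelets are nonzero at \<open>x\<close> or
  at \<open>y\<close>, and each contributes the smaller of its size and its Lipschitz bound;
  \<open>sum_powr_min\<close> adds the levels.\<close>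

lemma series_holder:
  assumes V: "finite V" "V \<subseteq> wav_index l0" and \<sigma>: "0 < \<sigma>" "\<sigma> < 1"
    and a: "\<And>v. v \<in> V \<Longrightarrow> \<bar>a v\<bar> \<le> A * 2 powr (- (\<sigma> + 1/2) * real (fst v))" and A: "A \<ge> 0"
    and x: "x \<in> {0..1}" "y \<in> {0..1}"
  shows "\<bar>(\<Sum>v\<in>V. a v * w v x) - (\<Sum>v\<in>V. a v * w v y)\<bar> \<le> 12 * M\<^sup>2 * geo2 \<sigma> * A * \<bar>x - y\<bar> powr \<sigma>"
proof -
  define h where "h = \<bar>x - y\<bar>"
  have h: "0 \<le> h" "h \<le> 1" using x by (auto simp: h_def)
  obtain n where n: "\<And>v. v \<in> V \<Longrightarrow> fst v < n" using finite_bounded_level[OF V(1)] by blast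
  have lev: "(\<Sum>v\<in>{v \<in> V. fst v = i}. \<bar>a v * (w v x - w v y)\<bar>) \<le> 12 * M\<^sup>2 * A * (2 powr (- \<sigma> * real i) * min 1 (2 ^ i * h))" for i
  proof -
    define K where "K = {v \<in> V. fst v = i}"
    have K: "K \<subseteq> lev i" "finite K" using V by (auto simp: K_def)
    define T where "T = {v \<in> K. w v x \<noteq> 0} \<union> {v \<in> K. w v y \<noteq> 0}"
    have cT: "real (card T) \<le> 6 * M"
      using card_active[OF K(1) x(1)] card_active[OF K(1) x(2)] card_Un_le[of "{v \<in> K. w v x \<noteq> 0}" "{v \<in> K. w v y \<noteq> 0}"]
      unfolding T_def by linarith
    have "(\<Sum>v\<in>K. \<bar>a v * (w v x - w v y)\<bar>) = (\<Sum>v\<in>T. \<bar>a v * (w v x - w v y)\<bar>)"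
      by (rule sum.mono_neutral_right) (use K in \<open>auto simp: T_def\<close>)
    also have "\<dots> \<le> real (card T) * ((A * 2 powr (- (\<sigma> + 1/2) * real i)) * (2 * M * 2 powr (real i / 2) * min 1 (2 ^ i * h)))"
    proof (rule sum_bounded_above)
      fix v assume "v \<in> T"
      then have v: "v \<in> K" by (auto simp: T_def)
      obtain k where vk: "v = (i, k)" "(i, k) \<in> wav_index l0" using v K(1) by (cases v) auto
      have 1: "\<bar>w v x - w v y\<bar> \<le> 2 * M * 2 powr (real i / 2)"
        using w_abs[OF vk(2) x(1)] w_abs[OF vk(2) x(2)] unfolding vk(1) by linarith
      have "\<bar>w v x - w v y\<bar> \<le> M * 2 powr (real i / 2) * 2 ^ i * h"
        using w_lip[OF vk(2) x] unfolding vk(1) h_def .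
      also have "\<dots> \<le> 2 * (M * 2 powr (real i / 2) * 2 ^ i * h)" using M h by simp
      finally have 2: "\<bar>w v x - w v y\<bar> \<le> 2 * M * 2 powr (real i / 2) * (2 ^ i * h)" by (simp add: mult_ac)
      have "\<bar>w v x - w v y\<bar> \<le> 2 * M * 2 powr (real i / 2) * min 1 (2 ^ i * h)"
        using 1 2 by (auto simp: min_def)
      moreover have "\<bar>a v\<bar> \<le> A * 2 powr (- (\<sigma> + 1/2) * real i)" using a[of v] v vk(1) by (auto simp: K_def)
      ultimately show "\<bar>a v * (w v x - w v y)\<bar> \<le> (A * 2 powr (- (\<sigma> + 1/2) * real i)) * (2 * M * 2 powr (real i / 2) * min 1 (2 ^ i * h))"
        unfolding abs_mult by (intro mult_mono) (use A in auto)
    qed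
    also have "\<dots> \<le> (6 * M) * ((A * 2 powr (- (\<sigma> + 1/2) * real i)) * (2 * M * 2 powr (real i / 2) * min 1 (2 ^ i * h)))"
      using cT A M h by (intro mult_right_mono mult_nonneg_nonneg) auto
    also have "\<dots> = 12 * M\<^sup>2 * A * ((2 powr (- (\<sigma> + 1/2) * real i) * 2 powr (real i / 2)) * min 1 (2 ^ i * h))"
      by (simp add: power2_eq_square)
    also have "2 powr (- (\<sigma> + 1/2) * real i) * 2 powr (real i / 2) = 2 powr (- \<sigma> * real i)"
      by (simp add: powr_add[symmetric] algebra_simps)
    finally show ?thesis unfolding K_def .
  qed
  have "\<bar>(\<Sum>v\<in>V. a v * w v x) - (\<Sum>v\<in>V. a v * w v y)\<bar> = \<bar>\<Sum>v\<in>V. a v * (w v x - w v y)\<bar>"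
    by (simp add: right_diff_distrib sum_subtractf)
  also have "\<dots> \<le> (\<Sum>v\<in>V. \<bar>a v * (w v x - w v y)\<bar>)" by (rule sum_abs)
  also have "\<dots> = (\<Sum>i<n. \<Sum>v\<in>{v \<in> V. fst v = i}. \<bar>a v * (w v x - w v y)\<bar>)" by (rule sum_levels[OF V(1) n])
  also have "\<dots> \<le> (\<Sum>i<n. 12 * M\<^sup>2 * A * (2 powr (- \<sigma> * real i) * min 1 (2 ^ i * h)))" by (intro sum_mono lev)
  also have "\<dots> \<le> 12 * M\<^sup>2 * A * (geo2 \<sigma> * h powr \<sigma>)"
    unfolding sum_distrib_left[symmetric] using sum_powr_min[OF \<sigma> h] A by (intro mult_left_mono) auto
  finally show ?thesis by (simp add: h_def mult_ac)
qed

lemma level_sup: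
  assumes K: "K \<subseteq> lev i" and a: "\<And>v. v \<in> K \<Longrightarrow> \<bar>a v\<bar> \<le> A" and x: "x \<in> {0..1}" and A: "A \<ge> 0"
  shows "(\<Sum>v\<in>K. \<bar>a v * w v x\<bar>) \<le> 3 * M\<^sup>2 * A * 2 powr (real i / 2)"
proof -
  have "(\<Sum>v\<in>K. \<bar>a v * w v x\<bar>) \<le> (\<Sum>v\<in>K. A * \<bar>w v x\<bar>)"
    using a by (intro sum_mono) (auto simp: abs_mult intro: mult_right_mono)
  also have "\<dots> \<le> A * (3 * M\<^sup>2 * 2 powr (real i / 2))"
    unfolding sum_distrib_left[symmetric] by (intro mult_left_mono sum_abs_w K x A)
  finally show ?thesis by (simp add: mult_ac)
qed

lemma series_sup:
  assumes V: "finite V" "V \<subseteq> wav_index l0" and \<sigma>: "0 < \<sigma>"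
    and a: "\<And>v. v \<in> V \<Longrightarrow> \<bar>a v\<bar> \<le> A * 2 powr (- (\<sigma> + 1/2) * real (fst v))" and A: "A \<ge> 0"
    and x: "x \<in> {0..1}" and m: "\<And>v. v \<in> V \<Longrightarrow> m \<le> fst v"
  shows "\<bar>\<Sum>v\<in>V. a v * w v x\<bar> \<le> 3 * M\<^sup>2 * A * geo \<sigma> * 2 powr (- \<sigma> * real m)"
proof -
  obtain n where n: "\<And>v. v \<in> V \<Longrightarrow> fst v < n" using finite_bounded_level[OF V(1)] by blast
  have lev: "(\<Sum>v\<in>{v \<in> V. fst v = i}. \<bar>a v * w v x\<bar>) \<le> 3 * M\<^sup>2 * A * 2 powr (- \<sigma> * real i)" for i
  proof -
    have "(\<Sum>v\<in>{v \<in> V. fst v = i}. \<bar>a v * w v x\<bar>) \<le> 3 * M\<^sup>2 * (A * 2 powr (- (\<sigma> + 1/2) * real i)) * 2 powr (real i / 2)"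
      using V a A x by (intro level_sup) auto
    also have "\<dots> = 3 * M\<^sup>2 * A * (2 powr (- (\<sigma> + 1/2) * real i) * 2 powr (real i / 2))" by simp
    also have "2 powr (- (\<sigma> + 1/2) * real i) * 2 powr (real i / 2) = 2 powr (- \<sigma> * real i)"
      by (simp add: powr_add[symmetric] algebra_simps)
    finally show ?thesis .
  qed
  have "\<bar>\<Sum>v\<in>V. a v * w v x\<bar> \<le> (\<Sum>v\<in>V. \<bar>a v * w v x\<bar>)" by (rule sum_abs)
  also have "\<dots> = (\<Sum>i<n. \<Sum>v\<in>{v \<in> V. fst v = i}. \<bar>a v * w v x\<bar>)" by (rule sum_levels[OF V(1) n])
  also have "\<dots> = (\<Sum>i\<in>{m..<n}. \<Sum>v\<in>{v \<in> V. fst v = i}. \<bar>a v * w v x\<bar>)"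
  proof (rule sum.mono_neutral_right)
    show "\<forall>i\<in>{..<n} - {m..<n}. (\<Sum>v\<in>{v \<in> V. fst v = i}. \<bar>a v * w v x\<bar>) = 0"
    proof
      fix i assume "i \<in> {..<n} - {m..<n}"
      then have "i < m" by auto
      then have "{v \<in> V. fst v = i} = {}" using m by (metis (mono_tags, lifting) empty_Collect_eq not_le)
      then show "(\<Sum>v\<in>{v \<in> V. fst v = i}. \<bar>a v * w v x\<bar>) = 0" by (simp only: sum.empty)
    qed
  qed auto
  also have "\<dots> \<le> (\<Sum>i\<in>{m..<n}. 3 * M\<^sup>2 * A * 2 powr (- \<sigma> * real i))" by (intro sum_mono lev)
  also have "\<dots> \<le> 3 * M\<^sup>2 * A * (geo \<sigma> * 2 powr (- \<sigma> * real m))"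
    unfolding sum_distrib_left[symmetric] using sum_powr_decreasing[OF \<sigma>] A by (intro mult_left_mono) auto
  finally show ?thesis by (simp add: mult_ac)
qed

lemma finite_below: "finite {v \<in> wav_index l0. fst v < n}"
proof -
  have "{v \<in> wav_index l0. fst v < n} = (\<Union>i<n. lev i)" by auto
  then show ?thesis using finite_level(1) by auto
qed

lemma integrable_w:
  assumes "v \<in> wav_index l0" "continuous_on {0..1} f"
  shows "integrable unit_leb (\<lambda>x. f x * w v x)"
proof -
  have c: "continuous_on {0..1} (\<lambda>x. f x * w v x)" by (intro continuous_intros assms w_continuous)
  then have "bounded ((\<lambda>x. f x * w v x) ` {0..1})" by (intro compact_imp_bounded compact_continuous_image) auto
  then obtain B where "\<And>x. x \<in> {0..1} \<Longrightarrow> \<bar>f x * w v x\<bar> \<le> B" unfolding bounded_iff real_norm_def by blast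
  then show ?thesis by (intro integrable_unit_leb_bounded measurable_unit_leb_cont c)
qed

text \<open>The decay makes the partial sums uniformly Cauchy. Their limit \<open>g\<close> is
  Hoelder and, by dominated convergence, has the coefficients of \<open>f\<close>; completeness
  gives \<open>f = g\<close> almost everywhere, and continuity everywhere. Thus coefficient bounds
  alone control a continuous function pointwise.\<close>

lemma expansion:
  assumes f: "continuous_on {0..1} f" and \<sigma>: "0 < \<sigma>" "\<sigma> < 1" and A: "A \<ge> 0"
    and a: "\<And>v. v \<in> wav_index l0 \<Longrightarrow> \<bar>ip f (w v)\<bar> \<le> A * 2 powr (- (\<sigma> + 1/2) * real (fst v))"
  shows "holder \<sigma> (12 * M\<^sup>2 * geo2 \<sigma> * A) f"
    and "\<And>x. x \<in> {0..1} \<Longrightarrow> \<bar>f x\<bar> \<le> 3 * M\<^sup>2 * A * geo \<sigma>"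
    and "\<And>x. x \<in> {0..1} \<Longrightarrow> (\<lambda>n. \<Sum>v\<in>{v \<in> wav_index l0. fst v < n}. ip f (w v) * w v x) \<longlonglongrightarrow> f x"
proof -
  define c where "c v = ip f (w v)" for v
  define S where "S n x = (\<Sum>v\<in>{v \<in> wav_index l0. fst v < n}. c v * w v x)" for n x
  define C where "C = 3 * M\<^sup>2 * A * geo \<sigma>"
  have step: "\<bar>S n x - S m x\<bar> \<le> C * 2 powr (- \<sigma> * real m)" if "m \<le> n" "x \<in> {0..1}" for m n x
  proof -
    have "S n x - S m x = (\<Sum>v\<in>{v \<in> wav_index l0. m \<le> fst v \<and> fst v < n}. c v * w v x)"
    proof -
      have "{v \<in> wav_index l0. fst v < n} = {v \<in> wav_index l0. fst v < m} \<union> {v \<in> wav_index l0. m \<le> fst v \<and> fst v < n}"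
        using that by auto
      moreover have "(\<Sum>v\<in>{v \<in> wav_index l0. fst v < m} \<union> {v \<in> wav_index l0. m \<le> fst v \<and> fst v < n}. c v * w v x)
          = S m x + (\<Sum>v\<in>{v \<in> wav_index l0. m \<le> fst v \<and> fst v < n}. c v * w v x)"
        unfolding S_def by (rule sum.union_disjoint) (auto intro: finite_subset[OF _ finite_below[of n]] finite_below)
      ultimately show ?thesis unfolding S_def by simp
    qed
    moreover have "\<bar>\<Sum>v\<in>{v \<in> wav_index l0. m \<le> fst v \<and> fst v < n}. c v * w v x\<bar> \<le> C * 2 powr (- \<sigma> * real m)"
      unfolding C_def
    proof (rule series_sup)
      show "finite {v \<in> wav_index l0. m \<le> fst v \<and> fst v < n}"
        by (rule finite_subset[OF _ finite_below[of n]]) auto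
      show "\<bar>c v\<bar> \<le> A * 2 powr (- (\<sigma> + 1/2) * real (fst v))" if "v \<in> {v \<in> wav_index l0. m \<le> fst v \<and> fst v < n}" for v
        unfolding c_def using that by (intro a) simp
    qed (use A \<sigma> that in simp_all)
    ultimately show ?thesis by simp
  qed
  have lim0: "(\<lambda>m. C * 2 powr (- \<sigma> * real m)) \<longlonglongrightarrow> 0"
  proof -
    have "(\<lambda>m. (2 powr - \<sigma>) ^ m) \<longlonglongrightarrow> 0"
      using two_powr_less_one[OF \<sigma>(1)] by (intro LIMSEQ_power_zero) auto
    moreover have "2 powr (- \<sigma> * real m) = (2 powr - \<sigma>) ^ m" for m
      by (simp add: powr_powr powr_realpow[symmetric] del: powr_realpow)
    ultimately show ?thesis by (auto intro: tendsto_mult_right_zero)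
  qed
  have cauchy: "Cauchy (\<lambda>n. S n x)" if x: "x \<in> {0..1}" for x
  proof (rule metric_CauchyI)
    fix e :: real assume "e > 0"
    then have "eventually (\<lambda>m. C * 2 powr (- \<sigma> * real m) < e / 2) sequentially"
      using lim0 by (intro order_tendstoD) auto
    then obtain m where m: "C * 2 powr (- \<sigma> * real m) < e / 2" by (auto simp: eventually_sequentially)
    have "dist (S i x) (S j x) < e" if "i \<ge> m" "j \<ge> m" for i j
      using step[OF that(1) x] step[OF that(2) x] m unfolding dist_real_def by linarith
    then show "\<exists>N. \<forall>i\<ge>N. \<forall>j\<ge>N. dist (S i x) (S j x) < e" by blast
  qed
  define g where "g x = lim (\<lambda>n. S n x)" for x
  have conv: "(\<lambda>n. S n x) \<longlonglongrightarrow> g x" if "x \<in> {0..1}" for x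
    using Cauchy_convergent[OF cauchy[OF that]] unfolding g_def by (simp add: convergent_LIMSEQ_iff)
  have tail: "\<bar>g x - S m x\<bar> \<le> C * 2 powr (- \<sigma> * real m)" if x: "x \<in> {0..1}" for m x
  proof (rule LIMSEQ_le_const2)
    show "(\<lambda>n. \<bar>S n x - S m x\<bar>) \<longlonglongrightarrow> \<bar>g x - S m x\<bar>" by (intro tendsto_intros conv x)
    show "\<exists>N. \<forall>n\<ge>N. \<bar>S n x - S m x\<bar> \<le> C * 2 powr (- \<sigma> * real m)" using step x by blast
  qed
  have hg: "holder \<sigma> (12 * M\<^sup>2 * geo2 \<sigma> * A) g"
    unfolding holder_def
  proof (intro ballI)
    fix x y :: real assume xy: "x \<in> {0..1}" "y \<in> {0..1}"
    show "\<bar>g x - g y\<bar> \<le> 12 * M\<^sup>2 * geo2 \<sigma> * A * \<bar>x - y\<bar> powr \<sigma>"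
    proof (rule LIMSEQ_le_const2)
      show "(\<lambda>n. \<bar>S n x - S n y\<bar>) \<longlonglongrightarrow> \<bar>g x - g y\<bar>" by (intro tendsto_intros conv xy)
      show "\<exists>N. \<forall>n\<ge>N. \<bar>S n x - S n y\<bar> \<le> 12 * M\<^sup>2 * geo2 \<sigma> * A * \<bar>x - y\<bar> powr \<sigma>"
        unfolding S_def using series_holder[OF finite_below _ \<sigma> _ A xy, of _ c] a by (auto simp: c_def)
    qed
  qed
  have cg: "continuous_on {0..1} g" by (rule holder_continuous[OF hg \<sigma>(1)])
  have cS: "continuous_on {0..1} (S n)" for n
    unfolding S_def by (intro continuous_intros w_continuous) auto
  have coef: "ip g (w v) = c v" if v: "v \<in> wav_index l0" for v
  proof -
    have S: "(LINT x|unit_leb. S n x * w v x) = c v" if "fst v < n" for n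
    proof -
      have "(LINT x|unit_leb. S n x * w v x) = (LINT x|unit_leb. (\<Sum>u\<in>{u \<in> wav_index l0. fst u < n}. c u * (w u x * w v x)))"
        by (simp add: S_def sum_distrib_right mult.assoc)
      also have "\<dots> = (\<Sum>u\<in>{u \<in> wav_index l0. fst u < n}. c u * ip (w u) (w v))"
        unfolding ip_def using integrable_w[OF v w_continuous]
        by (subst Bochner_Integration.integral_sum) auto
      also have "\<dots> = (\<Sum>u\<in>{u \<in> wav_index l0. fst u < n}. if u = v then c u else 0)"
        by (intro sum.cong) (use v orth in auto)
      also have "\<dots> = c v" using that v finite_below by (subst sum.delta) auto
      finally show ?thesis .
    qed
    have "(\<lambda>n. LINT x|unit_leb. S n x * w v x) \<longlonglongrightarrow> (LINT x|unit_leb. g x * w v x)"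
    proof (rule integral_dominated_convergence[where w = "\<lambda>x. \<bar>g x * w v x\<bar> + C * \<bar>1 * w v x\<bar>"])
      show "(\<lambda>x. g x * w v x) \<in> borel_measurable unit_leb" "\<And>n. (\<lambda>x. S n x * w v x) \<in> borel_measurable unit_leb"
        using integrable_w[OF v cg] integrable_w[OF v cS] by auto
      show "integrable unit_leb (\<lambda>x. \<bar>g x * w v x\<bar> + C * \<bar>1 * w v x\<bar>)"
        using integrable_w[OF v cg] integrable_w[OF v, of "\<lambda>_. 1"] by auto
      show "AE x in unit_leb. (\<lambda>n. S n x * w v x) \<longlonglongrightarrow> g x * w v x"
        by (intro AE_I2 tendsto_intros conv) auto
      show "AE x in unit_leb. norm (S n x * w v x) \<le> \<bar>g x * w v x\<bar> + C * \<bar>1 * w v x\<bar>" for n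
      proof (rule AE_I2)
        fix x assume "x \<in> space unit_leb"
        then have x: "x \<in> {0..1}" by simp
        have "C * 2 powr (- \<sigma> * real n) \<le> C * 1"
        proof (rule mult_left_mono)
          show "2 powr (- \<sigma> * real n) \<le> 1" using powr_mono[of "- \<sigma> * real n" 0 2] \<sigma> by simp
          show "0 \<le> C" using A geo_pos[OF \<sigma>(1)] by (simp add: C_def)
        qed
        then have "\<bar>S n x\<bar> \<le> \<bar>g x\<bar> + C" using tail[OF x, of n] by linarith
        from mult_right_mono[OF this, of "\<bar>w v x\<bar>"]
        show "norm (S n x * w v x) \<le> \<bar>g x * w v x\<bar> + C * \<bar>1 * w v x\<bar>"
          by (simp add: abs_mult distrib_right)
      qed
    qed
    moreover have "(\<lambda>n. LINT x|unit_leb. S n x * w v x) \<longlonglongrightarrow> c v"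
      by (rule tendsto_eventually) (use S in \<open>auto simp: eventually_sequentially intro!: exI[of _ "Suc (fst v)"]\<close>)
    ultimately show ?thesis unfolding ip_def using LIMSEQ_unique by blast
  qed
  have cd: "continuous_on {0..1} (\<lambda>x. f x - g x)" by (intro continuous_intros f cg)
  have "AE x in unit_leb. f x - g x = 0"
  proof (rule complete)
    show "(\<lambda>x. f x - g x) \<in> borel_measurable unit_leb" by (rule measurable_unit_leb_cont[OF cd])
    have c2: "continuous_on {0..1} (\<lambda>x. (f x - g x)\<^sup>2)" by (intro continuous_intros f cg)
    then have "bounded ((\<lambda>x. (f x - g x)\<^sup>2) ` {0..1})" by (intro compact_imp_bounded compact_continuous_image) auto
    then obtain B where "\<And>x. x \<in> {0..1} \<Longrightarrow> \<bar>(f x - g x)\<^sup>2\<bar> \<le> B" unfolding bounded_iff real_norm_def by blast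
    then show "integrable unit_leb (\<lambda>x. (f x - g x)\<^sup>2)" by (intro integrable_unit_leb_bounded measurable_unit_leb_cont c2)
    fix v assume v: "v \<in> wav_index l0"
    show "ip (\<lambda>x. f x - g x) (w v) = 0"
      using coef[OF v] integrable_w[OF v f] integrable_w[OF v cg]
      by (simp add: ip_def c_def left_diff_distrib)
  qed
  then have "AE x in unit_leb. f x = g x" by auto
  then have eq: "f x = g x" if "x \<in> {0..1}" for x by (rule AE_unit_leb_continuous_eq[OF _ f cg that])
  show "holder \<sigma> (12 * M\<^sup>2 * geo2 \<sigma> * A) f" using hg eq unfolding holder_def by simp
  show "\<bar>f x\<bar> \<le> 3 * M\<^sup>2 * A * geo \<sigma>" if "x \<in> {0..1}" for x
    using tail[OF that, of 0] eq[OF that] by (simp add: S_def C_def)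
  show "(\<lambda>n. \<Sum>v\<in>{v \<in> wav_index l0. fst v < n}. ip f (w v) * w v x) \<longlonglongrightarrow> f x" if "x \<in> {0..1}" for x
    using conv[OF that] eq[OF that] unfolding S_def c_def by simp
qed

text \<open>The expansion bounds \<open>L\<close> by \<open>B\<close> and its Hoelder constant by
  \<open>H\<close>, uniformly over the class, and \<open>exp\<close> is Lipschitz with constant
  \<open>exp B\<close> up to \<open>B\<close>. A single \<open>D\<close> serves as upper bound,
  inverse lower bound and Hoelder constant.\<close>

lemma density_bounds:
  assumes \<sigma>: "0 < \<sigma>" "\<sigma> < 1" "\<sigma> \<le> s" and R: "R > 0"
  shows "\<exists>D\<ge>1. \<forall>L\<in>Sigma_class l0 w R s. continuous_on {0..1} L \<and> (\<forall>x\<in>{0..1}. 1 / D \<le> exp (L x) \<and> exp (L x) \<le> D) \<and> holder \<sigma> D (\<lambda>x. exp (L x))"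
proof -
  define B where "B = 3 * M\<^sup>2 * R * geo \<sigma>"
  define H where "H = 12 * M\<^sup>2 * geo2 \<sigma> * R"
  have B: "B \<ge> 0" using R geo_pos[OF \<sigma>(1)] by (simp add: B_def)
  have H: "H \<ge> 0" using R geo_pos[OF \<sigma>(1)] geo_pos[of "1 - \<sigma>"] \<sigma>(2) by (simp add: H_def geo2_def)
  define D where "D = exp B * (1 + H)"
  have D: "exp B \<le> D" "exp B * H \<le> D" using H by (auto simp: D_def algebra_simps)
  have D1: "D \<ge> 1" using D(1) B by (smt (verit) one_le_exp_iff)
  have "continuous_on {0..1} L \<and> (\<forall>x\<in>{0..1}. 1 / D \<le> exp (L x) \<and> exp (L x) \<le> D) \<and> holder \<sigma> D (\<lambda>x. exp (L x))"
    if L: "L \<in> Sigma_class l0 w R s" for L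
  proof -
    have c: "continuous_on {0..1} L" using L by (auto simp: Sigma_class_def uniformly_continuous_imp_continuous)
    have a: "\<bar>ip L (w v)\<bar> \<le> R * 2 powr (- (\<sigma> + 1/2) * real (fst v))" if v: "v \<in> wav_index l0" for v
    proof -
      have "ereal (2 powr (real (fst v) * (s + 1/2)) * \<bar>ip L (w v)\<bar>) \<le> wav_norm l0 w s L"
        unfolding wav_norm_def using v by (intro SUP_upper2[of v]) (auto simp: case_prod_beta)
      also have "\<dots> \<le> ereal R" using L by (auto simp: Sigma_class_def)
      finally have "2 powr (real (fst v) * (s + 1/2)) * \<bar>ip L (w v)\<bar> \<le> R" by simp
      then have "\<bar>ip L (w v)\<bar> \<le> R * 2 powr (- (real (fst v) * (s + 1/2)))"
        by (simp add: powr_minus field_simps)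
      also have "\<dots> \<le> R * 2 powr (- (\<sigma> + 1/2) * real (fst v))"
        using \<sigma> R mult_right_mono[of \<sigma> s "real (fst v)"] by (intro mult_left_mono powr_mono) (auto simp: algebra_simps)
      finally show ?thesis .
    qed
    have b: "\<bar>L x\<bar> \<le> B" if "x \<in> {0..1}" for x
      unfolding B_def using expansion(2)[OF c \<sigma>(1,2) _ a that] R by simp
    have h: "holder \<sigma> H L" unfolding H_def using expansion(1)[OF c \<sigma>(1,2) _ a] R by simp
    have e1: "1 / D \<le> exp (L x)" "exp (L x) \<le> exp B" if "x \<in> {0..1}" for x
    proof -
      have "1 / D \<le> 1 / exp B" using D by (intro divide_left_mono) (auto intro!: mult_pos_pos less_le_trans[OF exp_gt_zero D(1)])
      also have "\<dots> = exp (- B)" by (simp add: exp_minus divide_inverse)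
      also have "\<dots> \<le> exp (L x)" using b[OF that] by auto
      finally show "1 / D \<le> exp (L x)" .
      show "exp (L x) \<le> exp B" using b[OF that] by auto
    qed
    have "holder \<sigma> D (\<lambda>x. exp (L x))" unfolding holder_def
    proof (intro ballI)
      fix x y :: real assume xy: "x \<in> {0..1}" "y \<in> {0..1}"
      have le: "exp u - exp v \<le> exp B * \<bar>u - v\<bar>" if "u \<le> B" for u v :: real
      proof -
        have "exp u * (1 + (v - u)) \<le> exp u * exp (v - u)" by (intro mult_left_mono exp_ge_add_one_self) auto
        then have "exp u - exp v \<le> exp u * (u - v)" by (simp add: exp_add[symmetric] algebra_simps)
        also have "\<dots> \<le> exp u * \<bar>u - v\<bar>" by (intro mult_left_mono) auto
        also have "\<dots> \<le> exp B * \<bar>u - v\<bar>" using that by (intro mult_right_mono) auto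
        finally show ?thesis .
      qed
      have "\<bar>exp (L x) - exp (L y)\<bar> \<le> exp B * \<bar>L x - L y\<bar>"
        using le[of "L x" "L y"] le[of "L y" "L x"] b[OF xy(1)] b[OF xy(2)] by (auto simp: abs_if split: if_splits)
      also have "\<dots> \<le> exp B * (H * \<bar>x - y\<bar> powr \<sigma>)"
        using h xy unfolding holder_def by (intro mult_left_mono) auto
      also have "\<dots> \<le> D * \<bar>x - y\<bar> powr \<sigma>" using D(2) by (simp add: mult.assoc[symmetric] mult_right_mono)
      finally show "\<bar>exp (L x) - exp (L y)\<bar> \<le> D * \<bar>x - y\<bar> powr \<sigma>" .
    qed
    then show ?thesis using c e1 D(1) by (meson order.trans)
  qed
  then show ?thesis using D1 by blast
qed

end

section \<open>Centred wavelets and their products\<close>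

text \<open>The quotient \<open>(exp t - 1) / t\<close>, written as an integral so that
  \<open>t = 0\<close> is no special case. It factors \<open>exp (Sb x) - 1\<close> into
  \<open>Sb x\<close>, which is linear in the inactive coordinates, and a Hoelder function.\<close>

definition expquot :: "real \<Rightarrow> real" where
  "expquot t = integral {0..1} (\<lambda>\<theta>. exp (\<theta> * t))"

lemma expquot_int: "(\<lambda>\<theta>. exp (\<theta> * t)) integrable_on {0..1::real}"
  by (intro integrable_continuous_real continuous_intros)

lemma expquot_mult: "t * expquot t = exp t - 1"
proof -
  have "((\<lambda>\<theta>. t * exp (\<theta> * t)) has_integral (exp (1 * t) - exp (0 * t))) {0..1}"
    by (rule fundamental_theorem_of_calculus)
       (auto simp: has_real_derivative_iff_has_vector_derivative[symmetric] intro!: derivative_eq_intros)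
  from integral_unique[OF this] show ?thesis by (simp add: expquot_def)
qed

lemma expquot_bound:
  assumes "\<bar>t\<bar> \<le> 1" shows "\<bar>expquot t\<bar> \<le> 3"
proof -
  have "norm (integral {0..1} (\<lambda>\<theta>. exp (\<theta> * t))) \<le> integral {0..1} (\<lambda>\<theta>::real. 3)"
  proof (rule integral_norm_bound_integral[OF expquot_int])
    fix \<theta> :: real assume "\<theta> \<in> {0..1}"
    then have "\<theta> * t \<le> 1" using assms mult_mono[of \<theta> 1 t 1] mult_nonneg_nonpos[of \<theta> t] by (cases "t \<ge> 0") auto
    then show "norm (exp (\<theta> * t)) \<le> 3" using exp_le by (smt (verit) exp_le_cancel_iff exp_gt_zero real_norm_def)
  qed auto
  then show ?thesis by (simp add: expquot_def)
qed

lemma expquot_lipschitz: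
  assumes "\<bar>t\<bar> \<le> 1" "\<bar>t'\<bar> \<le> 1" shows "\<bar>expquot t - expquot t'\<bar> \<le> 3 * \<bar>t - t'\<bar>"
proof -
  have le: "exp (\<theta> * u) - exp (\<theta> * v) \<le> 3 * \<bar>u - v\<bar>" if th: "\<theta> \<in> {0..1}" and "\<bar>u\<bar> \<le> 1" for \<theta> u v :: real
  proof -
    have "\<theta> * u \<le> 1" using that mult_mono[of \<theta> 1 u 1] mult_nonneg_nonpos[of \<theta> u] by (cases "u \<ge> 0") auto
    then have e: "exp (\<theta> * u) \<le> 3" using exp_le by (smt (verit) exp_le_cancel_iff)
    have "exp (\<theta> * u) * (1 + (\<theta> * v - \<theta> * u)) \<le> exp (\<theta> * u) * exp (\<theta> * v - \<theta> * u)"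
      by (intro mult_left_mono exp_ge_add_one_self) auto
    then have "exp (\<theta> * u) - exp (\<theta> * v) \<le> exp (\<theta> * u) * (\<theta> * (u - v))" by (simp add: exp_add[symmetric] algebra_simps)
    also have "\<dots> \<le> exp (\<theta> * u) * \<bar>u - v\<bar>"
    proof (rule mult_left_mono)
      have "\<theta> * (u - v) \<le> \<theta> * \<bar>u - v\<bar>" using th by (intro mult_left_mono) auto
      also have "\<dots> \<le> 1 * \<bar>u - v\<bar>" using th by (intro mult_right_mono) auto
      finally show "\<theta> * (u - v) \<le> \<bar>u - v\<bar>" by simp
    qed simp
    also have "\<dots> \<le> 3 * \<bar>u - v\<bar>" using e by (intro mult_right_mono) auto
    finally show ?thesis .
  qed
  have "expquot t - expquot t' = integral {0..1} (\<lambda>\<theta>. exp (\<theta> * t) - exp (\<theta> * t'))"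
    unfolding expquot_def by (rule integral_diff[symmetric, OF expquot_int expquot_int])
  also have "norm \<dots> \<le> integral {0..1} (\<lambda>\<theta>::real. 3 * \<bar>t - t'\<bar>)"
  proof (rule integral_norm_bound_integral)
    fix \<theta> :: real assume "\<theta> \<in> {0..1}"
    from le[OF this assms(1), of t'] le[OF this assms(2), of t]
    show "norm (exp (\<theta> * t) - exp (\<theta> * t')) \<le> 3 * \<bar>t - t'\<bar>"
      unfolding real_norm_def abs_le_iff using abs_minus_commute[of t t'] by simp
  qed (auto intro: integrable_diff expquot_int)
  finally show ?thesis by simp
qed

lemma continuous_bounded_unit:
  assumes "continuous_on {0..1::real} (f :: real \<Rightarrow> real)"
  obtains B where "B \<ge> 0" "\<And>x. x \<in> {0..1} \<Longrightarrow> \<bar>f x\<bar> \<le> B"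
proof -
  have "bounded (f ` {0..1})" by (intro compact_imp_bounded compact_continuous_image assms) auto
  then obtain B where "\<And>x. x \<in> {0..1} \<Longrightarrow> \<bar>f x\<bar> \<le> B" unfolding bounded_iff real_norm_def by blast
  then show thesis using that[of "\<bar>B\<bar>"] by fastforce
qed

lemma integrable_unit_leb_cont:
  assumes "continuous_on {0..1::real} (f :: real \<Rightarrow> real)"
  shows "integrable unit_leb f"
  using continuous_bounded_unit[OF assms] integrable_unit_leb_bounded[OF measurable_unit_leb_cont[OF assms]] by blast

context wavelets begin

lemma ip_sum_w:
  assumes V: "finite V" "V \<subseteq> wav_index l0" and v: "v \<in> wav_index l0"
  shows "ip (\<lambda>x. \<Sum>u\<in>V. b u * w u x) (w v) = (if v \<in> V then b v else 0)"
proof -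
  have "ip (\<lambda>x. \<Sum>u\<in>V. b u * w u x) (w v) = (LINT x|unit_leb. (\<Sum>u\<in>V. b u * (w u x * w v x)))"
    by (simp add: ip_def sum_distrib_right mult.assoc)
  also have "\<dots> = (\<Sum>u\<in>V. b u * ip (w u) (w v))"
    unfolding ip_def using integrable_w[OF v w_continuous] V(2)
    by (subst Bochner_Integration.integral_sum) auto
  also have "\<dots> = (\<Sum>u\<in>V. if u = v then b u else 0)"
    by (intro sum.cong refl) (simp add: orth[OF subsetD[OF V(2)] v])
  also have "\<dots> = (if v \<in> V then b v else 0)" using V(1) by (subst sum.delta) auto
  finally show ?thesis .
qed

lemma continuous_sum_w: "V \<subseteq> wav_index l0 \<Longrightarrow> continuous_on {0..1} (\<lambda>x. \<Sum>u\<in>V. b u * w u x)"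
  by (intro continuous_intros w_continuous) auto

lemma ip_sum_sum:
  assumes V: "finite V" "V \<subseteq> wav_index l0"
  shows "ip (\<lambda>x. \<Sum>u\<in>V. b u * w u x) (\<lambda>x. \<Sum>u\<in>V. b u * w u x) = (\<Sum>u\<in>V. (b u)\<^sup>2)"
proof -
  have "ip (\<lambda>x. \<Sum>u\<in>V. b u * w u x) (\<lambda>x. \<Sum>u\<in>V. b u * w u x)
      = (LINT x|unit_leb. (\<Sum>v\<in>V. b v * ((\<Sum>u\<in>V. b u * w u x) * w v x)))"
    unfolding ip_def by (intro Bochner_Integration.integral_cong refl) (simp add: sum_distrib_left mult_ac)
  also have "\<dots> = (\<Sum>v\<in>V. b v * ip (\<lambda>x. \<Sum>u\<in>V. b u * w u x) (w v))"
    unfolding ip_def using integrable_w[OF _ continuous_sum_w[OF V(2)]] V(2)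
    by (subst Bochner_Integration.integral_sum) auto
  also have "\<dots> = (\<Sum>u\<in>V. (b u)\<^sup>2)"
    by (intro sum.cong refl) (use ip_sum_w[OF V] V(2) in \<open>auto simp: power2_eq_square\<close>)
  finally show ?thesis .
qed

text \<open>An inverse inequality between sup norm and \<open>L2\<close> norm: every coefficient is
  at most \<open>B\<close>, and the level sums grow like \<open>2 powr (i / 2)\<close>, so that the
  last level dominates.\<close>

lemma norm_sup_low:
  assumes V: "V = {v \<in> wav_index l0. fst v \<le> J}" and F: "\<And>x. x \<in> {0..1} \<Longrightarrow> F x = (\<Sum>v\<in>V. b v * w v x)"
    and x: "x \<in> {0..1}" and B: "(\<Sum>v\<in>V. (b v)\<^sup>2) \<le> B\<^sup>2" "B \<ge> 0"
  shows "\<bar>F x\<bar> \<le> 3 * M\<^sup>2 * geo (1/2) * 2 powr (real J / 2) * B"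
proof -
  have fin: "finite V" unfolding V using finite_below[of "Suc J"] by (simp add: less_Suc_eq_le)
  have b: "\<bar>b v\<bar> \<le> B" if "v \<in> V" for v
  proof -
    have "(b v)\<^sup>2 \<le> (\<Sum>v\<in>V. (b v)\<^sup>2)" using that fin by (intro member_le_sum) auto
    then have "(b v)\<^sup>2 \<le> B\<^sup>2" using B by simp
    then show ?thesis using B(2) by (metis abs_le_square_iff abs_of_nonneg)
  qed
  have "\<bar>F x\<bar> \<le> (\<Sum>v\<in>V. \<bar>b v * w v x\<bar>)" unfolding F[OF x] by (rule sum_abs)
  also have "\<dots> = (\<Sum>i<Suc J. \<Sum>v\<in>{v \<in> V. fst v = i}. \<bar>b v * w v x\<bar>)"
    by (rule sum_levels[OF fin]) (auto simp: V)
  also have "\<dots> \<le> (\<Sum>i<Suc J. 3 * M\<^sup>2 * B * 2 powr (real i / 2))"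
    by (intro sum_mono level_sup x B) (auto simp: V b)
  also have "\<dots> = 3 * M\<^sup>2 * B * (\<Sum>i\<in>{0..<Suc J}. 2 powr (1/2 * real i))"
    unfolding sum_distrib_left atLeast0LessThan by (intro sum.cong refl) simp
  also have "\<dots> \<le> 3 * M\<^sup>2 * B * (geo (1/2) * 2 powr (1/2 * (real (Suc J) - 1)))"
    using B by (intro mult_left_mono sum_powr_increasing) auto
  finally show ?thesis by (simp add: mult_ac)
qed

end

section \<open>Near orthogonality of centred wavelets under a Hoelder weight\<close>

locale density = wavelets +
  fixes p :: "real \<Rightarrow> real" and D \<sigma> :: real and J0 :: nat
  assumes \<sigma>: "0 < \<sigma>" "\<sigma> < 1" and D: "D \<ge> 1"
    and p_lower: "x \<in> {0..1} \<Longrightarrow> 1 / D \<le> p x" and p_upper: "x \<in> {0..1} \<Longrightarrow> p x \<le> D"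
    and p_holder: "holder \<sigma> D p" and p_int: "(LINT x|unit_leb. p x) = 1"
    and vanish: "v \<in> wav_index l0 \<Longrightarrow> J0 < fst v \<Longrightarrow> ip (\<lambda>_. 1) (w v) = 0"
begin

definition mean :: "nat \<times> nat \<Rightarrow> real" where
  "mean v = (LINT x|unit_leb. w v x * p x)"

definition cw :: "nat \<times> nat \<Rightarrow> real \<Rightarrow> real" where
  "cw v x = w v x - mean v"

definition low :: "(nat \<times> nat) set" where
  "low = {v \<in> wav_index l0. fst v \<le> J0}"

lemma p_continuous: "continuous_on {0..1} p"
  by (rule holder_continuous[OF p_holder \<sigma>(1)])

lemma p_pos: "x \<in> {0..1} \<Longrightarrow> 0 < p x"
  using p_lower[of x] D by (smt (verit) zero_less_divide_1_iff)

lemma cw_continuous: "v \<in> wav_index l0 \<Longrightarrow> continuous_on {0..1} (cw v)"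
  unfolding cw_def by (intro continuous_intros w_continuous)

lemma p_abs: "x \<in> {0..1} \<Longrightarrow> \<bar>p x\<bar> \<le> D"
  using p_upper[of x] p_pos[of x] by auto

text \<open>\<open>oscillation\<close> with \<open>u = 1\<close>: above \<open>J0\<close> wavelets
  have integral zero. The first form keeps the \<open>L1\<close> norm, so that it can be summed over
  a level; the second evaluates it for one wavelet.\<close>

lemma integral_w_holder:
  assumes v: "v \<in> wav_index l0" "J0 < fst v"
    and G: "holder \<sigma> A G" "A \<ge> 0" "\<And>x. x \<in> {0..1} \<Longrightarrow> \<bar>G x\<bar> \<le> A"
  shows "\<bar>LINT x|unit_leb. w v x * G x\<bar> \<le> 2 * M * A * 2 powr (- \<sigma> * real (fst v)) * (LINT x|unit_leb. \<bar>w v x\<bar>)"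
    and "\<bar>LINT x|unit_leb. w v x * G x\<bar> \<le> 8 * M ^ 3 * A * 2 powr (- (\<sigma> + 1/2) * real (fst v))"
proof -
  obtain j k where vk: "v = (j, k)" by force
  have "(LINT x|unit_leb. w (j, k) x * 1) = 0" using vanish[OF v] unfolding ip_def vk by simp
  from oscillation[of j k "\<lambda>_. 1" 1 \<sigma> A G A, OF _ _ _ this] v G \<sigma>
  show 1: "\<bar>LINT x|unit_leb. w v x * G x\<bar> \<le> 2 * M * A * 2 powr (- \<sigma> * real (fst v)) * (LINT x|unit_leb. \<bar>w v x\<bar>)"
    unfolding vk by simp
  also have "\<dots> \<le> 2 * M * A * 2 powr (- \<sigma> * real (fst v)) * (4 * M\<^sup>2 * 2 powr (- real j / 2))"
    using integral_abs_w[of j k] v G(2) M unfolding vk by (intro mult_left_mono) auto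
  also have "\<dots> = 8 * M ^ 3 * A * (2 powr (- \<sigma> * real j) * 2 powr (- real j / 2))"
    by (simp add: vk power2_eq_square power3_eq_cube)
  also have "2 powr (- \<sigma> * real j) * 2 powr (- real j / 2) = 2 powr (- (\<sigma> + 1/2) * real (fst v))"
    by (simp add: powr_add[symmetric] algebra_simps vk)
  finally show "\<bar>LINT x|unit_leb. w v x * G x\<bar> \<le> 8 * M ^ 3 * A * 2 powr (- (\<sigma> + 1/2) * real (fst v))" .
qed

lemma sum_integral_abs:
  assumes K: "K \<subseteq> lev i" and u: "continuous_on {0..1} u"
  shows "(\<Sum>v\<in>K. LINT x|unit_leb. \<bar>w v x\<bar> * \<bar>u x\<bar>) \<le> 3 * M\<^sup>2 * 2 powr (real i / 2) * (LINT x|unit_leb. \<bar>u x\<bar>)"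
proof -
  have i: "integrable unit_leb (\<lambda>x. \<bar>w v x\<bar> * \<bar>u x\<bar>)" if "v \<in> K" for v
    using that K by (intro integrable_unit_leb_cont continuous_intros w_continuous u) auto
  have "(\<Sum>v\<in>K. LINT x|unit_leb. \<bar>w v x\<bar> * \<bar>u x\<bar>) = (LINT x|unit_leb. (\<Sum>v\<in>K. \<bar>w v x\<bar>) * \<bar>u x\<bar>)"
    using i by (simp add: sum_distrib_right)
  also have "\<dots> \<le> (LINT x|unit_leb. (3 * M\<^sup>2 * 2 powr (real i / 2)) * \<bar>u x\<bar>)"
  proof (rule integral_unit_leb_mono)
    show "integrable unit_leb (\<lambda>x. (\<Sum>v\<in>K. \<bar>w v x\<bar>) * \<bar>u x\<bar>)" using i by (simp add: sum_distrib_right)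
    show "integrable unit_leb (\<lambda>x. (3 * M\<^sup>2 * 2 powr (real i / 2)) * \<bar>u x\<bar>)"
      by (intro integrable_unit_leb_cont continuous_intros u)
  qed (intro mult_right_mono sum_abs_w K; simp)
  finally show ?thesis by simp
qed

lemma sum_integral_w_holder:
  assumes K: "K \<subseteq> lev i" "J0 < i"
    and G: "holder \<sigma> A G" "A \<ge> 0" "\<And>x. x \<in> {0..1} \<Longrightarrow> \<bar>G x\<bar> \<le> A"
  shows "(\<Sum>v\<in>K. \<bar>LINT x|unit_leb. w v x * G x\<bar>) \<le> 6 * M ^ 3 * A * 2 powr (real i / 2 - \<sigma> * real i)"
proof -
  have "(\<Sum>v\<in>K. \<bar>LINT x|unit_leb. w v x * G x\<bar>) \<le> (\<Sum>v\<in>K. 2 * M * A * 2 powr (- \<sigma> * real i) * (LINT x|unit_leb. \<bar>w v x\<bar> * \<bar>1\<bar>))"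
  proof (rule sum_mono)
    fix v assume "v \<in> K"
    then have "v \<in> wav_index l0" "fst v = i" using K by auto
    then show "\<bar>LINT x|unit_leb. w v x * G x\<bar> \<le> 2 * M * A * 2 powr (- \<sigma> * real i) * (LINT x|unit_leb. \<bar>w v x\<bar> * \<bar>1\<bar>)"
      using integral_w_holder(1)[of v A G] K(2) G by simp
  qed
  also have "\<dots> \<le> 2 * M * A * 2 powr (- \<sigma> * real i) * (3 * M\<^sup>2 * 2 powr (real i / 2) * (LINT x|unit_leb. \<bar>1\<bar>))"
    unfolding sum_distrib_left[symmetric] using M G by (intro mult_left_mono sum_integral_abs K) auto
  also have "\<dots> = 6 * M ^ 3 * A * (2 powr (- \<sigma> * real i) * 2 powr (real i / 2))"
    by (simp add: power2_eq_square power3_eq_cube unit_leb.prob_space[unfolded space_unit_leb])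
  also have "2 powr (- \<sigma> * real i) * 2 powr (real i / 2) = 2 powr (real i / 2 - \<sigma> * real i)"
    by (simp add: powr_add[symmetric] algebra_simps)
  finally show ?thesis .
qed

lemma mean_bound: "v \<in> wav_index l0 \<Longrightarrow> J0 < fst v \<Longrightarrow> \<bar>mean v\<bar> \<le> 8 * M ^ 3 * D * 2 powr (- (\<sigma> + 1/2) * real (fst v))"
  unfolding mean_def by (rule integral_w_holder(2)[OF _ _ p_holder]) (use D p_abs in auto)

lemma sum_mean_bound: "K \<subseteq> lev i \<Longrightarrow> J0 < i \<Longrightarrow> (\<Sum>v\<in>K. \<bar>mean v\<bar>) \<le> 6 * M ^ 3 * D * 2 powr (real i / 2 - \<sigma> * real i)"
  unfolding mean_def by (rule sum_integral_w_holder[OF _ _ p_holder]) (use D p_abs in auto)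

lemma integral_abs_le:
  fixes G :: "real \<Rightarrow> real"
  assumes "continuous_on {0..1} G" "\<And>x. x \<in> {0..1} \<Longrightarrow> \<bar>G x\<bar> \<le> A"
  shows "\<bar>LINT x|unit_leb. G x\<bar> \<le> A"
proof -
  have "\<bar>LINT x|unit_leb. G x\<bar> \<le> (LINT x|unit_leb. \<bar>G x\<bar>)"
    using integral_abs_bound[of unit_leb G] by simp
  also have "\<dots> \<le> (LINT x|unit_leb. A)"
    using assms by (intro integral_unit_leb_mono integrable_unit_leb_cont continuous_intros) auto
  finally show ?thesis by (simp add: unit_leb.prob_space[unfolded space_unit_leb])
qed

text \<open>Expanding the product of the centred wavelets leaves a main term and three terms with
  means. In the main term the finer of the two wavelets oscillates against a nearly constant weight,
  which gives the decay in \<open>max i (fst m)\<close>; counting overlaps gives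
  \<open>2 powr ((i - fst m) / 2)\<close>. The means are small because \<open>p\<close> is
  Hoelder.\<close>

lemma pair_bound:
  assumes m: "m \<in> wav_index l0" "J0 < fst m" and K: "K \<subseteq> lev i" "J0 < i" "m \<notin> K"
    and G: "holder \<sigma> A G" "A \<ge> 0" "\<And>x. x \<in> {0..1} \<Longrightarrow> \<bar>G x\<bar> \<le> A"
  shows "(\<Sum>v\<in>K. \<bar>LINT x|unit_leb. cw m x * cw v x * G x\<bar>)
    \<le> 168 * M ^ 6 * D\<^sup>2 * A * 2 powr ((real i - real (fst m)) / 2 - \<sigma> * real (max i (fst m)))"
proof -
  let ?wG = "\<lambda>v. \<bar>LINT x|unit_leb. w v x * G x\<bar>" and ?ww = "\<lambda>v. \<bar>LINT x|unit_leb. w m x * w v x * G x\<bar>"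
  define j where "j = fst m"
  define X where "X = 2 powr ((real i - real j) / 2 - \<sigma> * real (max i j))"
  have X: "X \<ge> 0" by (simp add: X_def)
  have cG: "continuous_on {0..1} G" by (rule holder_continuous[OF G(1) \<sigma>(1)])
  have Kv: "v \<in> wav_index l0" "fst v = i" "v \<noteq> m" if "v \<in> K" for v using that K by auto
  have wm: "(LINT x|unit_leb. \<bar>w m x\<bar>) \<le> 4 * M\<^sup>2 * 2 powr (- real j / 2)"
    using integral_abs_w[of "fst m" "snd m"] m unfolding j_def by simp
  have T1: "(\<Sum>v\<in>K. ?ww v) \<le> 24 * M ^ 5 * A * X"
  proof -
    have each: "?ww v \<le> 2 * M * A * 2 powr (- \<sigma> * real (max i j)) * (LINT x|unit_leb. \<bar>w v x\<bar> * \<bar>w m x\<bar>)"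
      if v: "v \<in> K" for v
    proof -
      have o1: "(LINT x|unit_leb. w v x * w m x) = 0" "(LINT x|unit_leb. w m x * w v x) = 0"
        using orth[OF Kv(1)[OF v] m(1)] orth[OF m(1) Kv(1)[OF v]] Kv(3)[OF v] unfolding ip_def by auto
      show ?thesis
      proof (cases "j \<le> i")
        case True
        have "\<bar>LINT x|unit_leb. w (fst v, snd v) x * w m x * G x\<bar> \<le> 2 * M * A * 2 powr (- \<sigma> * real (fst v)) * (LINT x|unit_leb. \<bar>w (fst v, snd v) x\<bar> * \<bar>w m x\<bar>)"
          by (rule oscillation[OF _ w_measurable[OF m(1)] w_bounded[OF m(1)] _ G(1) _ _ G(2,3)])
             (use o1 \<sigma> Kv[OF v] in auto)
        then show ?thesis unfolding prod.collapse using True Kv(2)[OF v] by (simp add: max_absorb1 mult_ac)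
      next
        case False
        have "\<bar>LINT x|unit_leb. w (fst m, snd m) x * w v x * G x\<bar> \<le> 2 * M * A * 2 powr (- \<sigma> * real (fst m)) * (LINT x|unit_leb. \<bar>w (fst m, snd m) x\<bar> * \<bar>w v x\<bar>)"
          by (rule oscillation[OF _ w_measurable[OF Kv(1)[OF v]] w_bounded[OF Kv(1)[OF v]] _ G(1) _ _ G(2,3)])
             (use o1 \<sigma> m in auto)
        then show ?thesis unfolding prod.collapse using False by (simp add: max_absorb2 j_def mult_ac)
      qed
    qed
    have "(\<Sum>v\<in>K. ?ww v)
        \<le> 2 * M * A * 2 powr (- \<sigma> * real (max i j)) * (\<Sum>v\<in>K. LINT x|unit_leb. \<bar>w v x\<bar> * \<bar>w m x\<bar>)"
      unfolding sum_distrib_left by (intro sum_mono each)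
    also have "\<dots> \<le> 2 * M * A * 2 powr (- \<sigma> * real (max i j)) * (3 * M\<^sup>2 * 2 powr (real i / 2) * (4 * M\<^sup>2 * 2 powr (- real j / 2)))"
    proof (rule mult_left_mono)
      have "(\<Sum>v\<in>K. LINT x|unit_leb. \<bar>w v x\<bar> * \<bar>w m x\<bar>) \<le> 3 * M\<^sup>2 * 2 powr (real i / 2) * (LINT x|unit_leb. \<bar>w m x\<bar>)"
        by (rule sum_integral_abs[OF K(1) w_continuous[OF m(1)]])
      also have "\<dots> \<le> 3 * M\<^sup>2 * 2 powr (real i / 2) * (4 * M\<^sup>2 * 2 powr (- real j / 2))"
        by (intro mult_left_mono wm) auto
      finally show "(\<Sum>v\<in>K. LINT x|unit_leb. \<bar>w v x\<bar> * \<bar>w m x\<bar>) \<le> 3 * M\<^sup>2 * 2 powr (real i / 2) * (4 * M\<^sup>2 * 2 powr (- real j / 2))" .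
    qed (use M G in auto)
    also have "\<dots> = 24 * M ^ 5 * A * (2 powr (- \<sigma> * real (max i j)) * 2 powr (real i / 2) * 2 powr (- real j / 2))"
      by (simp add: power2_eq_square numeral_eq_Suc)
    also have "2 powr (- \<sigma> * real (max i j)) * 2 powr (real i / 2) * 2 powr (- real j / 2) = X"
      by (simp add: powr_add[symmetric] X_def algebra_simps diff_divide_distrib)
    finally show ?thesis .
  qed
  \<comment> \<open>Terms with means decay in the sum of the two levels, which is more than the
    decay in their maximum that is required.\<close>
  have pw: "2 powr (- (\<sigma> + 1/2) * real j) * 2 powr (real i / 2 - \<sigma> * real i) \<le> X"
  proof -
    have "2 powr (- (\<sigma> + 1/2) * real j) * 2 powr (real i / 2 - \<sigma> * real i) = 2 powr ((real i - real j) / 2 - \<sigma> * (real i + real j))"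
      by (simp add: powr_add[symmetric] algebra_simps diff_divide_distrib)
    also have "\<dots> \<le> X" unfolding X_def using \<sigma>(1) by (intro powr_mono diff_left_mono mult_left_mono) auto
    finally show ?thesis .
  qed
  have pr: "(8 * M ^ 3 * c * 2 powr (- (\<sigma> + 1/2) * real j)) * (6 * M ^ 3 * d * 2 powr (real i / 2 - \<sigma> * real i)) \<le> 48 * M ^ 6 * (c * d) * X"
    if "c \<ge> 0" "d \<ge> 0" for c d
  proof -
    have "(8 * M ^ 3 * c * 2 powr (- (\<sigma> + 1/2) * real j)) * (6 * M ^ 3 * d * 2 powr (real i / 2 - \<sigma> * real i))
      = 48 * M ^ 6 * (c * d) * (2 powr (- (\<sigma> + 1/2) * real j) * 2 powr (real i / 2 - \<sigma> * real i))"
      by (simp add: numeral_eq_Suc)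
    also have "\<dots> \<le> 48 * M ^ 6 * (c * d) * X" using that M by (intro mult_left_mono pw) auto
    finally show ?thesis .
  qed
  have mm: "\<bar>mean m\<bar> \<le> 8 * M ^ 3 * D * 2 powr (- (\<sigma> + 1/2) * real j)" using mean_bound[OF m] by (simp add: j_def)
  have sK: "(\<Sum>v\<in>K. ?wG v) \<le> 6 * M ^ 3 * A * 2 powr (real i / 2 - \<sigma> * real i)"
    by (rule sum_integral_w_holder[OF K(1,2) G])
  have sm: "(\<Sum>v\<in>K. \<bar>mean v\<bar>) \<le> 6 * M ^ 3 * D * 2 powr (real i / 2 - \<sigma> * real i)"
    by (rule sum_mean_bound[OF K(1,2)])
  have wmG: "?wG m \<le> 8 * M ^ 3 * A * 2 powr (- (\<sigma> + 1/2) * real j)"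
    using integral_w_holder(2)[OF m G] by (simp add: j_def)
  have T2: "\<bar>mean m\<bar> * (\<Sum>v\<in>K. ?wG v) \<le> 48 * M ^ 6 * (D * A) * X"
    by (rule order.trans[OF mult_mono[OF mm sK] pr]) (use M D G(2) in \<open>auto intro: sum_nonneg\<close>)
  have T3: "?wG m * (\<Sum>v\<in>K. \<bar>mean v\<bar>) \<le> 48 * M ^ 6 * (A * D) * X"
    by (rule order.trans[OF mult_mono[OF wmG sm] pr]) (use M D G(2) in \<open>auto intro: sum_nonneg\<close>)
  have T4: "\<bar>mean m\<bar> * (\<Sum>v\<in>K. \<bar>mean v\<bar>) \<le> 48 * M ^ 6 * (D * D) * X"
    by (rule order.trans[OF mult_mono[OF mm sm] pr]) (use M D G(2) in \<open>auto intro: sum_nonneg\<close>)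
  have iG: "\<bar>LINT x|unit_leb. G x\<bar> \<le> A" by (rule integral_abs_le[OF cG G(3)])
  have each: "\<bar>LINT x|unit_leb. cw m x * cw v x * G x\<bar> \<le> ?ww v
      + \<bar>mean m\<bar> * ?wG v + ?wG m * \<bar>mean v\<bar> + \<bar>mean m\<bar> * \<bar>mean v\<bar> * A"
    if v: "v \<in> K" for v
  proof -
    have i: "integrable unit_leb (\<lambda>x. w m x * w v x * G x)" "integrable unit_leb (\<lambda>x. w v x * G x)"
      "integrable unit_leb (\<lambda>x. w m x * G x)" "integrable unit_leb G"
      by (intro integrable_unit_leb_cont continuous_intros w_continuous cG m Kv(1)[OF v])+
    have "(LINT x|unit_leb. cw m x * cw v x * G x)
      = (LINT x|unit_leb. w m x * w v x * G x - mean m * (w v x * G x) - mean v * (w m x * G x) + (mean m * mean v) * G x)"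
      by (simp add: cw_def algebra_simps)
    also have "\<dots> = (LINT x|unit_leb. w m x * w v x * G x) - mean m * (LINT x|unit_leb. w v x * G x)
       - mean v * (LINT x|unit_leb. w m x * G x) + (mean m * mean v) * (LINT x|unit_leb. G x)"
      using i by simp
    finally have "\<bar>LINT x|unit_leb. cw m x * cw v x * G x\<bar> \<le> ?ww v + \<bar>mean m * (LINT x|unit_leb. w v x * G x)\<bar>
        + \<bar>mean v * (LINT x|unit_leb. w m x * G x)\<bar> + \<bar>(mean m * mean v) * (LINT x|unit_leb. G x)\<bar>" by linarith
    also have "\<dots> \<le> ?ww v
      + \<bar>mean m\<bar> * ?wG v + ?wG m * \<bar>mean v\<bar> + \<bar>mean m\<bar> * \<bar>mean v\<bar> * A"
      unfolding abs_mult using iG by (intro add_mono mult_left_mono) (auto simp: mult.commute)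
    finally show ?thesis .
  qed
  have "(\<Sum>v\<in>K. \<bar>LINT x|unit_leb. cw m x * cw v x * G x\<bar>) \<le> (\<Sum>v\<in>K. ?ww v
      + \<bar>mean m\<bar> * ?wG v + ?wG m * \<bar>mean v\<bar> + \<bar>mean m\<bar> * \<bar>mean v\<bar> * A)"
    by (intro sum_mono each)
  also have "\<dots> = (\<Sum>v\<in>K. ?ww v)
      + \<bar>mean m\<bar> * (\<Sum>v\<in>K. ?wG v) + ?wG m * (\<Sum>v\<in>K. \<bar>mean v\<bar>)
      + \<bar>mean m\<bar> * (\<Sum>v\<in>K. \<bar>mean v\<bar>) * A"
    by (simp add: sum.distrib sum_distrib_left sum_distrib_right)
  also have "\<dots> \<le> 24 * M ^ 5 * A * X + 48 * M ^ 6 * (D * A) * X + 48 * M ^ 6 * (A * D) * X + 48 * M ^ 6 * (D * D) * X * A"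
    by (intro add_mono T1 T2 T3 mult_right_mono[OF T4] G(2))
  \<comment> \<open>As \<open>M \<ge> 1\<close> and \<open>D \<ge> 1\<close>, all four terms fit
    under \<open>M ^ 6 * D\<^sup>2\<close>, and \<open>168 = 24 + 3 * 48\<close>.\<close>
  also have "\<dots> \<le> 24 * (M ^ 6 * D\<^sup>2 * A * X) + 48 * (M ^ 6 * D\<^sup>2 * A * X) + 48 * (M ^ 6 * D\<^sup>2 * A * X) + 48 * (M ^ 6 * D\<^sup>2 * A * X)"
  proof -
    have d: "1 \<le> D\<^sup>2" "D \<le> D\<^sup>2" using D by (auto simp: power2_eq_square mult_ge1_I)
    have m5: "M ^ 5 \<le> M ^ 6 * D\<^sup>2"
      using M d power_increasing[of 5 6 M] mult_mono[of "M ^ 5" "M ^ 6" 1 "D\<^sup>2"] by simp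
    have "M ^ 5 * (A * X) \<le> (M ^ 6 * D\<^sup>2) * (A * X)" using m5 G X by (intro mult_right_mono) auto
    moreover have "M ^ 6 * A * X * D \<le> M ^ 6 * A * X * D\<^sup>2" using d M G X by (intro mult_left_mono) auto
    ultimately show ?thesis by (simp add: mult_ac power2_eq_square)
  qed
  also have "\<dots> = 168 * M ^ 6 * D\<^sup>2 * A * X" by simp
  finally show ?thesis unfolding X_def j_def .
qed

text \<open>\<open>F\<close> stands for a function of block 0. It is orthogonal to
  \<open>w v\<close> but not localized, so it enters through its sup norm and only the decay of the
  single wavelet \<open>v\<close> is gained.\<close>

lemma pair_bound_low:
  assumes v: "v \<in> wav_index l0" "J0 < fst v" and F: "continuous_on {0..1} F" "\<And>x. x \<in> {0..1} \<Longrightarrow> \<bar>F x\<bar> \<le> U"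
    and orth: "(LINT x|unit_leb. w v x * F x) = 0"
    and G: "holder \<sigma> A G" "A \<ge> 0" "\<And>x. x \<in> {0..1} \<Longrightarrow> \<bar>G x\<bar> \<le> A"
  shows "\<bar>LINT x|unit_leb. F x * cw v x * G x\<bar> \<le> 16 * M ^ 3 * D * U * A * 2 powr (- (\<sigma> + 1/2) * real (fst v))"
proof -
  define X where "X = 2 powr (- (\<sigma> + 1/2) * real (fst v))"
  have cG: "continuous_on {0..1} G" by (rule holder_continuous[OF G(1) \<sigma>(1)])
  have U: "U \<ge> 0" using F(2)[of 0] by auto
  have i: "integrable unit_leb (\<lambda>x. w v x * F x * G x)" "integrable unit_leb (\<lambda>x. F x * G x)"
    by (intro integrable_unit_leb_cont continuous_intros w_continuous cG F v)+
  have 1: "\<bar>LINT x|unit_leb. w v x * F x * G x\<bar> \<le> 8 * M ^ 3 * U * A * X"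
  proof -
    have "\<bar>LINT x|unit_leb. w (fst v, snd v) x * F x * G x\<bar> \<le> 2 * M * A * 2 powr (- \<sigma> * real (fst v)) * (LINT x|unit_leb. \<bar>w (fst v, snd v) x\<bar> * \<bar>F x\<bar>)"
      by (rule oscillation[OF _ measurable_unit_leb_cont[OF F(1)] F(2) _ G(1) _ _ G(2,3)])
         (use v orth \<sigma> in auto)
    also have "\<dots> \<le> 2 * M * A * 2 powr (- \<sigma> * real (fst v)) * (4 * M\<^sup>2 * 2 powr (- real (fst v) / 2) * U)"
    proof (rule mult_left_mono)
      have "(LINT x|unit_leb. \<bar>w (fst v, snd v) x\<bar> * \<bar>F x\<bar>) \<le> (LINT x|unit_leb. \<bar>w v x\<bar> * U)"
        using v F(2) by (intro integral_unit_leb_mono integrable_unit_leb_cont continuous_intros w_continuous F(1)) (auto intro!: mult_left_mono)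
      also have "\<dots> \<le> (4 * M\<^sup>2 * 2 powr (- real (fst v) / 2)) * U"
        using integral_abs_w[of "fst v" "snd v"] v U by (simp add: mult_right_mono)
      finally show "(LINT x|unit_leb. \<bar>w (fst v, snd v) x\<bar> * \<bar>F x\<bar>) \<le> (4 * M\<^sup>2 * 2 powr (- real (fst v) / 2)) * U" .
    qed (use M G in auto)
    also have "\<dots> = 8 * M ^ 3 * U * A * (2 powr (- \<sigma> * real (fst v)) * 2 powr (- real (fst v) / 2))"
      by (simp add: power2_eq_square power3_eq_cube)
    also have "2 powr (- \<sigma> * real (fst v)) * 2 powr (- real (fst v) / 2) = X"
      by (simp add: powr_add[symmetric] algebra_simps X_def)
    finally show ?thesis by simp
  qed
  have "\<bar>LINT x|unit_leb. F x * G x\<bar> \<le> U * A"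
    by (rule integral_abs_le) (auto intro!: continuous_intros F cG mult_mono G(3) U simp: abs_mult)
  then have 2: "\<bar>mean v\<bar> * \<bar>LINT x|unit_leb. F x * G x\<bar> \<le> (8 * M ^ 3 * D * X) * (U * A)"
    using mean_bound[OF v] M D unfolding X_def by (intro mult_mono) auto
  have "(LINT x|unit_leb. F x * cw v x * G x) = (LINT x|unit_leb. w v x * F x * G x - mean v * (F x * G x))"
    by (simp add: cw_def algebra_simps)
  also have "\<dots> = (LINT x|unit_leb. w v x * F x * G x) - mean v * (LINT x|unit_leb. F x * G x)" using i by simp
  finally have "\<bar>LINT x|unit_leb. F x * cw v x * G x\<bar> \<le> \<bar>LINT x|unit_leb. w v x * F x * G x\<bar> + \<bar>mean v\<bar> * \<bar>LINT x|unit_leb. F x * G x\<bar>"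
    unfolding abs_mult[symmetric] by linarith
  also have "\<dots> \<le> 8 * M ^ 3 * U * A * X + (8 * M ^ 3 * D * X) * (U * A)" by (intro add_mono 1 2)
  also have "\<dots> \<le> 8 * M ^ 3 * U * A * X * D + (8 * M ^ 3 * D * X) * (U * A)"
  proof -
    have "0 \<le> 8 * M ^ 3 * U * A * X" using M U G(2) by (simp add: X_def)
    from mult_left_mono[OF D this] show ?thesis by (simp add: mult_ac)
  qed
  finally show ?thesis by (simp add: X_def mult_ac)
qed

end

section \<open>The constant function and the span of block 0\<close>

context density begin

text \<open>The coefficients of the constant 1 vanish above \<open>J0\<close>, so its wavelet series
  is this finite sum. Hence \<open>low\<close> spans the constants, and centring a combination of
  low wavelets does not leave their span.\<close>

lemma one_expansion:
  assumes "x \<in> {0..1}"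
  shows "(\<Sum>v\<in>low. ip (\<lambda>_. 1) (w v) * w v x) = 1"
proof -
  define c where "c v = ip (\<lambda>_. 1) (w v)" for v
  \<comment> \<open>A finite sum of weighted coefficients dominates each of them, so the decay
    required by \<open>expansion\<close> holds for the constant function.\<close>
  define A where "A = (\<Sum>v\<in>low. \<bar>c v\<bar> * 2 powr ((\<sigma> + 1/2) * real (fst v)))"
  have fin: "finite low" unfolding low_def using finite_below[of "Suc J0"] by (simp add: less_Suc_eq_le)
  have A: "A \<ge> 0" unfolding A_def by (intro sum_nonneg) auto
  have b: "\<bar>ip (\<lambda>_. 1) (w v)\<bar> \<le> A * 2 powr (- (\<sigma> + 1/2) * real (fst v))" if v: "v \<in> wav_index l0" for v
  proof (cases "v \<in> low")
    case True
    have "\<bar>c v\<bar> * 2 powr ((\<sigma> + 1/2) * real (fst v)) \<le> A"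
      unfolding A_def by (rule member_le_sum[OF True]) (use fin in auto)
    then have "\<bar>c v\<bar> \<le> A * 2 powr (- ((\<sigma> + 1/2) * real (fst v)))"
      by (simp add: powr_minus field_simps)
    then show ?thesis unfolding c_def mult_minus_left .
  next
    case False
    then have "J0 < fst v" using v by (simp add: low_def)
    then show ?thesis using vanish[OF v] A by simp
  qed
  have "(\<lambda>n. \<Sum>v\<in>{v \<in> wav_index l0. fst v < n}. c v * w v x) \<longlonglongrightarrow> 1"
    unfolding c_def by (rule expansion(3)[OF _ \<sigma> A b assms]) auto
  moreover have "(\<Sum>v\<in>{v \<in> wav_index l0. fst v < n}. c v * w v x) = (\<Sum>v\<in>low. c v * w v x)" if "n > J0" for n
  proof (rule sum.mono_neutral_right[OF finite_below])
    show "low \<subseteq> {v \<in> wav_index l0. fst v < n}" using that by (auto simp: low_def)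
    show "\<forall>v\<in>{v \<in> wav_index l0. fst v < n} - low. c v * w v x = 0"
    proof
      fix v assume "v \<in> {v \<in> wav_index l0. fst v < n} - low"
      then have "v \<in> wav_index l0" "J0 < fst v" by (auto simp: low_def)
      then show "c v * w v x = 0" unfolding c_def by (simp add: vanish)
    qed
  qed
  then have "(\<lambda>n. \<Sum>v\<in>{v \<in> wav_index l0. fst v < n}. c v * w v x) \<longlonglongrightarrow> (\<Sum>v\<in>low. c v * w v x)"
    by (intro tendsto_eventually) (auto simp: eventually_sequentially intro!: exI[of _ "Suc J0"])
  ultimately show ?thesis unfolding c_def by (rule LIMSEQ_unique[symmetric])
qed

lemma finite_low: "finite low" and low_subset: "low \<subseteq> wav_index l0"
  unfolding low_def using finite_below[of "Suc J0"] by (auto simp: less_Suc_eq_le)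

lemma ip_cong: "(\<And>x. x \<in> {0..1} \<Longrightarrow> f x = f' x) \<Longrightarrow> (\<And>x. x \<in> {0..1} \<Longrightarrow> g x = g' x) \<Longrightarrow> ip f g = ip f' g'"
  unfolding ip_def by (intro Bochner_Integration.integral_cong refl) auto

lemma ip_self_nonneg: "ip f f \<ge> 0"
  unfolding ip_def by (intro integral_nonneg_AE) auto

lemma norm2_square: "(norm2 f)\<^sup>2 = ip f f"
  unfolding norm2_def using ip_self_nonneg by simp

lemma norm2_nonneg: "norm2 f \<ge> 0"
  unfolding norm2_def using ip_self_nonneg by simp

lemma integral_cw: "v \<in> wav_index l0 \<Longrightarrow> (LINT x|unit_leb. cw v x * p x) = 0"
proof -
  assume v: "v \<in> wav_index l0"
  have "integrable unit_leb (\<lambda>x. w v x * p x)" "integrable unit_leb p"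
    by (intro integrable_unit_leb_cont continuous_intros w_continuous p_continuous v)+
  then show ?thesis by (simp add: cw_def left_diff_distrib mean_def p_int)
qed

lemma integral_cw_square:
  assumes v: "v \<in> wav_index l0" "J0 < fst v"
  shows "ip (cw v) (cw v) = 1 + (mean v)\<^sup>2"
proof -
  have 1: "(LINT x|unit_leb. w v x) = 0" using vanish[OF v] by (simp add: ip_def)
  have 2: "(LINT x|unit_leb. w v x * w v x) = 1" using orth[OF v(1) v(1)] by (simp add: ip_def)
  have i: "integrable unit_leb (\<lambda>x. w v x * w v x)" "integrable unit_leb (w v)"
    by (intro integrable_unit_leb_cont continuous_intros w_continuous v(1))+
  have "ip (cw v) (cw v) = (LINT x|unit_leb. w v x * w v x - 2 * mean v * w v x + (mean v)\<^sup>2)"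
    unfolding ip_def cw_def by (simp add: algebra_simps power2_eq_square)
  also have "\<dots> = 1 + (mean v)\<^sup>2"
    using i 1 2 by (simp add: unit_leb.prob_space[unfolded space_unit_leb])
  finally show ?thesis .
qed

text \<open>The constant \<open>\<kappa>\<close> removed by centring is expanded in
  \<open>low\<close> by \<open>one_expansion\<close>; in the uncentred coordinates Parseval's
  identity applies.\<close>

lemma low_coefficients:
  assumes f: "\<And>x. x \<in> {0..1} \<Longrightarrow> f x = (\<Sum>v\<in>low. a v * cw v x)"
  obtains b where "\<And>x. x \<in> {0..1} \<Longrightarrow> f x = (\<Sum>v\<in>low. b v * w v x)" "(norm2 f)\<^sup>2 = (\<Sum>v\<in>low. (b v)\<^sup>2)"
proof
  define \<kappa> where "\<kappa> = (\<Sum>v\<in>low. a v * mean v)"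
  define b where "b v = a v - \<kappa> * ip (\<lambda>_. 1) (w v)" for v
  show *: "f x = (\<Sum>v\<in>low. b v * w v x)" if "x \<in> {0..1}" for x
  proof -
    have "(\<Sum>v\<in>low. b v * w v x) = (\<Sum>v\<in>low. a v * w v x) - \<kappa> * (\<Sum>v\<in>low. ip (\<lambda>_. 1) (w v) * w v x)"
      by (simp add: b_def left_diff_distrib sum_subtractf sum_distrib_left mult.assoc)
    also have "\<dots> = (\<Sum>v\<in>low. a v * w v x) - (\<Sum>v\<in>low. a v * mean v)"
      by (simp add: one_expansion[OF that] \<kappa>_def)
    also have "\<dots> = f x" by (simp add: f[OF that] cw_def right_diff_distrib sum_subtractf)
    finally show ?thesis by simp
  qed
  show "(norm2 f)\<^sup>2 = (\<Sum>v\<in>low. (b v)\<^sup>2)"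
    unfolding norm2_square ip_sum_sum[OF finite_low low_subset, symmetric] by (intro ip_cong *)
qed

end

section \<open>Blocks, and their norms compared with the second moment\<close>

locale enum = density +
  fixes e :: "nat \<Rightarrow> nat \<times> nat"
  assumes lex: "lex_enum l0 J0 e"
begin

definition in_block :: "nat \<Rightarrow> (real \<Rightarrow> real) \<Rightarrow> bool" where
  "in_block m f \<longleftrightarrow> (\<exists>a. \<forall>x\<in>{0..1}. f x = (\<Sum>v\<in>block l0 J0 e m. a v * cw v x))"

lemma e_bij: "bij_betw e {1..} {(j, k) \<in> wav_index l0. J0 < j}"
  using lex unfolding lex_enum_def by (rule conjunct1)

lemma e_mem: "m \<ge> 1 \<Longrightarrow> e m \<in> {(j, k) \<in> wav_index l0. J0 < j}"
proof -
  assume "m \<ge> 1"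
  then have "e m \<in> e ` {1..}" by (intro imageI) simp
  then show ?thesis unfolding bij_betw_imp_surj_on[OF e_bij] .
qed

lemma e_index: "m \<ge> 1 \<Longrightarrow> e m \<in> wav_index l0" and e_high: "m \<ge> 1 \<Longrightarrow> J0 < fst (e m)"
  using e_mem[of m] by auto

lemma e_inj: "m \<ge> 1 \<Longrightarrow> m' \<ge> 1 \<Longrightarrow> e m = e m' \<Longrightarrow> m = m'"
  using bij_betw_imp_inj_on[OF e_bij] by (auto dest: inj_onD)

lemma block_0: "block l0 J0 e 0 = low"
  by (auto simp: block_def low_def)

lemma block_subset: "block l0 J0 e m \<subseteq> wav_index l0" "finite (block l0 J0 e m)"
proof -
  have "block l0 J0 e m \<subseteq> wav_index l0 \<and> finite (block l0 J0 e m)"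
  proof (cases "m = 0")
    case True then show ?thesis using block_0 low_subset finite_low by simp
  next
    case False then show ?thesis using e_index[of m] by (auto simp: block_def)
  qed
  then show "block l0 J0 e m \<subseteq> wav_index l0" "finite (block l0 J0 e m)" by auto
qed

lemma in_block_continuous: "in_block m f \<Longrightarrow> continuous_on {0..1} f"
proof -
  assume "in_block m f"
  then obtain a where a: "\<And>x. x \<in> {0..1} \<Longrightarrow> f x = (\<Sum>v\<in>block l0 J0 e m. a v * cw v x)" unfolding in_block_def by blast
  have "continuous_on {0..1} (\<lambda>x. \<Sum>v\<in>block l0 J0 e m. a v * cw v x)"
    using block_subset by (intro continuous_intros cw_continuous) auto
  then show ?thesis by (rule continuous_on_eq) (simp add: a)
qed

lemma in_block_integral: "in_block m f \<Longrightarrow> (LINT x|unit_leb. f x * p x) = 0"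
proof -
  assume "in_block m f"
  then obtain a where a: "\<And>x. x \<in> {0..1} \<Longrightarrow> f x = (\<Sum>v\<in>block l0 J0 e m. a v * cw v x)" unfolding in_block_def by blast
  have i: "integrable unit_leb (\<lambda>x. cw v x * p x)" if "v \<in> block l0 J0 e m" for v
    using that block_subset by (intro integrable_unit_leb_cont continuous_intros cw_continuous p_continuous) auto
  have "(LINT x|unit_leb. f x * p x) = (LINT x|unit_leb. (\<Sum>v\<in>block l0 J0 e m. a v * (cw v x * p x)))"
    by (intro Bochner_Integration.integral_cong refl) (auto simp: a sum_distrib_right mult.assoc)
  also have "\<dots> = (\<Sum>v\<in>block l0 J0 e m. a v * (LINT x|unit_leb. cw v x * p x))"
    using i by (subst Bochner_Integration.integral_sum) auto
  also have "\<dots> = 0" using integral_cw block_subset by (intro sum.neutral) auto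
  finally show ?thesis .
qed

text \<open>A wavelet above \<open>J0\<close> integrates to zero, so centring adds exactly the
  square of its mean to its squared norm, which is therefore at least 1 and bounded through
  \<open>mean_bound\<close>.\<close>

lemma high_coefficient:
  assumes "m \<ge> 1" "in_block m f"
  obtains a where "\<And>x. x \<in> {0..1} \<Longrightarrow> f x = a * cw (e m) x" "\<bar>a\<bar> \<le> norm2 f" "(norm2 f)\<^sup>2 \<le> (1 + 64 * M ^ 6 * D\<^sup>2) * a\<^sup>2"
proof -
  obtain b where b: "\<And>x. x \<in> {0..1} \<Longrightarrow> f x = (\<Sum>v\<in>block l0 J0 e m. b v * cw v x)" using assms(2) unfolding in_block_def by blast
  define a where "a = b (e m)"
  have a: "f x = a * cw (e m) x" if "x \<in> {0..1}" for x using b[OF that] assms(1) by (simp add: block_def a_def)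
  have n: "(norm2 f)\<^sup>2 = a\<^sup>2 * (1 + (mean (e m))\<^sup>2)"
  proof -
    have "ip f f = (LINT x|unit_leb. a\<^sup>2 * (cw (e m) x * cw (e m) x))"
      unfolding ip_def by (intro Bochner_Integration.integral_cong refl) (auto simp: a power2_eq_square mult_ac)
    also have "\<dots> = a\<^sup>2 * ip (cw (e m)) (cw (e m))" by (simp add: ip_def)
    finally show ?thesis unfolding norm2_square integral_cw_square[OF e_index[OF assms(1)] e_high[OF assms(1)]] .
  qed
  have "a\<^sup>2 \<le> (norm2 f)\<^sup>2" unfolding n by (simp add: distrib_left)
  then have 1: "\<bar>a\<bar> \<le> norm2 f" using norm2_nonneg[of f] by (metis abs_le_square_iff abs_of_nonneg)
  have "\<bar>mean (e m)\<bar> \<le> 8 * M ^ 3 * D * 2 powr (- (\<sigma> + 1/2) * real (fst (e m)))"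
    by (rule mean_bound[OF e_index[OF assms(1)] e_high[OF assms(1)]])
  also have "\<dots> \<le> 8 * M ^ 3 * D * 1"
    using M D \<sigma> powr_mono[of "- (\<sigma> + 1/2) * real (fst (e m))" 0 2] by (intro mult_left_mono) (auto simp: mult_nonpos_nonneg)
  finally have "(mean (e m))\<^sup>2 \<le> (8 * M ^ 3 * D)\<^sup>2" by (intro abs_le_square_iff[THEN iffD1]) (use M D in auto)
  also have "\<dots> = 64 * M ^ 6 * D\<^sup>2" by (simp add: power_mult_distrib)
  finally have "(mean (e m))\<^sup>2 \<le> 64 * M ^ 6 * D\<^sup>2" .
  from mult_right_mono[OF add_left_mono[OF this, of 1], of "a\<^sup>2"]
  have "(norm2 f)\<^sup>2 \<le> (1 + 64 * M ^ 6 * D\<^sup>2) * a\<^sup>2" unfolding n by (simp add: mult.commute)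
  then show thesis using that a 1 by blast
qed

lemma low_orthogonal:
  assumes "in_block 0 f" "v \<in> wav_index l0" "J0 < fst v"
  shows "(LINT x|unit_leb. w v x * f x) = 0"
proof -
  obtain a where "\<And>x. x \<in> {0..1} \<Longrightarrow> f x = (\<Sum>v\<in>low. a v * cw v x)" using assms(1) unfolding in_block_def block_0 by blast
  then obtain b where b: "\<And>x. x \<in> {0..1} \<Longrightarrow> f x = (\<Sum>v\<in>low. b v * w v x)" using low_coefficients by blast
  have "(LINT x|unit_leb. w v x * f x) = ip (\<lambda>x. \<Sum>v\<in>low. b v * w v x) (w v)"
    unfolding ip_def by (intro Bochner_Integration.integral_cong refl) (auto simp: b mult.commute)
  also have "\<dots> = 0" using ip_sum_w[OF finite_low low_subset assms(2)] assms(3) by (simp add: low_def)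
  finally show ?thesis .
qed

definition K_low :: real where "K_low = 3 * M\<^sup>2 * geo (1/2)"

lemma K_low_nonneg: "K_low \<ge> 0"
  unfolding K_low_def using geo_pos[of "1/2"] by simp

lemma low_sup:
  assumes "in_block 0 f" "x \<in> {0..1}"
  shows "\<bar>f x\<bar> \<le> K_low * 2 powr (real J0 / 2) * norm2 f"
proof -
  obtain a where a: "\<And>x. x \<in> {0..1} \<Longrightarrow> f x = (\<Sum>v\<in>low. a v * cw v x)" using assms(1) unfolding in_block_def block_0 by blast
  obtain b where b: "\<And>x. x \<in> {0..1} \<Longrightarrow> f x = (\<Sum>v\<in>low. b v * w v x)" "(norm2 f)\<^sup>2 = (\<Sum>v\<in>low. (b v)\<^sup>2)"
    by (rule low_coefficients[OF a]) blast+
  show ?thesis unfolding K_low_def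
    by (rule norm_sup_low[OF low_def b(1) assms(2) _ norm2_nonneg]) (use b in simp_all)
qed

text \<open>Centred wavelets are not orthogonal, because each carries a constant. Moving all
  constants into \<open>low\<close> expresses the sum in the orthonormal system, where Parseval's
  identity and \<open>p \<ge> 1 / D\<close> bound the squared coefficients by the second
  moment.\<close>

lemma norm_equivalence:
  assumes I: "finite I" and F: "\<And>m. m \<in> I \<Longrightarrow> in_block m (F m)"
  shows "(\<Sum>m\<in>I. (norm2 (F m))\<^sup>2) \<le> (4 * D\<^sup>2 + (1 + 64 * M ^ 6 * D\<^sup>2) * D) * (LINT x|unit_leb. (\<Sum>m\<in>I. F m x)\<^sup>2 * p x)"
proof -
  define I' where "I' = I - {0}"
  have I': "finite I'" "\<And>m. m \<in> I' \<Longrightarrow> m \<ge> 1" "\<And>m. m \<in> I' \<Longrightarrow> in_block m (F m)" using I F by (auto simp: I'_def)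
  define F0 where "F0 = (if 0 \<in> I then F 0 else (\<lambda>_. 0))"
  have F0: "in_block 0 F0"
    using F unfolding F0_def by (auto simp: in_block_def intro!: exI[of _ "\<lambda>_. 0"])
  have "\<forall>m\<in>I'. \<exists>a. (\<forall>x\<in>{0..1}. F m x = a * cw (e m) x) \<and> (norm2 (F m))\<^sup>2 \<le> (1 + 64 * M ^ 6 * D\<^sup>2) * a\<^sup>2"
  proof
    fix m assume m: "m \<in> I'"
    show "\<exists>a. (\<forall>x\<in>{0..1}. F m x = a * cw (e m) x) \<and> (norm2 (F m))\<^sup>2 \<le> (1 + 64 * M ^ 6 * D\<^sup>2) * a\<^sup>2"
      by (rule high_coefficient[OF I'(2,3)[OF m]]) blast
  qed
  then obtain a where a: "\<And>m x. m \<in> I' \<Longrightarrow> x \<in> {0..1} \<Longrightarrow> F m x = a m * cw (e m) x"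
    "\<And>m. m \<in> I' \<Longrightarrow> (norm2 (F m))\<^sup>2 \<le> (1 + 64 * M ^ 6 * D\<^sup>2) * (a m)\<^sup>2" by (metis (no_types, lifting))
  obtain a0 where a0: "\<And>x. x \<in> {0..1} \<Longrightarrow> F0 x = (\<Sum>v\<in>low. a0 v * cw v x)" using F0 unfolding in_block_def block_0 by blast
  obtain b where b: "\<And>x. x \<in> {0..1} \<Longrightarrow> F0 x = (\<Sum>v\<in>low. b v * w v x)"
    by (rule low_coefficients[OF a0]) blast+
  define S where "S x = (\<Sum>m\<in>I. F m x)" for x
  define \<kappa> where "\<kappa> = (\<Sum>m\<in>I'. a m * mean (e m))"
  have S: "S x = F0 x + (\<Sum>m\<in>I'. F m x)" for x
    unfolding S_def F0_def I'_def using I by (auto simp: sum.remove)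
  define V where "V = low \<union> e ` I'"
  define c where "c v = (if v \<in> low then b v - \<kappa> * ip (\<lambda>_. 1) (w v) else a (inv_into I' e v))" for v
  have inj: "inj_on e I'" using e_inj I'(2) by (auto intro: inj_onI)
  have disj: "low \<inter> e ` I' = {}" using e_high I'(2) by (fastforce simp: low_def)
  have V: "finite V" "V \<subseteq> wav_index l0" using finite_low low_subset I' e_index by (auto simp: V_def)
  have clow: "(\<Sum>v\<in>low. c v * w v x) = F0 x - \<kappa>" if "x \<in> {0..1}" for x
  proof -
    have "(\<Sum>v\<in>low. c v * w v x) = (\<Sum>v\<in>low. b v * w v x) - \<kappa> * (\<Sum>v\<in>low. ip (\<lambda>_. 1) (w v) * w v x)"
      by (simp add: c_def left_diff_distrib sum_subtractf sum_distrib_left mult.assoc)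
    then show ?thesis using b[OF that] one_expansion[OF that] by simp
  qed
  have ce: "c (e m) = a m" if "m \<in> I'" for m
    using that disj inj by (auto simp: c_def)
  have SV: "S x = (\<Sum>v\<in>V. c v * w v x)" if x: "x \<in> {0..1}" for x
  proof -
    have "(\<Sum>v\<in>V. c v * w v x) = (\<Sum>v\<in>low. c v * w v x) + (\<Sum>v\<in>e ` I'. c v * w v x)"
      unfolding V_def by (rule sum.union_disjoint) (use finite_low I' disj in auto)
    also have "(\<Sum>v\<in>e ` I'. c v * w v x) = (\<Sum>m\<in>I'. a m * w (e m) x)"
      by (subst sum.reindex[OF inj]) (simp add: ce)
    also have "\<dots> = (\<Sum>m\<in>I'. F m x) + \<kappa>"
      using x by (simp add: a cw_def right_diff_distrib sum_subtractf \<kappa>_def)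
    finally show ?thesis using clow[OF x] S[of x] by simp
  qed
  define N where "N = (LINT x|unit_leb. (S x)\<^sup>2 * p x)"
  have cS: "continuous_on {0..1} S"
    unfolding S_def using F in_block_continuous by (intro continuous_intros) auto
  have c2: "(\<Sum>v\<in>V. (c v)\<^sup>2) \<le> D * N"
  proof -
    have "(\<Sum>v\<in>V. (c v)\<^sup>2) = ip S S"
      unfolding ip_sum_sum[OF V, symmetric] by (intro ip_cong) (simp_all add: SV)
    also have "\<dots> \<le> (LINT x|unit_leb. D * ((S x)\<^sup>2 * p x))"
      unfolding ip_def
    proof (rule integral_unit_leb_mono)
      fix x :: real assume x: "x \<in> {0..1}"
      have "1 \<le> D * p x" using p_lower[OF x] D by (simp add: field_simps)
      then have "(S x)\<^sup>2 * 1 \<le> (S x)\<^sup>2 * (D * p x)" by (intro mult_left_mono) auto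
      then show "S x * S x \<le> D * ((S x)\<^sup>2 * p x)" by (simp add: power2_eq_square mult_ac)
    qed (intro integrable_unit_leb_cont continuous_intros cS p_continuous)+
    finally show ?thesis by (simp add: N_def)
  qed
  have cV: "(\<Sum>v\<in>V. (c v)\<^sup>2) = (\<Sum>v\<in>low. (c v)\<^sup>2) + (\<Sum>m\<in>I'. (a m)\<^sup>2)"
  proof -
    have "(\<Sum>v\<in>V. (c v)\<^sup>2) = (\<Sum>v\<in>low. (c v)\<^sup>2) + (\<Sum>v\<in>e ` I'. (c v)\<^sup>2)"
      unfolding V_def by (rule sum.union_disjoint) (use finite_low I' disj in auto)
    moreover have "(\<Sum>v\<in>e ` I'. (c v)\<^sup>2) = (\<Sum>m\<in>I'. (a m)\<^sup>2)" by (simp add: sum.reindex[OF inj] ce)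
    ultimately show ?thesis by simp
  qed
  have a2: "(\<Sum>m\<in>I'. (a m)\<^sup>2) \<le> D * N" and l2: "(\<Sum>v\<in>low. (c v)\<^sup>2) \<le> D * N"
    using c2 cV sum_nonneg[of low "\<lambda>v. (c v)\<^sup>2"] sum_nonneg[of I' "\<lambda>m. (a m)\<^sup>2"] by auto
  have n0: "(norm2 F0)\<^sup>2 \<le> 4 * D\<^sup>2 * N"
  proof -
    \<comment> \<open>\<open>P\<close> is the low part of the expansion: block 0 minus the constant
      \<open>\<kappa>\<close> collected from the other blocks. As block 0 has mean zero under
      \<open>p\<close>, the mean of \<open>P\<close> is \<open>- \<kappa>\<close>, so
      \<open>\<kappa>\<close> is controlled by the norm of \<open>P\<close>.\<close>
    define P where "P x = F0 x - \<kappa>" for x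
    have cP: "continuous_on {0..1} P" unfolding P_def using in_block_continuous[OF F0] by (intro continuous_intros)
    have P2: "(LINT x|unit_leb. (P x)\<^sup>2) = (\<Sum>v\<in>low. (c v)\<^sup>2)"
    proof -
      have "(LINT x|unit_leb. (P x)\<^sup>2) = ip P P" by (simp add: ip_def power2_eq_square)
      also have "\<dots> = ip (\<lambda>x. \<Sum>v\<in>low. c v * w v x) (\<lambda>x. \<Sum>v\<in>low. c v * w v x)"
        by (intro ip_cong) (simp_all add: clow P_def)
      finally show ?thesis unfolding ip_sum_sum[OF finite_low low_subset] .
    qed
    have i: "integrable unit_leb (\<lambda>x. P x * p x)" "integrable unit_leb (\<lambda>x. (P x)\<^sup>2 * p x)" "integrable unit_leb p"
      "integrable unit_leb (\<lambda>x. (P x)\<^sup>2)" "integrable unit_leb P"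
      by (intro integrable_unit_leb_cont continuous_intros cP p_continuous)+
    have Pp: "(LINT x|unit_leb. P x * p x) = - \<kappa>"
    proof -
      have "integrable unit_leb (\<lambda>x. F0 x * p x)"
        by (intro integrable_unit_leb_cont continuous_intros in_block_continuous[OF F0] p_continuous)
      then show ?thesis using in_block_integral[OF F0] i(3) by (simp add: P_def left_diff_distrib p_int)
    qed
    have "0 \<le> (LINT x|unit_leb. (P x + \<kappa>)\<^sup>2 * p x)"
      by (intro integral_nonneg_AE AE_I2) (auto intro!: mult_nonneg_nonneg less_imp_le[OF p_pos])
    also have "\<dots> = (LINT x|unit_leb. (P x)\<^sup>2 * p x + 2 * \<kappa> * (P x * p x) + \<kappa>\<^sup>2 * p x)"
      by (simp add: power2_eq_square algebra_simps)
    also have "\<dots> = (LINT x|unit_leb. (P x)\<^sup>2 * p x) - \<kappa>\<^sup>2"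
      using i by (simp add: Pp p_int power2_eq_square)
    finally have "\<kappa>\<^sup>2 \<le> (LINT x|unit_leb. (P x)\<^sup>2 * p x)" by simp
    also have "\<dots> \<le> (LINT x|unit_leb. (P x)\<^sup>2 * D)"
      by (intro integral_unit_leb_mono mult_left_mono p_upper integrable_mult_left i) auto
    finally have k: "\<kappa>\<^sup>2 \<le> D * (LINT x|unit_leb. (P x)\<^sup>2)" by (simp add: mult.commute)
    have "(norm2 F0)\<^sup>2 = (LINT x|unit_leb. (P x + \<kappa>)\<^sup>2)"
      unfolding norm2_square ip_def P_def by (simp add: power2_eq_square)
    also have "\<dots> \<le> (LINT x|unit_leb. 2 * (P x)\<^sup>2 + 2 * \<kappa>\<^sup>2)"
    proof (rule integral_unit_leb_mono)
      show "(P x + \<kappa>)\<^sup>2 \<le> 2 * (P x)\<^sup>2 + 2 * \<kappa>\<^sup>2" for x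
        using sum_squares_bound[of "P x" \<kappa>] by (simp add: power2_sum)
    qed (intro integrable_unit_leb_cont continuous_intros cP)+
    also have "\<dots> = 2 * (LINT x|unit_leb. (P x)\<^sup>2) + 2 * \<kappa>\<^sup>2"
      using i by (simp add: unit_leb.prob_space[unfolded space_unit_leb])
    also have "\<dots> \<le> 2 * (LINT x|unit_leb. (P x)\<^sup>2) + 2 * (D * (LINT x|unit_leb. (P x)\<^sup>2))" using k by simp
    also have "\<dots> = (2 + 2 * D) * (LINT x|unit_leb. (P x)\<^sup>2)" by (simp add: algebra_simps)
    also have "\<dots> \<le> (4 * D) * (D * N)"
      using l2 D unfolding P2 by (intro mult_mono) (auto intro: sum_nonneg)
    finally show ?thesis by (simp add: power2_eq_square mult_ac)
  qed
  have "(\<Sum>m\<in>I. (norm2 (F m))\<^sup>2) \<le> (norm2 F0)\<^sup>2 + (\<Sum>m\<in>I'. (norm2 (F m))\<^sup>2)"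
    unfolding F0_def I'_def using I by (auto simp: sum.remove)
  also have "\<dots> \<le> 4 * D\<^sup>2 * N + (\<Sum>m\<in>I'. (1 + 64 * M ^ 6 * D\<^sup>2) * (a m)\<^sup>2)"
    by (intro add_mono n0 sum_mono a(2))
  also have "\<dots> \<le> 4 * D\<^sup>2 * N + (1 + 64 * M ^ 6 * D\<^sup>2) * (D * N)"
    unfolding sum_distrib_left[symmetric] using M by (intro add_left_mono mult_left_mono a2) (auto intro: add_nonneg_nonneg)
  finally show ?thesis by (simp add: N_def S_def algebra_simps)
qed

end

section \<open>The bias of the inactive coordinates\<close>

context enum begin

text \<open>\<open>h i\<close> bounds an inactive coefficient at level \<open>i\<close> and the
  weight is that of \<open>pair_bound\<close>: the total interaction of an active wavelet of level
  \<open>j\<close> with the inactive levels. The term \<open>i = J0\<close> accounts for block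
  0.\<close>

definition Q_high :: "(nat \<Rightarrow> real) \<Rightarrow> nat \<Rightarrow> nat \<Rightarrow> real" where
  "Q_high h n j = (\<Sum>i\<in>{J0..<n}. h i * 2 powr ((real i - real j) / 2 - \<sigma> * real (max i j)))"

text \<open>The same for an active block 0: \<open>pair_bound_low\<close> contributes
  \<open>2 powr (- (\<sigma> + 1/2) * i)\<close> for each of about \<open>2 ^ i\<close>
  wavelets.\<close>

definition Q_low :: "(nat \<Rightarrow> real) \<Rightarrow> nat \<Rightarrow> real" where
  "Q_low h n = (\<Sum>i\<in>{Suc J0..<n}. h i * 2 powr ((1/2 - \<sigma>) * real i))"

definition K_key :: real where
  "K_key = 168 * M ^ 6 * D\<^sup>2 + 48 * M ^ 3 * D * K_low"

text \<open>A common bound for the sup norm and the Hoelder constant of the weight \<open>G\<close>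
  below. The 3 bounds both \<open>expquot\<close> and its Lipschitz constant on
  \<open>[-1, 1]\<close>; the second summand is \<open>3 * D\<close> times the Hoelder constant of
  the inactive sum.\<close>

definition amp :: "real \<Rightarrow> real" where
  "amp \<gamma> = 3 * D + 36 * D * M\<^sup>2 * geo2 \<sigma> * \<gamma>"

lemma geo2_nonneg: "geo2 \<sigma> \<ge> 0"
  unfolding geo2_def using geo_pos[of \<sigma>] geo_pos[of "1 - \<sigma>"] \<sigma> by simp

lemma amp_nonneg: "\<gamma> \<ge> 0 \<Longrightarrow> amp \<gamma> \<ge> 0"
  unfolding amp_def using D geo2_nonneg by (intro add_nonneg_nonneg mult_nonneg_nonneg) auto

lemma group_levels:
  fixes a h c :: "nat \<Rightarrow> real" and \<phi> :: "nat \<times> nat \<Rightarrow> real"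
  assumes T: "finite T" "\<And>k. k \<in> T \<Longrightarrow> k \<ge> 1" and n: "\<And>k. k \<in> T \<Longrightarrow> fst (e k) < n"
    and a: "\<And>k. k \<in> T \<Longrightarrow> \<bar>a k\<bar> \<le> h (fst (e k))" and h: "\<And>i. h i \<ge> 0" and \<phi>: "\<And>v. \<phi> v \<ge> 0"
    and c: "\<And>K i. K \<subseteq> lev i \<Longrightarrow> K \<subseteq> e ` T \<Longrightarrow> J0 < i \<Longrightarrow> (\<Sum>v\<in>K. \<phi> v) \<le> c i"
  shows "(\<Sum>k\<in>T. \<bar>a k\<bar> * \<phi> (e k)) \<le> (\<Sum>i\<in>{Suc J0..<n}. h i * c i)"
proof -
  have inj: "inj_on e T" using e_inj T(2) by (auto intro: inj_onI)
  have "(\<Sum>k\<in>T. \<bar>a k\<bar> * \<phi> (e k)) \<le> (\<Sum>k\<in>T. h (fst (e k)) * \<phi> (e k))"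
  proof (rule sum_mono)
    fix k assume "k \<in> T"
    from mult_right_mono[OF a[OF this] \<phi>] show "\<bar>a k\<bar> * \<phi> (e k) \<le> h (fst (e k)) * \<phi> (e k)" .
  qed
  also have "\<dots> = (\<Sum>v\<in>e ` T. h (fst v) * \<phi> v)" by (simp add: sum.reindex[OF inj])
  also have "\<dots> = (\<Sum>i<n. \<Sum>v\<in>{v \<in> e ` T. fst v = i}. h (fst v) * \<phi> v)"
    by (rule sum_levels) (use T n in auto)
  also have "\<dots> = (\<Sum>i\<in>{Suc J0..<n}. \<Sum>v\<in>{v \<in> e ` T. fst v = i}. h (fst v) * \<phi> v)"
  proof (rule sum.mono_neutral_right)
    show "\<forall>i\<in>{..<n} - {Suc J0..<n}. (\<Sum>v\<in>{v \<in> e ` T. fst v = i}. h (fst v) * \<phi> v) = 0"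
    proof
      fix i assume "i \<in> {..<n} - {Suc J0..<n}"
      then have "i \<le> J0" by auto
      then have "\<not> (v \<in> e ` T \<and> fst v = i)" for v using e_high T(2) by fastforce
      then have "{v \<in> e ` T. fst v = i} = {}" by blast
      then show "(\<Sum>v\<in>{v \<in> e ` T. fst v = i}. h (fst v) * \<phi> v) = 0" by (simp only: sum.empty)
    qed
  qed auto
  also have "\<dots> \<le> (\<Sum>i\<in>{Suc J0..<n}. h i * c i)"
  proof (rule sum_mono)
    fix i assume i: "i \<in> {Suc J0..<n}"
    have "(\<Sum>v\<in>{v \<in> e ` T. fst v = i}. h (fst v) * \<phi> v) = h i * (\<Sum>v\<in>{v \<in> e ` T. fst v = i}. \<phi> v)"
      unfolding sum_distrib_left by (intro sum.cong) auto
    also have "\<dots> \<le> h i * c i"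
      using i e_index T(2) by (intro mult_left_mono c h) auto
    finally show "(\<Sum>v\<in>{v \<in> e ` T. fst v = i}. h (fst v) * \<phi> v) \<le> h i * c i" .
  qed
  finally show ?thesis .
qed

end

text \<open>The inactive coordinates of one fixed parameter. The bound 1 on the partial sums
  provides dominated convergence and keeps \<open>expquot\<close> in the range where it is
  bounded.\<close>

locale complement = enum +
  fixes F :: "nat \<Rightarrow> real \<Rightarrow> real" and I :: "nat set" and h :: "nat \<Rightarrow> real" and \<gamma> :: real and Sb :: "real \<Rightarrow> real"
  assumes F: "in_block m (F m)"
    and norm_le: "m \<notin> I \<Longrightarrow> norm2 (F m) \<le> h (level J0 e m)"
    and h: "h i \<ge> 0" "J0 \<le> i \<Longrightarrow> h i \<le> \<gamma> * 2 powr (- (\<sigma> + 1/2) * real i)"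
    and part_lim: "x \<in> {0..1} \<Longrightarrow> (\<lambda>N. \<Sum>m\<in>{..<N} - I. F m x) \<longlonglongrightarrow> Sb x"
    and part_bound: "x \<in> {0..1} \<Longrightarrow> \<bar>\<Sum>m\<in>{..<N} - I. F m x\<bar> \<le> 1"
begin

lemma gamma_nonneg: "\<gamma> \<ge> 0"
proof -
  have "0 \<le> \<gamma> * 2 powr (- (\<sigma> + 1/2) * real J0)" using h(1)[of J0] h(2)[of J0] by linarith
  then show ?thesis by (simp add: zero_le_mult_iff)
qed

lemma coefficients:
  obtains a where "\<And>m x. m \<ge> 1 \<Longrightarrow> x \<in> {0..1} \<Longrightarrow> F m x = a m * cw (e m) x"
    "\<And>m. m \<ge> 1 \<Longrightarrow> m \<notin> I \<Longrightarrow> \<bar>a m\<bar> \<le> h (fst (e m))"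
proof -
  have "\<exists>a. m \<ge> 1 \<longrightarrow> (\<forall>x\<in>{0..1}. F m x = a * cw (e m) x) \<and> \<bar>a\<bar> \<le> norm2 (F m)" for m
  proof (cases "m \<ge> 1")
    case True
    show ?thesis by (rule high_coefficient[OF True F[of m]]) blast
  qed simp
  then obtain a where a: "\<And>m. m \<ge> 1 \<Longrightarrow> (\<forall>x\<in>{0..1}. F m x = a m * cw (e m) x) \<and> \<bar>a m\<bar> \<le> norm2 (F m)" by metis
  show thesis
  proof (rule that[of a])
    show "\<bar>a m\<bar> \<le> h (fst (e m))" if "m \<ge> 1" "m \<notin> I" for m
      using a[OF that(1)] norm_le[OF that(2)] that(1) by (auto simp: level_def)
  qed (use a in blast)
qed

text \<open>Centring constants cancel in differences, so the partial sums can be treated as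
  uncentred wavelet series with decaying coefficients. The bound is uniform in \<open>N\<close> and
  passes to the limit \<open>Sb\<close>.\<close>

lemma part_holder:
  assumes x: "x \<in> {0..1}" "y \<in> {0..1}"
  shows "\<bar>(\<Sum>m\<in>{..<N} - I. F m x) - (\<Sum>m\<in>{..<N} - I. F m y)\<bar> \<le> 12 * M\<^sup>2 * geo2 \<sigma> * \<gamma> * \<bar>x - y\<bar> powr \<sigma>"
proof -
  obtain a where a: "\<And>m x. m \<ge> 1 \<Longrightarrow> x \<in> {0..1} \<Longrightarrow> F m x = a m * cw (e m) x"
    "\<And>m. m \<ge> 1 \<Longrightarrow> m \<notin> I \<Longrightarrow> \<bar>a m\<bar> \<le> h (fst (e m))" by (rule coefficients) blast
  define T where "T = {1..<N} - I"
  define Z where "Z = {..<N} \<inter> {0} - I"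
  define low' where "low' = (if Z = {} then {} else low)"
  obtain a0 where a0: "\<And>x. x \<in> {0..1} \<Longrightarrow> F 0 x = (\<Sum>v\<in>low. a0 v * cw v x)" using F[of 0] unfolding in_block_def block_0 by blast
  obtain b where b: "\<And>x. x \<in> {0..1} \<Longrightarrow> F 0 x = (\<Sum>v\<in>low. b v * w v x)" "(norm2 (F 0))\<^sup>2 = (\<Sum>v\<in>low. (b v)\<^sup>2)"
    by (rule low_coefficients[OF a0]) blast+
  define V where "V = low' \<union> e ` T"
  define c where "c v = (if v \<in> low then b v else a (inv_into T e v))" for v
  have inj: "inj_on e T" using e_inj by (auto intro: inj_onI simp: T_def)
  have disj: "low \<inter> e ` T = {}" using e_high by (fastforce simp: low_def T_def)
  have ce: "c (e m) = a m" if "m \<in> T" for m using that disj inj by (auto simp: c_def)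
  have low': "low' \<subseteq> low" by (simp add: low'_def)
  have fl: "finite low'" by (rule finite_subset[OF low' finite_low])
  have V: "finite V" "V \<subseteq> wav_index l0"
    using fl low' low_subset e_index by (auto simp: V_def T_def)
  have cb: "\<bar>c v\<bar> \<le> \<gamma> * 2 powr (- (\<sigma> + 1/2) * real (fst v))" if v: "v \<in> V" for v
  proof (cases "v \<in> low'")
    case True
    then have vl: "v \<in> low" and z: "0 \<notin> I" unfolding low'_def Z_def by (auto split: if_splits)
    have "(b v)\<^sup>2 \<le> (norm2 (F 0))\<^sup>2" unfolding b(2) using vl finite_low by (intro member_le_sum) auto
    then have "\<bar>b v\<bar> \<le> norm2 (F 0)" using norm2_nonneg by (metis abs_le_square_iff abs_of_nonneg)
    also have "\<dots> \<le> h J0" using norm_le[OF z] by (simp add: level_def)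
    also have "\<dots> \<le> \<gamma> * 2 powr (- (\<sigma> + 1/2) * real J0)" by (rule h) simp
    \<comment> \<open>Levels inside block 0 are at most \<open>J0\<close>, where the required bound
      is weaker than at \<open>J0\<close>.\<close>
    also have "\<dots> \<le> \<gamma> * 2 powr (- (\<sigma> + 1/2) * real (fst v))"
    proof -
      have "- (\<sigma> + 1/2) * real J0 \<le> - (\<sigma> + 1/2) * real (fst v)"
        using vl \<sigma> by (intro mult_left_mono_neg) (auto simp: low_def)
      from powr_mono[OF this, of 2] show ?thesis using gamma_nonneg by (intro mult_left_mono) auto
    qed
    finally show ?thesis using vl by (simp add: c_def)
  next
    case False
    then obtain m where m: "m \<in> T" "v = e m" using v by (auto simp: V_def)
    then have m1: "m \<ge> 1" "m \<notin> I" by (auto simp: T_def)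
    have "\<bar>c v\<bar> \<le> h (fst v)" using a(2)[OF m1] ce[OF m(1)] m(2) by simp
    also have "\<dots> \<le> \<gamma> * 2 powr (- (\<sigma> + 1/2) * real (fst v))" using e_high[OF m1(1)] m(2) by (intro h) simp
    finally show ?thesis .
  qed
  define \<kappa> where "\<kappa> = (\<Sum>m\<in>T. a m * mean (e m))"
  have SV: "(\<Sum>m\<in>{..<N} - I. F m x) = (\<Sum>v\<in>V. c v * w v x) - \<kappa>" if x: "x \<in> {0..1}" for x
  proof -
    have 0: "(\<Sum>m\<in>Z. F m x) = (\<Sum>v\<in>low'. c v * w v x)"
    proof (cases "Z = {}")
      case False
      then have "Z = {0}" by (auto simp: Z_def)
      then show ?thesis using b(1)[OF x] by (simp add: low'_def c_def)
    qed (simp add: low'_def)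
    have "{..<N} - I = Z \<union> T" by (auto simp: Z_def T_def)
    moreover have "(\<Sum>m\<in>Z \<union> T. F m x) = (\<Sum>m\<in>Z. F m x) + (\<Sum>m\<in>T. F m x)"
      by (rule sum.union_disjoint) (auto simp: Z_def T_def)
    moreover have "(\<Sum>m\<in>T. F m x) = (\<Sum>v\<in>e ` T. c v * w v x) - \<kappa>"
    proof -
      have "(\<Sum>v\<in>e ` T. c v * w v x) = (\<Sum>m\<in>T. a m * w (e m) x)"
        by (subst sum.reindex[OF inj]) (simp add: ce)
      moreover have "(\<Sum>m\<in>T. F m x) = (\<Sum>m\<in>T. a m * w (e m) x - a m * mean (e m))"
        by (intro sum.cong) (auto simp: a(1)[OF _ x] T_def cw_def right_diff_distrib)
      ultimately show ?thesis by (simp add: sum_subtractf \<kappa>_def)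
    qed
    moreover have "(\<Sum>v\<in>V. c v * w v x) = (\<Sum>v\<in>low'. c v * w v x) + (\<Sum>v\<in>e ` T. c v * w v x)"
      unfolding V_def by (rule sum.union_disjoint) (use fl disj low' in \<open>auto simp: T_def\<close>)
    ultimately show ?thesis using 0 by simp
  qed
  show ?thesis unfolding SV[OF x(1)] SV[OF x(2)] using series_holder[OF V \<sigma> cb gamma_nonneg x] by simp
qed

lemma part_continuous: "continuous_on {0..1} (\<lambda>x. \<Sum>m\<in>{..<N} - I. F m x)"
  using F by (intro continuous_intros in_block_continuous) auto

lemma Sb_bound: "x \<in> {0..1} \<Longrightarrow> \<bar>Sb x\<bar> \<le> 1"
  using LIMSEQ_le_const2[OF tendsto_rabs[OF part_lim], of x 1] part_bound by blast

lemma Sb_holder: "holder \<sigma> (12 * M\<^sup>2 * geo2 \<sigma> * \<gamma>) Sb"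
  unfolding holder_def
proof (intro ballI)
  fix x y :: real assume xy: "x \<in> {0..1}" "y \<in> {0..1}"
  show "\<bar>Sb x - Sb y\<bar> \<le> 12 * M\<^sup>2 * geo2 \<sigma> * \<gamma> * \<bar>x - y\<bar> powr \<sigma>"
    by (rule LIMSEQ_le_const2[OF tendsto_rabs[OF tendsto_diff[OF part_lim[OF xy(1)] part_lim[OF xy(2)]]]])
       (use part_holder[OF xy] in blast)
qed

lemma Sb_continuous: "continuous_on {0..1} Sb"
  by (rule holder_continuous[OF Sb_holder \<sigma>(1)])

text \<open>Chosen so that \<open>Sb x * G x = (exp (Sb x) - 1) * p x\<close>; under the weight
  \<open>G\<close> the factor \<open>Sb\<close> can be expanded block by block.\<close>

definition G :: "real \<Rightarrow> real" where "G x = p x * expquot (Sb x)"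

lemma G_bound: "x \<in> {0..1} \<Longrightarrow> \<bar>G x\<bar> \<le> amp \<gamma>"
proof -
  assume x: "x \<in> {0..1}"
  have "\<bar>G x\<bar> \<le> D * 3" unfolding G_def abs_mult
    using p_abs[OF x] expquot_bound[OF Sb_bound[OF x]] D by (intro mult_mono) auto
  moreover have "0 \<le> 36 * D * M\<^sup>2 * geo2 \<sigma> * \<gamma>" using D geo2_nonneg gamma_nonneg by (intro mult_nonneg_nonneg) auto
  ultimately show ?thesis unfolding amp_def by linarith
qed

lemma G_holder: "holder \<sigma> (amp \<gamma>) G"
  unfolding holder_def
proof (intro ballI)
  fix x y :: real assume xy: "x \<in> {0..1}" "y \<in> {0..1}"
  have 1: "\<bar>p x - p y\<bar> * \<bar>expquot (Sb x)\<bar> \<le> (D * \<bar>x - y\<bar> powr \<sigma>) * 3"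
    using p_holder xy expquot_bound[OF Sb_bound[OF xy(1)]] D unfolding holder_def by (intro mult_mono) auto
  have "\<bar>expquot (Sb x) - expquot (Sb y)\<bar> \<le> 3 * \<bar>Sb x - Sb y\<bar>"
    by (rule expquot_lipschitz[OF Sb_bound[OF xy(1)] Sb_bound[OF xy(2)]])
  also have "\<dots> \<le> 3 * (12 * M\<^sup>2 * geo2 \<sigma> * \<gamma> * \<bar>x - y\<bar> powr \<sigma>)"
    using Sb_holder xy unfolding holder_def by (intro mult_left_mono) auto
  finally have 2: "\<bar>p y\<bar> * \<bar>expquot (Sb x) - expquot (Sb y)\<bar> \<le> D * (3 * (12 * M\<^sup>2 * geo2 \<sigma> * \<gamma> * \<bar>x - y\<bar> powr \<sigma>))"
    using p_abs[OF xy(2)] D by (intro mult_mono) auto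
  have "G x - G y = (p x - p y) * expquot (Sb x) + p y * (expquot (Sb x) - expquot (Sb y))"
    unfolding G_def by (simp add: algebra_simps)
  then have "\<bar>G x - G y\<bar> \<le> \<bar>p x - p y\<bar> * \<bar>expquot (Sb x)\<bar> + \<bar>p y\<bar> * \<bar>expquot (Sb x) - expquot (Sb y)\<bar>"
    unfolding abs_mult[symmetric] by linarith
  also have "\<dots> \<le> (D * \<bar>x - y\<bar> powr \<sigma>) * 3 + D * (3 * (12 * M\<^sup>2 * geo2 \<sigma> * \<gamma> * \<bar>x - y\<bar> powr \<sigma>))"
    by (intro add_mono 1 2)
  also have "\<dots> = amp \<gamma> * \<bar>x - y\<bar> powr \<sigma>" by (simp add: amp_def algebra_simps)
  finally show "\<bar>G x - G y\<bar> \<le> amp \<gamma> * \<bar>x - y\<bar> powr \<sigma>" .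
qed

lemma G_continuous: "continuous_on {0..1} G"
  by (rule holder_continuous[OF G_holder \<sigma>(1)])

lemma integral_limit:
  assumes u: "continuous_on {0..1} u"
    and B: "\<And>N. (\<Sum>m\<in>{..<N} - I. \<bar>LINT x|unit_leb. u x * F m x * G x\<bar>) \<le> B"
  shows "\<bar>LINT x|unit_leb. u x * Sb x * G x\<bar> \<le> B"
proof (rule LIMSEQ_le_const2)
  have c: "continuous_on {0..1} (\<lambda>x. u x * G x)" by (intro continuous_intros u G_continuous)
  have "(\<lambda>N. LINT x|unit_leb. u x * (\<Sum>m\<in>{..<N} - I. F m x) * G x) \<longlonglongrightarrow> (LINT x|unit_leb. u x * Sb x * G x)"
  proof (rule integral_dominated_convergence[where w = "\<lambda>x. \<bar>u x * G x\<bar>"])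
    show "integrable unit_leb (\<lambda>x. \<bar>u x * G x\<bar>)" by (intro integrable_unit_leb_cont continuous_intros u G_continuous)
    show "AE x in unit_leb. (\<lambda>N. u x * (\<Sum>m\<in>{..<N} - I. F m x) * G x) \<longlonglongrightarrow> u x * Sb x * G x"
      by (intro AE_I2 tendsto_intros part_lim) auto
    show "AE x in unit_leb. norm (u x * (\<Sum>m\<in>{..<N} - I. F m x) * G x) \<le> \<bar>u x * G x\<bar>" for N
    proof (rule AE_I2)
      fix x assume "x \<in> space unit_leb"
      then have "\<bar>\<Sum>m\<in>{..<N} - I. F m x\<bar> \<le> 1" by (intro part_bound) simp
      from mult_left_mono[OF this, of "\<bar>u x * G x\<bar>"]
      show "norm (u x * (\<Sum>m\<in>{..<N} - I. F m x) * G x) \<le> \<bar>u x * G x\<bar>" by (simp add: abs_mult mult_ac)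
    qed
  qed (intro measurable_unit_leb_cont continuous_intros u G_continuous part_continuous Sb_continuous)+
  then show "(\<lambda>N. \<bar>LINT x|unit_leb. u x * (\<Sum>m\<in>{..<N} - I. F m x) * G x\<bar>) \<longlonglongrightarrow> \<bar>LINT x|unit_leb. u x * Sb x * G x\<bar>"
    by (rule tendsto_rabs)
  have "\<bar>LINT x|unit_leb. u x * (\<Sum>m\<in>{..<N} - I. F m x) * G x\<bar> \<le> B" for N
  proof -
    have i: "integrable unit_leb (\<lambda>x. u x * F m x * G x)" for m
      by (intro integrable_unit_leb_cont continuous_intros u G_continuous in_block_continuous[OF F])
    have "(LINT x|unit_leb. u x * (\<Sum>m\<in>{..<N} - I. F m x) * G x) = (\<Sum>m\<in>{..<N} - I. LINT x|unit_leb. u x * F m x * G x)"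
      using i by (simp add: sum_distrib_left sum_distrib_right)
    then have "\<bar>LINT x|unit_leb. u x * (\<Sum>m\<in>{..<N} - I. F m x) * G x\<bar> \<le> (\<Sum>m\<in>{..<N} - I. \<bar>LINT x|unit_leb. u x * F m x * G x\<bar>)"
      by simp
    then show ?thesis using B[of N] by linarith
  qed
  then show "\<exists>N0. \<forall>N\<ge>N0. \<bar>LINT x|unit_leb. u x * (\<Sum>m\<in>{..<N} - I. F m x) * G x\<bar> \<le> B" by blast
qed

lemma split_zero:
  fixes f :: "nat \<Rightarrow> real"
  assumes "\<And>m. f m \<ge> 0"
  shows "(\<Sum>m\<in>{..<N} - I. f m) \<le> (if 0 \<in> I then 0 else f 0) + (\<Sum>m\<in>{1..<N} - I. f m)"
proof -
  have "(\<Sum>m\<in>{..<N} - I. f m) \<le> (\<Sum>m\<in>({0} - I) \<union> ({1..<N} - I). f m)"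
    by (rule sum_mono2) (use assms in auto)
  also have "\<dots> = (\<Sum>m\<in>{0} - I. f m) + (\<Sum>m\<in>{1..<N} - I. f m)" by (rule sum.union_disjoint) auto
  also have "(\<Sum>m\<in>{0} - I. f m) = (if 0 \<in> I then 0 else f 0)" by (auto simp: insert_Diff_if)
  finally show ?thesis .
qed

text \<open>The inactive blocks above \<open>J0\<close> are paired with \<open>e m\<close> by
  \<open>pair_bound\<close> and regrouped by level; block 0 is paired by
  \<open>pair_bound_low\<close>, whose bound has exactly the weight of level \<open>J0\<close> in
  \<open>Q_high\<close>.\<close>

lemma high_estimate:
  assumes m: "m \<ge> 1" "m \<in> I" and B: "\<And>n. amp \<gamma> * Q_high h n (fst (e m)) \<le> B"
  shows "\<bar>LINT x|unit_leb. cw (e m) x * Sb x * G x\<bar> \<le> K_key * B"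
proof (rule integral_limit[OF cw_continuous[OF e_index[OF m(1)]]])
  let ?c = "\<lambda>f :: real \<Rightarrow> real. \<bar>LINT x|unit_leb. cw (e m) x * f x * G x\<bar>"
  fix N
  obtain a where a: "\<And>m x. m \<ge> 1 \<Longrightarrow> x \<in> {0..1} \<Longrightarrow> F m x = a m * cw (e m) x"
    "\<And>m. m \<ge> 1 \<Longrightarrow> m \<notin> I \<Longrightarrow> \<bar>a m\<bar> \<le> h (fst (e m))" by (rule coefficients) blast
  define j where "j = fst (e m)"
  define T where "T = {1..<N} - I"
  have T: "finite T" "\<And>k. k \<in> T \<Longrightarrow> k \<ge> 1" by (auto simp: T_def)
  have Jj: "J0 < j" using e_high[OF m(1)] by (simp add: j_def)
  obtain n0 where n0: "\<And>v. v \<in> e ` T \<Longrightarrow> fst v < n0" using finite_bounded_level[of "e ` T"] T(1) by blast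
  define n where "n = max n0 (Suc J0)"
  define X where "X i = 2 powr ((real i - real j) / 2 - \<sigma> * real (max i j))" for i
  define A where "A = amp \<gamma>"
  have A: "A \<ge> 0" unfolding A_def by (rule amp_nonneg[OF gamma_nonneg])
  define R where "R = (\<Sum>i\<in>{Suc J0..<n}. h i * X i)"
  have Q: "Q_high h n j = h J0 * X J0 + R"
    unfolding Q_high_def R_def X_def using n_def by (simp add: sum.atLeast_Suc_lessThan)
  have R0: "R \<ge> 0" unfolding R_def X_def using h(1) by (intro sum_nonneg) auto
  have hX: "h J0 * X J0 \<ge> 0" using h(1) by (simp add: X_def)
  have "(\<Sum>k\<in>{..<N} - I. ?c (F k))
      \<le> (if 0 \<in> I then 0 else ?c (F 0)) + (\<Sum>k\<in>T. ?c (F k))"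
    unfolding T_def by (rule split_zero) simp
  also have "\<dots> \<le> 16 * M ^ 3 * D * K_low * A * (h J0 * X J0) + 168 * M ^ 6 * D\<^sup>2 * A * R"
  proof (rule add_mono)
    show "(if 0 \<in> I then 0 else ?c (F 0)) \<le> 16 * M ^ 3 * D * K_low * A * (h J0 * X J0)"
    proof (cases "0 \<in> I")
      case True
      then show ?thesis using M D K_low_nonneg A hX by simp
    next
      case False
      have U: "\<bar>F 0 x\<bar> \<le> K_low * 2 powr (real J0 / 2) * h J0" if "x \<in> {0..1}" for x
      proof -
        have "\<bar>F 0 x\<bar> \<le> K_low * 2 powr (real J0 / 2) * norm2 (F 0)" by (rule low_sup[OF F that])
        also have "\<dots> \<le> K_low * 2 powr (real J0 / 2) * h J0"
          using norm_le[OF False] K_low_nonneg by (intro mult_left_mono) (auto simp: level_def)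
        finally show ?thesis .
      qed
      have "?c (F 0) = \<bar>LINT x|unit_leb. F 0 x * cw (e m) x * G x\<bar>" by (simp add: mult_ac)
      also have "\<dots> \<le> 16 * M ^ 3 * D * (K_low * 2 powr (real J0 / 2) * h J0) * A * 2 powr (- (\<sigma> + 1/2) * real (fst (e m)))"
        unfolding A_def by (rule pair_bound_low[OF e_index[OF m(1)] e_high[OF m(1)] in_block_continuous[OF F] U
           low_orthogonal[OF F e_index[OF m(1)] e_high[OF m(1)]] G_holder amp_nonneg[OF gamma_nonneg] G_bound])
      also have "\<dots> = 16 * M ^ 3 * D * K_low * A * (h J0 * (2 powr (real J0 / 2) * 2 powr (- (\<sigma> + 1/2) * real j)))"
        by (simp add: j_def)
      also have "2 powr (real J0 / 2) * 2 powr (- (\<sigma> + 1/2) * real j) = X J0"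
        unfolding X_def using Jj by (simp add: powr_add[symmetric] max_absorb2 algebra_simps diff_divide_distrib)
      finally show ?thesis using False by simp
    qed
    have "(\<Sum>k\<in>T. ?c (F k)) = (\<Sum>k\<in>T. \<bar>a k\<bar> * ?c (cw (e k)))"
    proof (rule sum.cong[OF refl])
      fix k assume k: "k \<in> T"
      have "(LINT x|unit_leb. cw (e m) x * F k x * G x) = (LINT x|unit_leb. a k * (cw (e m) x * cw (e k) x * G x))"
        by (intro Bochner_Integration.integral_cong refl) (auto simp: a(1)[OF T(2)[OF k]])
      also have "\<dots> = a k * (LINT x|unit_leb. cw (e m) x * cw (e k) x * G x)" by simp
      finally show "?c (F k) = \<bar>a k\<bar> * ?c (cw (e k))"
        by (simp add: abs_mult)
    qed
    also have "\<dots> \<le> (\<Sum>i\<in>{Suc J0..<n}. h i * (168 * M ^ 6 * D\<^sup>2 * A * X i))"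
    proof (rule group_levels[OF T, where \<phi> = "\<lambda>v. ?c (cw v)"])
      show "fst (e k) < n" if "k \<in> T" for k using n0[of "e k"] that by (simp add: n_def)
      show "\<bar>a k\<bar> \<le> h (fst (e k))" if "k \<in> T" for k using that by (intro a(2)) (auto simp: T_def)
      fix K i assume K: "K \<subseteq> lev i" "K \<subseteq> e ` T" "J0 < i"
      \<comment> \<open>\<open>m\<close> is active while \<open>K\<close> comes from inactive
        indices, so no wavelet is paired with itself.\<close>
      have "e m \<notin> K"
      proof
        assume "e m \<in> K"
        then obtain k where k: "k \<in> T" "e m = e k" using K(2) by blast
        then have "m = k" using e_inj[OF m(1) T(2)[OF k(1)]] by simp
        then show False using k(1) m(2) by (simp add: T_def)
      qed
      from pair_bound[OF e_index[OF m(1)] e_high[OF m(1)] K(1,3) this G_holder amp_nonneg[OF gamma_nonneg] G_bound]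
      show "(\<Sum>v\<in>K. ?c (cw v)) \<le> 168 * M ^ 6 * D\<^sup>2 * A * X i"
        unfolding X_def A_def j_def .
    qed (use h in auto)
    also have "\<dots> = 168 * M ^ 6 * D\<^sup>2 * A * R" by (simp add: R_def sum_distrib_left mult_ac)
    finally show "(\<Sum>k\<in>T. ?c (F k)) \<le> 168 * M ^ 6 * D\<^sup>2 * A * R" .
  qed
  also have "\<dots> \<le> K_key * A * (h J0 * X J0) + K_key * A * R"
    using R0 hX A M D K_low_nonneg unfolding K_key_def by (intro add_mono mult_right_mono) auto
  also have "\<dots> = K_key * (amp \<gamma> * Q_high h n (fst (e m)))" unfolding Q[unfolded j_def] A_def by (simp add: algebra_simps)
  also have "\<dots> \<le> K_key * B" using B M D K_low_nonneg unfolding K_key_def by (intro mult_left_mono) auto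
  finally show "(\<Sum>k\<in>{..<N} - I. ?c (F k)) \<le> K_key * B" .
qed

text \<open>An active block 0 offers no fine wavelet that localizes the pairing, so the wavelets of
  each level are merely counted; \<open>2 powr (J0 / 2)\<close> is the price of
  \<open>low_sup\<close>.\<close>

lemma low_estimate:
  assumes u: "in_block 0 u" and z: "0 \<in> I" and B: "\<And>n. amp \<gamma> * (2 powr (real J0 / 2) * Q_low h n) \<le> B"
  shows "\<bar>LINT x|unit_leb. u x * Sb x * G x\<bar> \<le> K_key * (norm2 u * B)"
proof (rule integral_limit[OF in_block_continuous[OF u]])
  let ?c = "\<lambda>f :: real \<Rightarrow> real. \<bar>LINT x|unit_leb. u x * f x * G x\<bar>"
  fix N
  obtain a where a: "\<And>m x. m \<ge> 1 \<Longrightarrow> x \<in> {0..1} \<Longrightarrow> F m x = a m * cw (e m) x"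
    "\<And>m. m \<ge> 1 \<Longrightarrow> m \<notin> I \<Longrightarrow> \<bar>a m\<bar> \<le> h (fst (e m))" by (rule coefficients) blast
  define T where "T = {1..<N} - I"
  have T: "finite T" "\<And>k. k \<in> T \<Longrightarrow> k \<ge> 1" by (auto simp: T_def)
  obtain n where n: "\<And>v. v \<in> e ` T \<Longrightarrow> fst v < n" using finite_bounded_level[of "e ` T"] T(1) by blast
  define A where "A = amp \<gamma>"
  define U where "U = K_low * 2 powr (real J0 / 2) * norm2 u"
  have A: "A \<ge> 0" unfolding A_def by (rule amp_nonneg[OF gamma_nonneg])
  have U: "U \<ge> 0" unfolding U_def using K_low_nonneg norm2_nonneg by simp
  have "(\<Sum>k\<in>{..<N} - I. ?c (F k)) \<le> 0 + (\<Sum>k\<in>T. ?c (F k))"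
    unfolding T_def using split_zero[of "\<lambda>k. ?c (F k)" N] z by simp
  also have "(\<Sum>k\<in>T. ?c (F k)) = (\<Sum>k\<in>T. \<bar>a k\<bar> * ?c (cw (e k)))"
  proof (rule sum.cong[OF refl])
    fix k assume k: "k \<in> T"
    have "(LINT x|unit_leb. u x * F k x * G x) = (LINT x|unit_leb. a k * (u x * cw (e k) x * G x))"
      by (intro Bochner_Integration.integral_cong refl) (auto simp: a(1)[OF T(2)[OF k]])
    also have "\<dots> = a k * (LINT x|unit_leb. u x * cw (e k) x * G x)" by simp
    finally show "?c (F k) = \<bar>a k\<bar> * ?c (cw (e k))"
      by (simp add: abs_mult)
  qed
  also have "\<dots> \<le> (\<Sum>i\<in>{Suc J0..<n}. h i * (32 * M ^ 3 * D * U * A * 2 powr ((1/2 - \<sigma>) * real i)))"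
  proof (rule group_levels[OF T, where \<phi> = "\<lambda>v. ?c (cw v)"])
    show "fst (e k) < n" if "k \<in> T" for k using n[of "e k"] that by simp
    show "\<bar>a k\<bar> \<le> h (fst (e k))" if "k \<in> T" for k using that by (intro a(2)) (auto simp: T_def)
    fix K i assume K: "K \<subseteq> lev i" "K \<subseteq> e ` T" "J0 < i"
    have cK: "real (card K) \<le> 2 * 2 powr (real i)"
    proof -
      have "card K \<le> 2 ^ (i + 1)" using card_mono[OF finite_level(1) K(1)] finite_level(2) by (rule order.trans)
      then have "real (card K) \<le> real (2 ^ (i + 1))" by (rule of_nat_mono)
      then show ?thesis by (simp add: powr_realpow)
    qed
    have "(\<Sum>v\<in>K. ?c (cw v)) \<le> real (card K) * (16 * M ^ 3 * D * U * A * 2 powr (- (\<sigma> + 1/2) * real i))"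
    proof (rule sum_bounded_above)
      fix v assume v: "v \<in> K"
      then have v': "v \<in> wav_index l0" "J0 < fst v" "fst v = i" using K by auto
      from pair_bound_low[OF v'(1,2) in_block_continuous[OF u] low_sup[OF u] low_orthogonal[OF u v'(1,2)] G_holder amp_nonneg[OF gamma_nonneg] G_bound]
      show "?c (cw v) \<le> 16 * M ^ 3 * D * U * A * 2 powr (- (\<sigma> + 1/2) * real i)"
        unfolding v'(3) A_def U_def .
    qed
    also have "\<dots> \<le> (2 * 2 powr (real i)) * (16 * M ^ 3 * D * U * A * 2 powr (- (\<sigma> + 1/2) * real i))"
      using A U M D by (intro mult_right_mono cK) auto
    also have "\<dots> = 32 * M ^ 3 * D * U * A * (2 powr (real i) * 2 powr (- (\<sigma> + 1/2) * real i))" by simp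
    also have "2 powr (real i) * 2 powr (- (\<sigma> + 1/2) * real i) = 2 powr ((1/2 - \<sigma>) * real i)"
      by (simp add: powr_add[symmetric] algebra_simps)
    finally show "(\<Sum>v\<in>K. ?c (cw v)) \<le> 32 * M ^ 3 * D * U * A * 2 powr ((1/2 - \<sigma>) * real i)" .
  qed (use h in auto)
  also have "\<dots> = 32 * M ^ 3 * D * U * A * Q_low h n" by (simp add: Q_low_def sum_distrib_left mult_ac)
  also have "\<dots> = 32 * M ^ 3 * D * K_low * (norm2 u * (amp \<gamma> * (2 powr (real J0 / 2) * Q_low h n)))"
    by (simp add: U_def A_def)
  also have "\<dots> \<le> 32 * M ^ 3 * D * K_low * (norm2 u * B)"
    using B M D K_low_nonneg norm2_nonneg by (intro mult_left_mono) auto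
  also have "\<dots> \<le> K_key * (norm2 u * B)"
  proof (rule mult_right_mono)
    show "32 * M ^ 3 * D * K_low \<le> K_key" unfolding K_key_def using M D K_low_nonneg by simp
    have "0 \<le> B"
    proof -
      have "0 \<le> amp \<gamma> * (2 powr (real J0 / 2) * Q_low h 0)" unfolding Q_low_def by simp
      then show ?thesis using B[of 0] by linarith
    qed
    then show "0 \<le> norm2 u * B" using norm2_nonneg by simp
  qed
  finally show "(\<Sum>k\<in>{..<N} - I. ?c (F k)) \<le> K_key * (norm2 u * B)" by simp
qed

text \<open>Each \<open>u m\<close> has mean zero under \<open>p\<close>, so
  \<open>exp (Sb x)\<close> may be replaced by \<open>exp (Sb x) - 1\<close>, and
  \<open>expquot_mult\<close> turns the integrand into \<open>u m x * Sb x * G x\<close>. What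
  remains are pairs of an active and an inactive block.\<close>

lemma key_estimate:
  assumes I: "finite I" and u: "\<And>m. m \<in> I \<Longrightarrow> in_block m (u m)"
    and high: "\<And>m n. m \<in> I \<Longrightarrow> m \<ge> 1 \<Longrightarrow> amp \<gamma> * Q_high h n (fst (e m)) \<le> \<eta> m"
    and low: "\<And>n. 0 \<in> I \<Longrightarrow> amp \<gamma> * (2 powr (real J0 / 2) * Q_low h n) \<le> \<eta> 0"
  shows "\<bar>LINT x|unit_leb. (\<Sum>m\<in>I. u m x) * exp (Sb x) * p x\<bar> \<le> K_key * (\<Sum>m\<in>I. norm2 (u m) * \<eta> m)"
proof -
  have each: "\<bar>LINT x|unit_leb. u m x * Sb x * G x\<bar> \<le> K_key * (norm2 (u m) * \<eta> m)" if m: "m \<in> I" for m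
  proof (cases "m = 0")
    case True
    then show ?thesis using low_estimate[of "u 0" "\<eta> 0"] u m low by auto
  next
    case False
    then have m1: "m \<ge> 1" by simp
    obtain a where a: "\<And>x. x \<in> {0..1} \<Longrightarrow> u m x = a * cw (e m) x" "\<bar>a\<bar> \<le> norm2 (u m)"
      using high_coefficient[OF m1 u[OF m]] by blast
    have "(LINT x|unit_leb. u m x * Sb x * G x) = (LINT x|unit_leb. a * (cw (e m) x * Sb x * G x))"
      by (intro Bochner_Integration.integral_cong refl) (auto simp: a(1))
    then have "\<bar>LINT x|unit_leb. u m x * Sb x * G x\<bar> = \<bar>a\<bar> * \<bar>LINT x|unit_leb. cw (e m) x * Sb x * G x\<bar>"
      by (simp add: abs_mult)
    also have "\<dots> \<le> norm2 (u m) * (K_key * \<eta> m)"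
      by (intro mult_mono a(2) high_estimate[OF m1 m high[OF m m1]] norm2_nonneg) auto
    finally show ?thesis by (simp add: mult_ac)
  qed
  have i: "integrable unit_leb (\<lambda>x. u m x * Sb x * G x)" "integrable unit_leb (\<lambda>x. u m x * p x)" if "m \<in> I" for m
    by (intro integrable_unit_leb_cont continuous_intros in_block_continuous[OF u[OF that]] Sb_continuous G_continuous p_continuous)+
  have "(LINT x|unit_leb. (\<Sum>m\<in>I. u m x) * exp (Sb x) * p x) = (LINT x|unit_leb. (\<Sum>m\<in>I. u m x * p x + u m x * Sb x * G x))"
  proof (intro Bochner_Integration.integral_cong refl)
    fix x
    have "Sb x * G x = p x * (exp (Sb x) - 1)" unfolding G_def using expquot_mult[of "Sb x"] by (simp add: mult_ac)
    then have "u m x * p x + u m x * Sb x * G x = u m x * exp (Sb x) * p x" for m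
      by (simp add: mult.assoc) (simp add: algebra_simps)
    then show "(\<Sum>m\<in>I. u m x) * exp (Sb x) * p x = (\<Sum>m\<in>I. u m x * p x + u m x * Sb x * G x)"
      by (simp add: sum_distrib_right)
  qed
  also have "\<dots> = (\<Sum>m\<in>I. (LINT x|unit_leb. u m x * p x) + (LINT x|unit_leb. u m x * Sb x * G x))"
    using i by (subst Bochner_Integration.integral_sum) auto
  also have "\<dots> = (\<Sum>m\<in>I. LINT x|unit_leb. u m x * Sb x * G x)"
    by (intro sum.cong refl) (simp add: in_block_integral[OF u])
  finally have "\<bar>LINT x|unit_leb. (\<Sum>m\<in>I. u m x) * exp (Sb x) * p x\<bar> \<le> (\<Sum>m\<in>I. \<bar>LINT x|unit_leb. u m x * Sb x * G x\<bar>)"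
    by simp
  also have "\<dots> \<le> (\<Sum>m\<in>I. K_key * (norm2 (u m) * \<eta> m))" by (intro sum_mono each)
  finally show ?thesis by (simp add: sum_distrib_left)
qed

end

section \<open>Rates\<close>

text \<open>The Hoelder exponent must stay below 1, for the Lipschitz half of
  \<open>sum_powr_min\<close>, and above 1/2 when \<open>s > 1/2\<close>, since the smooth regime
  sums \<open>2 powr ((1/2 - \<sigma>) * i)\<close>. The cap 3/4 lies in between.\<close>

definition regularity :: "real \<Rightarrow> real" where
  "regularity s = (if s > 1/2 then min s (3/4) else s)"

lemma regularity: "s > 0 \<Longrightarrow> 0 < regularity s" "regularity s < 1" "regularity s \<le> s"
  by (auto simp: regularity_def)

lemma ln_le_two_sqrt: "y > 0 \<Longrightarrow> ln y \<le> 2 * sqrt (y :: real)"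
  using ln_le_minus_one[of "sqrt y"] ln_sqrt[of y] by simp

locale sample_size =
  fixes s K1 K3 \<delta> \<Gamma> \<gamma> \<xi> :: real and n J0 :: nat and jn :: int
  assumes s: "s > 0" and K3: "K3 > 0" and \<delta>: "0 < \<delta>" "\<delta> \<le> 1" and \<Gamma>: "\<Gamma> > 0" and \<gamma>: "\<gamma> > 0" and \<xi>: "\<xi> > 1"
    and jn: "is_jn \<Gamma> \<gamma> n s jn" and K1: "K1 \<ge> 1"
    and sample: "ln (real n) \<ge> K1 * 2 ^ J0" "ln (real n) \<ge> K1 * (1 / \<delta>\<^sup>2)" "ln (real n) \<ge> K1 * ln \<Gamma>"
      "ln (real n) \<ge> K1 * ln \<gamma>" "ln (real n) \<ge> K1 * ln \<xi>"
    and gamma_K3: "\<gamma> \<ge> K3"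
begin

definition y :: real where "y = ln (real n)"

lemma y_K1: "y \<ge> K1"
proof -
  have "K1 * 1 \<le> K1 * 2 ^ J0" using K1 by (intro mult_left_mono) auto
  then show ?thesis using sample(1) by (simp add: y_def)
qed

lemma y_pos: "y \<ge> 1" "y > 0" using y_K1 K1 by auto

lemma n_pos: "real n > 0" "real n \<ge> 1"
proof -
  have "n \<noteq> 0" using y_pos(1) unfolding y_def by (cases n) auto
  then show "real n > 0" "real n \<ge> 1" by auto
qed

text \<open>On the scale \<open>y = ln n\<close> all parameters have small logarithms: a fraction
  \<open>1 / K1\<close> by Assumption (A), and for \<open>ln y\<close> a fraction
  \<open>2 / sqrt K1\<close> because \<open>ln y \<le> 2 * sqrt y\<close>.\<close>

lemma ln_bounds:
  "ln (max 1 \<gamma>) \<le> y / K1" "ln (max 1 \<Gamma>) \<le> y / K1" "ln \<xi> \<le> y / K1" "ln (2 ^ J0) \<le> y / K1" "ln (1 / \<delta>) \<le> y / K1"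
  "ln y \<le> 2 * (y / sqrt K1)" "y / K1 \<le> y / sqrt K1" "1 \<le> y / K1"
proof -
  have p: "0 \<le> y / K1" using y_pos K1 by simp
  have a: "u \<le> y / K1" if "K1 * u \<le> y" for u using that K1 by (simp add: field_simps)
  show "ln (max 1 \<gamma>) \<le> y / K1" using a[of "ln \<gamma>"] sample(4) p by (auto simp: max_def y_def)
  show "ln (max 1 \<Gamma>) \<le> y / K1" using a[of "ln \<Gamma>"] sample(3) p by (auto simp: max_def y_def)
  show "ln \<xi> \<le> y / K1" using a[of "ln \<xi>"] sample(5) by (auto simp: y_def)
  have "ln (2 ^ J0 :: real) \<le> 2 ^ J0" using ln_le_minus_one[of "2 ^ J0 :: real"] by simp
  then show "ln (2 ^ J0) \<le> y / K1" using a[of "2 ^ J0"] sample(1) by (auto simp: y_def)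
  have "ln (1 / \<delta>) \<le> 1 / \<delta> - 1" using \<delta> by (intro ln_le_minus_one) auto
  also have "\<dots> \<le> 1 / \<delta>\<^sup>2"
  proof -
    have "\<delta>\<^sup>2 \<le> \<delta>" using \<delta> by (simp add: power2_eq_square mult_left_le)
    then have "1 / \<delta> \<le> 1 / \<delta>\<^sup>2" using \<delta> by (intro divide_left_mono) auto
    then show ?thesis by simp
  qed
  finally show "ln (1 / \<delta>) \<le> y / K1" using a[of "1 / \<delta>\<^sup>2"] sample(2) by (auto simp: y_def)
  have "sqrt y = y / sqrt y" using y_pos by (simp add: real_div_sqrt)
  also have "\<dots> \<le> y / sqrt K1" using y_K1 K1 y_pos by (intro divide_left_mono) auto
  finally show "ln y \<le> 2 * (y / sqrt K1)" using ln_le_two_sqrt[OF y_pos(2)] by linarith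
  have "sqrt K1 \<le> K1" using K1 by (simp add: real_sqrt_le_iff' sqrt_le_D real_le_lsqrt power2_eq_square)
  then show "y / K1 \<le> y / sqrt K1" using y_pos K1 by (intro divide_left_mono) auto
  show "1 \<le> y / K1" using y_K1 K1 by simp
qed

text \<open>The logarithm of the strict inequality defining \<open>jn\<close>. For
  \<open>s \<le> 1/2\<close> the rate itself contains \<open>2 powr (- jn / 2)\<close>; collecting
  it leaves the factor \<open>s\<close> instead of \<open>s + 1/2\<close>.\<close>

lemma jn_bounds:
  "ln \<gamma> - ln \<Gamma> - (s + 1/2) * ln 2 + (y - ln y) * (if s > 1/2 then 1/2 else s / (2 * s + 1))
    \<le> (if s > 1/2 then s + 1/2 else s) * (of_int jn * ln 2)"
proof -
  define t where "t = (of_int jn :: real)"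
  have lt: "\<gamma> * 2 powr (- (t + 1) * (s + 1/2)) < \<Gamma> * rate n s jn" using jn by (simp add: is_jn_def t_def)
  have q: "ln (real n) / real n > 0" using y_pos n_pos by (simp add: y_def)
  have lq: "ln (ln (real n) / real n) = ln y - y" using y_pos n_pos by (simp add: ln_div y_def)
  have r: "rate n s jn > 0" using q y_pos n_pos by (simp add: rate_def eps_star_def y_def)
  have "ln (\<gamma> * 2 powr (- (t + 1) * (s + 1/2))) < ln (\<Gamma> * rate n s jn)" using lt \<gamma> by (subst ln_less_cancel_iff) (use \<Gamma> r in auto)
  then have l: "ln \<gamma> - (t + 1) * (s + 1/2) * ln 2 < ln \<Gamma> + ln (rate n s jn)"
  proof -
    have "ln (\<gamma> * 2 powr (- (t + 1) * (s + 1/2))) = ln \<gamma> + (- (t + 1) * (s + 1/2)) * ln 2"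
      using \<gamma> by (simp add: ln_mult ln_powr)
    moreover have "ln (\<Gamma> * rate n s jn) = ln \<Gamma> + ln (rate n s jn)" using \<Gamma> r by (simp add: ln_mult)
    ultimately show ?thesis using \<open>ln (\<gamma> * _) < _\<close> by (simp only: mult_minus_left)
  qed
  show ?thesis
  proof (cases "s > 1/2")
    case True
    have "ln (rate n s jn) = (ln y - y) / 2" using True q lq by (simp add: rate_def ln_sqrt)
    moreover have "(t + 1) * (s + 1/2) * ln 2 = (s + 1/2) * (t * ln 2) + (s + 1/2) * ln 2" by (simp add: algebra_simps)
    moreover have "(ln y - y) / 2 = - ((y - ln y) * (1/2))" by (simp add: field_simps)
    ultimately have "ln \<gamma> - ln \<Gamma> - (s + 1/2) * ln 2 + (y - ln y) * (1/2) \<le> (s + 1/2) * (t * ln 2)" using l by linarith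
    then show ?thesis using True by (simp add: t_def)
  next
    case False
    have "ln (rate n s jn) = - t / 2 * ln 2 + s / (2 * s + 1) * (ln y - y)"
      using False q lq n_pos y_pos by (simp add: rate_def eps_star_def ln_mult ln_powr t_def y_def)
    then have "ln \<gamma> - (t + 1) * (s + 1/2) * ln 2 < ln \<Gamma> - t / 2 * ln 2 + s / (2 * s + 1) * (ln y - y)" using l by simp
    moreover have "(t + 1) * (s + 1/2) * ln 2 = s * (t * ln 2) + t / 2 * ln 2 + (s + 1/2) * ln 2" by (simp add: algebra_simps)
    moreover have "s / (2 * s + 1) * (ln y - y) = - ((y - ln y) * (s / (2 * s + 1)))"
      by (simp add: algebra_simps diff_divide_distrib)
    ultimately have "ln \<gamma> - ln \<Gamma> - (s + 1/2) * ln 2 + (y - ln y) * (s / (2 * s + 1)) \<le> s * (t * ln 2)" by linarith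
    then show ?thesis using False by (simp add: t_def)
  qed
qed

text \<open>To leading order \<open>jn_bounds\<close> gives \<open>y / (2 * s + 1)\<close>. Half of
  this is spent on the logarithmic corrections, which a large \<open>K1\<close> makes possible, and
  the other half is the claim.\<close>

lemma jn_large:
  assumes "sqrt K1 \<ge> (\<bar>ln K3\<bar> + s + 4) * (4 * (s + 1) / s)"
  shows "y / (4 * s + 2) \<le> of_int jn * ln 2"
proof -
  define c where "c = (if s > 1/2 then 1/2 else s / (2 * s + 1))"
  define d where "d = (if s > 1/2 then s + 1/2 else s)"
  have c: "0 < c" "c \<le> 1/2" "d > 0" "d / (4 * s + 2) = c / 2"
  proof -
    have "(s + 1/2) / (4 * s + 2) = 1/2/2" using s by (simp add: field_simps)
    moreover have "s / (4 * s + 2) = s / (2 * s + 1) / 2" by (simp add: distrib_right)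
    ultimately show "d / (4 * s + 2) = c / 2" unfolding c_def d_def by (cases "s > 1/2") (simp_all only: if_True if_False)
  qed (use s in \<open>auto simp: c_def d_def field_simps\<close>)
  have c': "s / (2 * (s + 1)) \<le> c"
  proof -
    have "s / (2 * (s + 1)) \<le> s / (2 * s + 1)" using s by (intro divide_left_mono) auto
    moreover have "s / (2 * (s + 1)) \<le> 1/2" using s by (simp add: field_simps)
    ultimately show ?thesis by (simp add: c_def)
  qed
  define z where "z = y / sqrt K1"
  have z: "z \<ge> y / K1" "ln y \<le> 2 * z" "1 \<le> z" using ln_bounds by (auto simp: z_def)
  have g: "ln K3 \<le> ln \<gamma>" using gamma_K3 K3 by simp
  have G: "ln \<Gamma> \<le> z" using sample(3) z(1) K1 by (simp add: y_def field_simps) (smt (verit) divide_right_mono nonzero_mult_div_cancel_left)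
  have "ln y * c \<le> 2 * z * (1/2)" using z c y_pos by (intro mult_mono) auto
  moreover have "(s + 1/2) * ln 2 \<le> (s + 1/2) * z" using s z ln_2_less_1 by (intro mult_left_mono) auto
  moreover have "\<bar>ln K3\<bar> \<le> \<bar>ln K3\<bar> * z" using mult_left_mono[OF z(3), of "\<bar>ln K3\<bar>"] by simp
  ultimately have "y * c - (\<bar>ln K3\<bar> + s + 4) * z \<le> d * (of_int jn * ln 2)"
    using jn_bounds g G z unfolding c_def[symmetric] d_def[symmetric] by (simp add: algebra_simps)
  moreover have "(\<bar>ln K3\<bar> + s + 4) * z \<le> y * (c / 2)"
  proof -
    have "(\<bar>ln K3\<bar> + s + 4) \<le> sqrt K1 * (s / (4 * (s + 1)))" using assms s by (simp add: field_simps)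
    also have "\<dots> \<le> sqrt K1 * (c / 2)"
    proof (rule mult_left_mono)
      have "s / (4 * (s + 1)) = s / (2 * (s + 1)) / 2" by simp
      also have "\<dots> \<le> c / 2" by (rule divide_right_mono[OF c']) simp
      finally show "s / (4 * (s + 1)) \<le> c / 2" .
    qed (use K1 in auto)
    finally have "(\<bar>ln K3\<bar> + s + 4) * z \<le> sqrt K1 * (c / 2) * z" using z by (intro mult_right_mono) auto
    also have "\<dots> = y * (c / 2)" using K1 by (simp add: z_def)
    finally show ?thesis .
  qed
  ultimately have "y * (c / 2) \<le> d * (of_int jn * ln 2)" by (simp add: algebra_simps)
  then have "y * (d / (4 * s + 2)) \<le> d * (of_int jn * ln 2)" by (simp only: c(4))
  then have "d * (y / (4 * s + 2)) \<le> d * (of_int jn * ln 2)" by (simp add: mult.commute)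
  then show ?thesis by (simp only: mult_le_cancel_left_pos[OF c(3)])
qed

text \<open>Collects the factors that a negative power of \<open>2 ^ jn\<close> has to beat; the
  division by \<open>\<delta>\<close> in \<open>W\<close> lets a factor \<open>\<delta>\<close>
  survive.\<close>

abbreviation mass :: real where
  "mass \<equiv> max 1 \<gamma> * max 1 \<Gamma> * \<xi> * 2 ^ J0 * sqrt y"

definition W :: real where "W = mass / \<delta>"

lemma polynomial_gain:
  assumes K: "sqrt K1 \<ge> (\<bar>ln K3\<bar> + s + 4) * (4 * (s + 1) / s)" "sqrt K1 \<ge> 6 * (4 * s + 2) / c" and c: "c > 0"
  shows "W * 2 powr (- c * of_int jn) \<le> 1"
proof -
  define z where "z = y / sqrt K1"
  have z: "z \<ge> y / K1" "ln y \<le> 2 * z" "1 \<le> z" using ln_bounds by (auto simp: z_def)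
  have W: "W > 0" unfolding W_def using \<delta> \<xi> y_pos by (auto intro!: mult_pos_pos divide_pos_pos)
  have "ln W = ln (max 1 \<gamma>) + ln (max 1 \<Gamma>) + ln \<xi> + ln (2 ^ J0) + ln y / 2 + ln (1 / \<delta>)"
  proof -
    have "W = mass * (1 / \<delta>)" by (simp add: W_def)
    moreover have "max 1 \<gamma> > 0" "max 1 \<Gamma> > 0" "\<xi> > 0" "(2::real) ^ J0 > 0" "sqrt y > 0" "1 / \<delta> > 0" using \<delta> \<xi> y_pos by auto
    ultimately show ?thesis using y_pos by (simp only: ln_mult_pos mult_pos_pos ln_sqrt)
  qed
  \<comment> \<open>Six logarithms, each at most \<open>z\<close>; the halved \<open>ln y\<close>
    counts as one.\<close>
  also have "\<dots> \<le> 6 * z" using ln_bounds z by linarith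
  finally have lW: "ln W \<le> 6 * z" .
  have "6 * z \<le> c * (y / (4 * s + 2))"
  proof -
    have "6 \<le> sqrt K1 * (c / (4 * s + 2))" using K(2) s c by (simp add: field_simps)
    then have "6 * z \<le> sqrt K1 * (c / (4 * s + 2)) * z" using z by (intro mult_right_mono) auto
    also have "\<dots> = c * (y / (4 * s + 2))" using K1 by (simp add: z_def)
    finally show ?thesis .
  qed
  also have "\<dots> \<le> c * (of_int jn * ln 2)" using c jn_large[OF K(1)] by (intro mult_left_mono) auto
  finally have "ln W + (- c * of_int jn) * ln 2 \<le> 0" using lW by simp
  then have "exp (ln W + (- c * of_int jn) * ln 2) \<le> 1" by (simp only: exp_le_one_iff)
  moreover have "exp (ln W + u * ln 2) = W * 2 powr u" for u using W by (simp add: exp_add powr_def)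
  ultimately show ?thesis by metis
qed

end

text \<open>The 2 in \<open>2 / (c * ln 2)\<close> counts the logarithms of \<open>\<gamma>\<close>
  and of \<open>1 / \<delta>\<close>, both at most the maximum, that the decay in \<open>J0\<close>
  has to cover.\<close>

lemma level_gain:
  fixes K0 \<delta> \<gamma> c :: real
  assumes "real J0 \<ge> K0 * Max {1, ln (1 / \<delta>), ln \<gamma>}" "K0 \<ge> 2 / (c * ln 2)" "c > 0" "0 < \<delta>" "\<delta> \<le> 1" "\<gamma> > 0"
  shows "max 1 \<gamma> * 2 powr (- c * real J0) \<le> \<delta>"
proof -
  define X where "X = Max {1, ln (1 / \<delta>), ln \<gamma>}"
  have X: "1 \<le> X" "ln (1 / \<delta>) \<le> X" "ln \<gamma> \<le> X" by (auto simp: X_def)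
  have "2 / (c * ln 2) * X \<le> K0 * X" using assms X by (intro mult_right_mono) auto
  also have "\<dots> \<le> real J0" using assms by (simp add: X_def)
  finally have "2 * X \<le> real J0 * (c * ln 2)" using assms(3) by (simp add: field_simps)
  moreover have "ln (max 1 \<gamma>) \<le> X" using X by (auto simp: max_def)
  ultimately have "ln (max 1 \<gamma>) + ln (1 / \<delta>) \<le> real J0 * (c * ln 2)" using X by linarith
  then have "ln (max 1 \<gamma>) + (- c * real J0) * ln 2 \<le> ln \<delta>" using assms by (simp add: ln_div algebra_simps)
  then have "exp (ln (max 1 \<gamma>) + (- c * real J0) * ln 2) \<le> exp (ln \<delta>)" by (simp only: exp_le_cancel_iff)
  moreover have "exp (ln (max 1 \<gamma>) + u * ln 2) = max 1 \<gamma> * 2 powr u" for u by (simp add: exp_add powr_def)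
  ultimately have "max 1 \<gamma> * 2 powr (- c * real J0) \<le> exp (ln \<delta>)" by metis
  then show ?thesis using assms(4) by simp
qed

section \<open>Weighted sums of thresholds over levels\<close>

locale threshold_rates = sample_size +
  fixes \<kappa> :: real
  assumes \<kappa>: "1 / \<xi> \<le> \<kappa>" "\<kappa> \<le> 1"
    and gain: "W * 2 powr (- (if s > 1/2 then regularity s - 1/2 else s) * of_int jn) \<le> 1"
    and jn_nonneg: "jn \<ge> int J0"
    and low_gain: "max 1 \<gamma> * 2 powr (- (regularity s / 2) * real J0) \<le> \<delta>"
begin

text \<open>The threshold of a block at level \<open>i\<close>; \<open>\<kappa>\<close> will be
  \<open>1 / \<xi>\<close> if block 0 is active and 1 otherwise. An active block 0 is the one
  exception, as its own threshold lacks this factor.\<close>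

definition hl :: "nat \<Rightarrow> real" where
  "hl i = (if int i \<le> jn then \<Gamma> * \<kappa> * rate n s (int i) else \<gamma> * 2 powr (- real i * (s + 1/2)))"

abbreviation "\<sigma> \<equiv> regularity s"

lemma kappa_pos: "\<kappa> > 0" using \<kappa> \<xi> by (smt (verit) zero_less_divide_1_iff)

lemma rate_nonneg: "rate n s i \<ge> 0"
  using y_pos n_pos by (auto simp: rate_def eps_star_def y_def)

lemma hl_nonneg: "hl i \<ge> 0"
  using \<Gamma> \<gamma> kappa_pos rate_nonneg by (auto simp: hl_def)

definition t :: nat where "t = nat jn"

lemma t: "real_of_int jn = real t" "J0 \<le> t" "int i \<le> jn \<longleftrightarrow> i \<le> t"
  using jn_nonneg by (auto simp: t_def)

text \<open>Up to \<open>jn\<close> the rates are constant in the level or decay like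
  \<open>2 powr (- i / 2)\<close>, hence more slowly than the right-hand side; so it suffices to
  compare at \<open>jn\<close>, where this is the upper inequality defining
  \<open>jn\<close>.\<close>

lemma hl_le: "hl i \<le> \<gamma> * 2 powr (- (s + 1/2) * real i)"
proof (cases "i \<le> t")
  case True
  have up: "\<Gamma> * rate n s jn \<le> \<gamma> * 2 powr (- real t * (s + 1/2))" using jn by (simp add: is_jn_def t)
  have "\<Gamma> * \<kappa> * rate n s (int i) \<le> \<Gamma> * rate n s (int i)"
    using \<kappa> \<Gamma> rate_nonneg[of "int i"] kappa_pos by (intro mult_right_mono) auto
  also have "\<dots> \<le> \<gamma> * 2 powr (- (s + 1/2) * real i)"
  proof (cases "s > 1/2")
    case s1: True
    have "\<Gamma> * rate n s (int i) = \<Gamma> * rate n s jn" using s1 by (simp add: rate_def)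
    also have "\<dots> \<le> \<gamma> * 2 powr (- (s + 1/2) * real i)"
      using up True s \<gamma> mult_right_mono[of "real i" "real t" "s + 1/2"]
      by (elim order.trans, intro mult_left_mono powr_mono) (auto simp: algebra_simps)
    finally show ?thesis .
  next
    case False
    have "rate n s (int i) = 2 powr ((real t - real i) / 2) * rate n s jn"
      using False by (simp add: rate_def t powr_add[symmetric] mult.assoc[symmetric] diff_divide_distrib)
    then have "\<Gamma> * rate n s (int i) = 2 powr ((real t - real i) / 2) * (\<Gamma> * rate n s jn)" by simp
    also have "\<dots> \<le> 2 powr ((real t - real i) / 2) * (\<gamma> * 2 powr (- real t * (s + 1/2)))" by (intro mult_left_mono up) auto
    also have "\<dots> = \<gamma> * 2 powr ((real t - real i) / 2 - real t * (s + 1/2))" by (simp add: powr_add[symmetric])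
    also have "\<dots> \<le> \<gamma> * 2 powr (- (s + 1/2) * real i)"
      using True s \<gamma> mult_right_mono[of "real i" "real t" s] by (intro mult_left_mono powr_mono) (auto simp: algebra_simps diff_divide_distrib add_divide_distrib minus_diff_commute)
    finally show ?thesis .
  qed
  finally show ?thesis using True by (simp add: hl_def t)
next
  case False
  have "- real i * (s + 1/2) = - (s + 1/2) * real i" by (simp add: algebra_simps)
  then show ?thesis using False unfolding hl_def t by simp
qed

lemma W_factor:
  assumes "0 \<le> u" "u * \<delta> \<le> mass" "c \<ge> (if s > 1/2 then \<sigma> - 1/2 else s)"
  shows "u * 2 powr (- c * real t) \<le> 1"
proof -
  have "u \<le> W" unfolding W_def using assms(2) \<delta> by (simp add: field_simps)
  moreover have "2 powr (- c * real t) \<le> 2 powr (- (if s > 1/2 then \<sigma> - 1/2 else s) * of_int jn)"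
    unfolding t using assms(3) by (intro powr_mono) (auto intro: mult_right_mono)
  ultimately have "u * 2 powr (- c * real t) \<le> W * 2 powr (- (if s > 1/2 then \<sigma> - 1/2 else s) * of_int jn)"
    using assms(1) by (intro mult_mono) auto
  then show ?thesis using gain by simp
qed

lemma ones: "1 \<le> max 1 \<gamma>" "1 \<le> max 1 \<Gamma>" "1 \<le> \<xi>" "1 \<le> (2::real) ^ J0" "1 \<le> sqrt y"
  using \<xi> y_pos by auto

lemma gamma_level:
  assumes "J0 \<le> j" "c \<ge> \<sigma> / 2"
  shows "max 1 \<gamma> * 2 powr (- c * real j) \<le> \<delta>"
proof -
  have "\<sigma> / 2 * real J0 \<le> c * real j" using assms regularity(1)[OF s] by (intro mult_mono) auto
  then have "2 powr (- c * real j) \<le> 2 powr (- (\<sigma> / 2) * real J0)" by (intro powr_mono) auto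
  then have "max 1 \<gamma> * 2 powr (- c * real j) \<le> max 1 \<gamma> * 2 powr (- (\<sigma> / 2) * real J0)" by (intro mult_left_mono) auto
  then show ?thesis using low_gain by linarith
qed

lemma sum_split:
  fixes f A B :: "nat \<Rightarrow> real"
  assumes "\<And>i. i \<le> t \<Longrightarrow> f i \<le> A i" "\<And>i. i > t \<Longrightarrow> f i \<le> B i" "\<And>i. A i \<ge> 0" "\<And>i. B i \<ge> 0"
  shows "(\<Sum>i\<in>{a..<N}. f i) \<le> (\<Sum>i\<in>{a..<N}. A i) + (\<Sum>i\<in>{Suc t..<N}. B i)"
proof -
  have "(\<Sum>i\<in>{a..<N}. f i) \<le> (\<Sum>i\<in>{a..<N}. A i + (if i > t then B i else 0))"
  proof (rule sum_mono)
    fix i show "f i \<le> A i + (if i > t then B i else 0)"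
      using assms(1)[of i] assms(2)[of i] assms(3)[of i] by (cases "i > t") auto
  qed
  also have "\<dots> = (\<Sum>i\<in>{a..<N}. A i) + (\<Sum>i\<in>{i \<in> {a..<N}. i > t}. B i)"
    by (simp only: sum.distrib sum.inter_filter finite_atLeastLessThan)
  also have "(\<Sum>i\<in>{i \<in> {a..<N}. i > t}. B i) \<le> (\<Sum>i\<in>{Suc t..<N}. B i)"
    using assms(4) by (intro sum_mono2) auto
  finally show ?thesis by simp
qed

definition X :: "nat \<Rightarrow> nat \<Rightarrow> real" where
  "X j i = 2 powr ((real i - real j) / 2 - \<sigma> * real (max i j))"

lemma X_nonneg: "X j i \<ge> 0" by (simp add: X_def)

lemma X_le: "X j i \<le> 2 powr ((1/2 - \<sigma>) * real i)"
proof -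
  have "\<sigma> * real i \<le> \<sigma> * real (max i j)" using regularity(1)[OF s] by (intro mult_left_mono) auto
  then show ?thesis unfolding X_def by (intro powr_mono) (auto simp: algebra_simps diff_divide_distrib add_divide_distrib minus_diff_commute)
qed

lemma sum_X:
  assumes "s > 1/2"
  shows "(\<Sum>i\<in>{a..<N}. X j i) \<le> (geo (1/2) + geo (\<sigma> - 1/2)) * 2 powr (- \<sigma> * real j)"
proof -
  have \<sigma>: "\<sigma> - 1/2 > 0" using assms by (auto simp: regularity_def)
  have "(\<Sum>i\<in>{a..<N}. X j i) \<le> (\<Sum>i\<in>{0..<j} \<union> {j..<N}. X j i)" by (rule sum_mono2) (auto simp: X_nonneg)
  also have "\<dots> = (\<Sum>i\<in>{0..<j}. X j i) + (\<Sum>i\<in>{j..<N}. X j i)" by (rule sum.union_disjoint) auto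
  also have "\<dots> = (\<Sum>i\<in>{0..<j}. 2 powr (- real j / 2 - \<sigma> * real j) * 2 powr (1/2 * real i)) + (\<Sum>i\<in>{j..<N}. 2 powr (- real j / 2) * 2 powr (- (\<sigma> - 1/2) * real i))"
    by (intro arg_cong2[where f = "(+)"] sum.cong refl)
       (auto simp: X_def powr_add[symmetric] max_absorb1 max_absorb2 algebra_simps diff_divide_distrib add_divide_distrib minus_diff_commute)
  also have "\<dots> \<le> 2 powr (- real j / 2 - \<sigma> * real j) * (geo (1/2) * 2 powr (1/2 * (real j - 1))) + 2 powr (- real j / 2) * (geo (\<sigma> - 1/2) * 2 powr (- (\<sigma> - 1/2) * real j))"
    unfolding sum_distrib_left[symmetric] using \<sigma> by (intro add_mono mult_left_mono sum_powr_increasing sum_powr_decreasing) auto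
  also have "\<dots> = geo (1/2) * 2 powr (- \<sigma> * real j - 1/2) + geo (\<sigma> - 1/2) * 2 powr (- \<sigma> * real j)"
    by (simp add: powr_add[symmetric] mult.left_commute algebra_simps diff_divide_distrib add_divide_distrib minus_diff_commute)
  also have "\<dots> \<le> geo (1/2) * 2 powr (- \<sigma> * real j) + geo (\<sigma> - 1/2) * 2 powr (- \<sigma> * real j)"
    using geo_pos[of "1/2"] by (intro add_right_mono mult_left_mono powr_mono) auto
  finally show ?thesis by (simp add: distrib_right)
qed

text \<open>Contributions that are not proportional to the threshold of the active block are charged
  to \<open>r\<close>; its square \<open>1 / n\<close>, summed over the active blocks, becomes the
  term with \<open>|I|\<close>.\<close>

definition r :: real where "r = 1 / sqrt (real n)"

lemma r_nonneg: "r \<ge> 0" by (simp add: r_def)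

lemma rate_eq: "s > 1/2 \<Longrightarrow> rate n s i = sqrt y * r"
  by (simp add: rate_def y_def r_def real_sqrt_divide)

lemma jn_lower: "\<gamma> * 2 powr (- (real t + 1) * (s + 1/2)) \<le> \<Gamma> * rate n s jn"
  using jn by (simp add: is_jn_def t)

lemma prod_le:
  assumes "0 \<le> a" "a \<le> mass" "c \<ge> (if s > 1/2 then \<sigma> - 1/2 else s)"
  shows "a * 2 powr (- c * real t) \<le> \<delta>"
  using W_factor[of "a / \<delta>" c] assms \<delta> by (simp add: field_simps)

lemma mult_ones:
  assumes "0 \<le> a" "a \<le> a'" "1 \<le> b" shows "a \<le> a' * (b :: real)"
  using mult_mono[of a a' 1 b] assms by auto

text \<open>The tail is dominated by its first level \<open>t + 1\<close>, where
  \<open>\<gamma> * 2 powr (- (t + 1) * (s + 1/2))\<close> is below \<open>\<Gamma>\<close> times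
  the rate by the lower inequality defining \<open>jn\<close>. The surplus
  \<open>2 powr (- (\<sigma> - 1/2) * t)\<close> is the polynomial gain in \<open>n\<close>.\<close>

lemma tail_smooth:
  assumes s1: "s > 1/2"
  shows "(\<Sum>i\<in>{Suc t..<N}. \<gamma> * 2 powr (- (s + \<sigma>) * real i)) \<le> geo (s + \<sigma>) * (\<Gamma> * (sqrt y * r) * 2 powr (- (\<sigma> - 1/2) * real t))"
proof -
  have \<sigma>: "\<sigma> - 1/2 > 0" using s1 by (auto simp: regularity_def)
  have g: "geo (s + \<sigma>) \<ge> 0" using geo_pos[of "s + \<sigma>"] s1 \<sigma> by simp
  have "(\<Sum>i\<in>{Suc t..<N}. \<gamma> * 2 powr (- (s + \<sigma>) * real i)) \<le> \<gamma> * (geo (s + \<sigma>) * 2 powr (- (s + \<sigma>) * real (Suc t)))"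
    unfolding sum_distrib_left[symmetric] using \<gamma> s1 \<sigma> by (intro mult_left_mono sum_powr_decreasing) auto
  also have "\<dots> = geo (s + \<sigma>) * ((\<gamma> * 2 powr (- (real t + 1) * (s + 1/2))) * 2 powr (- (\<sigma> - 1/2) * (real t + 1)))"
    by (simp add: powr_combine)
  also have "\<dots> \<le> geo (s + \<sigma>) * ((\<Gamma> * (sqrt y * r)) * 2 powr (- (\<sigma> - 1/2) * real t))"
  proof (rule mult_left_mono[OF mult_mono g])
    show "\<gamma> * 2 powr (- (real t + 1) * (s + 1/2)) \<le> \<Gamma> * (sqrt y * r)" using jn_lower unfolding rate_eq[OF s1] .
    show "2 powr (- (\<sigma> - 1/2) * (real t + 1)) \<le> 2 powr (- (\<sigma> - 1/2) * real t)"
      using \<sigma> by (intro powr_mono mult_left_mono_neg) auto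
  qed (use \<Gamma> y_pos r_nonneg in auto)
  finally show ?thesis by (simp only: mult.assoc)
qed

lemma tail_rough:
  assumes s1: "\<not> s > 1/2"
  shows "(\<Sum>i\<in>{Suc t..<N}. \<gamma> * 2 powr (- (2 * s) * real i)) \<le> geo (2 * s) * (2 * (\<Gamma> * eps_star n s) * 2 powr (- s * real t))"
proof -
  have g: "geo (2 * s) \<ge> 0" using geo_pos[of "2 * s"] s by simp
  define E where "E = eps_star n s"
  have E: "E \<ge> 0" by (simp add: E_def eps_star_def)
  have "(\<Sum>i\<in>{Suc t..<N}. \<gamma> * 2 powr (- (2 * s) * real i)) \<le> \<gamma> * (geo (2 * s) * 2 powr (- (2 * s) * real (Suc t)))"
    unfolding sum_distrib_left[symmetric] using \<gamma> s by (intro mult_left_mono sum_powr_decreasing) auto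
  also have "\<dots> = geo (2 * s) * ((\<gamma> * 2 powr (- (real t + 1) * (s + 1/2))) * 2 powr ((real t + 1) / 2 - s * (real t + 1)))"
    by (simp add: powr_combine)
  also have "\<dots> \<le> geo (2 * s) * ((\<Gamma> * (2 powr (- real t / 2) * E)) * 2 powr ((real t + 1) / 2 - s * real t))"
  proof (rule mult_left_mono[OF mult_mono g])
    show "\<gamma> * 2 powr (- (real t + 1) * (s + 1/2)) \<le> \<Gamma> * (2 powr (- real t / 2) * E)"
      using jn_lower s1 unfolding rate_def t E_def by simp
    show "2 powr ((real t + 1) / 2 - s * (real t + 1)) \<le> 2 powr ((real t + 1) / 2 - s * real t)" using s by (intro powr_mono) auto
  qed (use \<Gamma> E in auto)
  also have "\<dots> = geo (2 * s) * ((\<Gamma> * E) * (2 powr (- real t / 2) * 2 powr ((real t + 1) / 2 - s * real t)))" by simp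
  also have "2 powr (- real t / 2) * 2 powr ((real t + 1) / 2 - s * real t) = 2 powr (1/2) * 2 powr (- s * real t)"
    by (simp add: powr_add[symmetric] add_divide_distrib)
  also have "geo (2 * s) * ((\<Gamma> * E) * (2 powr (1/2) * 2 powr (- s * real t))) \<le> geo (2 * s) * ((\<Gamma> * E) * (2 * 2 powr (- s * real t)))"
    using powr_mono[of "1/2" 1 2] \<Gamma> E g by (intro mult_left_mono mult_right_mono) auto
  finally show ?thesis by (simp add: E_def mult_ac)
qed

text \<open>Levels up to \<open>jn\<close> share one threshold and contribute
  \<open>2 powr (- \<sigma> * j)\<close> times it; as \<open>j > J0\<close>, this decay turns
  \<open>max 1 \<gamma>\<close> into \<open>\<delta>\<close>. Levels beyond \<open>jn\<close> carry
  the polynomial gain and end up in \<open>r\<close>.\<close>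

lemma high_rate_smooth:
  assumes s1: "s > 1/2" and j: "J0 < j"
  shows "max 1 \<gamma> * (\<Sum>i\<in>{J0..<N}. hl i * X j i) \<le> 2 * (geo (1/2) + geo (\<sigma> - 1/2) + geo (s + \<sigma>)) * \<delta> * (hl j + r)"
proof -
  let ?S = "\<Sum>i\<in>{J0..<N}. hl i * X j i"
  let ?q = "2 powr (- (\<sigma> - 1/2) * real t)"
  have \<sigma>: "\<sigma> - 1/2 > 0" using s1 by (auto simp: regularity_def)
  define g1 where "g1 = geo (1/2) + geo (\<sigma> - 1/2)"
  define g2 where "g2 = geo (s + \<sigma>)"
  have g: "g1 \<ge> 0" "g2 \<ge> 0" using geo_pos[of "1/2"] geo_pos[OF \<sigma>] geo_pos[of "s + \<sigma>"] s1 \<sigma> by (auto simp: g1_def g2_def)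
  define \<rho> where "\<rho> = sqrt y * r"
  have \<rho>: "\<rho> \<ge> 0" using y_pos r_nonneg by (simp add: \<rho>_def)
  have "?S \<le> (\<Sum>i\<in>{J0..<N}. \<Gamma> * \<kappa> * \<rho> * X j i) + (\<Sum>i\<in>{Suc t..<N}. \<gamma> * 2 powr (- (s + \<sigma>) * real i))"
  proof (rule sum_split)
    fix i
    show "hl i * X j i \<le> \<Gamma> * \<kappa> * \<rho> * X j i" if "i \<le> t" using that by (simp add: hl_def t rate_eq[OF s1] \<rho>_def)
    show "hl i * X j i \<le> \<gamma> * 2 powr (- (s + \<sigma>) * real i)" if "i > t"
    proof -
      have "hl i * X j i \<le> (\<gamma> * 2 powr (- (s + 1/2) * real i)) * 2 powr ((1/2 - \<sigma>) * real i)"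
        by (intro mult_mono hl_le X_le X_nonneg) (use \<gamma> in auto)
      also have "\<dots> = \<gamma> * 2 powr (- (s + \<sigma>) * real i)" by (simp add: powr_add[symmetric] algebra_simps)
      finally show ?thesis .
    qed
  qed (use \<Gamma> \<gamma> kappa_pos \<rho> X_nonneg in auto)
  also have "\<dots> \<le> \<Gamma> * \<kappa> * \<rho> * (g1 * 2 powr (- \<sigma> * real j)) + g2 * (\<Gamma> * \<rho> * ?q)"
  proof (rule add_mono)
    show "(\<Sum>i\<in>{J0..<N}. \<Gamma> * \<kappa> * \<rho> * X j i) \<le> \<Gamma> * \<kappa> * \<rho> * (g1 * 2 powr (- \<sigma> * real j))"
      unfolding sum_distrib_left[symmetric] g1_def using \<Gamma> kappa_pos \<rho> by (intro mult_left_mono sum_X s1) auto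
    show "(\<Sum>i\<in>{Suc t..<N}. \<gamma> * 2 powr (- (s + \<sigma>) * real i)) \<le> g2 * (\<Gamma> * \<rho> * ?q)"
      unfolding g2_def \<rho>_def by (rule tail_smooth[OF s1])
  qed
  finally have "max 1 \<gamma> * ?S \<le> max 1 \<gamma> * (\<Gamma> * \<kappa> * \<rho> * (g1 * 2 powr (- \<sigma> * real j)) + g2 * (\<Gamma> * \<rho> * ?q))"
    by (intro mult_left_mono) auto
  also have "\<dots> = g1 * (\<Gamma> * \<kappa> * \<rho> * (max 1 \<gamma> * 2 powr (- \<sigma> * real j))) + g2 * (r * ((max 1 \<gamma> * \<Gamma> * sqrt y) * ?q))"
    by (simp add: \<rho>_def algebra_simps)
  also have "\<dots> \<le> g1 * (\<delta> * (hl j + r)) + g2 * (r * \<delta>)"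
  proof (intro add_mono mult_left_mono g r_nonneg)
    have fac: "max 1 \<gamma> * \<Gamma> * sqrt y \<le> mass"
    proof (rule mult_right_mono)
      show "max 1 \<gamma> * \<Gamma> \<le> max 1 \<gamma> * max 1 \<Gamma> * \<xi> * 2 ^ J0"
      proof -
        have "max 1 \<gamma> * \<Gamma> \<le> max 1 \<gamma> * max 1 \<Gamma>" by (intro mult_left_mono) auto
        then have "max 1 \<gamma> * \<Gamma> \<le> max 1 \<gamma> * max 1 \<Gamma> * \<xi>" using \<Gamma> ones(3) by - (rule mult_ones, auto)
        then show ?thesis using \<Gamma> ones(4) by - (rule mult_ones, auto)
      qed
    qed (use y_pos in auto)
    show tail: "(max 1 \<gamma> * \<Gamma> * sqrt y) * ?q \<le> \<delta>"
      using fac s1 \<Gamma> y_pos by (intro prod_le) auto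
    show "\<Gamma> * \<kappa> * \<rho> * (max 1 \<gamma> * 2 powr (- \<sigma> * real j)) \<le> \<delta> * (hl j + r)"
    proof (cases "j \<le> t")
      case True
      have "\<Gamma> * \<kappa> * \<rho> * (max 1 \<gamma> * 2 powr (- \<sigma> * real j)) \<le> hl j * \<delta>"
        using True j regularity(1)[OF s] hl_nonneg[of j] gamma_level[of j \<sigma>]
        by (simp add: hl_def t rate_eq[OF s1] \<rho>_def mult_left_mono)
      then show ?thesis using r_nonneg \<delta> by (simp add: distrib_left mult.commute add_increasing2)
    next
      \<comment> \<open>The threshold of an active level beyond \<open>jn\<close> need not reach
        \<open>\<Gamma> * \<kappa> * \<rho>\<close>; but now the decay in \<open>j > t\<close> is
        strong enough for the polynomial gain, and \<open>r\<close> suffices.\<close>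
      case False
      have "\<Gamma> * \<kappa> * \<rho> * (max 1 \<gamma> * 2 powr (- \<sigma> * real j)) \<le> \<Gamma> * 1 * \<rho> * (max 1 \<gamma> * ?q)"
      proof (intro mult_mono)
        have "(\<sigma> - 1/2) * real t \<le> \<sigma> * real j" using False \<sigma> by (intro mult_mono) auto
        then have "- \<sigma> * real j \<le> - (\<sigma> - 1/2) * real t" by (simp only: mult_minus_left neg_le_iff_le)
        then show "2 powr (- \<sigma> * real j) \<le> ?q" by (rule powr_mono) simp
      qed (use \<kappa> kappa_pos \<Gamma> \<rho> in auto)
      also have "\<dots> = r * ((max 1 \<gamma> * \<Gamma> * sqrt y) * ?q)" by (simp add: \<rho>_def)
      also have "\<dots> \<le> r * \<delta>" by (intro mult_left_mono tail r_nonneg)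
      also have "\<dots> \<le> \<delta> * (hl j + r)" using hl_nonneg[of j] \<delta> by (simp add: algebra_simps)
      finally show ?thesis .
    qed
  qed
  also have "\<dots> \<le> g1 * (\<delta> * (hl j + r)) + g2 * (\<delta> * (hl j + r))"
    using g hl_nonneg[of j] \<delta> by (intro add_left_mono mult_left_mono) (auto simp: algebra_simps)
  also have "\<dots> = (g1 + g2) * (\<delta> * (hl j + r))" by (simp add: algebra_simps)
  also have "\<dots> \<le> (2 * (g1 + g2)) * (\<delta> * (hl j + r))"
    using g hl_nonneg[of j] r_nonneg \<delta> by (intro mult_right_mono) auto
  finally show ?thesis by (simp add: g1_def g2_def mult.assoc)
qed

text \<open>With block 0 active there is no decay in an active level to absorb
  \<open>max 1 \<gamma> * 2 powr (J0 / 2)\<close>. The factor \<open>\<kappa>\<close> in the other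
  thresholds does it; for \<open>\<kappa> = 1 / \<xi>\<close> the hypothesis is the lower bound on
  \<open>\<xi>\<close> in Assumption (A).\<close>

lemma low_rate_smooth:
  assumes s1: "s > 1/2" and \<kappa>1: "max 1 \<gamma> * 2 ^ J0 * \<kappa> \<le> \<delta>"
  shows "max 1 \<gamma> * (2 powr (real J0 / 2) * (\<Sum>i\<in>{Suc J0..<N}. hl i * 2 powr ((1/2 - \<sigma>) * real i)))
     \<le> 2 * (geo (1/2) + geo (\<sigma> - 1/2) + geo (s + \<sigma>)) * \<delta> * (\<Gamma> * rate n s (int J0) + r)"
proof -
  let ?S = "\<Sum>i\<in>{Suc J0..<N}. hl i * 2 powr ((1/2 - \<sigma>) * real i)"
  let ?q = "2 powr (- (\<sigma> - 1/2) * real t)"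
  have \<sigma>: "\<sigma> - 1/2 > 0" using s1 by (auto simp: regularity_def)
  define g1 where "g1 = geo (\<sigma> - 1/2)"
  define g2 where "g2 = geo (s + \<sigma>)"
  have g: "g1 \<ge> 0" "g2 \<ge> 0" using geo_pos[OF \<sigma>] geo_pos[of "s + \<sigma>"] s1 \<sigma> by (auto simp: g1_def g2_def)
  define \<rho> where "\<rho> = sqrt y * r"
  have \<rho>: "\<rho> \<ge> 0" using y_pos r_nonneg by (simp add: \<rho>_def)
  have "?S \<le> (\<Sum>i\<in>{Suc J0..<N}. \<Gamma> * \<kappa> * \<rho> * 2 powr (- (\<sigma> - 1/2) * real i)) + (\<Sum>i\<in>{Suc t..<N}. \<gamma> * 2 powr (- (s + \<sigma>) * real i))"
  proof (rule sum_split)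
    fix i
    show "hl i * 2 powr ((1/2 - \<sigma>) * real i) \<le> \<Gamma> * \<kappa> * \<rho> * 2 powr (- (\<sigma> - 1/2) * real i)" if "i \<le> t" using that by (simp add: hl_def t rate_eq[OF s1] \<rho>_def)
    show "hl i * 2 powr ((1/2 - \<sigma>) * real i) \<le> \<gamma> * 2 powr (- (s + \<sigma>) * real i)" if "i > t"
    proof -
      have "hl i * 2 powr ((1/2 - \<sigma>) * real i) \<le> (\<gamma> * 2 powr (- (s + 1/2) * real i)) * 2 powr ((1/2 - \<sigma>) * real i)"
        by (intro mult_right_mono hl_le) auto
      also have "\<dots> = \<gamma> * 2 powr (- (s + \<sigma>) * real i)" by (simp add: powr_add[symmetric] algebra_simps)
      finally show ?thesis .
    qed
  qed (use \<Gamma> \<gamma> kappa_pos \<rho> in auto)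
  also have "\<dots> \<le> \<Gamma> * \<kappa> * \<rho> * g1 + g2 * (\<Gamma> * \<rho> * ?q)"
  proof (rule add_mono)
    have "(\<Sum>i\<in>{Suc J0..<N}. 2 powr (- (\<sigma> - 1/2) * real i)) \<le> g1 * 2 powr (- (\<sigma> - 1/2) * real (Suc J0))"
      unfolding g1_def by (rule sum_powr_decreasing[OF \<sigma>])
    also have "\<dots> \<le> g1 * 1" using powr_mono[of "- (\<sigma> - 1/2) * real (Suc J0)" 0 2] \<sigma> g by (intro mult_left_mono) (auto simp: mult_nonpos_nonneg)
    finally show "(\<Sum>i\<in>{Suc J0..<N}. \<Gamma> * \<kappa> * \<rho> * 2 powr (- (\<sigma> - 1/2) * real i)) \<le> \<Gamma> * \<kappa> * \<rho> * g1"
      unfolding sum_distrib_left[symmetric] using \<Gamma> kappa_pos \<rho> by (intro mult_left_mono) auto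
    show "(\<Sum>i\<in>{Suc t..<N}. \<gamma> * 2 powr (- (s + \<sigma>) * real i)) \<le> g2 * (\<Gamma> * \<rho> * ?q)"
      unfolding g2_def \<rho>_def by (rule tail_smooth[OF s1])
  qed
  finally have "max 1 \<gamma> * (2 powr (real J0 / 2) * ?S)
     \<le> max 1 \<gamma> * (2 powr (real J0 / 2) * (\<Gamma> * \<kappa> * \<rho> * g1 + g2 * (\<Gamma> * \<rho> * ?q)))"
    by (intro mult_left_mono) auto
  also have "\<dots> = g1 * (\<Gamma> * \<rho> * (max 1 \<gamma> * 2 powr (real J0 / 2) * \<kappa>)) + g2 * (r * ((max 1 \<gamma> * \<Gamma> * 2 powr (real J0 / 2) * sqrt y) * ?q))"
    by (simp add: \<rho>_def algebra_simps)
  also have "\<dots> \<le> g1 * (\<Gamma> * \<rho> * \<delta>) + g2 * (r * \<delta>)"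
  proof (intro add_mono mult_left_mono g r_nonneg)
    have h2: "2 powr (real J0 / 2) \<le> 2 ^ J0" using powr_mono[of "real J0 / 2" "real J0" 2] by (simp add: powr_realpow)
    have "max 1 \<gamma> * 2 powr (real J0 / 2) * \<kappa> \<le> max 1 \<gamma> * 2 ^ J0 * \<kappa>"
      using h2 kappa_pos by (intro mult_right_mono mult_left_mono) auto
    then show "max 1 \<gamma> * 2 powr (real J0 / 2) * \<kappa> \<le> \<delta>" using \<kappa>1 by linarith
    have "max 1 \<gamma> * \<Gamma> * 2 powr (real J0 / 2) \<le> max 1 \<gamma> * (max 1 \<Gamma> * \<xi>) * 2 ^ J0"
      by (rule mult_mono[OF mult_left_mono[OF mult_ones] h2]) (use \<Gamma> ones in auto)
    then have fac: "max 1 \<gamma> * \<Gamma> * 2 powr (real J0 / 2) * sqrt y \<le> mass"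
      using y_pos by (intro mult_right_mono) (auto simp: mult.assoc)
    show "(max 1 \<gamma> * \<Gamma> * 2 powr (real J0 / 2) * sqrt y) * ?q \<le> \<delta>"
      using fac s1 \<Gamma> y_pos by (intro prod_le) auto
  qed (use \<Gamma> \<rho> in auto)
  also have "\<dots> \<le> g1 * (\<delta> * (\<Gamma> * \<rho> + r)) + g2 * (\<delta> * (\<Gamma> * \<rho> + r))"
    using g \<Gamma> \<rho> \<delta> r_nonneg by (intro add_mono mult_left_mono) (auto simp: algebra_simps)
  also have "\<dots> = (g1 + g2) * (\<delta> * (\<Gamma> * \<rho> + r))" by (simp add: algebra_simps)
  also have "\<dots> \<le> (2 * (geo (1/2) + geo (\<sigma> - 1/2) + geo (s + \<sigma>))) * (\<delta> * (\<Gamma> * \<rho> + r))"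
    using g \<Gamma> \<rho> r_nonneg \<delta> geo_pos[of "1/2"] by (intro mult_right_mono) (auto simp: g1_def g2_def)
  finally show ?thesis by (simp add: \<rho>_def rate_eq[OF s1] mult.assoc)
qed

text \<open>For \<open>s \<le> 1/2\<close> the thresholds up to \<open>jn\<close> shrink like
  \<open>2 powr (- i / 2)\<close>, which cancels the growth of \<open>X\<close> in \<open>i\<close>.
  The remaining decay in \<open>max i j \<ge> (i + j) / 2\<close> is shared: one half is summed over
  \<open>i\<close>, the other, in \<open>j\<close>, turns \<open>max 1 \<gamma>\<close> into
  \<open>\<delta>\<close>.\<close>

lemma high_rate_rough:
  assumes s1: "\<not> s > 1/2" and j: "J0 < j"
  shows "max 1 \<gamma> * (\<Sum>i\<in>{J0..<N}. hl i * X j i) \<le> 2 * (geo (s/2) + geo (2 * s) + geo s) * \<delta> * (hl j + r)"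
proof -
  let ?S = "\<Sum>i\<in>{J0..<N}. hl i * X j i"
  have \<sigma>: "\<sigma> = s" using s1 by (simp add: regularity_def)
  have g: "geo (s/2) \<ge> 0" "geo (2 * s) \<ge> 0" "geo s \<ge> 0" using geo_pos[of "s/2"] geo_pos[of "2 * s"] geo_pos[of s] s by auto
  define E where "E = eps_star n s"
  have E: "E \<ge> 0" by (simp add: E_def eps_star_def)
  have rt: "rate n s (int i) = 2 powr (- real i / 2) * E" for i using s1 by (simp add: rate_def E_def)
  have main: "max 1 \<gamma> * ?S \<le> 2 * (geo (s/2) + geo (2 * s) + geo s) * \<delta> * hl j"
  proof (cases "j \<le> t")
    case True
    define H where "H = \<Gamma> * E * 2 powr (- real j / 2)"
    have H: "H \<ge> 0" using \<Gamma> E by (simp add: H_def)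
    have hj: "hl j = \<kappa> * H" using True by (simp add: hl_def t rt H_def mult_ac)
    have "?S \<le> (\<Sum>i\<in>{J0..<N}. \<kappa> * H * 2 powr (- (s/2) * real j) * 2 powr (- (s/2) * real i)) + (\<Sum>i\<in>{Suc t..<N}. \<gamma> * 2 powr (- real j / 2) * 2 powr (- (2 * s) * real i))"
    proof (rule sum_split)
      fix i
      show "hl i * X j i \<le> \<kappa> * H * 2 powr (- (s/2) * real j) * 2 powr (- (s/2) * real i)" if "i \<le> t"
      proof -
        have "hl i * X j i = (\<kappa> * \<Gamma> * E) * (2 powr (- real i / 2) * X j i)" using that by (simp add: hl_def t rt)
        also have Xe: "2 powr (- real i / 2) * X j i = 2 powr (- real j / 2 - s * real (max i j))"
          by (simp add: X_def \<sigma> powr_add[symmetric] algebra_simps diff_divide_distrib add_divide_distrib minus_diff_commute)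
        also have "(\<kappa> * \<Gamma> * E) * \<dots> \<le> (\<kappa> * \<Gamma> * E) * 2 powr (- real j / 2 + - (s/2) * real j + - (s/2) * real i)"
        proof (intro mult_left_mono powr_mono)
          have "(s/2) * real j + (s/2) * real i = s * ((real i + real j) / 2)" by (simp add: algebra_simps)
          also have "\<dots> \<le> s * real (max i j)" using s by (intro mult_left_mono) auto
          finally show "- real j / 2 - s * real (max i j) \<le> - real j / 2 + - (s/2) * real j + - (s/2) * real i" by simp
        qed (use kappa_pos \<Gamma> E in auto)
        finally have "hl i * X j i \<le> (\<kappa> * \<Gamma> * E) * 2 powr (- real j / 2 + - (s/2) * real j + - (s/2) * real i)"
          using kappa_pos \<Gamma> E by simp
        then show ?thesis by (simp only: H_def powr_add mult_ac)
      qed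
      show "hl i * X j i \<le> \<gamma> * 2 powr (- real j / 2) * 2 powr (- (2 * s) * real i)" if "i > t"
      proof -
        have "hl i * X j i \<le> (\<gamma> * 2 powr (- (s + 1/2) * real i)) * 2 powr ((real i - real j) / 2 - s * real i)"
        proof (intro mult_mono hl_le)
          have "s * real i \<le> s * real (max i j)" using s by (intro mult_left_mono) auto
          then show "X j i \<le> 2 powr ((real i - real j) / 2 - s * real i)" unfolding X_def \<sigma> by (intro powr_mono) auto
        qed (use \<gamma> X_nonneg in auto)
        also have "\<dots> = \<gamma> * 2 powr (- real j / 2) * 2 powr (- (2 * s) * real i)"
          by (simp add: powr_combine)
        finally show ?thesis .
      qed
    qed (use H kappa_pos \<gamma> in auto)
    also have "\<dots> \<le> \<kappa> * H * 2 powr (- (s/2) * real j) * (geo (s/2) * 1) + geo (2 * s) * (2 * H * 2 powr (- s * real t))"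
    proof (rule add_mono)
      have "(\<Sum>i\<in>{J0..<N}. 2 powr (- (s/2) * real i)) \<le> geo (s/2) * 2 powr (- (s/2) * real J0)"
        using s by (intro sum_powr_decreasing) auto
      also have "\<dots> \<le> geo (s/2) * 1" using powr_mono[of "- (s/2) * real J0" 0 2] s g by (intro mult_left_mono) auto
      finally show "(\<Sum>i\<in>{J0..<N}. \<kappa> * H * 2 powr (- (s/2) * real j) * 2 powr (- (s/2) * real i)) \<le> \<kappa> * H * 2 powr (- (s/2) * real j) * (geo (s/2) * 1)"
        unfolding sum_distrib_left[symmetric] using kappa_pos H by (intro mult_left_mono) auto
      have "(\<Sum>i\<in>{Suc t..<N}. \<gamma> * 2 powr (- real j / 2) * 2 powr (- (2 * s) * real i)) = 2 powr (- real j / 2) * (\<Sum>i\<in>{Suc t..<N}. \<gamma> * 2 powr (- (2 * s) * real i))"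
        by (simp add: sum_distrib_left mult_ac)
      also have "\<dots> \<le> 2 powr (- real j / 2) * (geo (2 * s) * (2 * (\<Gamma> * E) * 2 powr (- s * real t)))"
        unfolding E_def by (intro mult_left_mono tail_rough s1) auto
      also have "\<dots> = geo (2 * s) * (2 * H * 2 powr (- s * real t))" by (simp add: H_def)
      finally show "(\<Sum>i\<in>{Suc t..<N}. \<gamma> * 2 powr (- real j / 2) * 2 powr (- (2 * s) * real i)) \<le> geo (2 * s) * (2 * H * 2 powr (- s * real t))" .
    qed
    finally have "max 1 \<gamma> * ?S \<le> max 1 \<gamma> * (\<kappa> * H * 2 powr (- (s/2) * real j) * (geo (s/2) * 1) + geo (2 * s) * (2 * H * 2 powr (- s * real t)))"
      by (intro mult_left_mono) auto
    also have "\<dots> = geo (s/2) * (\<kappa> * H * (max 1 \<gamma> * 2 powr (- (s/2) * real j))) + geo (2 * s) * (2 * H * (max 1 \<gamma> * 2 powr (- s * real t)))"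
      by (simp add: algebra_simps)
    also have "\<dots> \<le> geo (s/2) * (\<kappa> * H * \<delta>) + geo (2 * s) * (2 * H * (\<delta> * \<kappa>))"
    proof (intro add_mono mult_left_mono g)
      show "max 1 \<gamma> * 2 powr (- (s/2) * real j) \<le> \<delta>" using j by (intro gamma_level) (auto simp: \<sigma>)
      \<comment> \<open>The right-hand side \<open>hl j\<close> contains \<open>\<kappa>\<close>,
        possibly as small as \<open>1 / \<xi>\<close>, so the polynomial gain has to beat
        \<open>\<xi>\<close> as well.\<close>
      have "max 1 \<gamma> * \<xi> \<le> mass"
        by (rule mult_ones[OF _ mult_ones[OF _ mult_right_mono[OF mult_ones]]]) (use ones \<xi> in auto)
      then have "max 1 \<gamma> * \<xi> * 2 powr (- s * real t) \<le> \<delta>" using s1 \<xi> by (intro prod_le) auto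
      then have "max 1 \<gamma> * 2 powr (- s * real t) \<le> \<delta> * (1 / \<xi>)" using \<xi> by (simp add: field_simps)
      also have "\<dots> \<le> \<delta> * \<kappa>" using \<kappa> \<delta> by (intro mult_left_mono) auto
      finally show "max 1 \<gamma> * 2 powr (- s * real t) \<le> \<delta> * \<kappa>" .
    qed (use H kappa_pos in auto)
    also have "\<dots> = (geo (s/2) + 2 * geo (2 * s)) * (\<delta> * (\<kappa> * H))" by (simp add: algebra_simps)
    also have "\<dots> \<le> (2 * (geo (s/2) + geo (2 * s) + geo s)) * (\<delta> * (\<kappa> * H))"
      using g H kappa_pos \<delta> by (intro mult_right_mono) auto
    finally show ?thesis by (simp add: hj mult.assoc)
  next
    case False
    define H where "H = \<gamma> * 2 powr (- (s + 1/2) * real j)"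
    have H: "H \<ge> 0" using \<gamma> by (simp add: H_def)
    have e: "- real j * (s + 1/2) = - (s + 1/2) * real j" by (simp add: algebra_simps)
    have hj: "hl j = H" using False unfolding hl_def t H_def e by simp
    have "?S \<le> (\<Sum>i\<in>{J0..<N}. H * 2 powr (- s * real i))"
    proof (rule sum_mono)
      fix i
      have "hl i * X j i \<le> (\<gamma> * 2 powr (- (s + 1/2) * real i)) * 2 powr ((real i - real j) / 2 - s * real j)"
      proof (intro mult_mono hl_le)
        have "s * real j \<le> s * real (max i j)" using s by (intro mult_left_mono) auto
        then show "X j i \<le> 2 powr ((real i - real j) / 2 - s * real j)" unfolding X_def \<sigma> by (intro powr_mono) auto
      qed (use \<gamma> X_nonneg in auto)
      also have "\<dots> = H * 2 powr (- s * real i)" by (simp add: H_def powr_add[symmetric] algebra_simps diff_divide_distrib add_divide_distrib minus_diff_commute)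
      finally show "hl i * X j i \<le> H * 2 powr (- s * real i)" .
    qed
    also have "\<dots> \<le> H * (geo s * 2 powr (- s * real J0))"
      unfolding sum_distrib_left[symmetric] by (intro mult_left_mono sum_powr_decreasing s H)
    finally have "max 1 \<gamma> * ?S \<le> max 1 \<gamma> * (H * (geo s * 2 powr (- s * real J0)))"
      by (intro mult_left_mono) auto
    also have "\<dots> = H * geo s * (max 1 \<gamma> * 2 powr (- s * real J0))" by simp
    also have "\<dots> \<le> H * geo s * \<delta>" using gamma_level[of J0 s] s H g by (intro mult_left_mono) (auto simp: \<sigma>)
    also have "\<dots> = geo s * (\<delta> * H)" by simp
    also have "\<dots> \<le> (2 * (geo (s/2) + geo (2 * s) + geo s)) * (\<delta> * H)"
      using g H \<delta> by (intro mult_right_mono) auto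
    finally show ?thesis by (simp add: hj mult.assoc)
  qed
  also have "\<dots> \<le> 2 * (geo (s/2) + geo (2 * s) + geo s) * \<delta> * (hl j + r)"
    using g \<delta> r_nonneg by (intro mult_left_mono) auto
  finally show ?thesis .
qed

lemma low_rate_rough:
  assumes s1: "\<not> s > 1/2" and \<kappa>1: "max 1 \<gamma> * 2 ^ J0 * \<kappa> \<le> \<delta>"
  shows "max 1 \<gamma> * (2 powr (real J0 / 2) * (\<Sum>i\<in>{Suc J0..<N}. hl i * 2 powr ((1/2 - \<sigma>) * real i)))
     \<le> 2 * (geo (s/2) + geo (2 * s) + geo s) * \<delta> * (\<Gamma> * rate n s (int J0) + r)"
proof -
  let ?S = "\<Sum>i\<in>{Suc J0..<N}. hl i * 2 powr ((1/2 - \<sigma>) * real i)"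
  let ?q = "2 powr (- s * real t)"
  have \<sigma>: "\<sigma> = s" using s1 by (simp add: regularity_def)
  have g: "geo (s/2) \<ge> 0" "geo (2 * s) \<ge> 0" "geo s \<ge> 0" using geo_pos[of "s/2"] geo_pos[of "2 * s"] geo_pos[of s] s by auto
  define E where "E = eps_star n s"
  have E: "E \<ge> 0" by (simp add: E_def eps_star_def)
  have rt: "rate n s (int i) = 2 powr (- real i / 2) * E" for i using s1 by (simp add: rate_def E_def)
  define H where "H = \<Gamma> * E"
  have H: "H \<ge> 0" using \<Gamma> E by (simp add: H_def)
  have "?S \<le> (\<Sum>i\<in>{Suc J0..<N}. \<kappa> * H * 2 powr (- s * real i)) + (\<Sum>i\<in>{Suc t..<N}. \<gamma> * 2 powr (- (2 * s) * real i))"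
  proof (rule sum_split)
    fix i
    show "hl i * 2 powr ((1/2 - \<sigma>) * real i) \<le> \<kappa> * H * 2 powr (- s * real i)" if "i \<le> t"
    proof -
      have "hl i * 2 powr ((1/2 - \<sigma>) * real i) = \<kappa> * H * (2 powr (- real i / 2) * 2 powr ((1/2 - s) * real i))"
        using that by (simp add: hl_def t rt H_def \<sigma>)
      also have "2 powr (- real i / 2) * 2 powr ((1/2 - s) * real i) = 2 powr (- s * real i)" by (simp add: powr_add[symmetric] algebra_simps)
      finally show ?thesis by simp
    qed
    show "hl i * 2 powr ((1/2 - \<sigma>) * real i) \<le> \<gamma> * 2 powr (- (2 * s) * real i)" if "i > t"
    proof -
      have "hl i * 2 powr ((1/2 - \<sigma>) * real i) \<le> (\<gamma> * 2 powr (- (s + 1/2) * real i)) * 2 powr ((1/2 - s) * real i)"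
        unfolding \<sigma> by (intro mult_right_mono hl_le) auto
      also have "\<dots> = \<gamma> * 2 powr (- (2 * s) * real i)" by (simp add: powr_add[symmetric] algebra_simps)
      finally show ?thesis .
    qed
  qed (use \<gamma> kappa_pos H in auto)
  also have "\<dots> \<le> \<kappa> * H * geo s + geo (2 * s) * (2 * H * ?q)"
  proof (rule add_mono)
    have "(\<Sum>i\<in>{Suc J0..<N}. 2 powr (- s * real i)) \<le> geo s * 2 powr (- s * real (Suc J0))"
      by (intro sum_powr_decreasing s)
    also have "\<dots> \<le> geo s * 1" using powr_mono[of "- s * real (Suc J0)" 0 2] s g by (intro mult_left_mono) (auto simp: mult_nonpos_nonneg)
    finally show "(\<Sum>i\<in>{Suc J0..<N}. \<kappa> * H * 2 powr (- s * real i)) \<le> \<kappa> * H * geo s"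
      unfolding sum_distrib_left[symmetric] using kappa_pos H by (intro mult_left_mono) auto
    show "(\<Sum>i\<in>{Suc t..<N}. \<gamma> * 2 powr (- (2 * s) * real i)) \<le> geo (2 * s) * (2 * H * ?q)"
      unfolding H_def E_def by (rule tail_rough[OF s1])
  qed
  finally have "max 1 \<gamma> * (2 powr (real J0 / 2) * ?S)
     \<le> max 1 \<gamma> * (2 powr (real J0 / 2) * (\<kappa> * H * geo s + geo (2 * s) * (2 * H * ?q)))"
    by (intro mult_left_mono) auto
  also have "\<dots> = geo s * (H * (max 1 \<gamma> * 2 powr (real J0 / 2) * \<kappa>)) + geo (2 * s) * (2 * H * (max 1 \<gamma> * 2 powr (real J0 / 2) * ?q))"
    by (simp add: algebra_simps)
  also have "\<dots> \<le> geo s * (H * (\<delta> * 2 powr (- real J0 / 2))) + geo (2 * s) * (2 * H * (\<delta> * 2 powr (- real J0 / 2)))"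
  proof (intro add_mono mult_left_mono g)
    \<comment> \<open>One factor \<open>2 powr (J0 / 2)\<close> stands in front of the sum; the
      other is needed because the rate at \<open>J0\<close> contains
      \<open>2 powr (- J0 / 2)\<close>.\<close>
    have e: "2 ^ J0 = 2 powr (real J0 / 2) * 2 powr (real J0 / 2)" by (simp add: powr_add[symmetric] powr_realpow)
    have c: "a * 2 powr (real J0 / 2) \<le> \<delta> * 2 powr (- real J0 / 2)" if "a * 2 ^ J0 \<le> \<delta>" for a
      using mult_right_mono[OF that, of "2 powr (- real J0 / 2)"] unfolding e
      by (simp add: mult.assoc powr_add[symmetric])
    show "max 1 \<gamma> * 2 powr (real J0 / 2) * \<kappa> \<le> \<delta> * 2 powr (- real J0 / 2)"
      using c[of "max 1 \<gamma> * \<kappa>"] \<kappa>1 by (simp add: mult_ac)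
    have "max 1 \<gamma> * 2 ^ J0 \<le> mass"
      by (rule mult_ones[OF _ mult_right_mono[OF mult_ones[OF _ mult_ones]]]) (use ones in auto)
    then have "max 1 \<gamma> * 2 ^ J0 * ?q \<le> \<delta>" using s1 by (intro prod_le) auto
    then show "max 1 \<gamma> * 2 powr (real J0 / 2) * ?q \<le> \<delta> * 2 powr (- real J0 / 2)"
      using c[of "max 1 \<gamma> * ?q"] by (simp add: mult_ac)
  qed (use H in auto)
  also have "\<dots> = (geo s + 2 * geo (2 * s)) * (\<delta> * (H * 2 powr (- real J0 / 2)))" by (simp add: algebra_simps)
  also have "\<dots> \<le> (2 * (geo (s/2) + geo (2 * s) + geo s)) * (\<delta> * (H * 2 powr (- real J0 / 2) + r))"
    using g H r_nonneg \<delta> by (intro mult_mono) auto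
  finally show ?thesis by (simp add: rt H_def mult_ac)
qed

definition C_rate :: real where
  "C_rate = (if s > 1/2 then 2 * (geo (1/2) + geo (\<sigma> - 1/2) + geo (s + \<sigma>)) else 2 * (geo (s/2) + geo (2 * s) + geo s))"

lemma high_rate:
  "J0 < j \<Longrightarrow> max 1 \<gamma> * (\<Sum>i\<in>{J0..<N}. hl i * 2 powr ((real i - real j) / 2 - \<sigma> * real (max i j))) \<le> C_rate * \<delta> * (hl j + r)"
  using high_rate_smooth high_rate_rough unfolding C_rate_def X_def by auto

lemma low_rate:
  "max 1 \<gamma> * 2 ^ J0 * \<kappa> \<le> \<delta> \<Longrightarrow> max 1 \<gamma> * (2 powr (real J0 / 2) * (\<Sum>i\<in>{Suc J0..<N}. hl i * 2 powr ((1/2 - \<sigma>) * real i)))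
     \<le> C_rate * \<delta> * (\<Gamma> * rate n s (int J0) + r)"
  using low_rate_smooth low_rate_rough unfolding C_rate_def by auto

end

section \<open>Suprema of exponential likelihood ratios\<close>

text \<open>The cubic remainder has a coefficient of at most \<open>exp 1 / 6 \<le> 1/2\<close>, and
  one factor \<open>\<bar>t\<bar> \<le> \<tau>\<close> turns it into a relative error of the
  quadratic term.\<close>

lemma exp_taylor:
  fixes t \<tau> :: real
  assumes "\<bar>t\<bar> \<le> \<tau>" "\<tau> \<le> 1"
  shows "exp t \<le> 1 + t + (1 + \<tau>) / 2 * t\<^sup>2" "1 + t + (1 - \<tau>) / 2 * t\<^sup>2 \<le> exp t"
proof -
  obtain u where u: "\<bar>u\<bar> \<le> \<bar>t\<bar>" "exp t = (\<Sum>m<3. t ^ m / fact m) + exp u / fact 3 * t ^ 3"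
    using Maclaurin_exp_le[of t 3] by blast
  have e: "exp t = 1 + t + t\<^sup>2 / 2 + exp u / 6 * t ^ 3"
    using u(2) by (simp add: numeral_eq_Suc lessThan_Suc fact_numeral)
  have "exp u \<le> exp 1" using u(1) assms by auto
  then have "exp u / 6 \<le> 1 / 2" using exp_le by linarith
  then have "\<bar>exp u / 6 * t ^ 3\<bar> \<le> 1 / 2 * (\<bar>t\<bar> * t\<^sup>2)"
    unfolding abs_mult by (intro mult_mono) (auto simp: power_abs power3_eq_cube power2_eq_square abs_mult)
  also have "\<dots> \<le> 1 / 2 * (\<tau> * t\<^sup>2)" using assms by (intro mult_left_mono mult_right_mono) auto
  finally have b: "\<bar>exp u / 6 * t ^ 3\<bar> \<le> \<tau> / 2 * t\<^sup>2" by simp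
  show "exp t \<le> 1 + t + (1 + \<tau>) / 2 * t\<^sup>2" using b unfolding e by (simp add: algebra_simps add_divide_distrib abs_le_iff)
  show "1 + t + (1 - \<tau>) / 2 * t\<^sup>2 \<le> exp t" using b unfolding e by (simp add: algebra_simps diff_divide_distrib abs_le_iff)
qed

lemma (in prob_space) mgf_bound:
  fixes f :: "'a \<Rightarrow> real"
  assumes f: "f \<in> borel_measurable M" "AE x in M. \<bar>f x\<bar> \<le> \<tau>" "\<tau> \<le> 1" and mean: "expectation f = 0"
  shows "(\<integral>\<^sup>+ x. ennreal (exp (f x)) \<partial>M) \<le> ennreal (exp ((1 + \<tau>) / 2 * expectation (\<lambda>x. (f x)\<^sup>2)))"
proof -
  have i: "integrable M f" by (rule integrable_const_bound[OF _ f(1)]) (use f in auto)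
  have i2: "integrable M (\<lambda>x. (f x)\<^sup>2)"
  proof (rule integrable_const_bound[of _ "\<tau>\<^sup>2"])
    show "AE x in M. norm ((f x)\<^sup>2) \<le> \<tau>\<^sup>2" using f(2)
    proof eventually_elim
      case (elim x)
      then have "\<bar>f x\<bar> \<le> \<bar>\<tau>\<bar>" by linarith
      then show ?case by (simp add: abs_le_square_iff)
    qed
  qed (use f in auto)
  have "(\<integral>\<^sup>+ x. ennreal (exp (f x)) \<partial>M) \<le> (\<integral>\<^sup>+ x. ennreal (1 + f x + (1 + \<tau>) / 2 * (f x)\<^sup>2) \<partial>M)"
    by (intro nn_integral_mono_AE) (use f(2) exp_taylor(1)[OF _ f(3)] in \<open>auto elim!: eventually_mono intro!: ennreal_leI\<close>)
  also have "\<dots> = ennreal (expectation (\<lambda>x. 1 + f x + (1 + \<tau>) / 2 * (f x)\<^sup>2))"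
  proof (rule nn_integral_eq_integral)
    show "AE x in M. 0 \<le> 1 + f x + (1 + \<tau>) / 2 * (f x)\<^sup>2" using f(2)
    proof eventually_elim
      case (elim x) then show ?case using exp_taylor(1)[OF elim f(3)] exp_gt_zero[of "f x"] by linarith
    qed
  qed (use i i2 in auto)
  also have "expectation (\<lambda>x. 1 + f x + (1 + \<tau>) / 2 * (f x)\<^sup>2) = 1 + (1 + \<tau>) / 2 * expectation (\<lambda>x. (f x)\<^sup>2)"
    using i i2 mean prob_space by simp
  also have "ennreal \<dots> \<le> ennreal (exp ((1 + \<tau>) / 2 * expectation (\<lambda>x. (f x)\<^sup>2)))"
    by (intro ennreal_leI exp_ge_add_one_self)
  finally show ?thesis .
qed

section \<open>Volumes and exponential moments over the active coefficients\<close>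

abbreviation Leb :: "'d set \<Rightarrow> ('d \<Rightarrow> real) measure" where "Leb J \<equiv> \<Pi>\<^sub>M v\<in>J. lborel"

text \<open>One-dimensional substitution, one coordinate at a time. It is used both to translate the
  averaging set and to compare the volumes of dilated sets.\<close>

lemma nn_integral_PiM_affine:
  fixes t :: "'d \<Rightarrow> real" and c :: real
  assumes "finite J" "c \<noteq> 0" "f \<in> borel_measurable (Leb J)"
  shows "(\<integral>\<^sup>+ x. f (\<lambda>i\<in>J. t i + c * x i) \<partial>(Leb J)) = ennreal ((1 / \<bar>c\<bar>) ^ card J) * (\<integral>\<^sup>+ x. f x \<partial>(Leb J))"
  using assms(1,3)
proof (induction J arbitrary: f rule: finite_induct)
  case empty
  then show ?case by (simp add: PiM_empty nn_integral_count_space_finite)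
next
  case (insert i J)
  interpret product_sigma_finite "\<lambda>_ :: 'd. lborel :: real measure" ..
  let ?A = "\<lambda>x. \<lambda>k\<in>J. t k + c * x k"
  note f[measurable] = insert.prems
  have aff[measurable]: "(\<lambda>x. \<lambda>k\<in>insert i J. t k + c * x k) \<in> measurable (Leb (insert i J)) (Leb (insert i J))"
    by (rule measurable_restrict) auto
  have ins[measurable]: "(\<lambda>(x, y). x(i := y)) \<in> measurable ((Leb J) \<Otimes>\<^sub>M lborel) (Leb (insert i J))"
    using measurable_add_dim[of i J "\<lambda>_. lborel"] by simp
  have g[measurable]: "(\<lambda>x. \<integral>\<^sup>+ z. f (x(i := z)) \<partial>lborel) \<in> borel_measurable (Leb J)"
    by measurable
  have "(\<integral>\<^sup>+ x. f (\<lambda>k\<in>insert i J. t k + c * x k) \<partial>(Leb (insert i J)))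
     = (\<integral>\<^sup>+ x. \<integral>\<^sup>+ y. f (\<lambda>k\<in>insert i J. t k + c * (x(i := y)) k) \<partial>lborel \<partial>(Leb J))"
    by (rule product_nn_integral_insert) (use insert in auto)
  also have "\<dots> = (\<integral>\<^sup>+ x. ennreal (1 / \<bar>c\<bar>) * (\<integral>\<^sup>+ z. f ((?A x)(i := z)) \<partial>lborel) \<partial>(Leb J))"
  proof (rule nn_integral_cong)
    fix x :: "'d \<Rightarrow> real" assume x: "x \<in> space (Leb J)"
    have 1: "(\<lambda>k\<in>insert i J. t k + c * (x(i := y)) k) = (?A x)(i := t i + c * y)" for y
      using insert.hyps by (auto simp: restrict_def fun_eq_iff)
    have x': "(?A x) \<in> space (Leb J)" by (auto simp: space_PiM)
    have m: "(\<lambda>z. f ((?A x)(i := z))) \<in> borel_measurable borel"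
    proof -
      have "(\<lambda>z. (\<lambda>(x, y). x(i := y)) ((?A x), z)) \<in> measurable lborel (Leb (insert i J))"
        by (rule measurable_compose[OF measurable_Pair1'[OF x'] ins])
      then show ?thesis using measurable_compose[OF _ f] by simp
    qed
    have "(\<integral>\<^sup>+ z. f ((?A x)(i := z)) \<partial>lborel) = ennreal \<bar>c\<bar> * (\<integral>\<^sup>+ y. f ((?A x)(i := t i + c * y)) \<partial>lborel)"
      using nn_integral_real_affine[OF m assms(2), of "t i"] by simp
    then have "ennreal (1 / \<bar>c\<bar>) * (\<integral>\<^sup>+ z. f ((?A x)(i := z)) \<partial>lborel)
       = (ennreal (1 / \<bar>c\<bar>) * ennreal \<bar>c\<bar>) * (\<integral>\<^sup>+ y. f ((?A x)(i := t i + c * y)) \<partial>lborel)"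
      by (simp add: mult.assoc)
    also have "ennreal (1 / \<bar>c\<bar>) * ennreal \<bar>c\<bar> = 1" using assms(2) by (simp add: ennreal_mult[symmetric])
    finally show "(\<integral>\<^sup>+ y. f (\<lambda>k\<in>insert i J. t k + c * (x(i := y)) k) \<partial>lborel) = ennreal (1 / \<bar>c\<bar>) * (\<integral>\<^sup>+ z. f ((?A x)(i := z)) \<partial>lborel)"
      unfolding 1 by (simp only: mult_1_left)
  qed
  also have "\<dots> = ennreal (1 / \<bar>c\<bar>) * (\<integral>\<^sup>+ x. (\<integral>\<^sup>+ z. f ((?A x)(i := z)) \<partial>lborel) \<partial>(Leb J))"
  proof (rule nn_integral_cmult)
    have "?A \<in> measurable (Leb J) (Leb J)"
      by (rule measurable_restrict) auto
    from measurable_compose[OF this g]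
    show "(\<lambda>x. \<integral>\<^sup>+ z. f ((?A x)(i := z)) \<partial>lborel) \<in> borel_measurable (Leb J)" .
  qed
  also have "(\<integral>\<^sup>+ x. (\<integral>\<^sup>+ z. f ((?A x)(i := z)) \<partial>lborel) \<partial>(Leb J))
      = ennreal ((1 / \<bar>c\<bar>) ^ card J) * (\<integral>\<^sup>+ x. (\<integral>\<^sup>+ z. f (x(i := z)) \<partial>lborel) \<partial>(Leb J))"
    by (rule insert.IH[OF g])
  also have "(\<integral>\<^sup>+ x. (\<integral>\<^sup>+ z. f (x(i := z)) \<partial>lborel) \<partial>(Leb J)) = (\<integral>\<^sup>+ x. f x \<partial>(Leb (insert i J)))"
    by (rule product_nn_integral_insert[symmetric]) (use insert in auto)
  finally show ?case using insert.hyps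
    by (simp add: mult.assoc[symmetric] ennreal_mult[symmetric])
qed

locale exponential_family = prob_space P for P :: "'x measure" +
  fixes J :: "'d set" and b :: "'d \<Rightarrow> 'x \<Rightarrow> real" and \<beta> :: real
  assumes J: "finite J" and b_meas [measurable]: "\<And>v. v \<in> J \<Longrightarrow> b v \<in> borel_measurable P"
    and b_bound: "\<And>v x. v \<in> J \<Longrightarrow> x \<in> space P \<Longrightarrow> \<bar>b v x\<bar> \<le> \<beta>"
    and b_mean: "\<And>v. v \<in> J \<Longrightarrow> expectation (b v) = 0"
begin

abbreviation \<Lambda> :: "('d \<Rightarrow> real) measure" where "\<Lambda> \<equiv> Leb J"

definition S :: "('d \<Rightarrow> real) \<Rightarrow> 'x \<Rightarrow> real" where "S a x = (\<Sum>v\<in>J. a v * b v x)"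

definition Q :: "('d \<Rightarrow> real) \<Rightarrow> real" where "Q a = expectation (\<lambda>x. (S a x)\<^sup>2)"

lemma S_meas [measurable]: "S a \<in> borel_measurable P"
  unfolding S_def by measurable

lemma S_bound: "x \<in> space P \<Longrightarrow> \<bar>S a x\<bar> \<le> (\<Sum>v\<in>J. \<bar>a v\<bar>) * \<beta>"
proof -
  assume x: "x \<in> space P"
  have "\<bar>S a x\<bar> \<le> (\<Sum>v\<in>J. \<bar>a v * b v x\<bar>)" unfolding S_def by (rule sum_abs)
  also have "\<dots> \<le> (\<Sum>v\<in>J. \<bar>a v\<bar> * \<beta>)" unfolding abs_mult using b_bound x by (intro sum_mono mult_left_mono) auto
  finally show ?thesis by (simp add: sum_distrib_right)
qed

lemma S_integrable: "integrable P (S a)" "integrable P (\<lambda>x. S a x * S a' x)" "integrable P (\<lambda>x. (S a x)\<^sup>2)"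
proof -
  have i: "integrable P (\<lambda>x. S a x * S a' x)" for a a'
  proof (rule integrable_const_bound[of _ "((\<Sum>v\<in>J. \<bar>a v\<bar>) * \<beta>) * ((\<Sum>v\<in>J. \<bar>a' v\<bar>) * \<beta>)"])
    show "AE x in P. norm (S a x * S a' x) \<le> ((\<Sum>v\<in>J. \<bar>a v\<bar>) * \<beta>) * ((\<Sum>v\<in>J. \<bar>a' v\<bar>) * \<beta>)"
      using S_bound by (intro AE_I2) (auto simp: abs_mult intro!: mult_mono' order.trans[OF abs_ge_zero S_bound])
  qed simp
  show "integrable P (S a)" by (rule integrable_const_bound[of _ "(\<Sum>v\<in>J. \<bar>a v\<bar>) * \<beta>"]) (use S_bound in auto)
  show "integrable P (\<lambda>x. S a x * S a' x)" by (rule i)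
  show "integrable P (\<lambda>x. (S a x)\<^sup>2)" using i[of a a] by (simp add: power2_eq_square)
qed

lemma S_mean: "expectation (S a) = 0"
proof -
  have "integrable P (b v)" if "v \<in> J" for v
    using that b_bound by (intro integrable_const_bound[of _ \<beta>]) auto
  then show ?thesis unfolding S_def using b_mean by simp
qed

lemma S_linear: "S (\<lambda>v\<in>J. a v + c * u v) x = S a x + c * S u x"
  unfolding S_def by (simp add: distrib_right sum.distrib sum_distrib_left mult.assoc)

lemma S_scale: "S (\<lambda>v\<in>J. c * u v) x = c * S u x"
  unfolding S_def by (simp add: sum_distrib_left mult_ac)

lemma Q_nonneg: "Q a \<ge> 0" unfolding Q_def by simp

lemma Q_linear: "Q (\<lambda>v\<in>J. a v + c * u v) = Q a + 2 * c * expectation (\<lambda>x. S a x * S u x) + c\<^sup>2 * Q u"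
proof -
  have "Q (\<lambda>v\<in>J. a v + c * u v) = expectation (\<lambda>x. (S a x)\<^sup>2 + 2 * c * (S a x * S u x) + c\<^sup>2 * (S u x)\<^sup>2)"
    unfolding Q_def S_linear by (simp add: power2_eq_square algebra_simps)
  then show ?thesis using S_integrable(2,3) by (simp add: Q_def)
qed

lemma Q_scale: "Q (\<lambda>v\<in>J. c * u v) = c\<^sup>2 * Q u"
  unfolding Q_def S_scale by (simp add: power_mult_distrib)

lemma S_joint [measurable]: "(\<lambda>z. S (fst z) (snd z)) \<in> borel_measurable (\<Lambda> \<Otimes>\<^sub>M P)"
  unfolding S_def by measurable

lemma S_joint' [measurable]:
  assumes "f \<in> measurable N \<Lambda>" "g \<in> measurable N P"
  shows "(\<lambda>z. S (f z) (g z)) \<in> borel_measurable N"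
  using measurable_compose[OF measurable_Pair[OF assms] S_joint] by simp

lemma Q_meas [measurable]: "Q \<in> borel_measurable \<Lambda>"
  unfolding Q_def by measurable

text \<open>States \<open>\<bar>S a x\<bar> \<le> \<tau>\<close> almost everywhere, as
  \<open>ennreal\<close> truncates negative values to 0. Written as a vanishing integral, the
  condition is measurable in \<open>a\<close>.\<close>

definition near :: "real \<Rightarrow> ('d \<Rightarrow> real) \<Rightarrow> bool" where
  "near \<tau> a \<longleftrightarrow> (\<integral>\<^sup>+ x. ennreal (\<bar>S a x\<bar> - \<tau>) \<partial>P) = 0"

lemma near_AE: "near \<tau> a \<longleftrightarrow> (AE x in P. \<bar>S a x\<bar> \<le> \<tau>)"
  unfolding near_def by (subst nn_integral_0_iff_AE) (auto simp: ennreal_eq_0_iff)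

lemma near_meas [measurable]: "Measurable.pred \<Lambda> (near \<tau>)"
  unfolding near_def by measurable

text \<open>The constraint on the coefficients keeps the volume finite without any lower bound on
  \<open>Q\<close>.\<close>

definition Kset :: "real \<Rightarrow> real \<Rightarrow> real \<Rightarrow> ('d \<Rightarrow> real) set" where
  "Kset \<tau> r c = {a \<in> space \<Lambda>. near \<tau> a \<and> Q a \<le> r \<and> (\<Sum>v\<in>J. (a v)\<^sup>2) \<le> c}"

lemma Kset_meas [measurable]: "Kset \<tau> r c \<in> sets \<Lambda>"
  unfolding Kset_def by measurable

lemma Kset_finite: "emeasure \<Lambda> (Kset \<tau> r c) < \<infinity>"
proof -
  interpret product_sigma_finite "\<lambda>_ :: 'd. lborel :: real measure" ..
  have "Kset \<tau> r c \<subseteq> (\<Pi>\<^sub>E v\<in>J. {- sqrt c..sqrt c})"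
  proof
    fix a assume a: "a \<in> Kset \<tau> r c"
    have "a v \<in> {- sqrt c..sqrt c}" if v: "v \<in> J" for v
    proof -
      have "(a v)\<^sup>2 \<le> (\<Sum>v\<in>J. (a v)\<^sup>2)" using v J by (intro member_le_sum) auto
      then have "(a v)\<^sup>2 \<le> c" using a by (auto simp: Kset_def)
      then have "\<bar>a v\<bar> \<le> sqrt c" by (metis real_sqrt_abs real_sqrt_le_iff)
      then show ?thesis by auto
    qed
    moreover have "a \<in> extensional J" using a by (auto simp: Kset_def space_PiM PiE_def)
    ultimately show "a \<in> (\<Pi>\<^sub>E v\<in>J. {- sqrt c..sqrt c})" by (auto simp: PiE_def)
  qed
  then have "emeasure \<Lambda> (Kset \<tau> r c) \<le> emeasure \<Lambda> (\<Pi>\<^sub>E v\<in>J. {- sqrt c..sqrt c})"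
    using J by (intro emeasure_mono sets_PiM_I_finite) auto
  also have "\<dots> = (\<Prod>v\<in>J. emeasure lborel {- sqrt c..sqrt c})" by (rule emeasure_PiM[OF J]) auto
  also have "\<dots> < \<infinity>" using J by (auto simp: emeasure_lborel_Icc_eq power_less_top_ennreal)
  finally show ?thesis .
qed

lemma Kset_pos:
  assumes "\<tau> > 0" "r > 0" "c > 0"
  shows "emeasure \<Lambda> (Kset \<tau> r c) > 0"
proof -
  interpret product_sigma_finite "\<lambda>_ :: 'd. lborel :: real measure" ..
  define d where "d = real (card J) + 1"
  define B where "B = \<bar>\<beta>\<bar> + 1"
  \<comment> \<open>Half the side of a cube inside the set: on it the sum of the absolute
    coefficients is at most \<open>d * q\<close>, which meets each of the three constraints.\<close>
  define q where "q = min (min (\<tau> / (d * B)) (sqrt r / (d * B))) (min 1 c / d)"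
  have d: "d \<ge> 1" "B \<ge> 1" by (auto simp: d_def B_def)
  have q: "q > 0" using assms d by (simp add: q_def)
  have dBp: "d * B > 0" using d by (intro mult_pos_pos) auto
  have "q \<le> \<tau> / (d * B)" "q \<le> sqrt r / (d * B)" by (auto simp: q_def)
  then have q1: "d * q * B \<le> \<tau>" "d * q * B \<le> sqrt r" using dBp by (auto simp: pos_le_divide_eq mult_ac)
  have "q \<le> min 1 c / d" by (simp add: q_def)
  then have q2: "d * q \<le> min 1 c" using d by (simp add: pos_le_divide_eq mult.commute)
  have "q \<le> d * q" using d q by simp
  then have q3: "q \<le> 1" using q2 by simp
  have "(\<Pi>\<^sub>E v\<in>J. {- q..q}) \<subseteq> Kset \<tau> r c"
  proof
    fix a assume a: "a \<in> (\<Pi>\<^sub>E v\<in>J. {- q..q})"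
    then have av: "\<bar>a v\<bar> \<le> q" if "v \<in> J" for v using that by (auto simp: PiE_def Pi_def abs_le_iff)
    have "(\<Sum>v\<in>J. \<bar>a v\<bar>) \<le> real (card J) * q" using av by (intro sum_bounded_above) auto
    also have "\<dots> \<le> d * q" using q by (simp add: d_def)
    finally have sa: "(\<Sum>v\<in>J. \<bar>a v\<bar>) \<le> d * q" .
    have Sb: "\<bar>S a x\<bar> \<le> d * q * B" if "x \<in> space P" for x
    proof -
      have "\<bar>S a x\<bar> \<le> (\<Sum>v\<in>J. \<bar>a v\<bar>) * \<beta>" by (rule S_bound[OF that])
      also have "\<dots> \<le> (\<Sum>v\<in>J. \<bar>a v\<bar>) * B" by (intro mult_left_mono) (auto simp: B_def intro: sum_nonneg)
      also have "\<dots> \<le> d * q * B" using sa d by (intro mult_right_mono) auto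
      finally show ?thesis .
    qed
    have "near \<tau> a" unfolding near_AE using Sb q1(1) by (intro AE_I2) (meson order.trans)
    moreover have "Q a \<le> r"
    proof -
      have "Q a \<le> expectation (\<lambda>x. r)" unfolding Q_def
      proof (rule integral_mono[OF S_integrable(3)])
        fix x assume "x \<in> space P"
        then have "\<bar>S a x\<bar> \<le> sqrt r" using Sb q1(2) by (meson order.trans)
        then have "(S a x)\<^sup>2 \<le> (sqrt r)\<^sup>2" by (metis abs_ge_zero power2_abs power_mono)
        then show "(S a x)\<^sup>2 \<le> r" using assms by simp
      qed auto
      then show ?thesis by (simp add: prob_space)
    qed
    moreover have "(\<Sum>v\<in>J. (a v)\<^sup>2) \<le> c"
    proof -
      have "(\<Sum>v\<in>J. (a v)\<^sup>2) \<le> (\<Sum>v\<in>J. \<bar>a v\<bar>)"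
      proof (rule sum_mono)
        fix v assume "v \<in> J"
        then have "\<bar>a v\<bar> \<le> 1" using av q3 by (meson order.trans)
        then show "(a v)\<^sup>2 \<le> \<bar>a v\<bar>" using mult_left_le[of "\<bar>a v\<bar>" "\<bar>a v\<bar>"] by (simp add: power2_eq_square flip: abs_mult)
      qed
      then show ?thesis using sa q2 by linarith
    qed
    moreover have "a \<in> space \<Lambda>" using a by (auto simp: space_PiM PiE_def)
    ultimately show "a \<in> Kset \<tau> r c" by (simp add: Kset_def)
  qed
  then have "emeasure \<Lambda> (\<Pi>\<^sub>E v\<in>J. {- q..q}) \<le> emeasure \<Lambda> (Kset \<tau> r c)" by (intro emeasure_mono) auto
  moreover have "emeasure \<Lambda> (\<Pi>\<^sub>E v\<in>J. {- q..q}) = (\<Prod>v\<in>J. emeasure lborel {- q..q})" by (rule emeasure_PiM[OF J]) auto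
  moreover have "(\<Prod>v\<in>J. emeasure lborel {- q..q}) > 0" using q J
    by (auto simp: emeasure_lborel_Icc_eq zero_less_iff_neq_zero)
  ultimately show ?thesis by (metis less_le_trans)
qed

end

locale shifted_family = exponential_family P J b \<beta>
  for P :: "'x measure" and J :: "'d set" and b :: "'d \<Rightarrow> 'x \<Rightarrow> real" and \<beta> :: real +
  fixes T :: "'x \<Rightarrow> real" and \<delta> E bb C :: real and n :: nat
  assumes T_meas [measurable]: "T \<in> borel_measurable P" and T_bound: "\<And>x. x \<in> space P \<Longrightarrow> \<bar>T x\<bar> \<le> \<delta>"
    and T_mean: "expectation T = 0" and T_square: "expectation (\<lambda>x. (T x)\<^sup>2) \<le> \<delta>\<^sup>2 * E\<^sup>2"
    and \<delta>: "0 < \<delta>" "\<delta> \<le> 1/100" and E: "E > 0" and bb: "9/20 \<le> bb" "bb \<le> 1/2" and C: "C > 0"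
begin

abbreviation \<X> :: "(nat \<Rightarrow> 'x) measure" where "\<X> \<equiv> \<Pi>\<^sub>M i\<in>{..<n}. P"

text \<open>The square root of the surrogate \<open>h\<close>. A moment of order
  \<open>\<theta>\<close> has exponent about
  \<open>\<theta> * (\<theta> / 2 - bb) * n * Q a\<close>; with \<open>bb\<close> near 1/2 this is
  clearly negative at \<open>\<theta> = 1/2\<close> but close to 0 at \<open>\<theta> = 1\<close>,
  so the square root has an exponentially small mean.\<close>

definition H :: "('d \<Rightarrow> real) \<Rightarrow> (nat \<Rightarrow> 'x) \<Rightarrow> real" where
  "H a X = exp (((\<Sum>i<n. S a (X i) - T (X i)) - real n * bb * Q a) / 2)"

lemma H_meas [measurable]: "(\<lambda>z. H (fst z) (snd z)) \<in> borel_measurable (\<Lambda> \<Otimes>\<^sub>M \<X>)"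
  unfolding H_def by measurable

lemma H_meas1 [measurable]: "X \<in> space \<X> \<Longrightarrow> (\<lambda>a. H a X) \<in> borel_measurable \<Lambda>"
  using measurable_compose[OF measurable_Pair2' H_meas, of X] by simp

lemma T_integrable: "integrable P T" "integrable P (\<lambda>x. (T x)\<^sup>2)"
proof -
  show "integrable P T" by (rule integrable_const_bound[of _ \<delta>]) (use T_bound in auto)
  show "integrable P (\<lambda>x. (T x)\<^sup>2)"
  proof (rule integrable_const_bound[of _ "\<delta>\<^sup>2"])
    show "AE x in P. norm ((T x)\<^sup>2) \<le> \<delta>\<^sup>2"
    proof (rule AE_I2)
      fix x assume "x \<in> space P"
      then have "\<bar>T x\<bar> \<le> \<bar>\<delta>\<bar>" using T_bound[of x] by linarith
      then show "norm ((T x)\<^sup>2) \<le> \<delta>\<^sup>2" by (simp add: abs_le_square_iff)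
    qed
  qed simp
qed

text \<open>Young's inequality with weight \<open>\<delta>\<close>; the large factor
  \<open>1 + 1 / \<delta>\<close> on the square of \<open>T\<close> is paid by
  \<open>T_square\<close>. The 6 leaves room for perturbed parameters, whose \<open>Q a\<close> may
  fall below \<open>E\<^sup>2\<close>.\<close>

lemma shift_square: "E\<^sup>2 \<le> 6 * Q a \<Longrightarrow> expectation (\<lambda>x. (S a x - T x)\<^sup>2) \<le> (1 + 13 * \<delta>) * Q a"
proof -
  assume EQ: "E\<^sup>2 \<le> 6 * Q a"
  have "expectation (\<lambda>x. (S a x - T x)\<^sup>2) \<le> expectation (\<lambda>x. (1 + \<delta>) * (S a x)\<^sup>2 + (1 + 1 / \<delta>) * (T x)\<^sup>2)"
  proof (rule integral_mono)
    have eq: "(\<lambda>x. (S a x - T x)\<^sup>2) = (\<lambda>x. (S a x)\<^sup>2 + (T x)\<^sup>2 - 2 * (S a x * T x))"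
      by (simp add: power2_diff fun_eq_iff)
    have "integrable P (\<lambda>x. S a x * T x)"
    proof (rule integrable_const_bound[of _ "((\<Sum>v\<in>J. \<bar>a v\<bar>) * \<beta>) * \<delta>"])
      show "AE x in P. norm (S a x * T x) \<le> ((\<Sum>v\<in>J. \<bar>a v\<bar>) * \<beta>) * \<delta>"
        using S_bound T_bound by (intro AE_I2) (auto simp: abs_mult intro!: mult_mono' order.trans[OF abs_ge_zero S_bound])
    qed simp
    then show "integrable P (\<lambda>x. (S a x - T x)\<^sup>2)" unfolding eq using S_integrable(3) T_integrable by auto
    show "integrable P (\<lambda>x. (1 + \<delta>) * (S a x)\<^sup>2 + (1 + 1 / \<delta>) * (T x)\<^sup>2)" using S_integrable(3) T_integrable by auto
    fix x
    have "0 \<le> (\<delta> * S a x + T x)\<^sup>2 / \<delta>" using \<delta> by simp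
    also have "\<dots> = \<delta> * (S a x)\<^sup>2 + 2 * (S a x * T x) + 1 / \<delta> * (T x)\<^sup>2"
      using \<delta> by (simp add: power2_eq_square field_simps)
    finally show "(S a x - T x)\<^sup>2 \<le> (1 + \<delta>) * (S a x)\<^sup>2 + (1 + 1 / \<delta>) * (T x)\<^sup>2"
      by (simp add: power2_diff algebra_simps)
  qed
  also have "\<dots> = (1 + \<delta>) * Q a + (1 + 1 / \<delta>) * expectation (\<lambda>x. (T x)\<^sup>2)"
    using S_integrable(3) T_integrable by (simp add: Q_def)
  also have "\<dots> \<le> (1 + \<delta>) * Q a + (1 + 1 / \<delta>) * (\<delta>\<^sup>2 * (6 * Q a))"
    using \<delta> EQ by (intro add_left_mono mult_left_mono order.trans[OF T_square]) auto
  also have "\<dots> = (1 + \<delta>) * Q a + (\<delta>\<^sup>2 + \<delta>) * (6 * Q a)"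
    using \<delta> by (simp add: power2_eq_square field_simps)
  also have "\<dots> \<le> (1 + \<delta>) * Q a + (2 * \<delta>) * (6 * Q a)"
    using \<delta> Q_nonneg[of a] by (intro add_left_mono mult_right_mono) (auto simp: power2_eq_square mult_left_le)
  finally show ?thesis by (simp add: algebra_simps)
qed

lemma moment:
  assumes \<theta>: "0 \<le> \<theta>" "\<theta> \<le> 1" and a: "near (2 * \<delta>) a" "E\<^sup>2 \<le> 6 * Q a"
  shows "(\<integral>\<^sup>+ X. ennreal (exp (\<theta> * ((\<Sum>i<n. S a (X i) - T (X i)) - real n * bb * Q a))) \<partial>\<X>)
    \<le> ennreal (exp (real n * \<theta> * Q a * (\<theta> / 2 * (1 + 3 * \<delta>) * (1 + 13 * \<delta>) - bb)))"
proof -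
  interpret product_sigma_finite "\<lambda>_ :: nat. P" ..
  have "(\<integral>\<^sup>+ X. ennreal (exp (\<theta> * ((\<Sum>i<n. S a (X i) - T (X i)) - real n * bb * Q a))) \<partial>\<X>)
    = (\<integral>\<^sup>+ X. ennreal (exp (- \<theta> * real n * bb * Q a)) * (\<Prod>i<n. ennreal (exp (\<theta> * (S a (X i) - T (X i))))) \<partial>\<X>)"
  proof (rule nn_integral_cong)
    fix X
    have "exp (\<theta> * ((\<Sum>i<n. S a (X i) - T (X i)) - real n * bb * Q a)) = exp (- \<theta> * real n * bb * Q a) * (\<Prod>i<n. exp (\<theta> * (S a (X i) - T (X i))))"
    proof -
      have "(\<Prod>i<n. exp (\<theta> * (S a (X i) - T (X i)))) = exp (\<theta> * (\<Sum>i<n. S a (X i) - T (X i)))"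
        unfolding sum_distrib_left by (rule exp_sum[symmetric]) simp
      moreover have "\<theta> * ((\<Sum>i<n. S a (X i) - T (X i)) - real n * bb * Q a) = - \<theta> * real n * bb * Q a + \<theta> * (\<Sum>i<n. S a (X i) - T (X i))"
        by (simp add: right_diff_distrib)
      ultimately show ?thesis by (simp only: exp_add)
    qed
    then show "ennreal (exp (\<theta> * ((\<Sum>i<n. S a (X i) - T (X i)) - real n * bb * Q a))) = ennreal (exp (- \<theta> * real n * bb * Q a)) * (\<Prod>i<n. ennreal (exp (\<theta> * (S a (X i) - T (X i)))))"
      by (simp add: ennreal_mult prod_ennreal prod_nonneg)
  qed
  also have "\<dots> = ennreal (exp (- \<theta> * real n * bb * Q a)) * (\<integral>\<^sup>+ X. (\<Prod>i<n. ennreal (exp (\<theta> * (S a (X i) - T (X i))))) \<partial>\<X>)"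
    by (rule nn_integral_cmult) measurable
  also have "(\<integral>\<^sup>+ X. (\<Prod>i<n. ennreal (exp (\<theta> * (S a (X i) - T (X i))))) \<partial>\<X>) = (\<Prod>i<n. \<integral>\<^sup>+ x. ennreal (exp (\<theta> * (S a x - T x))) \<partial>P)"
    by (rule product_nn_integral_prod) auto
  also have "\<dots> \<le> (\<Prod>i<n. ennreal (exp (\<theta>\<^sup>2 / 2 * (1 + 3 * \<delta>) * (1 + 13 * \<delta>) * Q a)))"
  proof (rule prod_mono_ennreal)
    have "(\<integral>\<^sup>+ x. ennreal (exp (\<theta> * (S a x - T x))) \<partial>P) \<le> ennreal (exp ((1 + 3 * \<delta>) / 2 * expectation (\<lambda>x. (\<theta> * (S a x - T x))\<^sup>2)))"
    proof (rule mgf_bound)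
      show "AE x in P. \<bar>\<theta> * (S a x - T x)\<bar> \<le> 3 * \<delta>"
        using a(1)[unfolded near_AE] AE_space
      proof eventually_elim
        case (elim x)
        then have "\<bar>S a x - T x\<bar> \<le> 3 * \<delta>" using T_bound[of x] by linarith
        then have "\<theta> * \<bar>S a x - T x\<bar> \<le> 1 * (3 * \<delta>)" using \<theta> by (intro mult_mono) auto
        then show ?case using \<theta> by (simp add: abs_mult)
      qed
      show "expectation (\<lambda>x. \<theta> * (S a x - T x)) = 0" using S_integrable(1) T_integrable S_mean T_mean by simp
    qed (use \<delta> in auto)
    also have "\<dots> \<le> ennreal (exp ((1 + 3 * \<delta>) / 2 * (\<theta>\<^sup>2 * ((1 + 13 * \<delta>) * Q a))))"
    proof (intro ennreal_leI iffD2[OF exp_le_cancel_iff] mult_left_mono)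
      have "expectation (\<lambda>x. (\<theta> * (S a x - T x))\<^sup>2) = \<theta>\<^sup>2 * expectation (\<lambda>x. (S a x - T x)\<^sup>2)"
        by (simp add: power_mult_distrib)
      also have "\<dots> \<le> \<theta>\<^sup>2 * ((1 + 13 * \<delta>) * Q a)" by (intro mult_left_mono shift_square a) auto
      finally show "expectation (\<lambda>x. (\<theta> * (S a x - T x))\<^sup>2) \<le> \<theta>\<^sup>2 * ((1 + 13 * \<delta>) * Q a)" .
    qed (use \<delta> in auto)
    finally show "(\<integral>\<^sup>+ x. ennreal (exp (\<theta> * (S a x - T x))) \<partial>P) \<le> ennreal (exp (\<theta>\<^sup>2 / 2 * (1 + 3 * \<delta>) * (1 + 13 * \<delta>) * Q a))"
      by (simp add: mult_ac)
  qed
  also have "\<dots> = ennreal (exp (real n * (\<theta>\<^sup>2 / 2 * (1 + 3 * \<delta>) * (1 + 13 * \<delta>) * Q a)))"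
    by (simp add: ennreal_power flip: exp_of_nat_mult)
  also have "ennreal (exp (- \<theta> * real n * bb * Q a)) * \<dots> = ennreal (exp (real n * \<theta> * Q a * (\<theta> / 2 * (1 + 3 * \<delta>) * (1 + 13 * \<delta>) - bb)))"
    by (simp add: ennreal_mult[symmetric] exp_add[symmetric] power2_eq_square algebra_simps)
  finally show ?thesis by (simp add: mult_left_mono)
qed

lemma half_moment:
  assumes "near (2 * \<delta>) a" "E\<^sup>2 \<le> 6 * Q a"
  shows "(\<integral>\<^sup>+ X. ennreal (H a X) \<partial>\<X>) \<le> ennreal (exp (- real n * Q a * (75/1000)))"
proof -
  have "(\<integral>\<^sup>+ X. ennreal (H a X) \<partial>\<X>) \<le> ennreal (exp (real n * (1/2) * Q a * ((1/2) / 2 * (1 + 3 * \<delta>) * (1 + 13 * \<delta>) - bb)))"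
    using moment[of "1/2" a] assms unfolding H_def by simp
  also have "\<dots> \<le> ennreal (exp (- real n * Q a * (75/1000)))"
  proof (intro ennreal_leI iffD2[OF exp_le_cancel_iff])
    \<comment> \<open>\<open>1.03 * 1.13 / 4 < 0.3\<close>, so with \<open>bb \<ge> 0.45\<close> the
      bracket is at most \<open>-0.15\<close>; the factor \<open>\<theta> = 1/2\<close> makes this
      \<open>-75/1000\<close>.\<close>
    have "(1 + 3 * \<delta>) * (1 + 13 * \<delta>) \<le> (1 + 3/100) * (1 + 13/100)" using \<delta> by (intro mult_mono) auto
    then have "(1/2) / 2 * (1 + 3 * \<delta>) * (1 + 13 * \<delta>) - bb \<le> - (15/100)" using bb(1) by simp
    then have "(real n * (1/2) * Q a) * ((1/2) / 2 * (1 + 3 * \<delta>) * (1 + 13 * \<delta>) - bb) \<le> (real n * (1/2) * Q a) * (- (15/100))"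
      using Q_nonneg[of a] by (intro mult_left_mono) auto
    then show "real n * (1/2) * Q a * ((1/2) / 2 * (1 + 3 * \<delta>) * (1 + 13 * \<delta>) - bb) \<le> - real n * Q a * (75/1000)" by simp
  qed
  finally show ?thesis .
qed

text \<open>The log-likelihood surrogate is a concave quadratic, so its value at \<open>a\<close> is at most its average over a small
  symmetric neighbourhood of \<open>a\<close>, up to the curvature term; comparing volumes then replaces an entropy bound.\<close>

lemma shell:
  assumes R: "R \<ge> E"
  obtains V where "V \<in> borel_measurable \<X>" "(\<integral>\<^sup>+ X. V X \<partial>\<X>) \<le> ennreal (17 ^ card J * exp (- real n * R\<^sup>2 / 100))"
    "\<And>a X. a \<in> space \<Lambda> \<Longrightarrow> near \<delta> a \<Longrightarrow> R\<^sup>2 / 4 \<le> Q a \<Longrightarrow> Q a \<le> R\<^sup>2 \<Longrightarrow> (\<Sum>v\<in>J. (a v)\<^sup>2) \<le> C * Q a \<Longrightarrow> X \<in> space \<X> \<Longrightarrow> ennreal (H a X) \<le> V X"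
proof -
  interpret product_sigma_finite "\<lambda>_ :: 'd. lborel :: real measure" ..
  interpret pX: product_sigma_finite "\<lambda>_ :: nat. P" ..
  have sX: "sigma_finite_measure \<X>" using pX.sigma_finite[of "{..<n}"] by simp
  have sL: "sigma_finite_measure \<Lambda>" using sigma_finite[OF J] .
  interpret LX: pair_sigma_finite \<Lambda> \<X> unfolding pair_sigma_finite_def using sX sL by simp
  let ?e = "exp (real n * R\<^sup>2 / 1024)" and ?d = "exp (- real n * R\<^sup>2 * (14/1000))"
  have R0: "R > 0" using R E by simp
  \<comment> \<open>\<open>K\<close> holds the perturbations \<open>u\<close>, and \<open>K'\<close>
    will contain all \<open>a + u / 16\<close> and \<open>a - u / 16\<close> for \<open>a\<close> in
    the shell; hence the dilation \<open>q = 1 + 1/16\<close>. The lower bound 3/16 keeps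
    \<open>Q\<close> large enough for \<open>half_moment\<close>.\<close>
  define K where "K = Kset \<delta> (R\<^sup>2) (C * R\<^sup>2)"
  define q where "q = (17/16 :: real)"
  define K' where "K' = {a \<in> Kset (q * \<delta>) (q\<^sup>2 * R\<^sup>2) (q\<^sup>2 * (C * R\<^sup>2)). 3/16 * R\<^sup>2 \<le> Q a}"
  define v where "v = emeasure \<Lambda> K"
  have v: "0 < v" "v < \<infinity>" unfolding v_def K_def using \<delta> R0 C Kset_finite by (auto intro!: Kset_pos simp: infinity_ennreal_def[symmetric] simp del: infinity_ennreal_def)
  have K'_meas [measurable]: "K' \<in> sets \<Lambda>"
  proof -
    have "K' = Kset (q * \<delta>) (q\<^sup>2 * R\<^sup>2) (q\<^sup>2 * (C * R\<^sup>2)) \<inter> {a \<in> space \<Lambda>. 3/16 * R\<^sup>2 \<le> Q a}" by (auto simp: K'_def Kset_def)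
    then show ?thesis by simp
  qed
  have K_meas [measurable]: "K \<in> sets \<Lambda>" unfolding K_def by simp
  have volK': "emeasure \<Lambda> K' \<le> ennreal (q ^ card J) * v"
  proof -
    have "(\<integral>\<^sup>+ x. indicator K' (\<lambda>i\<in>J. 0 + q * x i) \<partial>\<Lambda>) = ennreal ((1 / \<bar>q\<bar>) ^ card J) * (\<integral>\<^sup>+ x. indicator K' x \<partial>\<Lambda>)"
      by (rule nn_integral_PiM_affine[OF J]) (auto simp: q_def)
    then have eq: "ennreal ((1 / q) ^ card J) * emeasure \<Lambda> K' = (\<integral>\<^sup>+ x. indicator K' (\<lambda>i\<in>J. q * x i) \<partial>\<Lambda>)"
      by (simp add: q_def)
    also have "\<dots> \<le> (\<integral>\<^sup>+ x. indicator K x \<partial>\<Lambda>)"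
    proof (rule nn_integral_mono)
      fix x assume x: "x \<in> space \<Lambda>"
      have "x \<in> K" if "(\<lambda>i\<in>J. q * x i) \<in> K'"
      proof -
        have k: "near (q * \<delta>) (\<lambda>i\<in>J. q * x i)" "Q (\<lambda>i\<in>J. q * x i) \<le> q\<^sup>2 * R\<^sup>2" "(\<Sum>v\<in>J. ((\<lambda>i\<in>J. q * x i) v)\<^sup>2) \<le> q\<^sup>2 * (C * R\<^sup>2)"
          using that by (auto simp: K'_def Kset_def)
        have "near \<delta> x" using k(1) unfolding near_AE S_scale by (auto simp: abs_mult q_def)
        moreover have "Q x \<le> R\<^sup>2" using k(2) unfolding Q_scale by (simp add: q_def)
        moreover have "(\<Sum>v\<in>J. (x v)\<^sup>2) \<le> C * R\<^sup>2"
        proof -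
          have "(\<Sum>v\<in>J. ((\<lambda>i\<in>J. q * x i) v)\<^sup>2) = q\<^sup>2 * (\<Sum>v\<in>J. (x v)\<^sup>2)"
            by (simp add: sum_distrib_left power_mult_distrib)
          then show ?thesis using k(3) by (simp add: q_def)
        qed
        ultimately show ?thesis using x by (simp add: K_def Kset_def)
      qed
      then show "indicator K' (\<lambda>i\<in>J. q * x i) \<le> (indicator K x :: ennreal)" by (auto simp: indicator_def)
    qed
    also have "\<dots> = v" by (simp add: v_def)
    finally have "ennreal (q ^ card J) * (ennreal ((1 / q) ^ card J) * emeasure \<Lambda> K') \<le> ennreal (q ^ card J) * v"
      by (rule mult_left_mono) simp
    moreover have "ennreal (q ^ card J) * ennreal ((1 / q) ^ card J) = 1"
      by (simp add: ennreal_mult[symmetric] power_mult_distrib[symmetric] q_def)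
    ultimately show ?thesis by (simp add: mult.assoc[symmetric])
  qed
  define I where "I X = (\<integral>\<^sup>+ a. ennreal (H a X) * indicator K' a \<partial>\<Lambda>)" for X
  have I_meas [measurable]: "I \<in> borel_measurable \<X>"
  proof -
    have "(\<lambda>z. ennreal (H (snd z) (fst z)) * indicator K' (snd z)) \<in> borel_measurable (\<X> \<Otimes>\<^sub>M \<Lambda>)"
    proof -
      have "(\<lambda>z. (snd z, fst z)) \<in> measurable (\<X> \<Otimes>\<^sub>M \<Lambda>) (\<Lambda> \<Otimes>\<^sub>M \<X>)" by measurable
      from measurable_compose[OF this H_meas] have [measurable]: "(\<lambda>z. H (snd z) (fst z)) \<in> borel_measurable (\<X> \<Otimes>\<^sub>M \<Lambda>)" by simp
      show ?thesis by measurable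
    qed
    from sigma_finite_measure.borel_measurable_nn_integral_fst[OF sL this]
    show ?thesis unfolding I_def by simp
  qed
  \<comment> \<open>The average of \<open>H\<close> over perturbations by \<open>u / 16\<close>: the
    substitution costs \<open>16 ^ card J\<close>, \<open>v\<close> normalizes, and the exponential
    pays for the curvature. Together with the volume ratio \<open>q ^ card J\<close> the base
    becomes 17.\<close>
  define V where "V X = ennreal (?e) * (ennreal (16 ^ card J) * I X) / v" for X
  have V_meas [measurable]: "V \<in> borel_measurable \<X>" unfolding V_def by measurable
  have EV: "(\<integral>\<^sup>+ X. V X \<partial>\<X>) \<le> ennreal (17 ^ card J * exp (- real n * R\<^sup>2 / 100))"
  proof -
    have inner: "(\<integral>\<^sup>+ X. I X \<partial>\<X>) \<le> ennreal (?d) * (ennreal (q ^ card J) * v)"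
    proof -
      have "(\<integral>\<^sup>+ X. I X \<partial>\<X>) = (\<integral>\<^sup>+ a. (\<integral>\<^sup>+ X. ennreal (H a X) * indicator K' a \<partial>\<X>) \<partial>\<Lambda>)"
        unfolding I_def by (rule LX.Fubini') measurable
      also have "\<dots> \<le> (\<integral>\<^sup>+ a. ennreal (?d) * indicator K' a \<partial>\<Lambda>)"
      proof (rule nn_integral_mono)
        fix a assume a: "a \<in> space \<Lambda>"
        show "(\<integral>\<^sup>+ X. ennreal (H a X) * indicator K' a \<partial>\<X>) \<le> ennreal (?d) * indicator K' a"
        proof (cases "a \<in> K'")
          case True
          then have k: "near (q * \<delta>) a" "3/16 * R\<^sup>2 \<le> Q a" by (auto simp: K'_def Kset_def)
          have "near (2 * \<delta>) a" using k(1) unfolding near_AE by eventually_elim (use \<delta> in \<open>auto simp: q_def\<close>)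
          moreover have "E\<^sup>2 \<le> 6 * Q a"
          proof -
            have "E\<^sup>2 \<le> R\<^sup>2" using R E by (intro power_mono) auto
            then show ?thesis using k(2) zero_le_power2[of R] by linarith
          qed
          ultimately have "(\<integral>\<^sup>+ X. ennreal (H a X) \<partial>\<X>) \<le> ennreal (exp (- real n * Q a * (75/1000)))" by (rule half_moment)
          also have "\<dots> \<le> ennreal (?d)"
          proof (intro ennreal_leI iffD2[OF exp_le_cancel_iff])
            \<comment> \<open>\<open>75/1000 * 3/16\<close> exceeds \<open>14/1000\<close>.\<close>
            have "real n * (R\<^sup>2 * (14/1000)) \<le> real n * (Q a * (75/1000))" using k(2) zero_le_power2[of R] by (intro mult_left_mono) linarith+
            then show "- real n * Q a * (75/1000) \<le> - real n * R\<^sup>2 * (14/1000)" by simp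
          qed
          finally show ?thesis using True by simp
        qed simp
      qed
      also have "\<dots> = ennreal (?d) * emeasure \<Lambda> K'" by (simp add: nn_integral_cmult)
      also have "\<dots> \<le> ennreal (?d) * (ennreal (q ^ card J) * v)" by (intro mult_left_mono volK') simp
      finally show ?thesis .
    qed
    have "(\<integral>\<^sup>+ X. V X \<partial>\<X>) = (\<integral>\<^sup>+ X. (ennreal (?e) * ennreal (16 ^ card J) / v) * I X \<partial>\<X>)"
      unfolding V_def by (intro nn_integral_cong) (simp add: divide_ennreal_def mult_ac)
    also have "\<dots> = (ennreal (?e) * ennreal (16 ^ card J) / v) * (\<integral>\<^sup>+ X. I X \<partial>\<X>)"
      by (rule nn_integral_cmult) simp
    also have "\<dots> \<le> (ennreal (?e) * ennreal (16 ^ card J) / v) * (ennreal (?d) * (ennreal (q ^ card J) * v))"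
      by (intro mult_left_mono inner) simp
    also have "\<dots> = ennreal (?e) * ennreal (16 ^ card J) * ennreal (?d) * ennreal (q ^ card J) * (v / v)"
      by (simp add: divide_ennreal_def mult_ac)
    also have "v / v = 1" using v by (simp add: ennreal_divide_self)
    also have "ennreal (?e) * ennreal (16 ^ card J) * ennreal (?d) * ennreal (q ^ card J) * 1
       = ennreal (17 ^ card J * exp (real n * R\<^sup>2 / 1024 - real n * R\<^sup>2 * (14/1000)))"
    proof -
      have "16 ^ card J * q ^ card J = 17 ^ card J" unfolding power_mult_distrib[symmetric] by (simp add: q_def)
      then have "?e * 16 ^ card J * ?d * q ^ card J = 17 ^ card J * (?e * ?d)"
        by (simp add: mult_ac)
      also have "?e * ?d = exp (real n * R\<^sup>2 / 1024 - real n * R\<^sup>2 * (14/1000))"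
        by (simp add: exp_add[symmetric])
      finally have eq: "?e * 16 ^ card J * ?d * q ^ card J
        = 17 ^ card J * exp (real n * R\<^sup>2 / 1024 - real n * R\<^sup>2 * (14/1000))" .
      have q0: "q \<ge> 0" by (simp add: q_def)
      show ?thesis unfolding eq[symmetric] mult_1_right using q0 by (simp only: ennreal_mult mult_nonneg_nonneg exp_ge_zero zero_le_power zero_le_numeral)
    qed
    also have "\<dots> \<le> ennreal (17 ^ card J * exp (- real n * R\<^sup>2 / 100))"
    proof (intro ennreal_leI mult_left_mono iffD2[OF exp_le_cancel_iff])
      have "0 \<le> real n * R\<^sup>2" by simp
      then show "real n * R\<^sup>2 / 1024 - real n * R\<^sup>2 * (14/1000) \<le> - real n * R\<^sup>2 / 100" by (simp add: field_simps)
    qed simp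
    finally show ?thesis .
  qed
  have dom: "ennreal (H a X) \<le> V X"
    if a: "a \<in> space \<Lambda>" "near \<delta> a" "R\<^sup>2 / 4 \<le> Q a" "Q a \<le> R\<^sup>2" "(\<Sum>v\<in>J. (a v)\<^sup>2) \<le> C * Q a" and X: "X \<in> space \<X>" for a X
  proof -
    define g where "g a = ennreal (H a X) * indicator K' a" for a
    have g_meas: "g \<in> borel_measurable \<Lambda>" unfolding g_def using H_meas1[OF X] by measurable
    have inK': "(\<lambda>i\<in>J. a i + c * u i) \<in> K'" if u: "u \<in> K" and c: "\<bar>c\<bar> = 1/16" for u c
    proof -
      have ku: "near \<delta> u" "Q u \<le> R\<^sup>2" "(\<Sum>v\<in>J. (u v)\<^sup>2) \<le> C * R\<^sup>2" using u by (auto simp: K_def Kset_def)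
      have "c\<^sup>2 = \<bar>c\<bar>\<^sup>2" by simp
      then have c2: "c\<^sup>2 = 1/256" unfolding c by (simp add: power2_eq_square)
      \<comment> \<open>The cross term is split with different weights: above, the total factor is
        \<open>q * (1 + 1/16) = q\<^sup>2\<close>; below, with \<open>p\<^sup>2\<close> standing for
        at least \<open>R\<^sup>2 / 4\<close>, it is \<open>7/8 * 1/4 - 1/32 = 3/16\<close>.\<close>
      have up: "(p + c * r)\<^sup>2 \<le> q * p\<^sup>2 + 17/256 * r\<^sup>2" and lo: "7/8 * p\<^sup>2 - 1/32 * r\<^sup>2 \<le> (p + c * r)\<^sup>2" for p r :: real
      proof -
        have e: "(p + c * r)\<^sup>2 = p\<^sup>2 + 2 * (c * (p * r)) + 1/256 * r\<^sup>2"
          by (simp add: power2_sum power_mult_distrib c2 mult_ac)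
        have b0: "\<bar>c * (p * r)\<bar> = 1/16 * \<bar>p * r\<bar>" using c by (simp add: abs_mult)
        have b1: "2 * \<bar>p * r\<bar> \<le> p\<^sup>2 + r\<^sup>2" using sum_squares_bound[of "\<bar>p\<bar>" "\<bar>r\<bar>"] by (simp add: abs_mult mult.assoc)
        have b2: "\<bar>p * r\<bar> \<le> p\<^sup>2 + r\<^sup>2 / 4" using sum_squares_bound[of "\<bar>p\<bar>" "\<bar>r\<bar> / 2"] by (simp add: abs_mult power_divide)
        have b: "\<bar>c * (p * r)\<bar> \<le> 1/32 * (p\<^sup>2 + r\<^sup>2)" unfolding b0 using b1 by simp
        have b': "\<bar>c * (p * r)\<bar> \<le> 1/16 * (p\<^sup>2 + r\<^sup>2 / 4)" unfolding b0 using b2 by simp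
        show "(p + c * r)\<^sup>2 \<le> q * p\<^sup>2 + 17/256 * r\<^sup>2" unfolding e q_def using b by (simp add: abs_le_iff)
        show "7/8 * p\<^sup>2 - 1/32 * r\<^sup>2 \<le> (p + c * r)\<^sup>2"
        proof -
          have "- (c * (p * r)) \<le> 1/16 * (p\<^sup>2 + r\<^sup>2 / 4)" by (rule order.trans[OF abs_ge_minus_self b'])
          have *: "7/8 * A - 1/32 * B \<le> A + 2 * Y + 1/256 * B" if "- Y \<le> 1/16 * (A + B / 4)" "0 \<le> B" for A B Y :: real
            using that by (simp add: field_simps)
          show ?thesis unfolding e by (rule *) (use \<open>- (c * (p * r)) \<le> _\<close> in auto)
        qed
      qed
      let ?a = "\<lambda>i\<in>J. a i + c * u i"
      have "near (q * \<delta>) ?a" unfolding near_AE S_linear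
        using a(2)[unfolded near_AE] ku(1)[unfolded near_AE]
      proof eventually_elim
        case (elim x)
        have "\<bar>S a x + c * S u x\<bar> \<le> \<bar>S a x\<bar> + \<bar>c\<bar> * \<bar>S u x\<bar>" unfolding abs_mult[symmetric] by (rule abs_triangle_ineq)
        also have "\<dots> \<le> \<delta> + 1/16 * \<delta>" unfolding c using elim by (intro add_mono mult_left_mono) auto
        finally show ?case by (simp add: q_def)
      qed
      moreover have "Q ?a \<le> q\<^sup>2 * R\<^sup>2"
      proof -
        have "Q ?a \<le> expectation (\<lambda>x. q * (S a x)\<^sup>2 + 17/256 * (S u x)\<^sup>2)"
          unfolding Q_def by (intro integral_mono S_integrable(3) Bochner_Integration.integrable_add integrable_mult_right) (use up in \<open>simp add: S_linear\<close>)
        also have "\<dots> = q * Q a + 17/256 * Q u" using S_integrable(3) by (simp add: Q_def)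
        also have "\<dots> \<le> q * R\<^sup>2 + 17/256 * R\<^sup>2" using a(4) ku(2) by (intro add_mono mult_left_mono) (auto simp: q_def)
        finally show ?thesis by (simp add: q_def power2_eq_square)
      qed
      moreover have "(\<Sum>v\<in>J. (?a v)\<^sup>2) \<le> q\<^sup>2 * (C * R\<^sup>2)"
      proof -
        have "(\<Sum>v\<in>J. (?a v)\<^sup>2) \<le> (\<Sum>v\<in>J. q * (a v)\<^sup>2 + 17/256 * (u v)\<^sup>2)" by (intro sum_mono) (use up in simp)
        also have "\<dots> = q * (\<Sum>v\<in>J. (a v)\<^sup>2) + 17/256 * (\<Sum>v\<in>J. (u v)\<^sup>2)" by (simp add: sum.distrib sum_distrib_left)
        also have "\<dots> \<le> q * (C * R\<^sup>2) + 17/256 * (C * R\<^sup>2)"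
        proof (intro add_mono mult_left_mono ku(3))
          show "(\<Sum>v\<in>J. (a v)\<^sup>2) \<le> C * R\<^sup>2" using a(4,5) C by (meson order.trans mult_left_mono less_imp_le)
        qed (auto simp: q_def)
        finally show ?thesis by (simp add: q_def power2_eq_square)
      qed
      moreover have "3/16 * R\<^sup>2 \<le> Q ?a"
      proof -
        have "3/16 * R\<^sup>2 \<le> 7/8 * Q a - 1/32 * Q u" using a(3) ku(2) by linarith
        also have "\<dots> = expectation (\<lambda>x. 7/8 * (S a x)\<^sup>2 - 1/32 * (S u x)\<^sup>2)" using S_integrable(3) by (simp add: Q_def)
        also have "\<dots> \<le> Q ?a"
          unfolding Q_def by (intro integral_mono S_integrable(3) Bochner_Integration.integrable_diff integrable_mult_right) (use lo in \<open>simp add: S_linear\<close>)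
        finally show ?thesis .
      qed
      moreover have "?a \<in> space \<Lambda>" by (auto simp: space_PiM)
      ultimately show ?thesis by (simp add: K'_def Kset_def)
    qed
    have each: "ennreal (H a X) \<le> ennreal (?e) * (ennreal (1/2) * (g (\<lambda>i\<in>J. a i + 1/16 * u i) + g (\<lambda>i\<in>J. a i + (-1/16) * u i)))"
      if u: "u \<in> K" for u
    proof -
      let ?p = "\<lambda>i\<in>J. a i + 1/16 * u i" and ?m = "\<lambda>i\<in>J. a i + (-1/16) * u i"
      have Qu: "Q u \<le> R\<^sup>2" using u by (auto simp: K_def Kset_def)
      define s where "s = ((\<Sum>i<n. S a (X i) - T (X i)) - real n * bb * Q a) / 2"
      define d where "d = real n * bb * Q u / 512"
      define z where "z = (\<Sum>i<n. S u (X i)) / 32 - real n * bb * expectation (\<lambda>x. S a x * S u x) / 16"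
      have sumc: "(\<Sum>i<n. S (\<lambda>i\<in>J. a i + c * u i) (X i) - T (X i)) = (\<Sum>i<n. S a (X i) - T (X i)) + c * (\<Sum>i<n. S u (X i))" for c
        by (simp add: S_linear sum.distrib sum_subtractf sum_distrib_left)
      have Hp: "H ?p X = exp (s - d + z)"
        unfolding H_def sumc Q_linear s_def d_def z_def
        by (rule arg_cong[where f = exp]) (simp add: power2_eq_square field_simps)
      have Hm: "H ?m X = exp (s - d - z)"
        unfolding H_def sumc Q_linear s_def d_def z_def
        by (rule arg_cong[where f = exp]) (simp add: power2_eq_square field_simps)
      have dR: "d \<le> real n * R\<^sup>2 / 1024"
      proof -
        have "bb * Q u \<le> (1/2) * R\<^sup>2" using bb Qu Q_nonneg[of u] by (intro mult_mono) auto
        then have "real n * (bb * Q u) \<le> real n * ((1/2) * R\<^sup>2)" by (intro mult_left_mono) auto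
        then show ?thesis by (simp add: d_def mult_ac)
      qed
      \<comment> \<open>Using both signs removes the linear term \<open>z\<close>. Only the
        curvature loss \<open>d\<close> is left, at most \<open>n * R\<^sup>2 / 1024\<close> since
        \<open>bb \<le> 1/2\<close>.\<close>
      have "2 \<le> exp z + exp (- z)"
        using exp_ge_add_one_self[of z] exp_ge_add_one_self[of "- z"] by linarith
      then have "exp (s - d) * 2 \<le> exp (s - d) * (exp z + exp (- z))" by (intro mult_left_mono) auto
      then have "exp (s - d) \<le> 1/2 * (exp (s - d + z) + exp (s - d - z))" by (simp add: exp_add[symmetric] distrib_left algebra_simps)
      then have "exp d * exp (s - d) \<le> ?e * (1/2 * (exp (s - d + z) + exp (s - d - z)))"
        using dR by (intro mult_mono) auto
      moreover have "H a X = exp d * exp (s - d)" by (simp add: H_def s_def exp_add[symmetric])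
      ultimately have "H a X \<le> ?e * (1/2 * (H ?p X + H ?m X))" unfolding Hp Hm by simp
      then have "ennreal (H a X) \<le> ennreal (?e * (1/2 * (H ?p X + H ?m X)))" by (rule ennreal_leI)
      also have "\<dots> = ennreal (?e) * (ennreal (1/2) * (ennreal (H ?p X) + ennreal (H ?m X)))"
      proof -
        have "ennreal (\<alpha> * (1/2 * (\<beta> + \<gamma>))) = ennreal \<alpha> * (ennreal (1/2) * (ennreal \<beta> + ennreal \<gamma>))"
          if "0 \<le> \<alpha>" "0 \<le> \<beta>" "0 \<le> \<gamma>" for \<alpha> \<beta> \<gamma> :: real
          using that ennreal_mult[of "1/2" "\<beta> + \<gamma>"] ennreal_mult[of \<alpha> "1/2 * (\<beta> + \<gamma>)"] ennreal_plus[of \<beta> \<gamma>] by simp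
        then show ?thesis by (simp only: H_def exp_ge_zero)
      qed
      also have "ennreal (H ?p X) = g ?p" using inK'[OF u, of "1/16"] by (simp add: g_def)
      also have "ennreal (H ?m X) = g ?m" using inK'[OF u, of "-1/16"] by (simp add: g_def)
      finally show ?thesis .
    qed
    have gp: "(\<integral>\<^sup>+ u. g (\<lambda>i\<in>J. a i + c * u i) \<partial>\<Lambda>) = ennreal (16 ^ card J) * (\<integral>\<^sup>+ u. g u \<partial>\<Lambda>)" if "\<bar>c\<bar> = 1/16" for c
      using nn_integral_PiM_affine[OF J _ g_meas, of c a] that by (auto simp: power_one_over)
    have gm [measurable]: "(\<lambda>u. g (\<lambda>i\<in>J. a i + c * u i)) \<in> borel_measurable \<Lambda>" for c
    proof -
      have "(\<lambda>u. \<lambda>i\<in>J. a i + c * u i) \<in> measurable \<Lambda> \<Lambda>" by (rule measurable_restrict) auto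
      from measurable_compose[OF this g_meas] show ?thesis .
    qed
    have "ennreal (H a X) * v = (\<integral>\<^sup>+ u. ennreal (H a X) * indicator K u \<partial>\<Lambda>)" by (simp add: nn_integral_cmult v_def)
    also have "\<dots> \<le> (\<integral>\<^sup>+ u. ennreal (?e) * (ennreal (1/2) * (g (\<lambda>i\<in>J. a i + 1/16 * u i) + g (\<lambda>i\<in>J. a i + (-1/16) * u i))) \<partial>\<Lambda>)"
      by (intro nn_integral_mono) (use each in \<open>auto simp: indicator_def simp del: ennreal_half\<close>)
    also have "\<dots> = ennreal (?e) * (ennreal (1/2) * ((\<integral>\<^sup>+ u. g (\<lambda>i\<in>J. a i + 1/16 * u i) \<partial>\<Lambda>) + (\<integral>\<^sup>+ u. g (\<lambda>i\<in>J. a i + (-1/16) * u i) \<partial>\<Lambda>)))"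
      by (subst nn_integral_cmult, measurable, subst nn_integral_cmult, measurable, subst nn_integral_add, measurable)
    also have "\<dots> = ennreal (?e) * ((ennreal (1/2) * 2) * (ennreal (16 ^ card J) * (\<integral>\<^sup>+ u. g u \<partial>\<Lambda>)))"
      using gp[of "1/16"] gp[of "-1/16"] by (simp add: mult_2 mult.assoc del: ennreal_half)
    also have "ennreal (1/2) * 2 = 1"
    proof -
      have "ennreal (1/2 * 2) = ennreal (1/2) * ennreal 2" by (rule ennreal_mult) auto
      then show ?thesis by (simp del: ennreal_half)
    qed
    finally have "ennreal (H a X) * v \<le> ennreal (?e) * (ennreal (16 ^ card J) * (\<integral>\<^sup>+ u. g u \<partial>\<Lambda>))" by simp
    then have "ennreal (H a X) * v / v \<le> V X" unfolding V_def I_def g_def by (rule divide_right_mono_ennreal)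
    moreover have "ennreal (H a X) * v / v = ennreal (H a X)" using v by (simp add: ennreal_divide_times ennreal_mult_divide_eq)
    ultimately show ?thesis by simp
  qed
  show thesis by (rule that[OF V_meas EV dom])
qed

text \<open>Peeling into shells on which \<open>Q\<close> varies by a factor 4. The bound of shell
  \<open>k\<close> is at most a multiple of \<open>x ^ Suc k\<close>, because
  \<open>4 ^ k \<ge> k + 1\<close>, and the geometric series gives
  \<open>x / (1 - x)\<close>.\<close>

lemma sup_exponential:
  assumes n: "n \<ge> 1"
  obtains V where "V \<in> borel_measurable \<X>"
    "(\<integral>\<^sup>+ X. V X \<partial>\<X>) \<le> ennreal (17 ^ card J * (exp (- real n * E\<^sup>2 / 25) / (1 - exp (- real n * E\<^sup>2 / 25))))"
    "\<And>a X. a \<in> space \<Lambda> \<Longrightarrow> near \<delta> a \<Longrightarrow> E\<^sup>2 \<le> Q a \<Longrightarrow> (\<Sum>v\<in>J. (a v)\<^sup>2) \<le> C * Q a \<Longrightarrow> X \<in> space \<X> \<Longrightarrow> ennreal (H a X) \<le> V X"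
proof -
  define R where "R k = 2 ^ Suc k * E" for k :: nat
  have RE: "R k \<ge> E" for k using E one_le_power[of "2::real" "Suc k"] mult_right_mono[of 1 "2 ^ Suc k" E] by (simp add: R_def)
  have "\<exists>V. V \<in> borel_measurable \<X> \<and> (\<integral>\<^sup>+ X. V X \<partial>\<X>) \<le> ennreal (17 ^ card J * exp (- real n * (R k)\<^sup>2 / 100)) \<and>
    (\<forall>a X. a \<in> space \<Lambda> \<longrightarrow> near \<delta> a \<longrightarrow> (R k)\<^sup>2 / 4 \<le> Q a \<longrightarrow> Q a \<le> (R k)\<^sup>2 \<longrightarrow> (\<Sum>v\<in>J. (a v)\<^sup>2) \<le> C * Q a \<longrightarrow> X \<in> space \<X> \<longrightarrow> ennreal (H a X) \<le> V X)" for k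
    by (rule shell[OF RE[of k]]) blast
  then obtain V where V: "\<And>k. V k \<in> borel_measurable \<X>" "\<And>k. (\<integral>\<^sup>+ X. V k X \<partial>\<X>) \<le> ennreal (17 ^ card J * exp (- real n * (R k)\<^sup>2 / 100))"
    "\<And>k a X. a \<in> space \<Lambda> \<Longrightarrow> near \<delta> a \<Longrightarrow> (R k)\<^sup>2 / 4 \<le> Q a \<Longrightarrow> Q a \<le> (R k)\<^sup>2 \<Longrightarrow> (\<Sum>v\<in>J. (a v)\<^sup>2) \<le> C * Q a \<Longrightarrow> X \<in> space \<X> \<Longrightarrow> ennreal (H a X) \<le> V k X"
    by metis
  define x where "x = exp (- real n * E\<^sup>2 / 25)"
  have x: "0 < x" "x < 1" using n E by (auto simp: x_def)
  have pw: "(R k)\<^sup>2 = 4 * 4 ^ k * E\<^sup>2" for k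
    by (simp add: R_def power_mult_distrib power2_eq_square) (simp add: power_mult_distrib[symmetric])
  have ex: "exp (- real n * (R k)\<^sup>2 / 100) \<le> x ^ Suc k" for k
  proof -
    have "real (Suc k) \<le> 4 ^ k" by (induction k) auto
    then have "real n * E\<^sup>2 / 25 * real (Suc k) \<le> real n * E\<^sup>2 / 25 * 4 ^ k" by (intro mult_left_mono) auto
    then have "- real n * (R k)\<^sup>2 / 100 \<le> real (Suc k) * (- real n * E\<^sup>2 / 25)" unfolding pw by (simp add: mult_ac)
    then have "exp (- real n * (R k)\<^sup>2 / 100) \<le> exp (real (Suc k) * (- real n * E\<^sup>2 / 25))" by (simp only: exp_le_cancel_iff)
    then show ?thesis unfolding exp_of_nat_mult x_def .
  qed
  show thesis
  proof (rule that[of "\<lambda>X. \<Sum>k. V k X"])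
    show "(\<lambda>X. \<Sum>k. V k X) \<in> borel_measurable \<X>" using V(1) by measurable
    have "(\<integral>\<^sup>+ X. (\<Sum>k. V k X) \<partial>\<X>) = (\<Sum>k. \<integral>\<^sup>+ X. V k X \<partial>\<X>)" by (rule nn_integral_suminf[OF V(1)])
    also have "\<dots> \<le> (\<Sum>k. ennreal (17 ^ card J * x ^ Suc k))"
    proof (intro suminf_le allI summableI)
      fix k
      have "ennreal (17 ^ card J * exp (- real n * (R k)\<^sup>2 / 100)) \<le> ennreal (17 ^ card J * x ^ Suc k)"
        by (intro ennreal_leI mult_left_mono ex) auto
      then show "(\<integral>\<^sup>+ X. V k X \<partial>\<X>) \<le> ennreal (17 ^ card J * x ^ Suc k)" using V(2)[of k] by (rule order.trans[rotated])
    qed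
    also have "\<dots> = ennreal (\<Sum>k. 17 ^ card J * x * x ^ k)"
      using x by (subst suminf_ennreal2) (auto intro!: summable_mult summable_geometric simp: mult.assoc)
    also have "(\<Sum>k. 17 ^ card J * x * x ^ k) = 17 ^ card J * (x / (1 - x))"
      using x by (subst suminf_mult) (auto intro!: summable_geometric simp: suminf_geometric)
    finally show "(\<integral>\<^sup>+ X. (\<Sum>k. V k X) \<partial>\<X>) \<le> ennreal (17 ^ card J * (exp (- real n * E\<^sup>2 / 25) / (1 - exp (- real n * E\<^sup>2 / 25))))"
      unfolding x_def .
  next
    fix a X assume a: "a \<in> space \<Lambda>" "near \<delta> a" "E\<^sup>2 \<le> Q a" "(\<Sum>v\<in>J. (a v)\<^sup>2) \<le> C * Q a" and X: "X \<in> space \<X>"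
    obtain m where m: "Q a / E\<^sup>2 < 4 ^ m" using real_arch_pow[of 4 "Q a / E\<^sup>2"] by auto
    define k where "k = (LEAST k. Q a < 4 ^ Suc k * E\<^sup>2)"
    have "Q a < 4 ^ m * E\<^sup>2" using m E by (simp add: divide_less_eq)
    also have "\<dots> \<le> 4 ^ Suc m * E\<^sup>2" by simp
    finally have k: "Q a < 4 ^ Suc k * E\<^sup>2" unfolding k_def by (rule LeastI)
    have "4 ^ k * E\<^sup>2 \<le> Q a"
    proof (cases k)
      case 0 then show ?thesis using a(3) by simp
    next
      case (Suc l)
      then have "\<not> Q a < 4 ^ Suc l * E\<^sup>2" using not_less_Least[of l "\<lambda>k. Q a < 4 ^ Suc k * E\<^sup>2"] unfolding k_def by simp
      then show ?thesis using Suc by simp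
    qed
    then have "ennreal (H a X) \<le> V k X" using k a X by (intro V(3)) (auto simp: pw)
    also have "\<dots> \<le> (\<Sum>k. V k X)" using sum_le_suminf[of "\<lambda>k. V k X" "{k}"] by (auto intro: summableI)
    finally show "ennreal (H a X) \<le> (\<Sum>k. V k X)" .
  qed
qed

end

section \<open>The prior as a product over blocks\<close>

lemma floor_grid_tendsto: "(\<lambda>k. real_of_int \<lfloor>real (Suc k) * x\<rfloor> / real (Suc k)) \<longlonglongrightarrow> x"
proof -
  have "(\<lambda>k. x - real_of_int \<lfloor>real (Suc k) * x\<rfloor> / real (Suc k)) \<longlonglongrightarrow> 0"
  proof (rule Lim_null_comparison)
    show "\<forall>\<^sub>F k in sequentially. norm (x - real_of_int \<lfloor>real (Suc k) * x\<rfloor> / real (Suc k)) \<le> inverse (real (Suc k))"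
    proof (intro always_eventually allI)
      fix k
      have "x - real_of_int \<lfloor>real (Suc k) * x\<rfloor> / real (Suc k) = (real (Suc k) * x - real_of_int \<lfloor>real (Suc k) * x\<rfloor>) / real (Suc k)"
        by (simp add: diff_divide_distrib)
      moreover have "0 \<le> real (Suc k) * x - real_of_int \<lfloor>real (Suc k) * x\<rfloor>" "real (Suc k) * x - real_of_int \<lfloor>real (Suc k) * x\<rfloor> \<le> 1"
        by linarith+
      ultimately show "norm (x - real_of_int \<lfloor>real (Suc k) * x\<rfloor> / real (Suc k)) \<le> inverse (real (Suc k))"
        by (simp add: divide_inverse mult_left_le_one_le del: of_nat_Suc)
    qed
    show "(\<lambda>k. inverse (real (Suc k))) \<longlonglongrightarrow> 0" by (rule LIMSEQ_inverse_real_of_nat)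
  qed
  from tendsto_diff[OF tendsto_const[of x] this] show ?thesis by simp
qed

text \<open>Parameters are measurable through evaluations at fixed points, while the likelihood
  evaluates them at the random observations. By continuity the random point may be rounded to a
  grid, where finitely many fixed evaluations suffice.\<close>

lemma evaluation_measurable:
  fixes N :: "'b measure"
  assumes f: "\<And>t. t \<in> {0..1::real} \<Longrightarrow> (\<lambda>z. f z t) \<in> borel_measurable N"
    and c: "\<And>z. z \<in> space N \<Longrightarrow> continuous_on {0..1} (f z)"
    and x: "x \<in> borel_measurable N" "\<And>z. z \<in> space N \<Longrightarrow> x z \<in> {0..1}"
  shows "(\<lambda>z. f z (x z) :: real) \<in> borel_measurable N"
proof (rule borel_measurable_LIMSEQ_real)
  define q where "q k t = real_of_int \<lfloor>real (Suc k) * t\<rfloor> / real (Suc k)" for k t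
  define g where "g k z = (\<Sum>i\<le>Suc k. (if \<lfloor>real (Suc k) * x z\<rfloor> = int i then f z (real i / real (Suc k)) else 0))" for k z
  have g: "g k z = f z (q k (x z))" if z: "z \<in> space N" for k z
  proof -
    have fl: "0 \<le> \<lfloor>real (Suc k) * x z\<rfloor>" "\<lfloor>real (Suc k) * x z\<rfloor> \<le> int (Suc k)"
    proof -
      have "0 \<le> real (Suc k) * x z" "real (Suc k) * x z \<le> real (Suc k)" using x(2)[OF z] by (auto simp: mult_left_le)
      then show "0 \<le> \<lfloor>real (Suc k) * x z\<rfloor>" "\<lfloor>real (Suc k) * x z\<rfloor> \<le> int (Suc k)" by - linarith+
    qed
    define j where "j = nat \<lfloor>real (Suc k) * x z\<rfloor>"
    have j: "\<lfloor>real (Suc k) * x z\<rfloor> = int j" "j \<le> Suc k" using fl by (auto simp: j_def)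
    have "g k z = (\<Sum>i\<le>Suc k. if i = j then f z (real i / real (Suc k)) else 0)"
      unfolding g_def j(1) by (intro sum.cong) auto
    also have "\<dots> = f z (real j / real (Suc k))" using j(2) by (subst sum.delta) auto
    finally show ?thesis unfolding q_def j(1) by simp
  qed
  show "(\<lambda>k. g k z) \<longlonglongrightarrow> f z (x z)" if z: "z \<in> space N" for z
  proof -
    have "(\<lambda>k. f z (q k (x z))) \<longlonglongrightarrow> f z (x z)"
    proof (rule continuous_on_tendsto_compose[OF c[OF z]])
      show "(\<lambda>k. q k (x z)) \<longlonglongrightarrow> x z" unfolding q_def by (rule floor_grid_tendsto)
      show "x z \<in> {0..1}" by (rule x(2)[OF z])
      show "\<forall>\<^sub>F k in sequentially. q k (x z) \<in> {0..1}"
      proof (intro always_eventually allI)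
        fix k
        have "0 \<le> real (Suc k) * x z" "real (Suc k) * x z \<le> real (Suc k)" using x(2)[OF z] by (auto simp: mult_left_le)
        then have "0 \<le> real_of_int \<lfloor>real (Suc k) * x z\<rfloor>" "real_of_int \<lfloor>real (Suc k) * x z\<rfloor> \<le> real (Suc k)"
          by (simp_all del: of_nat_Suc add: order.trans[OF of_int_floor_le])
        then show "q k (x z) \<in> {0..1}" by (simp add: q_def divide_le_eq)
      qed
    qed
    then show ?thesis by (simp add: g[OF z])
  qed
  show "g k \<in> borel_measurable N" for k
  proof -
    have [measurable]: "(\<lambda>z. f z (real i / real (Suc k))) \<in> borel_measurable N" if "i \<le> Suc k" for i
      using that by (intro f) (auto simp: divide_le_eq)
    have [measurable]: "x \<in> borel_measurable N" by (rule x)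
    show ?thesis unfolding g_def by (intro borel_measurable_sum) (auto intro!: measurable_If)
  qed
qed

type_synonym sequence = "nat \<Rightarrow> real \<Rightarrow> real"

locale prior_model = enum l0 w M "\<lambda>x. exp (L x)" D \<sigma> J0 e
  for l0 :: nat and w :: "nat \<times> nat \<Rightarrow> real \<Rightarrow> real" and M :: real and L :: "real \<Rightarrow> real" and D \<sigma> :: real and J0 :: nat
    and e :: "nat \<Rightarrow> nat \<times> nat" +
  fixes \<Pi>0 :: "sequence measure"
  assumes L_continuous: "continuous_on {0..1} L"
    and prior: "is_prior w L (block l0 J0 e) \<Pi>0" and indep: "indep_blocks w L (block l0 J0 e) \<Pi>0"
begin

abbreviation B :: "nat \<Rightarrow> (nat \<times> nat) set" where "B \<equiv> block l0 J0 e"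

definition blocks :: "nat set \<Rightarrow> sequence measure" where
  "blocks K = (\<Pi>\<^sub>M m\<in>K. block_space w L (B m))"

abbreviation target :: "(nat set \<Rightarrow> nat \<Rightarrow> real) \<Rightarrow> nat set \<Rightarrow> real \<Rightarrow> sequence set" where
  "target H I \<delta> \<equiv> C_star w L B \<delta> \<inter> S_set w L B H I"

lemma exp_L_measurable [measurable]: "(\<lambda>x. exp (L x)) \<in> borel_measurable unit_leb"
  by (intro measurable_unit_leb_cont continuous_intros L_continuous)

lemma space_P [simp]: "space (P L) = {0..1}" by (simp add: P_def)

lemma sets_P [measurable_cong, simp]: "sets (P L) = sets unit_leb" by (simp add: P_def)

lemma measurable_P_continuous: "continuous_on {0..1} f \<Longrightarrow> (f :: real \<Rightarrow> real) \<in> borel_measurable (P L)"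
  using measurable_unit_leb_cont[of f] by (simp cong: measurable_cong_sets)

lemma id_measurable_P: "(\<lambda>x. x) \<in> borel_measurable (P L)"
  by (intro measurable_P_continuous continuous_intros)

lemma EL_eq: "f \<in> borel_measurable unit_leb \<Longrightarrow> EL L f = (LINT x|unit_leb. f x * exp (L x))"
  unfolding EL_def P_def by (subst integral_density) (auto simp: mult.commute)

lemma EL_eq': "f \<in> borel_measurable (P L) \<Longrightarrow> (LINT x|P L. f x) = (LINT x|unit_leb. f x * exp (L x))"
  using EL_eq[of f] by (simp add: EL_def cong: measurable_cong_sets)

sublocale P: prob_space "P L"
proof (rule prob_spaceI)
  have "emeasure (P L) (space (P L)) = (\<integral>\<^sup>+ x. ennreal (exp (L x)) \<partial>unit_leb)"
    unfolding P_def by (subst emeasure_density) (auto intro!: nn_integral_cong simp: space_unit_leb[symmetric] simp del: space_unit_leb)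
  also have "\<dots> = ennreal (LINT x|unit_leb. exp (L x))"
    by (rule nn_integral_eq_integral) (auto intro!: integrable_unit_leb_cont continuous_intros L_continuous)
  finally show "emeasure (P L) (space (P L)) = 1" by (simp add: p_int)
qed

lemma AE_P_iff: "(AE x in P L. Q x) \<longleftrightarrow> (AE x in unit_leb. Q x)"
  unfolding P_def by (subst AE_density) auto

lemma mean_eq: "v \<in> wav_index l0 \<Longrightarrow> mean v = EL L (w v)"
  by (simp add: EL_eq w_measurable mean_def)

lemma space_block:
  assumes "f \<in> space (block_space w L (B m))"
  shows "in_block m f"
proof -
  obtain a where f: "f = (\<lambda>x\<in>{0..1}. (\<Sum>v\<in>B m. a v * (w v x - EL L (w v))))"
    using assms by (auto simp: block_space_def space_restrict_space)
  have "f x = (\<Sum>v\<in>B m. a v * cw v x)" if "x \<in> {0..1}" for x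
    using that block_subset(1)[of m] unfolding f cw_def by (auto intro!: sum.cong simp: mean_eq)
  then show ?thesis unfolding in_block_def by blast
qed

lemma block_eval [measurable]:
  assumes "t \<in> {0..1}"
  shows "(\<lambda>f. f t) \<in> borel_measurable (block_space w L (B m))"
  unfolding block_space_def by (intro measurable_restrict_space1 measurable_component_singleton assms)

lemma prior_prob: "prob_space \<Pi>0" and space_prior: "space \<Pi>0 = admissible w L B"
  using prior by (auto simp: is_prior_def)

sublocale \<Pi>: prob_space \<Pi>0 by (rule prior_prob)

lemma space_blocks: "F \<in> space (blocks K) \<Longrightarrow> m \<in> K \<Longrightarrow> in_block m (F m)"
  unfolding blocks_def space_PiM by (auto intro: space_block)

lemma prior_blocks: "F \<in> space \<Pi>0 \<Longrightarrow> F \<in> space (blocks UNIV)"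
  unfolding space_prior admissible_def param_space_def blocks_def by auto

lemma in_block_prior: "F \<in> space \<Pi>0 \<Longrightarrow> in_block m (F m)"
  using space_blocks[OF prior_blocks] by simp

lemma restrict_measurable [measurable]: "(\<lambda>F. restrict F K) \<in> measurable \<Pi>0 (blocks K)"
proof -
  have "prob_space.indep_var \<Pi>0 (blocks K) (\<lambda>F. restrict F K) (blocks (- K)) (\<lambda>F. restrict F (- K))"
    using indep unfolding indep_blocks_def blocks_def by blast
  then show ?thesis using \<Pi>.indep_var_rv1 by blast
qed

lemma blocks_eval:
  assumes F: "F \<in> measurable N (blocks K)" and m: "m \<in> K" and x: "x \<in> measurable N (P L)"
  shows "(\<lambda>z. F z m (x z)) \<in> borel_measurable N"
proof (rule evaluation_measurable[where f = "\<lambda>z. F z m" and x = x])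
  have c: "(\<lambda>z. F z m) \<in> measurable N (block_space w L (B m))"
    using measurable_compose[OF F[unfolded blocks_def] measurable_component_singleton[OF m]] .
  show "(\<lambda>z. F z m t) \<in> borel_measurable N" if "t \<in> {0..1}" for t
    by (rule measurable_compose[OF c block_eval[OF that]])
  show "continuous_on {0..1} (F z m)" if "z \<in> space N" for z
    by (rule in_block_continuous[OF space_blocks[OF measurable_space[OF F that] m]])
  show "x \<in> borel_measurable N" using measurable_compose[OF x id_measurable_P] by simp
  show "x z \<in> {0..1}" if "z \<in> space N" for z using measurable_space[OF x that] by simp
qed

lemma norm2_eq: "(norm2 f) = sqrt (LINT x|unit_leb. f x * f x)" by (simp add: norm2_def ip_def)

lemma id_unit_P: "(\<lambda>x. x) \<in> measurable unit_leb (P L)"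
  by (simp cong: measurable_cong_sets)

lemma norm2_measurable:
  assumes F: "F \<in> measurable N (blocks K)" and m: "m \<in> K"
  shows "(\<lambda>z. norm2 (F z m)) \<in> borel_measurable N"
proof -
  have "(\<lambda>z. F (fst z) m (snd z)) \<in> borel_measurable (N \<Otimes>\<^sub>M unit_leb)"
    by (rule blocks_eval[OF measurable_compose[OF measurable_fst F] m measurable_compose[OF measurable_snd id_unit_P]])
  then have "(\<lambda>(z, x). F z m x * F z m x) \<in> borel_measurable (N \<Otimes>\<^sub>M unit_leb)"
    by (simp add: case_prod_beta)
  then have "(\<lambda>z. LINT x|unit_leb. F z m x * F z m x) \<in> borel_measurable N"
    by (rule unit_leb.borel_measurable_lebesgue_integral)
  then show ?thesis unfolding norm2_eq by measurable
qed

lemma prior_id: "(\<lambda>F. F) \<in> measurable \<Pi>0 (blocks UNIV)"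
proof -
  have "(\<lambda>F. restrict F UNIV) = (\<lambda>F :: nat \<Rightarrow> real \<Rightarrow> real. F)" by (simp add: restrict_def)
  then show ?thesis using restrict_measurable[of UNIV] by simp
qed

lemma factorization:
  assumes g1: "g1 \<in> borel_measurable (blocks K)" and g2: "g2 \<in> borel_measurable (blocks (- K))"
  shows "(\<integral>\<^sup>+ F. g1 (restrict F K) * g2 (restrict F (- K)) \<partial>\<Pi>0)
    = (\<integral>\<^sup>+ F. g1 (restrict F K) \<partial>\<Pi>0) * (\<integral>\<^sup>+ F. g2 (restrict F (- K)) \<partial>\<Pi>0)"
proof -
  have iv: "prob_space.indep_var \<Pi>0 (blocks K) (\<lambda>F. restrict F K) (blocks (- K)) (\<lambda>F. restrict F (- K))"
    using indep unfolding indep_blocks_def blocks_def by blast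
  define M1 where "M1 = distr \<Pi>0 (blocks K) (\<lambda>F. restrict F K)"
  define M2 where "M2 = distr \<Pi>0 (blocks (- K)) (\<lambda>F. restrict F (- K))"
  have eq: "M1 \<Otimes>\<^sub>M M2 = distr \<Pi>0 (blocks K \<Otimes>\<^sub>M blocks (- K)) (\<lambda>F. (restrict F K, restrict F (- K)))"
    using iv unfolding \<Pi>.indep_var_distribution_eq M1_def M2_def by simp
  interpret M1: prob_space M1 unfolding M1_def by (rule \<Pi>.prob_space_distr) simp
  interpret M2: prob_space M2 unfolding M2_def by (rule \<Pi>.prob_space_distr) simp
  have [measurable_cong]: "sets M1 = sets (blocks K)" "sets M2 = sets (blocks (- K))" by (auto simp: M1_def M2_def)
  note [measurable] = g1 g2
  have "(\<integral>\<^sup>+ F. g1 (restrict F K) * g2 (restrict F (- K)) \<partial>\<Pi>0) = (\<integral>\<^sup>+ z. g1 (fst z) * g2 (snd z) \<partial>(M1 \<Otimes>\<^sub>M M2))"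
    unfolding eq by (subst nn_integral_distr) auto
  also have "\<dots> = (\<integral>\<^sup>+ x. \<integral>\<^sup>+ y. g1 x * g2 y \<partial>M2 \<partial>M1)"
    by (subst M2.nn_integral_fst[symmetric]) auto
  also have "\<dots> = (\<integral>\<^sup>+ x. g1 x * (\<integral>\<^sup>+ y. g2 y \<partial>M2) \<partial>M1)"
    by (intro nn_integral_cong nn_integral_cmult) simp
  also have "\<dots> = (\<integral>\<^sup>+ x. g1 x \<partial>M1) * (\<integral>\<^sup>+ y. g2 y \<partial>M2)" by (rule nn_integral_multc) simp
  also have "(\<integral>\<^sup>+ x. g1 x \<partial>M1) = (\<integral>\<^sup>+ F. g1 (restrict F K) \<partial>\<Pi>0)" unfolding M1_def by (rule nn_integral_distr) auto
  also have "(\<integral>\<^sup>+ y. g2 y \<partial>M2) = (\<integral>\<^sup>+ F. g2 (restrict F (- K)) \<partial>\<Pi>0)" unfolding M2_def by (rule nn_integral_distr) auto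
  finally show ?thesis .
qed

lemma A_event_measurable: "A_event \<Pi>0 H I \<in> sets \<Pi>0"
proof -
  have [measurable]: "(\<lambda>F. norm2 (F m)) \<in> borel_measurable \<Pi>0" for m by (rule norm2_measurable[OF prior_id]) simp
  have "A_event \<Pi>0 H I = {F \<in> space \<Pi>0. \<forall>m. m \<in> I \<longrightarrow> norm2 (F m) > H I m}" by (auto simp: A_event_def)
  then show ?thesis by simp
qed

definition SI :: "nat set \<Rightarrow> sequence \<Rightarrow> real \<Rightarrow> real" where
  "SI I F x = (\<Sum>m\<in>I. F m x)"

definition QI :: "nat set \<Rightarrow> sequence \<Rightarrow> real" where
  "QI I F = (LINT x|P L. (SI I F x)\<^sup>2)"

lemma SI_continuous: "(\<And>m. m \<in> I \<Longrightarrow> in_block m (F m)) \<Longrightarrow> continuous_on {0..1} (SI I F)"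
  unfolding SI_def by (intro continuous_intros in_block_continuous)

lemma SI_measurable:
  assumes "F \<in> measurable N (blocks K)" "I \<subseteq> K" "x \<in> measurable N (P L)"
  shows "(\<lambda>z. SI I (F z) (x z)) \<in> borel_measurable N"
  unfolding SI_def using assms(2) by (intro borel_measurable_sum blocks_eval[OF assms(1) _ assms(3)]) auto

lemma QI_measurable:
  assumes "F \<in> measurable N (blocks K)" "I \<subseteq> K"
  shows "(\<lambda>z. QI I (F z)) \<in> borel_measurable N"
proof -
  have [measurable]: "(\<lambda>z. SI I (F (fst z)) (snd z)) \<in> borel_measurable (N \<Otimes>\<^sub>M P L)"
    by (rule SI_measurable[OF measurable_compose[OF measurable_fst assms(1)] assms(2) measurable_snd])
  show ?thesis unfolding QI_def by (rule P.borel_measurable_lebesgue_integral) (simp add: case_prod_beta)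
qed

text \<open>For finite \<open>I\<close> the partial sums are eventually constant, so the
  \<open>L2\<close> limit is the finite sum up to a null set.\<close>

lemma series_sum_finite:
  assumes I: "finite I" and F: "\<And>m. m \<in> I \<Longrightarrow> in_block m (F m)"
  shows "series_sum L I F g \<longleftrightarrow> g \<in> borel_measurable (P L) \<and> (AE x in P L. g x = SI I F x)"
proof -
  have [measurable]: "SI I F \<in> borel_measurable (P L)" by (intro measurable_P_continuous SI_continuous F)
  obtain N where N: "\<And>m. m \<in> I \<Longrightarrow> m < N" using I unfolding finite_nat_set_iff_bounded by auto
  have ev: "\<forall>\<^sub>F M in sequentially. (\<integral>\<^sup>+ x. ennreal (((\<Sum>m\<in>I \<inter> {..<M}. F m x) - g x)\<^sup>2) \<partial>P L) = (\<integral>\<^sup>+ x. ennreal ((SI I F x - g x)\<^sup>2) \<partial>P L)"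
    unfolding eventually_sequentially
  proof (intro exI[of _ N] allI impI)
    fix M assume "M \<ge> N"
    then have "I \<inter> {..<M} = I" using N by force
    then show "(\<integral>\<^sup>+ x. ennreal (((\<Sum>m\<in>I \<inter> {..<M}. F m x) - g x)\<^sup>2) \<partial>P L) = (\<integral>\<^sup>+ x. ennreal ((SI I F x - g x)\<^sup>2) \<partial>P L)"
      by (simp add: SI_def)
  qed
  have A: "(\<lambda>M. \<integral>\<^sup>+ x. ennreal (((\<Sum>m\<in>I \<inter> {..<M}. F m x) - g x)\<^sup>2) \<partial>P L) \<longlonglongrightarrow> 0 \<longleftrightarrow> (\<integral>\<^sup>+ x. ennreal ((SI I F x - g x)\<^sup>2) \<partial>P L) = 0"
    unfolding tendsto_cong[OF ev] by (simp add: tendsto_const_iff)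
  have B: "(\<integral>\<^sup>+ x. ennreal ((SI I F x - g x)\<^sup>2) \<partial>P L) = 0 \<longleftrightarrow> (AE x in P L. g x = SI I F x)" if [measurable]: "g \<in> borel_measurable (P L)"
    by (subst nn_integral_0_iff_AE) (auto simp: ennreal_eq_0_iff elim!: eventually_mono)
  show ?thesis
  proof (cases "g \<in> borel_measurable (P L)")
    case True
    show ?thesis unfolding series_sum_def A B[OF True] ..
  qed (simp add: series_sum_def)
qed

lemma SI_square_integrable:
  assumes "\<And>m. m \<in> I \<Longrightarrow> in_block m (F m)"
  shows "integrable (P L) (\<lambda>x. (SI I F x)\<^sup>2)"
proof -
  have c: "continuous_on {0..1} (\<lambda>x. (SI I F x)\<^sup>2)" by (intro continuous_intros SI_continuous assms)
  then obtain b where "\<And>x. x \<in> {0..1} \<Longrightarrow> \<bar>(SI I F x)\<^sup>2\<bar> \<le> b" by (rule continuous_bounded_unit) blast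
  then show ?thesis by (intro P.integrable_const_bound[of _ b] measurable_P_continuous c) auto
qed

lemma second_moment_finite:
  assumes I: "finite I" and F: "\<And>m. m \<in> I \<Longrightarrow> in_block m (F m)"
  shows "second_moment L I F = ennreal (QI I F)"
proof -
  have eq: "(\<integral>\<^sup>+ x. ennreal ((SI I F x)\<^sup>2) \<partial>P L) = ennreal (QI I F)"
    unfolding QI_def by (rule nn_integral_eq_integral[OF SI_square_integrable[OF F]]) auto
  have S: "SI I F \<in> borel_measurable (P L)" by (intro measurable_P_continuous SI_continuous F)
  have each: "(\<integral>\<^sup>+ x. ennreal ((g x)\<^sup>2) \<partial>P L) = ennreal (QI I F)" if "series_sum L I F g" for g
  proof -
    have "AE x in P L. g x = SI I F x" using that series_sum_finite[OF I F] by auto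
    then have "AE x in P L. ennreal ((g x)\<^sup>2) = ennreal ((SI I F x)\<^sup>2)" by eventually_elim simp
    then show ?thesis unfolding eq[symmetric] by (rule nn_integral_cong_AE)
  qed
  have "series_sum L I F (SI I F)" by (subst series_sum_finite[OF I F]) (use S in auto)
  then have "{g. series_sum L I F g} \<noteq> {}" by blast
  then show ?thesis unfolding second_moment_def by (rule INF_eq_const) (use each in auto)
qed

text \<open>All versions in the infimum agree almost everywhere, and for the continuous one an
  essential bound holds at every point.\<close>

lemma sup_norm_finite:
  assumes I: "finite I" and F: "\<And>m. m \<in> I \<Longrightarrow> in_block m (F m)" and s: "sup_norm L I F \<le> ereal \<delta>" and x: "x \<in> {0..1}"
  shows "\<bar>SI I F x\<bar> \<le> \<delta>"
proof -
  have S: "SI I F \<in> borel_measurable (P L)" by (intro measurable_P_continuous SI_continuous F)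
  have "esssup (P L) (\<lambda>x. ereal \<bar>SI I F x\<bar>) \<le> sup_norm L I F"
    unfolding sup_norm_def
  proof (rule INF_greatest)
    fix g assume "g \<in> {g. series_sum L I F g}"
    then have g: "g \<in> borel_measurable (P L)" "AE x in P L. g x = SI I F x" using series_sum_finite[OF I F] by auto
    show "esssup (P L) (\<lambda>x. ereal \<bar>SI I F x\<bar>) \<le> esssup (P L) (\<lambda>x. ereal \<bar>g x\<bar>)"
      by (rule esssup_AE_mono) (use g S in auto)
  qed
  then have le: "esssup (P L) (\<lambda>x. ereal \<bar>SI I F x\<bar>) \<le> ereal \<delta>" using s by (rule order.trans)
  have "AE x in P L. ereal \<bar>SI I F x\<bar> \<le> ereal \<delta>"
    using esssup_AE[of "\<lambda>x. ereal \<bar>SI I F x\<bar>" "P L"]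
  proof eventually_elim
    case (elim x) show ?case by (rule order.trans[OF elim le])
  qed
  then have "AE x in unit_leb. \<delta> - \<bar>SI I F x\<bar> \<ge> 0" unfolding AE_P_iff by auto
  then have "\<delta> - \<bar>SI I F x\<bar> \<ge> 0"
    by (rule AE_unit_leb_continuous_nonneg[OF _ _ x]) (intro continuous_intros SI_continuous F)
  then show ?thesis by simp
qed

end

section \<open>Contraction\<close>

text \<open>\<open>T\<close> plays the inactive part here. Expanding \<open>exp (S x)\<close> to
  second order under the weight \<open>exp (T x)\<close> gives a linear term of size
  \<open>u\<close>, the bias, and a quadratic term close to \<open>q / 2\<close>. The inequality
  \<open>ln z \<le> z - 1\<close>, for the ratio of the two means and for its inverse, yields the
  two directions.\<close>

lemma (in prob_space) log_ratio_bounds: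
  fixes S T :: "'a \<Rightarrow> real"
  assumes S [measurable]: "S \<in> borel_measurable M" and T [measurable]: "T \<in> borel_measurable M"
    and b: "\<And>x. x \<in> space M \<Longrightarrow> \<bar>S x\<bar> \<le> \<delta>" "\<And>x. x \<in> space M \<Longrightarrow> \<bar>T x\<bar> \<le> \<delta>" and \<delta>: "\<delta> \<le> 1/100"
  defines "u \<equiv> \<bar>expectation (\<lambda>x. S x * exp (T x))\<bar>" and "q \<equiv> expectation (\<lambda>x. (S x)\<^sup>2)"
  defines "r \<equiv> ln (expectation (\<lambda>x. exp (S x + T x))) - ln (expectation (\<lambda>x. exp (T x)))"
  shows "(1/2 - 2 * \<delta>) * q - 2 * u \<le> r" "r \<le> 2 * u + 2 * q"
proof -
  have \<delta>0: "\<delta> \<ge> 0"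
  proof -
    obtain x where "x \<in> space M" using not_empty by blast
    then show ?thesis using b(1)[of x] by linarith
  qed
  have bd: "integrable M f" if "f \<in> borel_measurable M" "\<And>x. x \<in> space M \<Longrightarrow> \<bar>f x\<bar> \<le> B" for f :: "'a \<Rightarrow> real" and B
    by (rule integrable_const_bound[of _ B]) (use that in auto)
  have eT: "exp (T x) \<le> exp \<delta>" "exp (- \<delta>) \<le> exp (T x)" if "x \<in> space M" for x using b(2)[OF that] by auto
  have eS: "exp (S x + T x) \<le> exp (2 * \<delta>)" "exp (- 2 * \<delta>) \<le> exp (S x + T x)" if "x \<in> space M" for x
    using b(1)[OF that] b(2)[OF that] by auto
  have s2: "(S x)\<^sup>2 \<le> \<delta>\<^sup>2" if "x \<in> space M" for x using b(1)[OF that] \<delta>0 by (metis abs_le_square_iff abs_of_nonneg)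
  have i1: "integrable M (\<lambda>x. exp (T x))" by (rule bd[of _ "exp \<delta>"]) (use eT in auto)
  have i2: "integrable M (\<lambda>x. exp (S x + T x))" by (rule bd[of _ "exp (2 * \<delta>)"]) (use eS in auto)
  have i3: "integrable M (\<lambda>x. S x * exp (T x))"
    by (rule bd[of _ "\<delta> * exp \<delta>"]) (use b eT \<delta>0 in \<open>auto simp: abs_mult intro!: mult_mono\<close>)
  have i4: "integrable M (\<lambda>x. (S x)\<^sup>2 * exp (T x))"
    by (rule bd[of _ "\<delta>\<^sup>2 * exp \<delta>"]) (use s2 eT in \<open>auto simp: abs_mult intro!: mult_mono\<close>)
  have i5: "integrable M (\<lambda>x. (S x)\<^sup>2)" by (rule bd[of _ "\<delta>\<^sup>2"]) (use s2 in auto)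
  define Zb where "Zb = expectation (\<lambda>x. exp (T x))"
  define Z where "Z = expectation (\<lambda>x. exp (S x + T x))"
  define v where "v = expectation (\<lambda>x. (S x)\<^sup>2 * exp (T x))"
  have lowexp: "1 - t \<le> exp (- t)" for t :: real using exp_ge_add_one_self[of "- t"] by simp
  have q0: "q \<ge> 0" unfolding q_def by (rule integral_nonneg_AE) auto
  have Zb: "exp (- \<delta>) \<le> Zb"
  proof -
    have "expectation (\<lambda>x. exp (- \<delta>)) \<le> Zb" unfolding Zb_def by (rule integral_mono[OF _ i1]) (use eT in auto)
    then show ?thesis by (simp add: prob_space)
  qed
  have Z: "exp (- 2 * \<delta>) \<le> Z" "Z \<le> exp (2 * \<delta>)"
  proof -
    have "expectation (\<lambda>x. exp (- 2 * \<delta>)) \<le> Z" unfolding Z_def by (rule integral_mono[OF _ i2]) (use eS in auto)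
    then show "exp (- 2 * \<delta>) \<le> Z" by (simp add: prob_space)
    have "Z \<le> expectation (\<lambda>x. exp (2 * \<delta>))" unfolding Z_def by (rule integral_mono[OF i2]) (use eS in auto)
    then show "Z \<le> exp (2 * \<delta>)" by (simp add: prob_space)
  qed
  have pos: "Zb > 0" "Z > 0" using Zb Z(1) exp_gt_zero less_le_trans by blast+
  have vb: "exp (- \<delta>) * q \<le> v" "v \<le> exp \<delta> * q"
  proof -
    have "expectation (\<lambda>x. exp (- \<delta>) * (S x)\<^sup>2) \<le> v" unfolding v_def
      by (rule integral_mono[OF _ i4]) (use i5 eT in \<open>auto simp: mult.commute[of "(S _)\<^sup>2"] intro!: mult_right_mono\<close>)
    then show "exp (- \<delta>) * q \<le> v" by (simp add: q_def)
    have "v \<le> expectation (\<lambda>x. exp \<delta> * (S x)\<^sup>2)" unfolding v_def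
      by (rule integral_mono[OF i4]) (use i5 eT in \<open>auto simp: mult.commute[of "(S _)\<^sup>2"] intro!: mult_right_mono\<close>)
    then show "v \<le> exp \<delta> * q" by (simp add: q_def)
  qed
  have v0: "v \<ge> 0" using vb(1) mult_nonneg_nonneg[OF _ q0, of "exp (- \<delta>)"] by auto
  define m where "m = expectation (\<lambda>x. S x * exp (T x))"
  have up: "Z \<le> Zb + m + (1 + \<delta>) / 2 * v"
  proof -
    have "Z \<le> expectation (\<lambda>x. exp (T x) + S x * exp (T x) + (1 + \<delta>) / 2 * ((S x)\<^sup>2 * exp (T x)))"
      unfolding Z_def
    proof (rule integral_mono[OF i2])
      fix x assume x: "x \<in> space M"
      have "exp (S x) * exp (T x) \<le> (1 + S x + (1 + \<delta>) / 2 * (S x)\<^sup>2) * exp (T x)"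
        using exp_taylor(1)[OF b(1)[OF x]] \<delta> by (intro mult_right_mono) auto
      then show "exp (S x + T x) \<le> exp (T x) + S x * exp (T x) + (1 + \<delta>) / 2 * ((S x)\<^sup>2 * exp (T x))"
        by (simp add: exp_add algebra_simps)
    qed (use i1 i3 i4 in auto)
    then show ?thesis using i1 i3 i4 by (simp add: Zb_def m_def v_def)
  qed
  have lo: "Zb + m + (1 - \<delta>) / 2 * v \<le> Z"
  proof -
    have "expectation (\<lambda>x. exp (T x) + S x * exp (T x) + (1 - \<delta>) / 2 * ((S x)\<^sup>2 * exp (T x))) \<le> Z"
      unfolding Z_def
    proof (rule integral_mono[OF _ i2])
      fix x assume x: "x \<in> space M"
      have "(1 + S x + (1 - \<delta>) / 2 * (S x)\<^sup>2) * exp (T x) \<le> exp (S x) * exp (T x)"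
        using exp_taylor(2)[OF b(1)[OF x]] \<delta> by (intro mult_right_mono) auto
      then show "exp (T x) + S x * exp (T x) + (1 - \<delta>) / 2 * ((S x)\<^sup>2 * exp (T x)) \<le> exp (S x + T x)"
        by (simp add: exp_add algebra_simps)
    qed (use i1 i3 i4 in auto)
    then show ?thesis using i1 i3 i4 by (simp add: Zb_def m_def v_def)
  qed
  have um: "\<bar>m\<bar> = u" by (simp add: u_def m_def)
  have inv2: "exp (2 * \<delta>) \<le> 2"
  proof -
    have "1/2 \<le> exp (- (2 * \<delta>))" using lowexp[of "2 * \<delta>"] \<delta> by linarith
    then show ?thesis by (simp add: exp_minus field_simps)
  qed
  have e1: "exp \<delta> \<le> 10/9"
  proof -
    have "9/10 \<le> exp (- \<delta>)" using lowexp[of \<delta>] \<delta> by linarith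
    then show ?thesis by (simp add: exp_minus field_simps)
  qed
  have r: "r = ln (Z / Zb)" using pos by (simp add: r_def Z_def Zb_def ln_div)
  show "r \<le> 2 * u + 2 * q"
  proof -
    have "r \<le> Z / Zb - 1" unfolding r using pos by (intro ln_le_minus_one) auto
    also have "\<dots> = (Z - Zb) / Zb" using pos by (simp add: diff_divide_distrib)
    also have "\<dots> \<le> (u + 101/200 * (10/9 * q)) / Zb"
    proof (rule divide_right_mono)
      have "(1 + \<delta>) / 2 * v \<le> 101/200 * (10/9 * q)"
      proof (rule mult_mono)
        show "v \<le> 10/9 * q" using vb(2) mult_right_mono[OF e1 q0] by linarith
      qed (use \<delta> \<delta>0 v0 in auto)
      then show "Z - Zb \<le> u + 101/200 * (10/9 * q)" using up um by linarith
    qed (use pos in simp)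
    also have "\<dots> = (u + 101/200 * (10/9 * q)) * (1 / Zb)" by simp
    also have "\<dots> \<le> (u + 101/200 * (10/9 * q)) * (10/9)"
    proof (rule mult_left_mono)
      have "1 / Zb \<le> 1 / exp (- \<delta>)" using Zb pos by (intro divide_left_mono) auto
      also have "\<dots> = exp \<delta>" by (simp add: exp_minus field_simps)
      finally show "1 / Zb \<le> 10/9" using e1 by linarith
    qed (use q0 in \<open>auto simp: u_def\<close>)
    also have "\<dots> \<le> 2 * u + 2 * q" using q0 by (simp add: u_def)
    finally show ?thesis .
  qed
  show "(1/2 - 2 * \<delta>) * q - 2 * u \<le> r"
  proof -
    have "ln (Zb / Z) \<le> Zb / Z - 1" using pos by (intro ln_le_minus_one) auto
    moreover have "ln (Zb / Z) = - r" using pos by (simp add: r ln_div)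
    moreover have "Zb / Z - 1 = - ((Z - Zb) / Z)" using pos by (simp add: diff_divide_distrib)
    ultimately have "(Z - Zb) / Z \<le> r" by simp
    moreover have "(1/2 - 2 * \<delta>) * q - 2 * u \<le> (Z - Zb) / Z"
    proof -
      have "(Z - Zb) / Z \<ge> ((1 - \<delta>) / 2 * v - u) / Z" using lo um pos by (intro divide_right_mono) auto
      moreover have "u / Z \<le> 2 * u"
      proof -
        have "1 / Z \<le> 1 / exp (- 2 * \<delta>)" using Z pos by (intro divide_left_mono) auto
        also have "\<dots> = exp (2 * \<delta>)" by (simp add: exp_minus field_simps)
        finally have "1 / Z \<le> 2" using inv2 by linarith
        from mult_left_mono[OF this, of u] show ?thesis by (simp add: u_def)
      qed
      moreover have "(1/2 - 2 * \<delta>) * q \<le> (1 - \<delta>) / 2 * v / Z"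
      proof -
        have "1 / exp (2 * \<delta>) \<le> 1 / Z" using Z pos by (intro divide_left_mono) auto
        then have z: "exp (- (2 * \<delta>)) \<le> 1 / Z" by (simp add: exp_minus field_simps)
        \<comment> \<open>The loss \<open>exp (- (3 * \<delta>))\<close> is made up of
          \<open>exp (- \<delta>)\<close> from the weight and \<open>exp (- (2 * \<delta>))\<close>
          from dividing by \<open>Z\<close>.\<close>
        have "(1/2 - 2 * \<delta>) * q \<le> ((1 - \<delta>) / 2 * (1 - 3 * \<delta>)) * q"
        proof (rule mult_right_mono[OF _ q0])
          have "0 \<le> 3/2 * (\<delta> * \<delta>)" using \<delta>0 by simp
          then show "1/2 - 2 * \<delta> \<le> (1 - \<delta>) / 2 * (1 - 3 * \<delta>)" by (simp add: algebra_simps diff_divide_distrib add_divide_distrib)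
        qed
        also have "\<dots> \<le> ((1 - \<delta>) / 2 * exp (- (3 * \<delta>))) * q"
          using lowexp[of "3 * \<delta>"] \<delta> by (intro mult_right_mono[OF _ q0] mult_left_mono) auto
        also have "\<dots> = (1 - \<delta>) / 2 * ((exp (- \<delta>) * q) * exp (- (2 * \<delta>)))"
          by (simp add: exp_add[symmetric])
        also have "\<dots> \<le> (1 - \<delta>) / 2 * (v * (1 / Z))"
          using \<delta> vb(1) z q0 v0 by (intro mult_left_mono[OF mult_mono]) auto
        finally show ?thesis by simp
      qed
      ultimately show ?thesis by (simp add: diff_divide_distrib)
    qed
    ultimately show ?thesis by linarith
  qed
qed

text \<open>\<open>high\<close> and \<open>low\<close> are what the rates provide, with
  \<open>h\<close> for the inactive thresholds; through them \<open>jn\<close>,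
  \<open>\<Gamma>\<close> and \<open>\<xi>\<close> disappear from the contraction argument.\<close>

locale contraction = prior_model l0 w M L D \<sigma> J0 e \<Pi>0
  for l0 :: nat and w :: "nat \<times> nat \<Rightarrow> real \<Rightarrow> real" and M :: real and L :: "real \<Rightarrow> real" and D \<sigma> :: real and J0 :: nat
    and e :: "nat \<Rightarrow> nat \<times> nat" and \<Pi>0 :: "sequence measure" +
  fixes H :: "nat set \<Rightarrow> nat \<Rightarrow> real" and I :: "nat set" and h :: "nat \<Rightarrow> real" and \<gamma> \<delta> C :: real and n :: nat
  assumes I: "finite I" "I \<noteq> {}" and \<delta>: "0 < \<delta>" "\<delta> \<le> 1/100" and n: "n \<ge> 1" and C: "C \<ge> 0"
    and H_nonneg: "\<And>m. H I m \<ge> 0"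
    and H_off: "\<And>m. m \<notin> I \<Longrightarrow> H I m = h (level J0 e m)"
    and h_nonneg: "\<And>i. h i \<ge> 0" and h_decay: "\<And>i. J0 \<le> i \<Longrightarrow> h i \<le> \<gamma> * 2 powr (- (\<sigma> + 1/2) * real i)"
    and high: "\<And>m N. m \<in> I \<Longrightarrow> m \<ge> 1 \<Longrightarrow> amp \<gamma> * Q_high h N (fst (e m)) \<le> C * \<delta> * (H I m + 1 / sqrt (real n))"
    and low: "\<And>N. 0 \<in> I \<Longrightarrow> amp \<gamma> * (2 powr (real J0 / 2) * Q_low h N) \<le> C * \<delta> * (H I 0 + 1 / sqrt (real n))"
begin

definition Sb :: "sequence \<Rightarrow> real \<Rightarrow> real" where
  "Sb F x = (\<Sum>m. if m \<in> I then 0 else F m x)"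

text \<open>What the target set requires of the inactive coordinates. Rational points and partial
  sums make it a countable, hence measurable condition; continuity recovers the remaining
  points.\<close>

definition Wset :: "sequence \<Rightarrow> bool" where
  "Wset F \<longleftrightarrow> (\<forall>m\<in>- I. norm2 (F m) \<le> H I m) \<and> (\<forall>x\<in>{0..1} \<inter> \<rat>. \<forall>N. (\<Sum>m\<in>{..<N} - I. \<bar>F m x\<bar>) \<le> \<delta>)"

lemma rational_extend:
  assumes c: "continuous_on {0..1::real} (f :: real \<Rightarrow> real)" and le: "\<And>x. x \<in> {0..1} \<inter> \<rat> \<Longrightarrow> f x \<le> b" and x: "x \<in> {0..1}"
  shows "f x \<le> b"
proof (rule LIMSEQ_le_const2)
  define q where "q k = real_of_int \<lfloor>real (Suc k) * x\<rfloor> / real (Suc k)" for k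
  have q01: "q k \<in> {0..1}" for k
  proof -
    have "0 \<le> real (Suc k) * x" "real (Suc k) * x \<le> real (Suc k)" using x by (auto simp: mult_left_le)
    then have "0 \<le> real_of_int \<lfloor>real (Suc k) * x\<rfloor>" "real_of_int \<lfloor>real (Suc k) * x\<rfloor> \<le> real (Suc k)"
      by (simp_all del: of_nat_Suc add: order.trans[OF of_int_floor_le])
    then show ?thesis by (simp add: q_def divide_le_eq)
  qed
  show "(\<lambda>k. f (q k)) \<longlonglongrightarrow> f x"
    by (rule continuous_on_tendsto_compose[OF c _ x]) (use q01 floor_grid_tendsto[of x] in \<open>auto simp: q_def\<close>)
  have "q k \<in> \<rat>" for k by (simp add: q_def del: of_nat_Suc)
  then show "\<exists>N. \<forall>k\<ge>N. f (q k) \<le> b" using le q01 by blast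
qed

lemma Wset_all:
  assumes F: "\<And>m. m \<notin> I \<Longrightarrow> in_block m (F m)" and W: "Wset F" and x: "x \<in> {0..1}"
  shows "(\<Sum>m\<in>{..<N} - I. \<bar>F m x\<bar>) \<le> \<delta>"
proof (rule rational_extend[OF _ _ x, where f = "\<lambda>x. \<Sum>m\<in>{..<N} - I. \<bar>F m x\<bar>"])
  show "continuous_on {0..1} (\<lambda>x. \<Sum>m\<in>{..<N} - I. \<bar>F m x\<bar>)"
    by (intro continuous_intros in_block_continuous[OF F]) auto
  show "(\<Sum>m\<in>{..<N} - I. \<bar>F m x\<bar>) \<le> \<delta>" if "x \<in> {0..1} \<inter> \<rat>" for x
    using W that unfolding Wset_def by blast
qed

lemma Sb_facts:
  assumes F: "\<And>m. m \<notin> I \<Longrightarrow> in_block m (F m)" and W: "Wset F" and x: "x \<in> {0..1}"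
  shows "summable (\<lambda>m. if m \<in> I then 0 else F m x)" "(\<lambda>N. \<Sum>m\<in>{..<N} - I. F m x) \<longlonglongrightarrow> Sb F x" "\<bar>Sb F x\<bar> \<le> \<delta>"
proof -
  have eq: "(\<Sum>m<N. if m \<in> I then 0 else g (F m x)) = (\<Sum>m\<in>{..<N} - I. g (F m x))" for N and g :: "real \<Rightarrow> real"
    by (rule sum.mono_neutral_cong_right) auto
  have "summable (\<lambda>m. \<bar>if m \<in> I then 0 else F m x\<bar>)"
  proof (rule bounded_imp_summable[of _ \<delta>])
    fix N
    have "(\<Sum>m\<le>N. \<bar>if m \<in> I then 0 else F m x\<bar>) = (\<Sum>m<Suc N. if m \<in> I then 0 else \<bar>F m x\<bar>)"
      unfolding lessThan_Suc_atMost by (intro sum.cong) auto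
    also have "\<dots> \<le> \<delta>" unfolding eq using Wset_all[OF F W x] by simp
    finally show "(\<Sum>m\<le>N. \<bar>if m \<in> I then 0 else F m x\<bar>) \<le> \<delta>" .
  qed auto
  then show s: "summable (\<lambda>m. if m \<in> I then 0 else F m x)" by (rule summable_rabs_cancel)
  show l: "(\<lambda>N. \<Sum>m\<in>{..<N} - I. F m x) \<longlonglongrightarrow> Sb F x"
    using summable_LIMSEQ[OF s] unfolding eq[of "\<lambda>y. y"] Sb_def .
  show "\<bar>Sb F x\<bar> \<le> \<delta>"
  proof (rule LIMSEQ_le_const2[OF tendsto_rabs[OF l]])
    have "\<bar>\<Sum>m\<in>{..<N} - I. F m x\<bar> \<le> \<delta>" for N
      using sum_abs[of "\<lambda>m. F m x" "{..<N} - I"] Wset_all[OF F W x, of N] by linarith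
    then show "\<exists>N0. \<forall>N\<ge>N0. \<bar>\<Sum>m\<in>{..<N} - I. F m x\<bar> \<le> \<delta>" by blast
  qed
qed

definition K_norm :: real where "K_norm = 4 * D\<^sup>2 + (1 + 64 * M ^ 6 * D\<^sup>2) * D"

lemma K_norm_pos: "K_norm > 0" unfolding K_norm_def using D M by (intro add_pos_nonneg) auto

lemma norm2_QI:
  assumes F: "\<And>m. in_block m (F m)"
  shows "(\<Sum>m\<in>I. (norm2 (F m))\<^sup>2) \<le> K_norm * QI I F"
proof -
  have c: "continuous_on {0..1} (\<lambda>x. (SI I F x)\<^sup>2)" by (intro continuous_intros SI_continuous F)
  have "QI I F = (LINT x|unit_leb. (\<Sum>m\<in>I. F m x)\<^sup>2 * exp (L x))"
    unfolding QI_def using EL_eq'[OF measurable_P_continuous[OF c]] unfolding SI_def .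
  then show ?thesis using norm_equivalence[OF I(1) F] by (simp add: K_norm_def)
qed

lemma complement_Sb:
  assumes F: "\<And>m. in_block m (F m)" and W: "Wset F"
  shows "complement l0 w M (\<lambda>x. exp (L x)) D \<sigma> J0 e F I h \<gamma> (Sb F)"
proof unfold_locales
  show "norm2 (F m) \<le> h (level J0 e m)" if "m \<notin> I" for m
  proof -
    have "norm2 (F m) \<le> H I m" using W that unfolding Wset_def by blast
    then show ?thesis using H_off[OF that] by simp
  qed
  show "\<bar>\<Sum>m\<in>{..<N} - I. F m x\<bar> \<le> 1" if "x \<in> {0..1}" for x N
    using sum_abs[of "\<lambda>m. F m x" "{..<N} - I"] Wset_all[OF F W that, of N] \<delta> by linarith
  show "(\<lambda>N. \<Sum>m\<in>{..<N} - I. F m x) \<longlonglongrightarrow> Sb F x" if "x \<in> {0..1}" for x by (rule Sb_facts(2)[OF F W that])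
qed (use F h_nonneg h_decay in auto)

lemma cross_term:
  assumes F: "\<And>m. in_block m (F m)" and W: "Wset F"
  shows "\<bar>LINT x|P L. SI I F x * exp (Sb F x)\<bar> \<le> K_key * C * \<delta> * (\<Sum>m\<in>I. norm2 (F m) * (H I m + 1 / sqrt (real n)))"
proof -
  interpret complement l0 w M "\<lambda>x. exp (L x)" D \<sigma> J0 e F I h \<gamma> "Sb F" by (rule complement_Sb[OF F W])
  have c: "continuous_on {0..1} (\<lambda>x. SI I F x * exp (Sb F x))"
    by (intro continuous_intros SI_continuous F Sb_continuous)
  have "(LINT x|P L. SI I F x * exp (Sb F x)) = (LINT x|unit_leb. (\<Sum>m\<in>I. F m x) * exp (Sb F x) * exp (L x))"
    using EL_eq'[OF measurable_P_continuous[OF c]] by (simp add: SI_def)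
  also have "\<bar>\<dots>\<bar> \<le> K_key * (\<Sum>m\<in>I. norm2 (F m) * (C * \<delta> * (H I m + 1 / sqrt (real n))))"
    by (rule key_estimate[OF I(1) F high low])
  finally show ?thesis by (simp add: sum_distrib_left mult_ac)
qed

lemma Sb_continuous_W:
  assumes F: "\<And>m. in_block m (F m)" and W: "Wset F"
  shows "continuous_on {0..1} (Sb F)"
proof -
  interpret complement l0 w M "\<lambda>x. exp (L x)" D \<sigma> J0 e F I h \<gamma> "Sb F" by (rule complement_Sb[OF F W])
  show ?thesis by (rule Sb_continuous)
qed

definition K_bias :: real where "K_bias = K_key * C * (K_norm + 1)"

lemma K_key_nonneg: "K_key \<ge> 0"
  unfolding K_key_def using M D K_low_nonneg by simp

lemma K_bias_nonneg: "K_bias \<ge> 0"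
  unfolding K_bias_def using K_key_nonneg C K_norm_pos by simp

text \<open>The inequality of arithmetic and geometric means splits
  \<open>norm2 (F m) * (H I m + r)\<close>. The squared norms sum to a multiple of
  \<open>QI\<close>, the squared thresholds to a multiple of \<open>E\<^sup>2\<close> by hypothesis,
  and \<open>r\<^sup>2 = 1 / n\<close> leaves \<open>card I / n\<close>.\<close>

lemma bias:
  assumes F: "\<And>m. in_block m (F m)" and W: "Wset F" and E: "(\<Sum>m\<in>I. (H I m)\<^sup>2) \<le> K_norm * E\<^sup>2"
  shows "\<bar>LINT x|P L. SI I F x * exp (Sb F x)\<bar> \<le> K_bias * \<delta> * (QI I F + E\<^sup>2 + real (card I) / real n)"
proof -
  define r where "r = 1 / sqrt (real n)"
  have r2: "r\<^sup>2 = 1 / real n" by (simp add: r_def power_divide)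
  have Q: "QI I F \<ge> 0" unfolding QI_def by (rule integral_nonneg_AE) auto
  have "(\<Sum>m\<in>I. norm2 (F m) * (H I m + r)) \<le> (\<Sum>m\<in>I. (norm2 (F m))\<^sup>2 + (H I m)\<^sup>2 + r\<^sup>2)"
  proof (rule sum_mono)
    fix m
    show "norm2 (F m) * (H I m + r) \<le> (norm2 (F m))\<^sup>2 + (H I m)\<^sup>2 + r\<^sup>2"
      unfolding distrib_left using sum_squares_bound[of "norm2 (F m)" "H I m"] sum_squares_bound[of "norm2 (F m)" r]
        zero_le_power2[of "H I m"] zero_le_power2[of r]
      by linarith
  qed
  also have "\<dots> = (\<Sum>m\<in>I. (norm2 (F m))\<^sup>2) + (\<Sum>m\<in>I. (H I m)\<^sup>2) + real (card I) * r\<^sup>2"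
    by (simp add: sum.distrib)
  also have "\<dots> \<le> K_norm * QI I F + K_norm * E\<^sup>2 + real (card I) / real n"
    using norm2_QI[OF F] E unfolding r2 by simp
  also have "\<dots> \<le> (K_norm + 1) * (QI I F + E\<^sup>2 + real (card I) / real n)"
  proof -
    have "0 \<le> K_norm * (real (card I) / real n)" using K_norm_pos by simp
    then show ?thesis using Q zero_le_power2[of E] unfolding distrib_left distrib_right by simp
  qed
  finally have "K_key * C * \<delta> * (\<Sum>m\<in>I. norm2 (F m) * (H I m + r)) \<le> K_key * C * \<delta> * ((K_norm + 1) * (QI I F + E\<^sup>2 + real (card I) / real n))"
    using K_key_nonneg C \<delta> by (intro mult_left_mono) auto
  with cross_term[OF F W] show ?thesis by (simp add: r_def K_bias_def mult_ac)
qed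

definition Zb :: "sequence \<Rightarrow> real" where
  "Zb F = (LINT x|P L. exp (Sb F x))"

text \<open>One constant for both directions of \<open>log_partition\<close>. The losses are at most
  \<open>2 * \<delta>\<close> from \<open>log_ratio_bounds\<close> and twice the bias, where
  \<open>QI + E\<^sup>2\<close> is at most twice the larger summand; this requires
  \<open>2 + 4 * K_bias\<close>.\<close>

definition K_curv :: real where "K_curv = 6 + 8 * K_bias"

lemma total_sum:
  assumes F: "\<And>m. in_block m (F m)" and W: "Wset F" and x: "x \<in> {0..1}"
  shows "(\<Sum>m. F m x) = SI I F x + Sb F x"
proof -
  have "(\<lambda>m. (if m \<in> I then F m x else 0) + (if m \<in> I then 0 else F m x)) sums (SI I F x + Sb F x)"
  proof (rule sums_add)
    show "(\<lambda>m. if m \<in> I then F m x else 0) sums SI I F x"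
      unfolding SI_def using sums_If_finite_set[OF I(1)] .
    show "(\<lambda>m. if m \<in> I then 0 else F m x) sums Sb F x"
      unfolding Sb_def by (rule summable_sums[OF Sb_facts(1)[OF F W x]])
  qed
  moreover have "(\<lambda>m. (if m \<in> I then F m x else 0) + (if m \<in> I then 0 else F m x)) = (\<lambda>m. F m x)" by auto
  ultimately show ?thesis by (simp add: sums_unique[symmetric])
qed

text \<open>\<open>Zb\<close> normalizes the inactive part alone, so the difference isolates what
  the active part adds to the log-normalizer. The lower bound serves the numerator of the posterior,
  the upper bound its denominator.\<close>

lemma log_partition:
  assumes F: "\<And>m. in_block m (F m)" and W: "Wset F" and S: "\<And>x. x \<in> {0..1} \<Longrightarrow> \<bar>SI I F x\<bar> \<le> \<delta>"
    and E: "(\<Sum>m\<in>I. (H I m)\<^sup>2) \<le> K_norm * E\<^sup>2"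
  shows "E\<^sup>2 \<le> QI I F \<Longrightarrow> real n * (1/2 - K_curv * \<delta>) * QI I F - K_curv * \<delta> * real (card I)
      \<le> real n * (ln (EL L (\<lambda>x. exp (\<Sum>m. F m x))) - ln (Zb F))"
    and "QI I F \<le> \<delta>\<^sup>2 * E\<^sup>2 \<Longrightarrow> real n * (ln (EL L (\<lambda>x. exp (\<Sum>m. F m x))) - ln (Zb F))
      \<le> K_curv * \<delta> * (real n * E\<^sup>2 + real (card I))"
proof -
  define u where "u = \<bar>LINT x|P L. SI I F x * exp (Sb F x)\<bar>"
  define q where "q = QI I F"
  define r where "r = ln (EL L (\<lambda>x. exp (\<Sum>m. F m x))) - ln (Zb F)"
  have q0: "q \<ge> 0" unfolding q_def QI_def by (rule integral_nonneg_AE) auto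
  have EL: "EL L (\<lambda>x. exp (\<Sum>m. F m x)) = (LINT x|P L. exp (SI I F x + Sb F x))"
    unfolding EL_def by (intro Bochner_Integration.integral_cong refl) (simp add: total_sum[OF F W])
  have cS: "continuous_on {0..1} (SI I F)" by (intro SI_continuous F)
  note b = P.log_ratio_bounds[OF measurable_P_continuous[OF cS] measurable_P_continuous[OF Sb_continuous_W[OF F W]], of \<delta>,
      unfolded space_P, OF S Sb_facts(3)[OF F W] \<delta>(2)]
  have lo: "(1/2 - 2 * \<delta>) * q - 2 * u \<le> r" and up: "r \<le> 2 * u + 2 * q"
    using b unfolding u_def q_def QI_def r_def EL Zb_def by simp_all
  have ub: "u \<le> K_bias * \<delta> * (q + E\<^sup>2 + real (card I) / real n)" unfolding u_def q_def by (rule bias[OF F W E])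
  have n0: "real n > 0" using n by simp
  have kd: "0 \<le> K_bias * \<delta>" using K_bias_nonneg \<delta> by simp
  show "real n * (1/2 - K_curv * \<delta>) * QI I F - K_curv * \<delta> * real (card I) \<le> real n * (ln (EL L (\<lambda>x. exp (\<Sum>m. F m x))) - ln (Zb F))"
    if Eq: "E\<^sup>2 \<le> QI I F"
  proof -
    have "u \<le> K_bias * \<delta> * (2 * q + real (card I) / real n)"
      using ub mult_left_mono[OF _ kd, of "q + E\<^sup>2 + real (card I) / real n" "2 * q + real (card I) / real n"] Eq by (simp add: q_def)
    then have "real n * u \<le> real n * (K_bias * \<delta> * (2 * q + real (card I) / real n))" by (intro mult_left_mono) auto
    also have "\<dots> = K_bias * \<delta> * (2 * (real n * q) + real (card I))" using n0 by (simp add: algebra_simps)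
    finally have nu: "real n * u \<le> K_bias * \<delta> * (2 * (real n * q) + real (card I))" .
    have "real n * ((1/2 - 2 * \<delta>) * q - 2 * u) \<le> real n * r" using lo by (intro mult_left_mono) auto
    moreover have "0 \<le> K_bias * \<delta> * real (card I)" "0 \<le> \<delta> * real (card I)" "0 \<le> \<delta> * (real n * q)" "0 \<le> K_bias * \<delta> * (real n * q)"
      using kd \<delta> q0 by auto
    ultimately show ?thesis using nu unfolding q_def[symmetric] r_def[symmetric] K_curv_def by (simp add: algebra_simps)
  qed
  show "real n * (ln (EL L (\<lambda>x. exp (\<Sum>m. F m x))) - ln (Zb F)) \<le> K_curv * \<delta> * (real n * E\<^sup>2 + real (card I))"
    if Eq: "QI I F \<le> \<delta>\<^sup>2 * E\<^sup>2"
  proof -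
    have "\<delta>\<^sup>2 * E\<^sup>2 \<le> \<delta> * E\<^sup>2" using \<delta> by (intro mult_right_mono) (auto simp: power2_eq_square mult_left_le)
    then have qd: "q \<le> \<delta> * E\<^sup>2" using Eq by (simp add: q_def)
    moreover have "\<delta> * E\<^sup>2 \<le> 1 * E\<^sup>2" using \<delta> by (intro mult_right_mono) auto
    ultimately have "u \<le> K_bias * \<delta> * (2 * E\<^sup>2 + real (card I) / real n)"
      using ub mult_left_mono[OF _ kd, of "q + E\<^sup>2 + real (card I) / real n" "2 * E\<^sup>2 + real (card I) / real n"] by simp
    then have "real n * u \<le> real n * (K_bias * \<delta> * (2 * E\<^sup>2 + real (card I) / real n))" by (intro mult_left_mono) auto
    also have "\<dots> = K_bias * \<delta> * (2 * (real n * E\<^sup>2) + real (card I))" using n0 by (simp add: algebra_simps)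
    finally have nu: "real n * u \<le> K_bias * \<delta> * (2 * (real n * E\<^sup>2) + real (card I))" .
    have nq: "real n * q \<le> \<delta> * (real n * E\<^sup>2)" using mult_left_mono[OF qd, of "real n"] by (simp add: mult_ac)
    have "real n * r \<le> real n * (2 * u + 2 * q)" using up by (intro mult_left_mono) auto
    moreover have "0 \<le> K_bias * \<delta> * real (card I)" "0 \<le> \<delta> * real (card I)" "0 \<le> \<delta> * (real n * E\<^sup>2)" "0 \<le> K_bias * \<delta> * (real n * E\<^sup>2)"
      using kd \<delta> by auto
    ultimately show ?thesis using nu nq unfolding r_def[symmetric] K_curv_def by (simp add: algebra_simps)
  qed
qed

end

locale active_event = contraction +
  fixes E :: real
  assumes E: "E > 0" "E_inf w L B H I = ennreal E"
    and tilde: "emeasure \<Pi>0 (A_tilde_event w L B \<Pi>0 H \<delta> I) > 0"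
    and curv: "K_curv * \<delta> \<le> 1/20"
begin

abbreviation \<X> :: "(nat \<Rightarrow> real) measure" where "\<X> \<equiv> \<Pi>\<^sub>M i\<in>{..<n}. P L"

lemma sample_space: "X \<in> space \<X> \<Longrightarrow> i < n \<Longrightarrow> X i \<in> {0..1}"
  by (auto simp: space_PiM PiE_iff)

lemma param_in_block: "F \<in> space (param_space w L B) \<Longrightarrow> in_block m (F m)"
  using space_blocks[of F UNIV m] by (simp add: param_space_def blocks_def)

lemma S_set_in_block: "F \<in> S_set w L B H I \<Longrightarrow> in_block m (F m)"
  by (rule param_in_block) (simp add: S_set_def)

lemma QI_nonneg: "QI I F \<ge> 0" unfolding QI_def by (rule integral_nonneg_AE) auto

lemma epowr_half: "F \<in> S_set w L B H I \<Longrightarrow> epowr (second_moment L I F) (1/2) = ennreal (sqrt (QI I F))"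
  by (subst second_moment_finite[OF I(1) S_set_in_block]) (auto simp: epowr_def powr_half_sqrt QI_nonneg)

lemma S_set_moment:
  assumes "F \<in> S_set w L B H I" shows "E\<^sup>2 \<le> QI I F"
proof -
  have "ennreal E \<le> ennreal (sqrt (QI I F))"
    unfolding E(2)[symmetric] E_inf_def epowr_half[OF assms, symmetric] by (rule INF_lower[OF assms])
  then have "E \<le> sqrt (QI I F)" by (simp add: QI_nonneg)
  then have "E\<^sup>2 \<le> (sqrt (QI I F))\<^sup>2" using E by (intro power_mono) auto
  then show ?thesis by (simp add: QI_nonneg)
qed

text \<open>On \<open>S_set\<close> the block norms exceed the thresholds, so
  \<open>norm2_QI\<close> bounds every second moment from below, and the infimum inherits the bound.
  This supplies the hypothesis of \<open>bias\<close>.\<close>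

lemma H_square_sum: "(\<Sum>m\<in>I. (H I m)\<^sup>2) \<le> K_norm * E\<^sup>2"
proof -
  define h2 where "h2 = (\<Sum>m\<in>I. (H I m)\<^sup>2) / K_norm"
  have h2: "h2 \<ge> 0" unfolding h2_def using K_norm_pos by (intro divide_nonneg_pos sum_nonneg) auto
  have "ennreal (sqrt h2) \<le> ennreal E"
    unfolding E(2)[symmetric] E_inf_def
  proof (rule INF_greatest)
    fix F assume F: "F \<in> S_set w L B H I"
    have "(\<Sum>m\<in>I. (H I m)\<^sup>2) \<le> (\<Sum>m\<in>I. (norm2 (F m))\<^sup>2)"
      using F H_nonneg by (intro sum_mono power_mono) (auto simp: S_set_def less_imp_le)
    also have "\<dots> \<le> K_norm * QI I F" by (rule norm2_QI[OF S_set_in_block[OF F]])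
    finally have "h2 \<le> QI I F" unfolding h2_def using K_norm_pos by (simp add: divide_le_eq mult.commute)
    then show "ennreal (sqrt h2) \<le> epowr (second_moment L I F) (1/2)"
      unfolding epowr_half[OF F] by (intro ennreal_leI) simp
  qed
  then have "sqrt h2 \<le> E" using E by (simp add: h2)
  then have "(sqrt h2)\<^sup>2 \<le> E\<^sup>2" using h2 by (intro power_mono) auto
  then have "h2 \<le> E\<^sup>2" using h2 by simp
  then show ?thesis unfolding h2_def using K_norm_pos by (simp add: divide_le_eq mult.commute)
qed

definition sup_le :: "sequence \<Rightarrow> bool" where
  "sup_le F \<longleftrightarrow> (\<forall>x\<in>{0..1} \<inter> \<rat>. \<bar>SI I F x\<bar> \<le> \<delta>)"

text \<open>Involves the active coordinates only and holds on the target set. The sup norm and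
  moment conditions, automatic there, are recorded because the exponential moment bounds rely on
  them.\<close>

definition A1 :: "sequence \<Rightarrow> bool" where
  "A1 F \<longleftrightarrow> (\<forall>m\<in>I. H I m < norm2 (F m)) \<and> sup_le F \<and> E\<^sup>2 \<le> QI I F"

text \<open>\<open>A_tilde_event\<close> is phrased by infima over versions of a series; this
  condition is visibly measurable and contains that event, so it can only have larger prior
  probability.\<close>

definition A2 :: "sequence \<Rightarrow> bool" where
  "A2 F \<longleftrightarrow> sup_le F \<and> QI I F \<le> \<delta>\<^sup>2 * E\<^sup>2"

lemma sup_le_all:
  assumes F: "\<And>m. m \<in> I \<Longrightarrow> in_block m (F m)" and s: "sup_le F" and x: "x \<in> {0..1}"
  shows "\<bar>SI I F x\<bar> \<le> \<delta>"
  by (rule rational_extend[OF _ _ x, where f = "\<lambda>x. \<bar>SI I F x\<bar>"])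
     (use s in \<open>auto simp: sup_le_def intro!: continuous_on_rabs SI_continuous F\<close>)

lemma restrict_invariant:
  "SI I (restrict F I) = SI I F" "QI I (restrict F I) = QI I F" "sup_le (restrict F I) = sup_le F"
  "A1 (restrict F I) = A1 F" "A2 (restrict F I) = A2 F"
  "Sb (restrict F (- I)) = Sb F" "Zb (restrict F (- I)) = Zb F" "Wset (restrict F (- I)) = Wset F"
proof -
  show SI: "SI I (restrict F I) = SI I F" by (rule ext) (simp add: SI_def)
  show QI: "QI I (restrict F I) = QI I F" unfolding QI_def SI ..
  show s: "sup_le (restrict F I) = sup_le F" unfolding sup_le_def SI ..
  show "A1 (restrict F I) = A1 F" "A2 (restrict F I) = A2 F" unfolding A1_def A2_def s QI by auto
  show Sb: "Sb (restrict F (- I)) = Sb F"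
    unfolding Sb_def by (intro ext arg_cong[where f = suminf]) auto
  show "Zb (restrict F (- I)) = Zb F" unfolding Zb_def Sb ..
  have "(\<Sum>m\<in>{..<N} - I. \<bar>restrict F (- I) m x\<bar>) = (\<Sum>m\<in>{..<N} - I. \<bar>F m x\<bar>)" for N x
    by (intro sum.cong) auto
  then show "Wset (restrict F (- I)) = Wset F" unfolding Wset_def by auto
qed

lemma blocks_id: "(\<lambda>F. F) \<in> measurable (blocks K) (blocks K)" by simp

lemma const_P: "x \<in> {0..1} \<Longrightarrow> (\<lambda>z. x) \<in> measurable N (P L)" by (rule measurable_const) simp

lemma SI_meas [measurable]: "x \<in> {0..1} \<Longrightarrow> (\<lambda>F. SI I F x) \<in> borel_measurable (blocks I)"
  by (rule SI_measurable[OF blocks_id order.refl const_P])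

lemma QI_meas [measurable]: "(\<lambda>F. QI I F) \<in> borel_measurable (blocks I)"
  by (rule QI_measurable[OF blocks_id order.refl])

lemma countable_unit_rat: "countable ({0..1::real} \<inter> \<rat>)" by (rule countable_Int2[OF countable_rat])

lemma sup_le_meas [measurable]: "Measurable.pred (blocks I) sup_le"
  unfolding sup_le_def
  by (intro measurable_pred_countable(1)[OF countable_unit_rat]) measurable

lemma A1_meas [measurable]: "Measurable.pred (blocks I) A1"
proof -
  have [measurable]: "(\<lambda>F. norm2 (F m)) \<in> borel_measurable (blocks I)" if "m \<in> I" for m
    by (rule norm2_measurable[OF blocks_id that])
  show ?thesis unfolding A1_def by measurable
qed

lemma A2_meas [measurable]: "Measurable.pred (blocks I) A2"
  unfolding A2_def by measurable

lemma Sb_meas: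
  assumes F: "F \<in> measurable N (blocks (- I))" and x: "x \<in> measurable N (P L)"
  shows "(\<lambda>z. Sb (F z) (x z)) \<in> borel_measurable N"
proof -
  have [measurable]: "(\<lambda>z. if m \<in> I then 0 else F z m (x z)) \<in> borel_measurable N" for m
    by (cases "m \<in> I") (auto intro: blocks_eval[OF F _ x])
  show ?thesis unfolding Sb_def by measurable
qed

lemma Zb_meas [measurable]: "Zb \<in> borel_measurable (blocks (- I))"
proof -
  have [measurable]: "(\<lambda>z. Sb (fst z) (snd z)) \<in> borel_measurable (blocks (- I) \<Otimes>\<^sub>M P L)"
    by (rule Sb_meas[OF measurable_fst measurable_snd])
  show ?thesis unfolding Zb_def by (rule P.borel_measurable_lebesgue_integral) (simp add: case_prod_beta)
qed

lemma Wset_meas [measurable]: "Measurable.pred (blocks (- I)) Wset"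
proof -
  have [measurable]: "(\<lambda>F. norm2 (F m)) \<in> borel_measurable (blocks (- I))" if "m \<in> - I" for m
    by (rule norm2_measurable[OF blocks_id that])
  have [measurable]: "(\<lambda>F. \<Sum>m\<in>{..<N} - I. \<bar>F m x\<bar>) \<in> borel_measurable (blocks (- I))" if "x \<in> {0..1}" for N x
    by (intro borel_measurable_sum borel_measurable_abs blocks_eval[OF blocks_id _ const_P[OF that]]) auto
  have [measurable]: "Measurable.pred (blocks (- I)) (\<lambda>F. \<forall>x\<in>{0..1} \<inter> \<rat>. \<forall>N. (\<Sum>m\<in>{..<N} - I. \<bar>F m x\<bar>) \<le> \<delta>)"
    by (intro measurable_pred_countable(1)[OF countable_unit_rat]) measurable
  show ?thesis unfolding Wset_def by measurable
qed

end

lemma ennreal_inverse_antimono: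
  assumes "b \<le> (c :: ennreal)" shows "inverse c \<le> inverse b"
proof (cases b c rule: ennreal2_cases)
  case (real_real r t)
  show ?thesis
  proof (cases "r = 0")
    case False
    then have "0 < r" "r \<le> t" using real_real assms by auto
    then show ?thesis using real_real by (simp add: inverse_ennreal ennreal_leI)
  qed (use real_real in simp)
qed (use assms in \<open>auto simp: top_unique\<close>)

context active_event begin

definition bb :: real where "bb = 1/2 - K_curv * \<delta>"

definition e2 :: real where "e2 = K_curv * \<delta> * (real n * E\<^sup>2 + real (card I))"

text \<open>\<open>num\<close> bounds the active factor of the likelihood relative to
  \<open>P L\<close> from above on the target set, \<open>den\<close> bounds it from below, and the
  inactive factor \<open>rest\<close>, with its own normalizer \<open>Zb\<close>, is common to
  both.\<close>

definition num :: "(nat \<Rightarrow> real) \<Rightarrow> sequence \<Rightarrow> ennreal" where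
  "num X F = (if A1 F then ennreal (exp ((\<Sum>i<n. SI I F (X i)) - real n * bb * QI I F + K_curv * \<delta> * real (card I))) else 0)"

definition den :: "(nat \<Rightarrow> real) \<Rightarrow> sequence \<Rightarrow> ennreal" where
  "den X F = (if A2 F then ennreal (exp ((\<Sum>i<n. SI I F (X i)) - e2)) else 0)"

definition rest :: "(nat \<Rightarrow> real) \<Rightarrow> sequence \<Rightarrow> ennreal" where
  "rest X F = (if Wset F then ennreal (exp ((\<Sum>i<n. Sb F (X i)) - real n * ln (Zb F))) else 0)"

lemma K_curv_nonneg: "K_curv \<ge> 6" unfolding K_curv_def using K_bias_nonneg by simp

context
  fixes X assumes X: "X \<in> space \<X>"
begin

lemma num_meas [measurable]: "num X \<in> borel_measurable (blocks I)"
proof -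
  have [measurable]: "(\<lambda>F. SI I F (X i)) \<in> borel_measurable (blocks I)" if "i \<in> {..<n}" for i
    using that by (intro SI_meas sample_space[OF X]) auto
  show ?thesis unfolding num_def by measurable
qed

lemma den_meas [measurable]: "den X \<in> borel_measurable (blocks I)"
proof -
  have [measurable]: "(\<lambda>F. SI I F (X i)) \<in> borel_measurable (blocks I)" if "i \<in> {..<n}" for i
    using that by (intro SI_meas sample_space[OF X]) auto
  show ?thesis unfolding den_def by measurable
qed

lemma rest_meas [measurable]: "rest X \<in> borel_measurable (blocks (- I))"
proof -
  have [measurable]: "(\<lambda>F. Sb F (X i)) \<in> borel_measurable (blocks (- I))" if "i \<in> {..<n}" for i
    using that by (intro Sb_meas[OF blocks_id const_P] sample_space[OF X]) auto
  show ?thesis unfolding rest_def by measurable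
qed

lemma invariant: "num X (restrict F I) = num X F" "den X (restrict F I) = den X F" "rest X (restrict F (- I)) = rest X F"
  unfolding num_def den_def rest_def restrict_invariant by (rule refl)+

lemma likelihood_split:
  assumes F: "F \<in> space \<Pi>0" and W: "Wset F"
  shows "likelihood n L X F = exp (\<Sum>i<n. L (X i)) * exp ((\<Sum>i<n. SI I F (X i)) + ((\<Sum>i<n. Sb F (X i)) - real n * ln (EL L (\<lambda>x. exp (\<Sum>m. F m x)))))"
proof -
  have "likelihood n L X F = exp (\<Sum>i<n. log_density L F (X i))"
    unfolding likelihood_def by (simp add: exp_sum)
  also have "(\<Sum>i<n. log_density L F (X i)) = (\<Sum>i<n. L (X i) + (SI I F (X i) + Sb F (X i)) - ln (EL L (\<lambda>x. exp (\<Sum>m. F m x))))"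
    unfolding log_density_def using total_sum[OF in_block_prior[OF F] W sample_space[OF X]]
    by (intro sum.cong refl) auto
  also have "\<dots> = (\<Sum>i<n. L (X i)) + ((\<Sum>i<n. SI I F (X i)) + ((\<Sum>i<n. Sb F (X i)) - real n * ln (EL L (\<lambda>x. exp (\<Sum>m. F m x)))))"
    by (simp add: sum.distrib sum_subtractf)
  finally show ?thesis by (simp only: exp_add)
qed

lemma likelihood_le:
  assumes F: "F \<in> space \<Pi>0" and A: "F \<in> target H I \<delta>"
  shows "ennreal (likelihood n L X F) \<le> ennreal (exp (\<Sum>i<n. L (X i))) * (num X F * rest X F)"
proof -
  have sum_le: "(\<Sum>m\<in>K. \<bar>F m x\<bar>) \<le> \<delta>" if x: "x \<in> {0..1}" and K: "finite K" for x K
  proof -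
    have "(\<Sum>m\<in>K. ennreal \<bar>F m x\<bar>) \<le> (\<Sum>m. ennreal \<bar>F m x\<bar>)"
      by (rule sum_le_suminf) (use K in auto)
    also have "\<dots> \<le> (SUP x\<in>{0..1}. \<Sum>m. ennreal \<bar>F m x\<bar>)" using x by (rule SUP_upper)
    also have "\<dots> \<le> ennreal \<delta>" using A by (simp add: C_star_def)
    finally have "ennreal (\<Sum>m\<in>K. \<bar>F m x\<bar>) \<le> ennreal \<delta>" by (simp add: sum_ennreal)
    then show ?thesis using \<delta> by simp
  qed
  have S: "\<bar>SI I F x\<bar> \<le> \<delta>" if "x \<in> {0..1}" for x
    unfolding SI_def using sum_abs[of "\<lambda>m. F m x" I] sum_le[OF that I(1)] by linarith
  have W: "Wset F"
    unfolding Wset_def using A sum_le by (auto simp: S_set_def)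
  have Eq: "E\<^sup>2 \<le> QI I F" using S_set_moment A by blast
  have A1: "A1 F" unfolding A1_def sup_le_def using A S Eq by (auto simp: S_set_def)
  have "real n * (1/2 - K_curv * \<delta>) * QI I F - K_curv * \<delta> * real (card I)
      \<le> real n * (ln (EL L (\<lambda>x. exp (\<Sum>m. F m x))) - ln (Zb F))"
    by (rule log_partition(1)[OF in_block_prior[OF F] W S H_square_sum Eq])
  then have "(\<Sum>i<n. SI I F (X i)) + ((\<Sum>i<n. Sb F (X i)) - real n * ln (EL L (\<lambda>x. exp (\<Sum>m. F m x))))
      \<le> ((\<Sum>i<n. SI I F (X i)) - real n * bb * QI I F + K_curv * \<delta> * real (card I)) + ((\<Sum>i<n. Sb F (X i)) - real n * ln (Zb F))"
    unfolding bb_def right_diff_distrib by linarith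
  then have "likelihood n L X F \<le> exp (\<Sum>i<n. L (X i)) * (exp ((\<Sum>i<n. SI I F (X i)) - real n * bb * QI I F + K_curv * \<delta> * real (card I)) * exp ((\<Sum>i<n. Sb F (X i)) - real n * ln (Zb F)))"
    unfolding likelihood_split[OF F W] exp_add[symmetric] by simp
  from ennreal_leI[OF this] show ?thesis using A1 W by (simp add: num_def rest_def ennreal_mult)
qed

lemma likelihood_ge:
  assumes F: "F \<in> space \<Pi>0"
  shows "ennreal (exp (\<Sum>i<n. L (X i))) * (den X F * rest X F) \<le> ennreal (likelihood n L X F)"
proof (cases "A2 F \<and> Wset F")
  case True
  then have W: "Wset F" and A: "A2 F" by auto
  have S: "\<bar>SI I F x\<bar> \<le> \<delta>" if "x \<in> {0..1}" for x
    by (rule sup_le_all[OF in_block_prior[OF F] _ that]) (use A in \<open>simp add: A2_def\<close>)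
  have Q: "QI I F \<le> \<delta>\<^sup>2 * E\<^sup>2" using A by (simp add: A2_def)
  have "real n * (ln (EL L (\<lambda>x. exp (\<Sum>m. F m x))) - ln (Zb F)) \<le> e2"
    unfolding e2_def by (rule log_partition(2)[OF in_block_prior[OF F] W S H_square_sum Q])
  then have "((\<Sum>i<n. SI I F (X i)) - e2) + ((\<Sum>i<n. Sb F (X i)) - real n * ln (Zb F))
      \<le> (\<Sum>i<n. SI I F (X i)) + ((\<Sum>i<n. Sb F (X i)) - real n * ln (EL L (\<lambda>x. exp (\<Sum>m. F m x))))"
    unfolding right_diff_distrib by linarith
  then have "exp (\<Sum>i<n. L (X i)) * (exp ((\<Sum>i<n. SI I F (X i)) - e2) * exp ((\<Sum>i<n. Sb F (X i)) - real n * ln (Zb F))) \<le> likelihood n L X F"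
    unfolding likelihood_split[OF F W] exp_add[symmetric] by simp
  from ennreal_leI[OF this] show ?thesis using True by (simp add: den_def rest_def ennreal_mult)
qed (auto simp: den_def rest_def)

text \<open>Cancelling the inactive factor from a quotient of extended reals needs it to be finite.
  On \<open>Wset\<close> its exponent is at most \<open>2 * n * \<delta>\<close>, as
  \<open>Sb\<close> is at most \<open>\<delta>\<close> and \<open>ln (Zb F)\<close> at least
  \<open>- \<delta>\<close>.\<close>

lemma rest_finite: "(\<integral>\<^sup>+ F. rest X F \<partial>\<Pi>0) < \<infinity>"
proof -
  have "rest X F \<le> ennreal (exp (real n * \<delta> + real n * \<delta>))" if F: "F \<in> space \<Pi>0" for F
  proof (cases "Wset F")
    case W: True
    note S = Sb_facts(3)[OF in_block_prior[OF F] W]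
    have c: "continuous_on {0..1} (Sb F)" by (rule Sb_continuous_W[OF in_block_prior[OF F] W])
    have "(LINT x|P L. exp (- \<delta>)) \<le> Zb F"
      unfolding Zb_def
    proof (rule integral_mono)
      show "integrable (P L) (\<lambda>x. exp (Sb F x))"
        by (rule P.integrable_const_bound[of _ "exp \<delta>"])
           (use S in \<open>auto intro!: measurable_P_continuous continuous_intros c simp: abs_le_iff\<close>)
    next
      fix x assume "x \<in> space (P L)"
      then show "exp (- \<delta>) \<le> exp (Sb F x)" using S[of x] by auto
    qed auto
    then have "exp (- \<delta>) \<le> Zb F" by (simp add: P.prob_space[unfolded space_P])
    then have Z: "- \<delta> \<le> ln (Zb F)" by (subst ln_ge_iff) (auto intro: less_le_trans[OF exp_gt_zero])
    have "(\<Sum>i<n. Sb F (X i)) \<le> real n * \<delta>"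
      by (rule sum_bounded_above[where A = "{..<n}", simplified card_lessThan]) (use S sample_space[OF X] in \<open>auto simp: abs_le_iff\<close>)
    moreover have "real n * (- \<delta>) \<le> real n * ln (Zb F)" by (rule mult_left_mono[OF Z]) simp
    ultimately have "(\<Sum>i<n. Sb F (X i)) - real n * ln (Zb F) \<le> real n * \<delta> + real n * \<delta>"
      unfolding mult_minus_right by linarith
    then show ?thesis using W by (simp add: rest_def ennreal_leI del: mult_2 mult_2_right)
  qed (simp add: rest_def)
  then have "(\<integral>\<^sup>+ F. rest X F \<partial>\<Pi>0) \<le> (\<integral>\<^sup>+ F. ennreal (exp (real n * \<delta> + real n * \<delta>)) \<partial>\<Pi>0)"
    by (intro nn_integral_mono) auto
  also have "\<dots> < \<infinity>" by (simp add: \<Pi>.emeasure_space_1)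
  finally show ?thesis .
qed

lemma split_integral:
  assumes f: "f \<in> borel_measurable (blocks I)" and inv: "\<And>F. f (restrict F I) = f F"
  shows "(\<integral>\<^sup>+ F. ennreal c * (f F * rest X F) \<partial>\<Pi>0) = ennreal c * ((\<integral>\<^sup>+ F. f F \<partial>\<Pi>0) * (\<integral>\<^sup>+ F. rest X F \<partial>\<Pi>0))"
proof -
  have [measurable]: "f \<in> borel_measurable \<Pi>0" "rest X \<in> borel_measurable \<Pi>0"
    using measurable_compose[OF restrict_measurable f] measurable_compose[OF restrict_measurable rest_meas]
    unfolding inv invariant by simp_all
  have "(\<integral>\<^sup>+ F. f F * rest X F \<partial>\<Pi>0) = (\<integral>\<^sup>+ F. f F \<partial>\<Pi>0) * (\<integral>\<^sup>+ F. rest X F \<partial>\<Pi>0)"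
    using factorization[OF f rest_meas] unfolding inv invariant .
  then show ?thesis by (simp add: nn_integral_cmult)
qed

lemma posterior_le_one: "posterior n L \<Pi>0 A X \<le> 1"
proof -
  have le: "(\<integral>\<^sup>+ F. indicator A F * ennreal (likelihood n L X F) \<partial>\<Pi>0) \<le> (\<integral>\<^sup>+ F. ennreal (likelihood n L X F) \<partial>\<Pi>0)" (is "?N \<le> ?D")
    by (intro nn_integral_mono) (auto split: split_indicator)
  show ?thesis
  proof (cases "?D = 0 \<or> ?D = \<infinity>")
    case True
    then show ?thesis using le by (auto simp: posterior_def)
  next
    case False
    then show ?thesis unfolding posterior_def using le
      by (intro order.trans[OF divide_right_mono_ennreal[OF le]]) (simp add: ennreal_divide_self less_top)
  qed
qed

text \<open>By independence both integrals contain the same inactive factor \<open>G\<close>, which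
  cancels. If \<open>G = 0\<close>, the numerator is already 0.\<close>

lemma posterior_le_ratio:
  assumes d: "(\<integral>\<^sup>+ F. den X F \<partial>\<Pi>0) \<ge> d" and d0: "d \<noteq> 0" "d \<noteq> \<infinity>"
  shows "posterior n L \<Pi>0 (target H I \<delta>) X \<le> (\<integral>\<^sup>+ F. num X F \<partial>\<Pi>0) / d"
proof -
  define c where "c = exp (\<Sum>i<n. L (X i))"
  define G where "G = (\<integral>\<^sup>+ F. rest X F \<partial>\<Pi>0)"
  define N where "N = (\<integral>\<^sup>+ F. indicator (target H I \<delta>) F * ennreal (likelihood n L X F) \<partial>\<Pi>0)"
  define Z where "Z = (\<integral>\<^sup>+ F. ennreal (likelihood n L X F) \<partial>\<Pi>0)"
  have "N \<le> (\<integral>\<^sup>+ F. ennreal c * (num X F * rest X F) \<partial>\<Pi>0)"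
    unfolding N_def c_def by (intro nn_integral_mono) (use likelihood_le in \<open>auto split: split_indicator\<close>)
  also have "\<dots> = ennreal c * ((\<integral>\<^sup>+ F. num X F \<partial>\<Pi>0) * G)"
    unfolding G_def by (rule split_integral[OF num_meas invariant(1)])
  finally have N: "N \<le> (ennreal c * G) * (\<integral>\<^sup>+ F. num X F \<partial>\<Pi>0)" by (simp add: mult_ac)
  have "(ennreal c * G) * d \<le> ennreal c * ((\<integral>\<^sup>+ F. den X F \<partial>\<Pi>0) * G)"
    using mult_left_mono[OF mult_right_mono[OF d, of G], of "ennreal c"] by (simp add: mult.assoc mult.commute[of d])
  also have "\<dots> = (\<integral>\<^sup>+ F. ennreal c * (den X F * rest X F) \<partial>\<Pi>0)"
    unfolding G_def by (rule split_integral[OF den_meas invariant(2), symmetric])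
  also have "\<dots> \<le> Z" unfolding Z_def c_def by (intro nn_integral_mono likelihood_ge)
  finally have Z: "(ennreal c * G) * d \<le> Z" .
  have c0: "c > 0" by (simp add: c_def)
  show ?thesis
  proof (cases "G = 0")
    case True
    then have "N = 0" using N by simp
    then show ?thesis by (simp add: posterior_def N_def)
  next
    case False
    define k where "k = ennreal c * G"
    have k: "k \<noteq> 0" "k \<noteq> \<infinity>" using False c0 rest_finite unfolding k_def G_def
      by (auto simp: ennreal_mult_eq_top_iff less_top[symmetric] ennreal_eq_0_iff)
    have "posterior n L \<Pi>0 (target H I \<delta>) X = N / Z" by (simp add: posterior_def N_def Z_def)
    also have "\<dots> \<le> (k * (\<integral>\<^sup>+ F. num X F \<partial>\<Pi>0)) / (k * d)"
      using N Z unfolding k_def[symmetric] divide_ennreal_def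
      by (intro mult_mono ennreal_inverse_antimono) auto
    also have "\<dots> = (\<integral>\<^sup>+ F. num X F \<partial>\<Pi>0) / d"
      by (simp only: mult.commute[of k]) (rule divide_mult_eq[OF k])
    finally show ?thesis .
  qed
qed

end

end

section \<open>Coefficient vectors of the active part and their dimension\<close>

context enum begin

lemma block_coefficients:
  assumes f: "in_block m f"
  obtains c where "\<And>x. x \<in> {0..1} \<Longrightarrow> f x = (\<Sum>v\<in>block l0 J0 e m. c v * cw v x)"
    "(\<Sum>v\<in>block l0 J0 e m. (c v)\<^sup>2) \<le> (norm2 f)\<^sup>2"
proof (cases "m = 0")
  case True
  obtain a where "\<And>x. x \<in> {0..1} \<Longrightarrow> f x = (\<Sum>v\<in>low. a v * cw v x)"
    using f unfolding in_block_def True block_0 by blast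
  then obtain b where b: "\<And>x. x \<in> {0..1} \<Longrightarrow> f x = (\<Sum>v\<in>low. b v * w v x)" "(norm2 f)\<^sup>2 = (\<Sum>v\<in>low. (b v)\<^sup>2)"
    using low_coefficients[of f a] by blast
  \<comment> \<open>An element of block 0 has mean zero under \<open>p\<close>, so the means of its
    uncentred terms cancel in total: the coefficients that satisfy Parseval's identity also
    represent it by centred wavelets.\<close>
  have "0 = (LINT x|unit_leb. f x * p x)" using in_block_integral[OF f] by simp
  also have "\<dots> = (LINT x|unit_leb. (\<Sum>v\<in>low. b v * (w v x * p x)))"
    by (intro Bochner_Integration.integral_cong refl) (simp add: b(1) sum_distrib_right mult.assoc)
  also have "\<dots> = (\<Sum>v\<in>low. LINT x|unit_leb. b v * (w v x * p x))"
    using low_subset by (intro Bochner_Integration.integral_sum integrable_mult_right integrable_unit_leb_cont continuous_intros w_continuous p_continuous) auto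
  also have "\<dots> = (\<Sum>v\<in>low. b v * mean v)" by (simp add: mean_def)
  finally have z: "(\<Sum>v\<in>low. b v * mean v) = 0" by simp
  show thesis
  proof (rule that[of b])
    fix x :: real assume x: "x \<in> {0..1}"
    show "f x = (\<Sum>v\<in>block l0 J0 e m. b v * cw v x)"
      unfolding True block_0 b(1)[OF x] cw_def right_diff_distrib sum_subtractf z by simp
  qed (simp add: True block_0 b(2))
next
  case False
  then have m: "m \<ge> 1" by simp
  obtain a where a: "\<And>x. x \<in> {0..1} \<Longrightarrow> f x = a * cw (e m) x" "\<bar>a\<bar> \<le> norm2 f"
    by (rule high_coefficient[OF m f]) blast
  have "a\<^sup>2 \<le> (norm2 f)\<^sup>2" using a(2) norm2_nonneg[of f] by (metis abs_le_square_iff abs_of_nonneg)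
  then show thesis using a(1) that[of "\<lambda>_. a"] False by (simp add: block_def)
qed

lemma block_disjoint: "m \<noteq> m' \<Longrightarrow> block l0 J0 e m \<inter> block l0 J0 e m' = {}"
  using e_high[of m] e_high[of m'] e_inj[of m m'] unfolding block_def
  by (cases "m = 0"; cases "m' = 0") auto

lemma active_coefficients:
  assumes I: "finite I" and F: "\<And>m. m \<in> I \<Longrightarrow> in_block m (F m)"
  defines "J \<equiv> \<Union>m\<in>I. block l0 J0 e m"
  obtains a where "a \<in> space (\<Pi>\<^sub>M v\<in>J. lborel)" "\<And>x. x \<in> {0..1} \<Longrightarrow> (\<Sum>m\<in>I. F m x) = (\<Sum>v\<in>J. a v * cw v x)"
    "(\<Sum>v\<in>J. (a v)\<^sup>2) \<le> (\<Sum>m\<in>I. (norm2 (F m))\<^sup>2)"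
proof -
  have "\<exists>c. \<forall>m\<in>I. (\<forall>x\<in>{0..1}. F m x = (\<Sum>v\<in>block l0 J0 e m. c m v * cw v x))
      \<and> (\<Sum>v\<in>block l0 J0 e m. (c m v)\<^sup>2) \<le> (norm2 (F m))\<^sup>2"
  proof (rule bchoice, rule ballI)
    fix m assume "m \<in> I"
    from block_coefficients[OF F[OF this]] obtain c where "\<And>x. x \<in> {0..1} \<Longrightarrow> F m x = (\<Sum>v\<in>block l0 J0 e m. c v * cw v x)"
      "(\<Sum>v\<in>block l0 J0 e m. (c v)\<^sup>2) \<le> (norm2 (F m))\<^sup>2" by blast
    then show "\<exists>c. (\<forall>x\<in>{0..1}. F m x = (\<Sum>v\<in>block l0 J0 e m. c v * cw v x)) \<and> (\<Sum>v\<in>block l0 J0 e m. (c v)\<^sup>2) \<le> (norm2 (F m))\<^sup>2"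
      by blast
  qed
  then obtain c where c: "\<And>m x. m \<in> I \<Longrightarrow> x \<in> {0..1} \<Longrightarrow> F m x = (\<Sum>v\<in>block l0 J0 e m. c m v * cw v x)"
    "\<And>m. m \<in> I \<Longrightarrow> (\<Sum>v\<in>block l0 J0 e m. (c m v)\<^sup>2) \<le> (norm2 (F m))\<^sup>2" by blast
  define a where "a = (\<lambda>v\<in>J. \<Sum>m\<in>I. if v \<in> block l0 J0 e m then c m v else 0)"
  have a: "a v = c m v" if "m \<in> I" "v \<in> block l0 J0 e m" for m v
  proof -
    have "(\<Sum>m'\<in>I. if v \<in> block l0 J0 e m' then c m' v else 0) = (\<Sum>m'\<in>I. if m' = m then c m v else 0)"
    proof (rule sum.cong[OF refl])
      fix m'
      show "(if v \<in> block l0 J0 e m' then c m' v else 0) = (if m' = m then c m v else 0)"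
        using that(2) block_disjoint[of m m'] by (cases "m' = m") auto
    qed
    also have "\<dots> = c m v" using I that by simp
    finally show ?thesis using that by (auto simp: a_def J_def)
  qed
  have S: "(\<Sum>v\<in>J. g v) = (\<Sum>m\<in>I. \<Sum>v\<in>block l0 J0 e m. g v)" for g :: "nat \<times> nat \<Rightarrow> real"
    unfolding J_def using block_subset(2) block_disjoint I by (intro sum.UNION_disjoint) auto
  show thesis
  proof (rule that)
    show "a \<in> space (\<Pi>\<^sub>M v\<in>J. lborel)" by (simp add: a_def space_PiM)
    show "(\<Sum>m\<in>I. F m x) = (\<Sum>v\<in>J. a v * cw v x)" if "x \<in> {0..1}" for x
      unfolding S using c(1)[OF _ that] a by (intro sum.cong refl) simp
    have "(\<Sum>v\<in>J. (a v)\<^sup>2) = (\<Sum>m\<in>I. \<Sum>v\<in>block l0 J0 e m. (c m v)\<^sup>2)"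
      unfolding S using a by (intro sum.cong refl) simp
    also have "\<dots> \<le> (\<Sum>m\<in>I. (norm2 (F m))\<^sup>2)" by (intro sum_mono c(2))
    finally show "(\<Sum>v\<in>J. (a v)\<^sup>2) \<le> (\<Sum>m\<in>I. (norm2 (F m))\<^sup>2)" .
  qed
qed

lemma card_low: "card low \<le> 2 ^ (J0 + 2)"
proof -
  have "low = (\<Union>i\<in>{..<Suc J0}. lev i)" unfolding low_def by auto
  then have "card low \<le> (\<Sum>i<Suc J0. card (lev i))"
    by (simp only: card_UN_le[OF finite_lessThan])
  also have "\<dots> \<le> (\<Sum>i<Suc J0. 2 ^ (i + 1))" by (intro sum_mono finite_level)
  also have "\<dots> \<le> 2 ^ (J0 + 2)"
  proof (induction J0)
    case (Suc k)
    then show ?case by simp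
  qed simp
  finally show ?thesis .
qed

text \<open>Block 0 has at most \<open>2 ^ (J0 + 2)\<close> elements and every other block has one;
  this is the source of \<open>2 ^ J0 * |I|\<close> in the exponent of the bound.\<close>

lemma card_active:
  assumes "finite I"
  shows "card (\<Union>m\<in>I. block l0 J0 e m) \<le> card I * 2 ^ (J0 + 2)"
proof -
  have "card (\<Union>m\<in>I. block l0 J0 e m) \<le> (\<Sum>m\<in>I. card (block l0 J0 e m))" by (rule card_UN_le[OF assms])
  also have "\<dots> \<le> (\<Sum>m\<in>I. 2 ^ (J0 + 2))"
  proof (intro sum_mono)
    fix m show "card (block l0 J0 e m) \<le> 2 ^ (J0 + 2)"
    proof (cases "m = 0")
      case True
      then show ?thesis using card_low block_0 by simp
    qed (simp add: block_def)
  qed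
  finally show ?thesis by simp
qed

end

section \<open>The conditional mean on the denominator event, and Jensen's inequality\<close>

context active_event begin

definition A2set :: "sequence set" where "A2set = {F \<in> space \<Pi>0. A2 F}"

lemma A1_prior [measurable]: "Measurable.pred \<Pi>0 A1" and A2_prior [measurable]: "Measurable.pred \<Pi>0 A2"
  using measurable_compose[OF restrict_measurable A1_meas] measurable_compose[OF restrict_measurable A2_meas]
  unfolding restrict_invariant by simp_all

lemma A2set_sets [measurable]: "A2set \<in> sets \<Pi>0" unfolding A2set_def by measurable

lemma tilde_subset: "A_tilde_event w L B \<Pi>0 H \<delta> I \<subseteq> A2set"
proof
  fix F assume "F \<in> A_tilde_event w L B \<Pi>0 H \<delta> I"
  then have F: "F \<in> space \<Pi>0" and m: "second_moment L I F \<le> ennreal (\<delta>\<^sup>2) * (ennreal E)\<^sup>2" and s: "sup_norm L I F \<le> ereal \<delta>"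
    by (auto simp: A_tilde_event_def E(2))
  have "ennreal (QI I F) \<le> ennreal (\<delta>\<^sup>2 * E\<^sup>2)"
    using m E(1) unfolding second_moment_finite[OF I(1) in_block_prior[OF F]]
    by (simp add: ennreal_mult ennreal_power)
  then have "QI I F \<le> \<delta>\<^sup>2 * E\<^sup>2" by simp
  moreover have "sup_le F" unfolding sup_le_def using sup_norm_finite[OF I(1) in_block_prior[OF F] s] by auto
  ultimately show "F \<in> A2set" using F by (simp add: A2set_def A2_def)
qed

lemma tilde_le: "emeasure \<Pi>0 (A_tilde_event w L B \<Pi>0 H \<delta> I) \<le> emeasure \<Pi>0 A2set"
  by (rule emeasure_mono[OF tilde_subset A2set_sets])

definition p2 :: real where "p2 = \<Pi>.prob A2set"

lemma p2: "p2 > 0" "emeasure \<Pi>0 A2set = ennreal p2"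
  using tilde tilde_le unfolding p2_def \<Pi>.emeasure_eq_measure by (auto simp: less_le_trans)

definition Q2 :: "sequence measure" where "Q2 = uniform_measure \<Pi>0 A2set"

lemma sets_Q2 [measurable_cong, simp]: "sets Q2 = sets \<Pi>0" and space_Q2 [simp]: "space Q2 = space \<Pi>0"
  by (simp_all add: Q2_def)

sublocale Q2: prob_space Q2
  unfolding Q2_def by (rule prob_space_uniform_measure) (use p2 in \<open>auto simp: ennreal_eq_0_iff\<close>)

sublocale PQ: pair_prob_space "P L" Q2 ..

text \<open>Set to zero off \<open>A2\<close>, which changes nothing \<open>Q2\<close>-almost surely
  but makes the bound \<open>\<delta>\<close> hold for every parameter.\<close>

definition SA :: "sequence \<Rightarrow> real \<Rightarrow> real" where
  "SA F x = (if A2 F then SI I F x else 0)"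

definition T :: "real \<Rightarrow> real" where "T x = (LINT F|Q2. SA F x)"

lemma SA_joint:
  assumes F: "F \<in> measurable N \<Pi>0" and x: "x \<in> measurable N (P L)"
  shows "(\<lambda>z. SA (F z) (x z)) \<in> borel_measurable N"
proof -
  have [measurable]: "(\<lambda>z. SI I (F z) (x z)) \<in> borel_measurable N"
    by (rule SI_measurable[OF measurable_compose[OF F prior_id] _ x]) simp
  have [measurable]: "Measurable.pred N (\<lambda>z. A2 (F z))" by (rule measurable_compose[OF F A2_prior])
  show ?thesis unfolding SA_def by measurable
qed

lemma SA_meas: "x \<in> {0..1} \<Longrightarrow> (\<lambda>F. SA F x) \<in> borel_measurable Q2"
  using SA_joint[OF measurable_ident const_P] by (simp cong: measurable_cong_sets)

lemma SA_pair [measurable]: "(\<lambda>z. SA (snd z) (fst z)) \<in> borel_measurable (P L \<Otimes>\<^sub>M Q2)"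
  by (rule SA_joint) (simp_all cong: measurable_cong_sets)

lemma SA_bound: "F \<in> space \<Pi>0 \<Longrightarrow> x \<in> {0..1} \<Longrightarrow> \<bar>SA F x\<bar> \<le> \<delta>"
  using sup_le_all[of F x] in_block_prior[of F] \<delta> by (auto simp: SA_def A2_def)

lemma SA_integrable:
  assumes "x \<in> {0..1}" shows "integrable Q2 (\<lambda>F. SA F x)" "integrable Q2 (\<lambda>F. (SA F x)\<^sup>2)"
proof -
  note [measurable] = SA_meas[OF assms]
  show "integrable Q2 (\<lambda>F. SA F x)" by (rule Q2.integrable_const_bound[of _ \<delta>]) (use SA_bound assms in auto)
  show "integrable Q2 (\<lambda>F. (SA F x)\<^sup>2)"
    by (rule Q2.integrable_const_bound[of _ "\<delta>\<^sup>2"]) (use SA_bound assms \<delta> in \<open>auto simp: abs_le_square_iff[symmetric]\<close>)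
qed

lemma T_measurable [measurable]: "T \<in> borel_measurable (P L)"
  unfolding T_def by (rule Q2.borel_measurable_lebesgue_integral) (simp add: case_prod_beta)

lemma T_bound: "x \<in> {0..1} \<Longrightarrow> \<bar>T x\<bar> \<le> \<delta>"
proof -
  assume x: "x \<in> {0..1}"
  have "\<bar>T x\<bar> \<le> (LINT F|Q2. \<bar>SA F x\<bar>)" unfolding T_def by (rule integral_abs_bound)
  also have "\<dots> \<le> (LINT F|Q2. \<delta>)" by (rule integral_mono) (use SA_integrable[OF x] SA_bound[OF _ x] in auto)
  finally show ?thesis by (simp add: Q2.prob_space[unfolded space_Q2])
qed

lemma T_mean: "(LINT x|P L. T x) = 0"
proof -
  have int: "integrable (P L \<Otimes>\<^sub>M Q2) (\<lambda>(x, F). SA F x)"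
    unfolding case_prod_beta
    by (rule PQ.integrable_const_bound[of _ \<delta>]) (use SA_bound in \<open>auto simp: space_pair_measure\<close>)
  have "(LINT x|P L. T x) = (LINT F|Q2. LINT x|P L. SA F x)"
    unfolding T_def by (rule PQ.Fubini_integral[OF int, symmetric])
  also have "\<dots> = (LINT F|Q2. 0)"
  proof (rule Bochner_Integration.integral_cong[OF refl])
    fix F assume "F \<in> space Q2"
    then have F: "in_block m (F m)" for m using in_block_prior by simp
    have "(LINT x|P L. SI I F x) = (LINT x|unit_leb. SI I F x * exp (L x))"
      by (rule EL_eq'[OF measurable_P_continuous[OF SI_continuous[OF F]]])
    also have "\<dots> = (LINT x|unit_leb. (\<Sum>m\<in>I. F m x * exp (L x)))" by (simp add: SI_def sum_distrib_right)
    also have "\<dots> = (\<Sum>m\<in>I. LINT x|unit_leb. F m x * exp (L x))"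
      by (intro Bochner_Integration.integral_sum integrable_unit_leb_cont continuous_intros in_block_continuous[OF F] L_continuous)
    also have "\<dots> = 0" using in_block_integral[OF F] by simp
    finally show "(LINT x|P L. SA F x) = 0" by (cases "A2 F") (simp_all add: SA_def)
  qed
  finally show ?thesis by simp
qed

text \<open>A nonnegative variance bounds the square of the conditional mean by the conditional mean
  of the square; Fubini's theorem then leads to the second moments, which \<open>A2\<close>
  restricts.\<close>

lemma T_square: "(LINT x|P L. (T x)\<^sup>2) \<le> \<delta>\<^sup>2 * E\<^sup>2"
proof -
  have b: "\<bar>(SA F x)\<^sup>2\<bar> \<le> \<delta>\<^sup>2" if "F \<in> space \<Pi>0" "x \<in> {0..1}" for F x
    using SA_bound[OF that] \<delta> by (simp add: abs_le_square_iff[symmetric])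
  have int: "integrable (P L \<Otimes>\<^sub>M Q2) (\<lambda>(x, F). (SA F x)\<^sup>2)"
    unfolding case_prod_beta
    by (rule PQ.integrable_const_bound[of _ "\<delta>\<^sup>2"]) (use b in \<open>auto simp: space_pair_measure\<close>)
  have "(LINT x|P L. (T x)\<^sup>2) \<le> (LINT x|P L. LINT F|Q2. (SA F x)\<^sup>2)"
  proof (rule integral_mono)
    show "integrable (P L) (\<lambda>x. (T x)\<^sup>2)"
      by (rule P.integrable_const_bound[of _ "\<delta>\<^sup>2"]) (use T_bound \<delta> in \<open>auto simp: abs_le_square_iff[symmetric]\<close>)
    show "integrable (P L) (\<lambda>x. LINT F|Q2. (SA F x)\<^sup>2)" using PQ.integrable_fst[OF int] by simp
    fix x assume "x \<in> space (P L)"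
    then have x: "x \<in> {0..1}" by simp
    have "0 \<le> Q2.variance (\<lambda>F. SA F x)" by (rule Q2.variance_positive)
    then show "(T x)\<^sup>2 \<le> (LINT F|Q2. (SA F x)\<^sup>2)"
      unfolding T_def Q2.variance_eq[OF SA_integrable[OF x]] by simp
  qed
  also have "\<dots> = (LINT F|Q2. LINT x|P L. (SA F x)\<^sup>2)" by (rule PQ.Fubini_integral[OF int, symmetric])
  also have "\<dots> \<le> (LINT F|Q2. \<delta>\<^sup>2 * E\<^sup>2)"
  proof (rule integral_mono)
    show "integrable Q2 (\<lambda>F. LINT x|P L. (SA F x)\<^sup>2)" using PQ.integrable_snd[OF int] by simp
    show "(LINT x|P L. (SA F x)\<^sup>2) \<le> \<delta>\<^sup>2 * E\<^sup>2" for F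
      by (cases "A2 F") (auto simp: SA_def A2_def QI_def)
  qed simp
  finally show ?thesis by (simp add: Q2.prob_space[unfolded space_Q2])
qed

text \<open>Jensen's inequality through the tangent of \<open>exp\<close> at the mean exponent
  \<open>t\<close>. The tangent can be negative, hence the \<open>max 0\<close> before passing to
  nonnegative integrals.\<close>

lemma den_lower:
  assumes X: "X \<in> space \<X>"
  shows "ennreal (p2 * exp ((\<Sum>i<n. T (X i)) - e2)) \<le> (\<integral>\<^sup>+ F. den X F \<partial>\<Pi>0)"
proof -
  define s where "s F = (\<Sum>i<n. SA F (X i)) - e2" for F
  define t where "t = (\<Sum>i<n. T (X i)) - e2"
  have s [measurable]: "s \<in> borel_measurable Q2"
    unfolding s_def using SA_meas[OF sample_space[OF X]] by (intro borel_measurable_diff borel_measurable_sum) auto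
  have s': "s \<in> borel_measurable \<Pi>0" using s by (simp cong: measurable_cong_sets)
  have si: "integrable Q2 s" unfolding s_def using SA_integrable(1)[OF sample_space[OF X]]
    by (intro Bochner_Integration.integrable_diff Bochner_Integration.integrable_sum) auto
  have st: "Q2.expectation s = t"
  proof -
    have "integrable Q2 (\<lambda>F. \<Sum>i<n. SA F (X i))" using SA_integrable(1)[OF sample_space[OF X]]
      by (intro Bochner_Integration.integrable_sum) auto
    then have "Q2.expectation s = Q2.expectation (\<lambda>F. \<Sum>i<n. SA F (X i)) - e2"
      unfolding s_def by (simp add: Q2.prob_space[unfolded space_Q2])
    also have "Q2.expectation (\<lambda>F. \<Sum>i<n. SA F (X i)) = (\<Sum>i<n. T (X i))"
      unfolding T_def by (rule Bochner_Integration.integral_sum) (use SA_integrable(1)[OF sample_space[OF X]] in auto)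
    finally show ?thesis by (simp add: t_def)
  qed
  have "ennreal (exp t) = ennreal (Q2.expectation (\<lambda>F. exp t * (1 + s F - t)))"
    using si st by (simp add: Q2.prob_space[unfolded space_Q2])
  also have "\<dots> \<le> ennreal (Q2.expectation (\<lambda>F. max 0 (exp t * (1 + s F - t))))"
    using si by (intro ennreal_leI integral_mono integrable_max) auto
  also have "\<dots> = (\<integral>\<^sup>+ F. ennreal (max 0 (exp t * (1 + s F - t))) \<partial>Q2)"
    using si by (intro nn_integral_eq_integral[symmetric] integrable_max) auto
  also have "\<dots> \<le> (\<integral>\<^sup>+ F. ennreal (exp (s F)) \<partial>Q2)"
  proof (intro nn_integral_mono ennreal_leI)
    fix F
    have "exp t * (1 + (s F - t)) \<le> exp t * exp (s F - t)" by (intro mult_left_mono exp_ge_add_one_self) auto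
    then show "max 0 (exp t * (1 + s F - t)) \<le> exp (s F)" by (simp add: exp_add[symmetric] add_diff_eq)
  qed
  also have "\<dots> = (\<integral>\<^sup>+ F. ennreal (exp (s F)) * indicator A2set F \<partial>\<Pi>0) / emeasure \<Pi>0 A2set"
    unfolding Q2_def by (rule nn_integral_uniform_measure) (use s' in auto)
  also have "(\<integral>\<^sup>+ F. ennreal (exp (s F)) * indicator A2set F \<partial>\<Pi>0) = (\<integral>\<^sup>+ F. den X F \<partial>\<Pi>0)"
    by (intro nn_integral_cong) (auto simp: A2set_def den_def s_def SA_def split: split_indicator)
  finally have "ennreal (exp t) * ennreal p2 \<le> (\<integral>\<^sup>+ F. den X F \<partial>\<Pi>0) / ennreal p2 * ennreal p2"
    unfolding p2(2) by (rule mult_right_mono) simp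
  also have "\<dots> = (\<integral>\<^sup>+ F. den X F \<partial>\<Pi>0)"
    unfolding ennreal_divide_times using p2(1) by (simp add: divide_ennreal)
  finally show ?thesis unfolding t_def[symmetric] using p2(1) by (simp add: ennreal_mult mult.commute)
qed

end

text \<open>The right-hand side is the tangent plane at \<open>(U, V)\<close> of the concave
  function on the left. Integrated pointwise, it yields Hoelder's inequality when \<open>U\<close>
  and \<open>V\<close> bound the two means.\<close>

lemma weighted_young:
  fixes u v U V \<alpha> :: real
  assumes "0 < \<alpha>" "\<alpha> < 1" "0 \<le> u" "0 \<le> v" "U > 0" "V > 0"
  shows "u powr \<alpha> * v powr (1 - \<alpha>) \<le> U powr \<alpha> * V powr (1 - \<alpha>) * (\<alpha> / U * u + (1 - \<alpha>) / V * v)"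
proof (cases "u = 0 \<or> v = 0")
  case False
  then have "(u / U) powr \<alpha> * (v / V) powr (1 - \<alpha>) \<le> \<alpha> * (u / U) + (1 - \<alpha>) * (v / V)"
    using assms by (intro Youngs_inequality_0) auto
  then have "U powr \<alpha> * V powr (1 - \<alpha>) * ((u / U) powr \<alpha> * (v / V) powr (1 - \<alpha>)) \<le> U powr \<alpha> * V powr (1 - \<alpha>) * (\<alpha> * (u / U) + (1 - \<alpha>) * (v / V))"
    using assms by (intro mult_left_mono) auto
  moreover have "U powr \<alpha> * V powr (1 - \<alpha>) * ((u / U) powr \<alpha> * (v / V) powr (1 - \<alpha>)) = u powr \<alpha> * v powr (1 - \<alpha>)"
    using assms by (simp add: powr_divide)
  ultimately show ?thesis by simp
qed (use assms in \<open>auto intro!: mult_nonneg_nonneg add_nonneg_nonneg divide_nonneg_pos\<close>)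

text \<open>For \<open>y \<ge> 1\<close> the bound 1 is enough, and for \<open>y < 1\<close> the
  power is larger than \<open>y\<close>.\<close>

lemma min_le_powr:
  fixes y a :: real
  assumes "z \<le> 1" "z \<le> y" "0 \<le> a" "a \<le> 1" "z \<ge> 0"
  shows "z \<le> y powr a"
proof (cases "y \<ge> 1")
  case True
  then show ?thesis using assms ge_one_powr_ge_zero[of y a] by linarith
next
  case False
  have "y \<ge> 0" using assms by linarith
  then have "y powr 1 \<le> y powr a \<or> y = 0" using False assms powr_mono'[of a 1 y] by auto
  then show ?thesis using assms \<open>y \<ge> 0\<close> by auto
qed

section \<open>Hoelder's inequality for the mean posterior\<close>

context active_event begin

definition J :: "(nat \<times> nat) set" where "J = (\<Union>m\<in>I. B m)"

lemma J: "finite J" "J \<subseteq> wav_index l0"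
  using I block_subset by (auto simp: J_def)

text \<open>Any common bound serves: it secures integrability and positive volumes, and no constant
  of the result depends on it.\<close>

definition \<beta> :: real where "\<beta> = (SOME b. \<forall>v\<in>J. \<forall>x\<in>{0..1}. \<bar>cw v x\<bar> \<le> b)"

lemma cw_bound: "v \<in> J \<Longrightarrow> x \<in> {0..1} \<Longrightarrow> \<bar>cw v x\<bar> \<le> \<beta>"
proof -
  have "\<forall>v\<in>J. \<exists>b. \<forall>x\<in>{0..1}. \<bar>cw v x\<bar> \<le> b"
    using continuous_bounded_unit[OF cw_continuous] J(2) by (metis subsetD)
  then obtain b where b: "\<And>v x. v \<in> J \<Longrightarrow> x \<in> {0..1} \<Longrightarrow> \<bar>cw v x\<bar> \<le> b v" by metis
  have "\<bar>cw v x\<bar> \<le> (\<Sum>u\<in>J. \<bar>b u\<bar>)" if "v \<in> J" "x \<in> {0..1}" for v x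
    using b[OF that] member_le_sum[of v J "\<lambda>u. \<bar>b u\<bar>"] that J by (auto intro: order.trans)
  then have "\<exists>b. \<forall>v\<in>J. \<forall>x\<in>{0..1}. \<bar>cw v x\<bar> \<le> b" by blast
  from someI_ex[OF this] show "v \<in> J \<Longrightarrow> x \<in> {0..1} \<Longrightarrow> \<bar>cw v x\<bar> \<le> \<beta>" unfolding \<beta>_def by blast
qed

sublocale sf: shifted_family "P L" J cw \<beta> T \<delta> E bb K_norm n
proof unfold_locales
  show "cw v \<in> borel_measurable (P L)" if "v \<in> J" for v
    using that J by (intro measurable_P_continuous cw_continuous) auto
  show "P.expectation (cw v) = 0" if "v \<in> J" for v
    using EL_eq'[OF measurable_P_continuous[OF cw_continuous[of v]]] integral_cw[of v] that J by auto
  show "\<bar>cw v x\<bar> \<le> \<beta>" if "v \<in> J" "x \<in> space (P L)" for v x using cw_bound that by simp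
  show "9/20 \<le> bb" "bb \<le> 1/2" using curv K_curv_nonneg \<delta> by (auto simp: bb_def)
qed (use J(1) T_bound T_mean T_square \<delta> E(1) K_norm_pos in auto)

sublocale X: prob_space \<X> by (rule prob_space_PiM) (rule P.prob_space_axioms)

lemma coefficients:
  assumes F: "F \<in> space \<Pi>0" and A: "A1 F"
  obtains a where "a \<in> space sf.\<Lambda>" "\<And>x. x \<in> {0..1} \<Longrightarrow> sf.S a x = SI I F x" "sf.Q a = QI I F"
    "sf.near \<delta> a" "sf.near (2 * \<delta>) a" "E\<^sup>2 \<le> sf.Q a" "(\<Sum>v\<in>J. (a v)\<^sup>2) \<le> K_norm * sf.Q a"
proof -
  note FB = in_block_prior[OF F]
  obtain a where a: "a \<in> space (\<Pi>\<^sub>M v\<in>J. lborel)" "\<And>x. x \<in> {0..1} \<Longrightarrow> (\<Sum>m\<in>I. F m x) = (\<Sum>v\<in>J. a v * cw v x)"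
    "(\<Sum>v\<in>J. (a v)\<^sup>2) \<le> (\<Sum>m\<in>I. (norm2 (F m))\<^sup>2)"
    using active_coefficients[OF I(1) FB] unfolding J_def[symmetric] by blast
  have S: "sf.S a x = SI I F x" if "x \<in> {0..1}" for x using a(2)[OF that] by (simp add: sf.S_def SI_def)
  have Q: "sf.Q a = QI I F" unfolding sf.Q_def QI_def by (intro Bochner_Integration.integral_cong refl) (simp add: S)
  have s: "\<bar>sf.S a x\<bar> \<le> \<delta>" if "x \<in> {0..1}" for x
    using sup_le_all[OF FB _ that] A S[OF that] by (simp add: A1_def)
  show thesis
  proof (rule that[of a])
    show "sf.near \<delta> a" "sf.near (2 * \<delta>) a" unfolding sf.near_AE
      using s \<delta> by (auto intro!: AE_I2 intro: order.trans[OF s])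
    show "E\<^sup>2 \<le> sf.Q a" using A Q by (simp add: A1_def)
    show "(\<Sum>v\<in>J. (a v)\<^sup>2) \<le> K_norm * sf.Q a" unfolding Q by (rule order.trans[OF a(3) norm2_QI[OF FB]])
  qed (use a S Q in auto)
qed

text \<open>The logarithm of the surrogate \<open>h\<close>; in terms of coefficients its half is
  the exponent of \<open>sf.H\<close>.\<close>

definition expo :: "sequence \<Rightarrow> (nat \<Rightarrow> real) \<Rightarrow> real" where
  "expo F X = (\<Sum>i<n. SI I F (X i) - T (X i)) - real n * bb * QI I F"

definition moment :: "real \<Rightarrow> (nat \<Rightarrow> real) \<Rightarrow> ennreal" where
  "moment \<theta> X = (\<integral>\<^sup>+ F. (if A1 F then ennreal (exp (\<theta> * expo F X)) else 0) \<partial>\<Pi>0)"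

lemma expo_meas:
  assumes "F \<in> measurable N \<Pi>0" "X \<in> measurable N \<X>"
  shows "(\<lambda>z. expo (F z) (X z)) \<in> borel_measurable N"
proof -
  have c [measurable]: "(\<lambda>z. X z i) \<in> measurable N (P L)" if "i \<in> {..<n}" for i
    by (rule measurable_compose[OF assms(2) measurable_component_singleton[OF that]])
  have Fb: "F \<in> measurable N (blocks UNIV)" by (rule measurable_compose[OF assms(1) prior_id])
  have [measurable]: "(\<lambda>z. SI I (F z) (X z i)) \<in> borel_measurable N" if "i \<in> {..<n}" for i
    by (rule SI_measurable[OF Fb _ c[OF that]]) simp
  have [measurable]: "(\<lambda>z. QI I (F z)) \<in> borel_measurable N" by (rule QI_measurable[OF Fb]) simp
  show ?thesis unfolding expo_def by measurable
qed

lemma integrand_meas [measurable]: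
  "(\<lambda>z. if A1 (fst z) then ennreal (exp (\<theta> * expo (fst z) (snd z))) else 0) \<in> borel_measurable (\<Pi>0 \<Otimes>\<^sub>M \<X>)"
proof -
  have [measurable]: "(\<lambda>z. expo (fst z) (snd z)) \<in> borel_measurable (\<Pi>0 \<Otimes>\<^sub>M \<X>)"
    by (rule expo_meas[OF measurable_fst measurable_snd])
  show ?thesis by measurable
qed

lemma section_meas:
  assumes X: "X \<in> space \<X>"
  shows "(\<lambda>F. if A1 F then ennreal (exp (\<theta> * expo F X)) else 0) \<in> borel_measurable \<Pi>0"
  using measurable_compose[OF measurable_Pair2'[OF X] integrand_meas[of \<theta>]] by (simp only: fst_conv snd_conv)

lemma moment_meas [measurable]: "moment \<theta> \<in> borel_measurable \<X>"
proof -
  have "(\<lambda>(X, F). if A1 F then ennreal (exp (\<theta> * expo F X)) else 0) \<in> borel_measurable (\<X> \<Otimes>\<^sub>M \<Pi>0)"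
    using measurable_compose[OF measurable_pair_swap' integrand_meas[of \<theta>]] by (simp only: case_prod_unfold fst_conv snd_conv)
  then show ?thesis unfolding moment_def by (rule \<Pi>.borel_measurable_nn_integral)
qed

text \<open>After Fubini's theorem the sample moment at a fixed parameter has the bracket
  \<open>\<theta> / 2 * (1 + 3 * \<delta>) * (1 + 13 * \<delta>) - bb\<close> in its exponent.
  Hypothesis \<open>small\<close> makes it nonpositive, so the inner integral is at most 1.\<close>

lemma moment_bound:
  assumes \<theta>: "0 \<le> \<theta>" "\<theta> \<le> 1" and small: "\<theta> / 2 * ((1 + 3 * \<delta>) * (1 + 13 * \<delta>)) \<le> bb"
  shows "(\<integral>\<^sup>+ X. moment \<theta> X \<partial>\<X>) \<le> emeasure \<Pi>0 (A_event \<Pi>0 H I)"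
proof -
  interpret pair_sigma_finite \<Pi>0 \<X> ..
  have "(\<integral>\<^sup>+ X. moment \<theta> X \<partial>\<X>) = (\<integral>\<^sup>+ F. \<integral>\<^sup>+ X. (if A1 F then ennreal (exp (\<theta> * expo F X)) else 0) \<partial>\<X> \<partial>\<Pi>0)"
    unfolding moment_def by (rule Fubini') (simp add: case_prod_beta)
  also have "\<dots> \<le> (\<integral>\<^sup>+ F. indicator (A_event \<Pi>0 H I) F \<partial>\<Pi>0)"
  proof (rule nn_integral_mono)
    fix F assume F: "F \<in> space \<Pi>0"
    show "(\<integral>\<^sup>+ X. (if A1 F then ennreal (exp (\<theta> * expo F X)) else 0) \<partial>\<X>) \<le> indicator (A_event \<Pi>0 H I) F"
    proof (cases "A1 F")
      case True
      obtain a where a: "a \<in> space sf.\<Lambda>" "\<And>x. x \<in> {0..1} \<Longrightarrow> sf.S a x = SI I F x" "sf.Q a = QI I F"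
        "sf.near (2 * \<delta>) a" "E\<^sup>2 \<le> sf.Q a" by (rule coefficients[OF F True]) blast
      have E6: "E\<^sup>2 \<le> 6 * sf.Q a" using a(5) zero_le_power2[of E] by linarith
      have "(\<integral>\<^sup>+ X. ennreal (exp (\<theta> * expo F X)) \<partial>\<X>)
          = (\<integral>\<^sup>+ X. ennreal (exp (\<theta> * ((\<Sum>i<n. sf.S a (X i) - T (X i)) - real n * bb * sf.Q a))) \<partial>\<X>)"
      proof (intro nn_integral_cong)
        fix X assume X: "X \<in> space \<X>"
        have "(\<Sum>i<n. SI I F (X i) - T (X i)) = (\<Sum>i<n. sf.S a (X i) - T (X i))"
          using a(2) sample_space[OF X] by (intro sum.cong) auto
        then show "ennreal (exp (\<theta> * expo F X)) = ennreal (exp (\<theta> * ((\<Sum>i<n. sf.S a (X i) - T (X i)) - real n * bb * sf.Q a)))"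
          by (simp add: expo_def a(3))
      qed
      also have "\<dots> \<le> ennreal (exp (real n * \<theta> * sf.Q a * (\<theta> / 2 * (1 + 3 * \<delta>) * (1 + 13 * \<delta>) - bb)))"
        by (rule sf.moment[OF \<theta> a(4) E6])
      also have "\<dots> \<le> ennreal 1"
      proof (rule ennreal_leI)
        have "real n * \<theta> * sf.Q a * (\<theta> / 2 * (1 + 3 * \<delta>) * (1 + 13 * \<delta>) - bb) \<le> 0"
          using small \<theta> sf.Q_nonneg[of a] by (intro mult_nonneg_nonpos) (auto simp: mult.assoc)
        then show "exp (real n * \<theta> * sf.Q a * (\<theta> / 2 * (1 + 3 * \<delta>) * (1 + 13 * \<delta>) - bb)) \<le> 1" by simp
      qed
      finally show ?thesis using True F by (simp add: A1_def A_event_def)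
    qed simp
  qed
  also have "\<dots> = emeasure \<Pi>0 (A_event \<Pi>0 H I)" by (simp add: A_event_measurable)
  finally show ?thesis .
qed

definition e0 :: real where "e0 = K_curv * \<delta> * real (card I) + e2"

lemma posterior_moment:
  assumes X: "X \<in> space \<X>"
  shows "posterior n L \<Pi>0 (target H I \<delta>) X \<le> ennreal (exp e0 / p2) * moment 1 X"
proof -
  define t where "t = (\<Sum>i<n. T (X i))"
  define k where "k = exp (K_curv * \<delta> * real (card I) + t)"
  define d where "d = p2 * exp (t - e2)"
  have d: "d > 0" using p2(1) by (simp add: d_def)
  have "posterior n L \<Pi>0 (target H I \<delta>) X \<le> (\<integral>\<^sup>+ F. num X F \<partial>\<Pi>0) / ennreal d"
    by (rule posterior_le_ratio[OF X]) (use den_lower[OF X] d in \<open>auto simp: d_def t_def ennreal_eq_0_iff\<close>)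
  also have "(\<integral>\<^sup>+ F. num X F \<partial>\<Pi>0) = (\<integral>\<^sup>+ F. ennreal k * (if A1 F then ennreal (exp (1 * expo F X)) else 0) \<partial>\<Pi>0)"
  proof (rule nn_integral_cong)
    fix F
    have "exp ((\<Sum>i<n. SI I F (X i)) - real n * bb * QI I F + K_curv * \<delta> * real (card I)) = k * exp (expo F X)"
      unfolding k_def exp_add[symmetric] expo_def t_def sum_subtractf by (simp add: algebra_simps)
    then show "num X F = ennreal k * (if A1 F then ennreal (exp (1 * expo F X)) else 0)"
      by (simp add: num_def ennreal_mult k_def)
  qed
  also have "\<dots> = ennreal k * moment 1 X"
    unfolding moment_def by (rule nn_integral_cmult[OF section_meas[OF X]])
  also have "\<dots> / ennreal d = ennreal (k / d) * moment 1 X"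
    using d by (simp add: divide_ennreal[symmetric] k_def ennreal_divide_times ennreal_times_divide mult.commute)
  also have "k / d = exp e0 / p2"
    unfolding k_def d_def e0_def by (simp add: exp_add exp_diff field_simps)
  finally show ?thesis .
qed

text \<open>Of the factorization of \<open>h\<close> into powers \<open>b\<close> and
  \<open>1 - b\<close>, the first is the power \<open>2 * b\<close> of \<open>sf.H\<close>, which
  \<open>v\<close> bounds uniformly.\<close>

lemma moment_split:
  assumes X: "X \<in> space \<X>" and v: "v \<ge> 0" and \<beta>': "0 \<le> b"
    and V: "\<And>a. a \<in> space sf.\<Lambda> \<Longrightarrow> sf.near \<delta> a \<Longrightarrow> E\<^sup>2 \<le> sf.Q a \<Longrightarrow> (\<Sum>v\<in>J. (a v)\<^sup>2) \<le> K_norm * sf.Q a \<Longrightarrow> sf.H a X \<le> v"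
  shows "moment 1 X \<le> ennreal (v powr (2 * b)) * moment (1 - b) X"
proof -
  have "moment 1 X \<le> (\<integral>\<^sup>+ F. ennreal (v powr (2 * b)) * (if A1 F then ennreal (exp ((1 - b) * expo F X)) else 0) \<partial>\<Pi>0)"
    unfolding moment_def
  proof (rule nn_integral_mono)
    fix F assume F: "F \<in> space \<Pi>0"
    show "(if A1 F then ennreal (exp (1 * expo F X)) else 0) \<le> ennreal (v powr (2 * b)) * (if A1 F then ennreal (exp ((1 - b) * expo F X)) else 0)"
    proof (cases "A1 F")
      case True
      obtain a where a: "a \<in> space sf.\<Lambda>" "\<And>x. x \<in> {0..1} \<Longrightarrow> sf.S a x = SI I F x" "sf.Q a = QI I F"
        "sf.near \<delta> a" "E\<^sup>2 \<le> sf.Q a" "(\<Sum>v\<in>J. (a v)\<^sup>2) \<le> K_norm * sf.Q a" by (rule coefficients[OF F True]) blast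
      have "(\<Sum>i<n. SI I F (X i) - T (X i)) = (\<Sum>i<n. sf.S a (X i) - T (X i))"
        using a(2) sample_space[OF X] by (intro sum.cong) auto
      then have "sf.H a X = exp (expo F X / 2)" by (simp add: sf.H_def expo_def a(3))
      then have "exp (expo F X / 2) \<le> v" using V[OF a(1,4,5,6)] by simp
      then have "exp (expo F X / 2) powr (2 * b) \<le> v powr (2 * b)" using \<beta>' by (intro powr_mono2) auto
      then have "exp (b * expo F X) \<le> v powr (2 * b)" by (simp add: powr_def mult_ac)
      then have "exp (b * expo F X) * exp ((1 - b) * expo F X) \<le> v powr (2 * b) * exp ((1 - b) * expo F X)"
        by (intro mult_right_mono) auto
      then have "exp (expo F X) \<le> v powr (2 * b) * exp ((1 - b) * expo F X)"
        by (simp add: exp_add[symmetric] algebra_simps)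
      from ennreal_leI[OF this] True show ?thesis by (simp add: ennreal_mult)
    qed simp
  qed
  also have "\<dots> = ennreal (v powr (2 * b)) * moment (1 - b) X"
    unfolding moment_def by (rule nn_integral_cmult[OF section_meas[OF X]])
  finally show ?thesis .
qed

definition x\<^sub>0 :: real where "x\<^sub>0 = exp (- real n * E\<^sup>2 / 25)"

lemma mean_posterior_bound:
  assumes \<alpha>: "0 < \<alpha>" "\<alpha> \<le> 1/2" "(17 + 2 * K_curv) * \<delta> \<le> \<alpha> / 2"
    and U: "emeasure \<Pi>0 (A_event \<Pi>0 H I) = ennreal U" "U > 0"
  shows "mean_posterior n L \<Pi>0 (target H I \<delta>)
    \<le> ennreal ((exp e0 / p2) powr (1 - \<alpha>) * ((17 ^ card J * (x\<^sub>0 / (1 - x\<^sub>0))) powr \<alpha> * U powr (1 - \<alpha>)))"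
proof -
  \<comment> \<open>Chosen so that, after raising to the power \<open>1 - \<alpha>\<close>, the
    supremum carries exactly the power \<open>2 * b * (1 - \<alpha>) = \<alpha>\<close> that
    Hoelder's inequality pairs with \<open>1 - \<alpha>\<close>.\<close>
  define b where "b = \<alpha> / (2 * (1 - \<alpha>))"
  have b: "\<alpha> / 2 \<le> b" "0 \<le> b" "b \<le> 1" "2 * b * (1 - \<alpha>) = \<alpha>"
    using \<alpha> unfolding b_def by (auto simp: field_simps)
  have x0: "0 < x\<^sub>0" "x\<^sub>0 < 1" unfolding x\<^sub>0_def using n E(1) by auto
  define W where "W = 17 ^ card J * (x\<^sub>0 / (1 - x\<^sub>0))"
  have W: "W > 0" using x0 by (simp add: W_def)
  define k where "k = exp e0 / p2"
  have k: "k > 0" using p2(1) by (simp add: k_def)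
  obtain V where V: "V \<in> borel_measurable \<X>" "(\<integral>\<^sup>+ X. V X \<partial>\<X>) \<le> ennreal W"
    "\<And>a X. a \<in> space sf.\<Lambda> \<Longrightarrow> sf.near \<delta> a \<Longrightarrow> E\<^sup>2 \<le> sf.Q a \<Longrightarrow> (\<Sum>v\<in>J. (a v)\<^sup>2) \<le> K_norm * sf.Q a \<Longrightarrow> X \<in> space \<X> \<Longrightarrow> ennreal (sf.H a X) \<le> V X"
    by (rule sf.sup_exponential[OF n]) (unfold W_def x\<^sub>0_def, blast)
  \<comment> \<open>The reduction by \<open>b\<close> has to outweigh \<open>17 * \<delta>\<close>
    from the moment bound and the \<open>2 * K_curv * \<delta>\<close> by which
    \<open>2 * bb\<close> falls short of 1; since \<open>b \<ge> \<alpha> / 2\<close>, the third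
    hypothesis on \<open>\<alpha>\<close> suffices.\<close>
  have small: "(1 - b) / 2 * ((1 + 3 * \<delta>) * (1 + 13 * \<delta>)) \<le> bb"
  proof -
    have dd: "\<delta> * \<delta> \<le> \<delta> * (1/100)" using \<delta> by (intro mult_left_mono) auto
    have "(1 + 3 * \<delta>) * (1 + 13 * \<delta>) \<le> 1 + 17 * \<delta>" using dd \<delta> by (simp add: algebra_simps)
    then have "(1 - b) / 2 * ((1 + 3 * \<delta>) * (1 + 13 * \<delta>)) \<le> (1 - b) / 2 * (1 + 17 * \<delta>)" using b by (intro mult_left_mono) auto
    also have "\<dots> \<le> (1 + 17 * \<delta> - b) / 2"
    proof -
      have "(1 - b) * (1 + 17 * \<delta>) = 1 + 17 * \<delta> - b - 17 * (b * \<delta>)" by (simp add: algebra_simps)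
      then show ?thesis using mult_nonneg_nonneg[OF b(2), of \<delta>] \<delta> by simp
    qed
    also have "\<dots> \<le> bb"
    proof -
      have "17 * \<delta> + 2 * (K_curv * \<delta>) \<le> b" using \<alpha>(3) b(1) by (simp add: distrib_right)
      then show ?thesis unfolding bb_def by simp
    qed
    finally show ?thesis .
  qed
  define Z where "Z = moment (1 - b)"
  have ZU: "(\<integral>\<^sup>+ X. Z X \<partial>\<X>) \<le> ennreal U"
    unfolding Z_def U(1)[symmetric] by (rule moment_bound) (use b small in auto)
  have Zm [measurable]: "Z \<in> borel_measurable \<X>" unfolding Z_def by simp
  note V(1) [measurable]
  define K where "K = k powr (1 - \<alpha>) * (W powr \<alpha> * U powr (1 - \<alpha>))"
  have K: "K > 0" using k W U by (simp add: K_def)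
  have pt: "posterior n L \<Pi>0 (target H I \<delta>) X
      \<le> ennreal K * (ennreal (\<alpha> / W) * V X + ennreal ((1 - \<alpha>) / U) * Z X)" if X: "X \<in> space \<X>" for X
  proof (cases "V X = \<infinity> \<or> Z X = \<infinity>")
    case True
    have "ennreal (\<alpha> / W) * V X + ennreal ((1 - \<alpha>) / U) * Z X = \<infinity>"
      using True \<alpha> W U(2) by (auto simp: ennreal_mult_top)
    then show ?thesis using K by (simp only:) (simp add: ennreal_mult_top)
  next
    case False
    then obtain v z where v: "V X = ennreal v" "v \<ge> 0" and z: "Z X = ennreal z" "z \<ge> 0"
      by (metis ennreal_cases infinity_ennreal_def)
    define post where "post = posterior n L \<Pi>0 (target H I \<delta>) X"
    have p1: "post \<le> 1" unfolding post_def by (rule posterior_le_one[OF X])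
    have "post \<le> ennreal k * moment 1 X" unfolding post_def k_def by (rule posterior_moment[OF X])
    also have "\<dots> \<le> ennreal k * (ennreal (v powr (2 * b)) * Z X)"
      unfolding Z_def
      by (intro mult_left_mono moment_split[OF X v(2) b(2)]) (use V(3)[OF _ _ _ _ X] v in auto)
    also have "\<dots> = ennreal (k * (v powr (2 * b) * z))"
      using k z by (simp add: ennreal_mult)
    finally have p: "post \<le> ennreal (k * (v powr (2 * b) * z))" .
    obtain q where q: "post = ennreal q" "q \<ge> 0" using p1 by (metis ennreal_cases ennreal_one_neq_top top_unique)
    have q1: "q \<le> 1" using p1 q by (simp add: ennreal_le_1)
    have q2: "q \<le> k * (v powr (2 * b) * z)" using p q k z by simp
    have "q \<le> (k * (v powr (2 * b) * z)) powr (1 - \<alpha>)"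
      by (rule min_le_powr[OF q1 q2]) (use \<alpha> q in auto)
    also have "\<dots> = k powr (1 - \<alpha>) * (v powr \<alpha> * z powr (1 - \<alpha>))"
      using k z b(4) by (simp add: powr_mult powr_powr)
    also have "\<dots> \<le> k powr (1 - \<alpha>) * (W powr \<alpha> * U powr (1 - \<alpha>) * (\<alpha> / W * v + (1 - \<alpha>) / U * z))"
      using \<alpha> v z W U by (intro mult_left_mono weighted_young) auto
    also have "\<dots> = K * (\<alpha> / W * v + (1 - \<alpha>) / U * z)" by (simp add: K_def)
    finally have "ennreal q \<le> ennreal (K * (\<alpha> / W * v + (1 - \<alpha>) / U * z))" by (rule ennreal_leI)
    also have "\<dots> = ennreal K * (ennreal (\<alpha> / W) * V X + ennreal ((1 - \<alpha>) / U) * Z X)"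
      unfolding v(1) z(1) using K \<alpha> W U(2) v(2) z(2)
      by (simp add: ennreal_mult[symmetric] ennreal_plus[symmetric] del: ennreal_plus)
    finally show ?thesis unfolding post_def[symmetric] q(1) .
  qed
  have "mean_posterior n L \<Pi>0 (target H I \<delta>)
      \<le> (\<integral>\<^sup>+ X. ennreal K * (ennreal (\<alpha> / W) * V X + ennreal ((1 - \<alpha>) / U) * Z X) \<partial>\<X>)"
    unfolding mean_posterior_def by (rule nn_integral_mono[OF pt])
  also have "\<dots> = ennreal K * (ennreal (\<alpha> / W) * (\<integral>\<^sup>+ X. V X \<partial>\<X>) + ennreal ((1 - \<alpha>) / U) * (\<integral>\<^sup>+ X. Z X \<partial>\<X>))"
    by (simp add: nn_integral_cmult nn_integral_add)
  also have "\<dots> \<le> ennreal K * (ennreal (\<alpha> / W) * ennreal W + ennreal ((1 - \<alpha>) / U) * ennreal U)"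
    by (intro mult_left_mono add_mono V(2) ZU) auto
  also have "\<dots> = ennreal K"
  proof -
    have "ennreal (\<alpha> / W) * ennreal W + ennreal ((1 - \<alpha>) / U) * ennreal U = ennreal \<alpha> + ennreal (1 - \<alpha>)"
      using \<alpha> W U(2) by (simp add: ennreal_mult[symmetric])
    also have "\<dots> = 1" using \<alpha> by (simp add: ennreal_plus[symmetric] del: ennreal_plus)
    finally show ?thesis by simp
  qed
  finally show ?thesis unfolding K_def k_def W_def .
qed

end

section \<open>Comparison with the stated bound\<close>

lemma post_bound_finite:
  assumes "n \<ge> 1" "c2 > 0" "c1 > 0" "E > 0" "\<rho> \<ge> 0" "0 < \<alpha>" "\<alpha> < 1" "0 < \<delta>" and N: "N \<ge> 0"
  shows "post_bound c1 c2 n J0 \<delta> \<alpha> (ennreal E) (ennreal N) (ennreal \<rho>) =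
    ennreal ((3 * exp (c1 * 2 ^ J0 * N - c2 * real n * E\<^sup>2) powr \<alpha> / (1 - exp (- (c2 * real n * E\<^sup>2))) powr (2 * \<alpha>) * \<rho> powr (1 - \<alpha>)) powr (1 / (1 + 2 * \<delta>)))"
proof -
  define z where "z = c2 * real n * E\<^sup>2"
  have z: "z > 0" using assms by (simp add: z_def)
  have e1: "enn2ereal (ennreal (c2 * real n) * (ennreal E)\<^sup>2) = ereal z"
    using assms by (simp add: ennreal_power ennreal_mult[symmetric] z_def enn2ereal_ennreal)
  have e2: "enn2ereal (ennreal (c1 * 2 ^ J0) * ennreal N) = ereal (c1 * 2 ^ J0 * N)"
    using assms N by (simp add: ennreal_mult[symmetric] enn2ereal_ennreal)
  have a: "eexp (- ereal z + ereal (c1 * 2 ^ J0 * N)) = ennreal (exp (c1 * 2 ^ J0 * N - z))" by (simp add: eexp_def)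
  have b: "1 - eexp (- ereal z) = ennreal (1 - exp (- z))"
    using z by (simp add: eexp_def ennreal_minus flip: ennreal_1)
  have ep: "epowr (ennreal x) a = ennreal (x powr a)" if "x \<ge> 0" for x a using that by (simp add: epowr_def)
  have d: "(1 - exp (- z)) powr (2 * \<alpha>) > 0" using z by simp
  have three: "(3 :: ennreal) = ennreal 3" by simp
  show ?thesis
    unfolding post_bound_def e1 e2 a b using z assms(5) d unfolding three
    by (simp add: ep divide_ennreal ennreal_mult[symmetric] z_def[symmetric] del: ennreal_numeral)
qed

lemma post_bound_infinite:
  assumes r: "r \<noteq> 0" and c1: "c1 > 0" and \<alpha>: "\<alpha> < 1"
  shows "post_bound c1 c2 n J0 \<delta> \<alpha> E \<infinity> r = \<infinity>"
proof -
  have N: "ennreal (c1 * 2 ^ J0) * \<infinity> = \<infinity>" using c1 by (simp add: ennreal_mult_top)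
  \<comment> \<open>In \<open>ereal\<close> minus infinity plus infinity is plus infinity, so the
    exponential is infinite even when \<open>n * E\<^sup>2\<close> is.\<close>
  have A: "eexp (- enn2ereal (ennreal (c2 * real n) * E\<^sup>2) + enn2ereal (ennreal (c1 * 2 ^ J0) * \<infinity>)) = \<infinity>"
    unfolding N by (simp add: eexp_def)
  define d where "d = epowr (1 - eexp (- enn2ereal (ennreal (c2 * real n) * E\<^sup>2))) (2 * \<alpha>)"
  have "1 - eexp (- enn2ereal (ennreal (c2 * real n) * E\<^sup>2)) \<noteq> \<infinity>"
    by (simp add: ennreal_minus_eq_top)
  then have d: "d \<noteq> \<infinity>" by (simp add: d_def epowr_def)
  have e: "epowr r (1 - \<alpha>) \<noteq> 0"
    using r by (auto simp: epowr_def ennreal_eq_0_iff enn2real_eq_0_iff not_le)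
  have "3 * epowr \<infinity> \<alpha> / d * epowr r (1 - \<alpha>) = \<infinity>"
    using d e by (simp add: epowr_def ennreal_mult_top ennreal_top_mult ennreal_top_divide)
  then show ?thesis unfolding post_bound_def A d_def[symmetric] by (simp add: epowr_def)
qed

context prior_model begin

lemma posterior_null:
  assumes "emeasure \<Pi>0 (A_event \<Pi>0 H I) = 0 \<or> space \<Pi>0 \<inter> S_set w L B H I = {}"
  shows "mean_posterior n L \<Pi>0 (target H I \<delta>) = 0"
proof -
  have ae: "AE F in \<Pi>0. F \<notin> S_set w L B H I"
    using assms
  proof
    assume "emeasure \<Pi>0 (A_event \<Pi>0 H I) = 0"
    then have "A_event \<Pi>0 H I \<in> null_sets \<Pi>0" using A_event_measurable by auto
    then have "AE F in \<Pi>0. F \<notin> A_event \<Pi>0 H I" by (rule AE_not_in)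
    then show ?thesis using AE_space by eventually_elim (auto simp: A_event_def S_set_def)
  qed (auto intro: AE_I2)
  have "posterior n L \<Pi>0 (target H I \<delta>) X = 0" for X
  proof -
    have "(\<integral>\<^sup>+ F. indicator (target H I \<delta>) F * ennreal (likelihood n L X F) \<partial>\<Pi>0) = (\<integral>\<^sup>+ F. 0 \<partial>\<Pi>0)"
      by (rule nn_integral_cong_AE) (use ae in eventually_elim, auto)
    then show ?thesis by (simp add: posterior_def)
  qed
  then show ?thesis by (simp add: mean_posterior_def)
qed

lemma E_inf_finite:
  assumes "finite I" "F \<in> S_set w L B H I"
  shows "E_inf w L B H I < \<infinity>"
proof -
  have F: "in_block m (F m)" for m
    using assms(2) space_blocks[of F UNIV m] by (simp add: S_set_def param_space_def blocks_def)
  have "E_inf w L B H I \<le> epowr (second_moment L I F) (1/2)"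
    unfolding E_inf_def by (rule INF_lower[OF assms(2)])
  also have "\<dots> < \<infinity>" unfolding second_moment_finite[OF assms(1) F] by (simp add: epowr_def)
  finally show ?thesis .
qed

end

context active_event begin

lemma contraction_bound:
  assumes \<alpha>: "0 < \<alpha>" "\<alpha> \<le> 1/2" "256 * K_curv * \<delta> \<le> \<alpha>"
  shows "mean_posterior n L \<Pi>0 (target H I \<delta>)
    \<le> post_bound 21 (1/50) n J0 \<delta> \<alpha> (E_inf w L B H I) (emeasure (count_space UNIV) I)
        (emeasure \<Pi>0 (A_event \<Pi>0 H I) / emeasure \<Pi>0 (A_tilde_event w L B \<Pi>0 H \<delta> I))"
proof (cases "emeasure \<Pi>0 (A_event \<Pi>0 H I) = 0")
  case True
  show ?thesis unfolding posterior_null[OF disjI1[OF True]] by simp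
next
  case False
  define U where "U = \<Pi>.prob (A_event \<Pi>0 H I)"
  have U: "emeasure \<Pi>0 (A_event \<Pi>0 H I) = ennreal U" by (simp add: U_def \<Pi>.emeasure_eq_measure)
  have U0: "U > 0" using False unfolding U by (simp add: ennreal_eq_0_iff not_le)
  define p where "p = \<Pi>.prob (A_tilde_event w L B \<Pi>0 H \<delta> I)"
  have p: "emeasure \<Pi>0 (A_tilde_event w L B \<Pi>0 H \<delta> I) = ennreal p" by (simp add: p_def \<Pi>.emeasure_eq_measure)
  have p0: "p > 0" "p \<le> p2" using tilde tilde_le p2(1) unfolding p p2(2) by auto
  define N where "N = real (card I)"
  define K where "K = K_curv * \<delta>"
  have K: "K \<ge> 0" "256 * K \<le> \<alpha>" using K_curv_nonneg \<delta> \<alpha>(3) by (auto simp: K_def mult.assoc)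
  have J1: "1 \<le> (2::real) ^ J0" by simp
  have N0: "N \<ge> 0" by (simp add: N_def)
  define nE where "nE = real n * E\<^sup>2"
  have nE: "nE > 0" using n E(1) by (simp add: nE_def)
  define y where "y = exp (- (1/50 * real n * E\<^sup>2))"
  define G where "G = exp (21 * 2 ^ J0 * N - 1/50 * real n * E\<^sup>2)"
  have y: "y = exp (- nE / 50)" by (simp add: y_def nE_def)
  have y1: "0 < y" "y < 1" using nE by (auto simp: y)
  have x: "x\<^sub>0 = exp (- nE / 25)" "0 < x\<^sub>0" by (simp_all add: x\<^sub>0_def nE_def)
  have xy: "x\<^sub>0 \<le> y" using nE by (simp add: x y)
  define bd where "bd = 3 * G powr \<alpha> / (1 - y) powr (2 * \<alpha>) * (U / p) powr (1 - \<alpha>)"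
  define cst where "cst = (exp e0 / p2) powr (1 - \<alpha>) * ((17 ^ card J * (x\<^sub>0 / (1 - x\<^sub>0))) powr \<alpha> * U powr (1 - \<alpha>))"
  have small: "(17 + 2 * K_curv) * \<delta> \<le> \<alpha> / 2"
  proof -
    have "6 * \<delta> \<le> K_curv * \<delta>" using K_curv_nonneg \<delta> by (intro mult_right_mono) auto
    then show ?thesis using K unfolding K_def distrib_right mult.assoc by linarith
  qed
  have m1: "mean_posterior n L \<Pi>0 (target H I \<delta>) \<le> ennreal cst"
    unfolding cst_def by (rule mean_posterior_bound[OF \<alpha>(1,2) small U U0])
  have "mean_posterior n L \<Pi>0 (target H I \<delta>) \<le> (\<integral>\<^sup>+ X. 1 \<partial>\<X>)"
    unfolding mean_posterior_def by (intro nn_integral_mono posterior_le_one)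
  then have m2: "mean_posterior n L \<Pi>0 (target H I \<delta>) \<le> 1" by (simp add: X.emeasure_space_1)
  have cb: "cst \<le> bd"
  proof -
    \<comment> \<open>\<open>17 \<le> 2 ^ 5 \<le> exp 5\<close> together with
      \<open>card J \<le> 4 * 2 ^ J0 * card I\<close> gives the 20.\<close>
    have s17: "(17::real) ^ card J \<le> exp (20 * 2 ^ J0 * N)"
    proof -
      have e2: "(2::real) \<le> exp 1" using exp_ge_add_one_self[of 1] by simp
      have "(17::real) \<le> 2 ^ 5" by simp
      also have "\<dots> \<le> exp 1 ^ 5" by (rule power_mono[OF e2]) simp
      also have "\<dots> = exp 5" by (simp add: exp_of_nat_mult[symmetric])
      finally have "(17::real) ^ card J \<le> exp 5 ^ card J" by (intro power_mono) auto
      also have "\<dots> = exp (5 * real (card J))" by (simp add: exp_of_nat_mult[symmetric] mult.commute)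
      also have "\<dots> \<le> exp (20 * 2 ^ J0 * N)"
      proof -
        have "real (card J) \<le> real (card I * 2 ^ (J0 + 2))"
          unfolding J_def of_nat_le_iff by (rule card_active[OF I(1)])
        then show ?thesis by (simp add: N_def mult_ac)
      qed
      finally show ?thesis .
    qed
    have e0: "e0 = K * (nE + 2 * N)" by (simp add: e0_def e2_def K_def nE_def N_def algebra_simps)
    have main: "exp ((1 - \<alpha>) * e0) * (17 ^ card J * x\<^sub>0) powr \<alpha> \<le> G powr \<alpha>"
    proof -
      have "(17 ^ card J * x\<^sub>0) powr \<alpha> \<le> (exp (20 * 2 ^ J0 * N) * x\<^sub>0) powr \<alpha>"
        using \<alpha> x s17 by (intro powr_mono2 mult_right_mono) auto
      also have "\<dots> = exp (\<alpha> * (20 * 2 ^ J0 * N - nE / 25))"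
        unfolding x exp_add[symmetric] by (simp add: powr_def mult.commute)
      finally have "exp ((1 - \<alpha>) * e0) * (17 ^ card J * x\<^sub>0) powr \<alpha> \<le> exp ((1 - \<alpha>) * e0) * exp (\<alpha> * (20 * 2 ^ J0 * N - nE / 25))"
        by (intro mult_left_mono) auto
      also have "\<dots> = exp ((1 - \<alpha>) * e0 + \<alpha> * (20 * 2 ^ J0 * N - nE / 25))" by (simp only: exp_add)
      \<comment> \<open>By the hypothesis on \<open>\<alpha>\<close> the errors \<open>e0\<close>
        are at most \<open>\<alpha> / 256 * (nE + 2 * N)\<close>. They fit into the gap between 1/25
        and 1/50 and into one more \<open>2 ^ J0 * N\<close>, whence 21.\<close>
      also have "\<dots> \<le> exp (\<alpha> * (21 * 2 ^ J0 * N - nE / 50))"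
      proof -
        have "(1 - \<alpha>) * e0 \<le> 1 * e0" using \<alpha> K nE N0 unfolding e0 by (intro mult_right_mono mult_nonneg_nonneg) auto
        also have "1 * e0 \<le> \<alpha> / 256 * (nE + 2 * N)" unfolding e0 using K nE N0 by (auto intro!: mult_right_mono)
        also have "\<dots> \<le> \<alpha> * (nE / 50 + 2 ^ J0 * N)"
        proof -
          have "N \<le> 2 ^ J0 * N" using mult_right_mono[OF J1 N0] by simp
          moreover have "(nE + 2 * N) / 256 \<le> nE / 50 + N" using nE N0 by simp
          ultimately have "(nE + 2 * N) / 256 \<le> nE / 50 + 2 ^ J0 * N" by (rule order.trans[OF _ add_left_mono, rotated])
          from mult_left_mono[OF this, of \<alpha>] \<alpha> show ?thesis by simp
        qed
        finally show ?thesis unfolding exp_le_cancel_iff by (simp add: algebra_simps)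
      qed
      also have "\<dots> = G powr \<alpha>" unfolding G_def nE_def by (simp add: powr_def)
      finally show ?thesis .
    qed
    have den: "(1 - y) powr (2 * \<alpha>) \<le> (1 - x\<^sub>0) powr \<alpha>"
    proof -
      have "(1 - y) powr (2 * \<alpha>) \<le> (1 - y) powr \<alpha>" using y1 \<alpha> by (intro powr_mono') auto
      also have "\<dots> \<le> (1 - x\<^sub>0) powr \<alpha>" using xy y1 \<alpha> by (intro powr_mono2) auto
      finally show ?thesis .
    qed
    have "cst = (exp ((1 - \<alpha>) * e0) * (17 ^ card J * x\<^sub>0) powr \<alpha>) / (1 - x\<^sub>0) powr \<alpha> * (U / p2) powr (1 - \<alpha>)"
      unfolding cst_def using p2(1) U0 x xy y1
      by (simp add: powr_divide powr_mult exp_powr_real mult_ac)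
    also have "\<dots> \<le> G powr \<alpha> / (1 - y) powr (2 * \<alpha>) * (U / p) powr (1 - \<alpha>)"
    proof (rule mult_mono)
      show "(exp ((1 - \<alpha>) * e0) * (17 ^ card J * x\<^sub>0) powr \<alpha>) / (1 - x\<^sub>0) powr \<alpha> \<le> G powr \<alpha> / (1 - y) powr (2 * \<alpha>)"
        by (rule frac_le[OF _ main _ den]) (use y1 in auto)
      show "(U / p2) powr (1 - \<alpha>) \<le> (U / p) powr (1 - \<alpha>)"
        using U0 p0 p2(1) \<alpha> by (intro powr_mono2 divide_left_mono) auto
    qed auto
    also have "\<dots> \<le> 3 * (G powr \<alpha> / (1 - y) powr (2 * \<alpha>) * (U / p) powr (1 - \<alpha>))"
    proof -
      have "q \<le> 3 * q" if "q \<ge> 0" for q :: real using that by simp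
      then show ?thesis by (metis divide_nonneg_nonneg mult_nonneg_nonneg powr_ge_zero)
    qed
    finally show ?thesis by (simp add: bd_def)
  qed
  obtain q where q: "mean_posterior n L \<Pi>0 (target H I \<delta>) = ennreal q" "q \<ge> 0"
    using m2 by (metis ennreal_cases ennreal_one_neq_top top_unique)
  have cst0: "cst \<ge> 0" by (simp add: cst_def)
  have "q \<le> 1" "q \<le> cst" using m1 m2 q cst0 by (simp_all add: ennreal_le_1)
  \<comment> \<open>The mean posterior is at most 1, so the exponent
    \<open>1 / (1 + 2 * \<delta>) \<le> 1\<close> may be put on its bound.\<close>
  then have "q \<le> bd powr (1 / (1 + 2 * \<delta>))"
    using cb q(2) \<delta> by (intro min_le_powr) auto
  then have "ennreal q \<le> ennreal (bd powr (1 / (1 + 2 * \<delta>)))" by (rule ennreal_leI)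
  moreover have "emeasure (count_space UNIV) I = ennreal N" using I(1) by (simp add: N_def ennreal_of_nat_eq_real_of_nat)
  moreover have "ennreal U / ennreal p = ennreal (U / p)" using U0 p0 by (simp add: divide_ennreal)
  moreover have "post_bound 21 (1/50) n J0 \<delta> \<alpha> (ennreal E) (ennreal N) (ennreal (U / p)) = ennreal (bd powr (1 / (1 + 2 * \<delta>)))"
    unfolding bd_def G_def y_def by (rule post_bound_finite) (use n E(1) U0 p0 \<alpha> \<delta> N0 in auto)
  ultimately show ?thesis by (simp only: q(1) E(2) U p)
qed

end

text \<open>\<open>4 * s + 2\<close> secures \<open>jn \<ge> J0\<close>; the squares are the two
  lower bounds on \<open>sqrt K1\<close> in \<open>polynomial_gain\<close>.\<close>

definition sample_const :: "real \<Rightarrow> real \<Rightarrow> real" where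
  "sample_const s K3 = max (max 1 (4 * s + 2)) (max (((\<bar>ln K3\<bar> + s + 4) * (4 * (s + 1) / s))\<^sup>2)
     ((6 * (4 * s + 2) / (if s > 1/2 then regularity s - 1/2 else s))\<^sup>2))"

lemma sqrt_ge_of_square: "a \<ge> 0 \<Longrightarrow> a\<^sup>2 \<le> b \<Longrightarrow> a \<le> sqrt b"
  using real_le_rsqrt by blast

text \<open>\<open>K_curv\<close> written out in \<open>M\<close>, \<open>D\<close>,
  \<open>\<sigma>\<close> and the rate constant, so that it is available before \<open>L\<close>,
  \<open>J0\<close>, \<open>n\<close> and the prior are fixed.\<close>

definition curv_const :: "real \<Rightarrow> real \<Rightarrow> real \<Rightarrow> real \<Rightarrow> real" where
  "curv_const M D \<sigma> C = 6 + 8 * ((168 * M ^ 6 * D\<^sup>2 + 48 * M ^ 3 * D * (3 * M\<^sup>2 * geo (1/2)))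
     * ((3 * D + 36 * D * M\<^sup>2 * geo2 \<sigma>) * C) * (4 * D\<^sup>2 + (1 + 64 * M ^ 6 * D\<^sup>2) * D + 1))"

definition rate_const :: "real \<Rightarrow> real" where
  "rate_const s = (if s > 1/2 then 2 * (geo (1/2) + geo (regularity s - 1/2) + geo (s + regularity s))
     else 2 * (geo (s/2) + geo (2 * s) + geo s))"

lemma rate_const_nonneg: "s > 0 \<Longrightarrow> rate_const s \<ge> 0"
proof -
  assume s: "s > 0"
  have g: "geo c \<ge> 0" if "c > 0" for c using geo_pos[OF that] by simp
  show ?thesis
    unfolding rate_const_def regularity_def using s by (auto intro!: add_nonneg_nonneg g)
qed

context prior_model begin

text \<open>Verifies the abstract rate conditions for the actual thresholds. An empty
  \<open>S_set\<close> makes \<open>E_inf\<close> infinite and is treated apart: the posterior mass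
  is then 0.\<close>

lemma finite_case:
  fixes s K0 K1 K2 K3 K4 \<delta> \<Gamma> \<gamma> \<xi> \<alpha> :: real and n :: nat and jn :: int and I :: "nat set"
  defines "H \<equiv> threshold \<Gamma> \<gamma> \<xi> n s jn (level J0 e)" and "K \<equiv> curv_const M D \<sigma> (rate_const s)"
  assumes s: "s > 0" and \<sigma>: "\<sigma> = regularity s" and K3: "K3 > 0"
    and K0: "K0 \<ge> 2 / (\<sigma> / 2 * ln 2)" and K1: "K1 \<ge> sample_const s K3" and K2: "K2 \<ge> 1"
    and A: "assumption_A K0 K1 K2 K3 K4 J0 n \<delta> \<Gamma> \<gamma> \<xi>" and jn: "is_jn \<Gamma> \<gamma> n s jn"
    and pos: "0 < \<delta>" "\<Gamma> > 0" "\<gamma> > 0" "\<xi> > 1" and \<delta>: "\<delta> \<le> 1/100" "K * \<delta> \<le> 1/20"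
    and tilde: "emeasure \<Pi>0 (A_tilde_event w L B \<Pi>0 H \<delta> I) > 0" and E: "E_inf w L B H I > 0"
    and I: "finite I" "I \<noteq> {}" and \<alpha>: "0 < \<alpha>" "\<alpha> \<le> 1/2" "256 * K * \<delta> \<le> \<alpha>"
  shows "mean_posterior n L \<Pi>0 (target H I \<delta>)
    \<le> post_bound 21 (1/50) n J0 \<delta> \<alpha> (E_inf w L B H I) (emeasure (count_space UNIV) I)
        (emeasure \<Pi>0 (A_event \<Pi>0 H I) / emeasure \<Pi>0 (A_tilde_event w L B \<Pi>0 H \<delta> I))"
proof (cases "S_set w L B H I = {}")
  case True
  then have "space \<Pi>0 \<inter> S_set w L B H I = {}" by simp
  from posterior_null[OF disjI2[OF this]] show ?thesis by simp
next
  case False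
  then obtain F where "F \<in> S_set w L B H I" by blast
  from E_inf_finite[OF I(1) this] obtain E' where E': "E_inf w L B H I = ennreal E'" "E' > 0"
    using E by (cases "E_inf w L B H I") (auto simp: less_top)
  have \<delta>1: "\<delta> \<le> 1" using \<delta> by simp
  have K11: "K1 \<ge> 1" "K1 \<ge> 4 * s + 2" using K1 by (auto simp: sample_const_def)
  have A': "real J0 \<ge> K0 * Max {1, ln (1 / \<delta>), ln \<gamma>}" "ln (real n) \<ge> K1 * Max {2 ^ J0, 1 / \<delta>\<^sup>2, ln \<Gamma>, ln \<gamma>, ln \<xi>}"
    "\<xi> \<ge> K2 * (1 / \<delta>) * max 1 \<gamma> * 2 ^ J0" "\<gamma> \<ge> K3 * max 1 (1 / \<delta>)"
    using A unfolding assumption_A_def by auto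
  have sample: "ln (real n) \<ge> K1 * t" if "t \<in> {2 ^ J0, 1 / \<delta>\<^sup>2, ln \<Gamma>, ln \<gamma>, ln \<xi>}" for t
    by (rule order.trans[OF mult_left_mono[OF Max_ge[OF _ that]] A'(2)]) (use K11 in auto)
  have gK3: "\<gamma> \<ge> K3" using A'(4) mult_left_mono[OF max.cobounded1, of K3 1 "1 / \<delta>"] K3 by linarith
  interpret ss: sample_size s K1 K3 \<delta> \<Gamma> \<gamma> \<xi> n J0 jn
    by unfold_locales (use s K3 pos \<delta>1 jn K11(1) sample[of "1 / \<delta>\<^sup>2"] sample gK3 in auto)
  define c where "c = (if s > 1/2 then regularity s - 1/2 else s)"
  have c: "c > 0" using s by (auto simp: c_def regularity_def)
  have q1: "(\<bar>ln K3\<bar> + s + 4) * (4 * (s + 1) / s) \<le> sqrt K1"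
    using K1 s unfolding sample_const_def by (intro sqrt_ge_of_square) auto
  have q2: "6 * (4 * s + 2) / c \<le> sqrt K1"
    using K1 s c unfolding sample_const_def c_def[symmetric] by (intro sqrt_ge_of_square) auto
  have n1: "n \<ge> 1" using ss.n_pos by simp
  have jn0: "jn \<ge> int J0"
  proof -
    have "real J0 \<le> 2 ^ J0" using of_nat_less_two_power[of J0] by (simp add: less_imp_le)
    then have "(4 * s + 2) * real J0 \<le> K1 * 2 ^ J0" using K11 s by (intro mult_mono) auto
    also have "\<dots> \<le> ss.y" unfolding ss.y_def by (rule sample) simp
    finally have "real J0 \<le> ss.y / (4 * s + 2)" using s by (simp add: field_simps)
    also have "\<dots> \<le> of_int jn * ln 2" by (rule ss.jn_large[OF q1])
    finally have a: "real J0 \<le> of_int jn * ln 2" .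
    have "real J0 * ln 2 \<le> real J0" using ln_2_less_1 by (intro mult_left_le) auto
    then have "real J0 * ln 2 \<le> of_int jn * ln 2" using a by linarith
    then have "real J0 \<le> of_int jn" by simp
    then show ?thesis by linarith
  qed
  define \<kappa> where "\<kappa> = (if 0 \<in> I then 1 / \<xi> else 1)"
  interpret tr: threshold_rates s K1 K3 \<delta> \<Gamma> \<gamma> \<xi> n J0 jn \<kappa>
  proof unfold_locales
    show "1 / \<xi> \<le> \<kappa>" "\<kappa> \<le> 1" using pos by (auto simp: \<kappa>_def)
    show "ss.W * 2 powr (- (if s > 1/2 then regularity s - 1/2 else s) * of_int jn) \<le> 1"
      using ss.polynomial_gain[OF q1 q2 c] unfolding c_def .
    show "max 1 \<gamma> * 2 powr (- (regularity s / 2) * real J0) \<le> \<delta>"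
      by (rule level_gain[OF A'(1)]) (use K0 regularity(1)[OF s] pos \<delta>1 in \<open>auto simp: \<sigma>\<close>)
  qed (use jn0 in auto)
  have kd: "max 1 \<gamma> * 2 ^ J0 * \<kappa> \<le> \<delta>" if "0 \<in> I"
  proof -
    have "1 * ((1 / \<delta>) * max 1 \<gamma> * 2 ^ J0) \<le> K2 * ((1 / \<delta>) * max 1 \<gamma> * 2 ^ J0)"
      using K2 pos by (intro mult_right_mono) auto
    then have "(1 / \<delta>) * max 1 \<gamma> * 2 ^ J0 \<le> \<xi>" using A'(3) by (simp add: mult.assoc)
    then have "max 1 \<gamma> * 2 ^ J0 \<le> \<xi> * \<delta>" using pos by (simp add: field_simps)
    then show ?thesis using that pos by (simp add: \<kappa>_def divide_le_eq mult.commute)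
  qed
  define C where "C = (3 * D + 36 * D * M\<^sup>2 * geo2 \<sigma>) * rate_const s"
  have geo2: "geo2 \<sigma> \<ge> 0" using geo_pos[of \<sigma>] geo_pos[of "1 - \<sigma>"] regularity(1)[OF s] regularity(2)[of s] unfolding geo2_def \<sigma> by (simp add: less_imp_le)
  have amp1: "3 * D + 36 * D * M\<^sup>2 * geo2 \<sigma> \<ge> 0" using D geo2 by simp
  have amp: "amp \<gamma> \<le> (3 * D + 36 * D * M\<^sup>2 * geo2 \<sigma>) * max 1 \<gamma>"
  proof -
    have "3 * D * 1 \<le> 3 * D * max 1 \<gamma>" using D by (intro mult_left_mono) auto
    moreover have "36 * D * M\<^sup>2 * geo2 \<sigma> * \<gamma> \<le> 36 * D * M\<^sup>2 * geo2 \<sigma> * max 1 \<gamma>" using D geo2 by (intro mult_left_mono) auto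
    ultimately show ?thesis unfolding amp_def distrib_right by simp
  qed
  have Crate: "tr.C_rate = rate_const s" by (simp add: tr.C_rate_def rate_const_def)
  have transfer: "amp \<gamma> * q \<le> C * \<delta> * t" if "max 1 \<gamma> * q \<le> tr.C_rate * \<delta> * t" "q \<ge> 0" for q t
  proof -
    have "amp \<gamma> * q \<le> ((3 * D + 36 * D * M\<^sup>2 * geo2 \<sigma>) * max 1 \<gamma>) * q" by (rule mult_right_mono[OF amp that(2)])
    also have "\<dots> = (3 * D + 36 * D * M\<^sup>2 * geo2 \<sigma>) * (max 1 \<gamma> * q)" by (simp only: mult.assoc)
    also have "\<dots> \<le> (3 * D + 36 * D * M\<^sup>2 * geo2 \<sigma>) * (tr.C_rate * \<delta> * t)" by (rule mult_left_mono[OF that(1) amp1])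
    finally show ?thesis by (simp only: C_def Crate mult.assoc)
  qed
  have H_eq: "H I m = tr.hl (level J0 e m)" if "m \<noteq> 0 \<or> 0 \<notin> I" for m
    unfolding H_def threshold_def tr.hl_def unfolding \<kappa>_def using that by auto
  have H_0: "H I 0 = \<Gamma> * rate n s (int J0)" if "0 \<in> I"
    using that jn0 by (simp add: H_def threshold_def level_def)
  interpret ct: contraction l0 w M L D \<sigma> J0 e \<Pi>0 H I tr.hl \<gamma> \<delta> C n
  proof unfold_locales
    show "C \<ge> 0" unfolding C_def using amp1 rate_const_nonneg[OF s] by simp
    show "H I m \<ge> 0" for m
      using H_eq[of m] H_0 tr.hl_nonneg tr.rate_nonneg pos by (cases "m \<noteq> 0 \<or> 0 \<notin> I") auto
    show "H I m = tr.hl (level J0 e m)" if "m \<notin> I" for m using that by (intro H_eq) auto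
    show "tr.hl i \<ge> 0" for i by (rule tr.hl_nonneg)
    show "tr.hl i \<le> \<gamma> * 2 powr (- (\<sigma> + 1/2) * real i)" if "J0 \<le> i" for i
    proof -
      have "- (s + 1/2) * real i \<le> - (\<sigma> + 1/2) * real i"
        using regularity(3)[of s] \<sigma> by (intro mult_right_mono) auto
      then have "\<gamma> * 2 powr (- (s + 1/2) * real i) \<le> \<gamma> * 2 powr (- (\<sigma> + 1/2) * real i)"
        using pos by (intro mult_left_mono powr_mono) auto
      then show ?thesis using tr.hl_le[of i] by linarith
    qed
    show "amp \<gamma> * Q_high tr.hl N (fst (e m)) \<le> C * \<delta> * (H I m + 1 / sqrt (real n))" if m: "m \<in> I" "m \<ge> 1" for m N
    proof (rule transfer)
      have "H I m = tr.hl (fst (e m))" using H_eq[of m] m by (simp add: level_def)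
      then show "max 1 \<gamma> * Q_high tr.hl N (fst (e m)) \<le> tr.C_rate * \<delta> * (H I m + 1 / sqrt (real n))"
        using tr.high_rate[OF e_high[OF m(2)], of N] unfolding Q_high_def unfolding \<sigma> tr.r_def by simp
      show "Q_high tr.hl N (fst (e m)) \<ge> 0" unfolding Q_high_def using tr.hl_nonneg by (intro sum_nonneg mult_nonneg_nonneg) auto
    qed
    show "amp \<gamma> * (2 powr (real J0 / 2) * Q_low tr.hl N) \<le> C * \<delta> * (H I 0 + 1 / sqrt (real n))" if 0: "0 \<in> I" for N
    proof (rule transfer)
      show "max 1 \<gamma> * (2 powr (real J0 / 2) * Q_low tr.hl N) \<le> tr.C_rate * \<delta> * (H I 0 + 1 / sqrt (real n))"
        using tr.low_rate[OF kd[OF 0], of N] unfolding Q_low_def unfolding \<sigma> tr.r_def H_0[OF 0] .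
      show "2 powr (real J0 / 2) * Q_low tr.hl N \<ge> 0" unfolding Q_low_def using tr.hl_nonneg by (intro sum_nonneg mult_nonneg_nonneg) auto
    qed
  qed (use I pos \<delta> n1 in auto)
  have Kc: "ct.K_curv = K"
    unfolding ct.K_curv_def ct.K_bias_def ct.K_norm_def K_key_def K_low_def K_def curv_const_def unfolding C_def by (rule refl)
  interpret ae: active_event l0 w M L D \<sigma> J0 e \<Pi>0 H I tr.hl \<gamma> \<delta> C n E'
    by unfold_locales (use E' tilde \<delta> Kc in auto)
  show ?thesis by (rule ae.contraction_bound[OF \<alpha>(1,2)]) (use \<alpha>(3) Kc in simp)
qed

end

theorem theorem3p1:
  fixes w :: "nat \<times> nat \<Rightarrow> real \<Rightarrow> real" and S l0 :: nat and R s K3 K4 :: real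
  assumes basis: "cdv_basis S l0 w"
    and R: "R > 0" and s: "0 < s" "s \<le> real S"
    and K: "K3 > 0" "K4 > 0"
  shows "\<exists>k0>0. \<exists>k1>0. \<exists>k2>0. \<forall>K0\<ge>k0. \<forall>K1\<ge>k1. \<forall>K2\<ge>k2.
    \<exists>c0>0. \<exists>c1>0. \<exists>c2>0. \<exists>\<delta>0>0.
      \<forall>(L :: real \<Rightarrow> real) (J0 :: nat) (e :: nat \<Rightarrow> nat \<times> nat) (n :: nat)
        (\<delta> :: real) (\<Gamma> :: real) (\<gamma> :: real) (\<xi> :: real) (jn :: int)
        (\<Pi>0 :: (nat \<Rightarrow> real \<Rightarrow> real) measure)
        (B :: nat \<Rightarrow> (nat \<times> nat) set) (H :: nat set \<Rightarrow> nat \<Rightarrow> real).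
        L \<in> Sigma_class l0 w R s \<longrightarrow>
        (\<forall>(j, k) \<in> wav_index l0. j > J0 \<longrightarrow> ip (\<lambda>_. 1) (w (j, k)) = 0) \<longrightarrow>
        lex_enum l0 J0 e \<longrightarrow>
        B = block l0 J0 e \<longrightarrow>
        0 < \<delta> \<longrightarrow> \<delta> \<le> 1 \<longrightarrow> \<Gamma> > 0 \<longrightarrow> \<gamma> > 0 \<longrightarrow> \<xi> > 1 \<longrightarrow>
        is_jn \<Gamma> \<gamma> n s jn \<longrightarrow>
        H = threshold \<Gamma> \<gamma> \<xi> n s jn (level J0 e) \<longrightarrow>
        assumption_A K0 K1 K2 K3 K4 J0 n \<delta> \<Gamma> \<gamma> \<xi> \<longrightarrow>
        is_prior w L B \<Pi>0 \<longrightarrow>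
        indep_blocks w L B \<Pi>0 \<longrightarrow>
        (\<forall>I. I \<noteq> {} \<longrightarrow> emeasure \<Pi>0 (A_tilde_event w L B \<Pi>0 H \<delta> I) > 0 \<and> E_inf w L B H I > 0) \<longrightarrow>
        \<delta> \<le> \<delta>0 \<longrightarrow>
        (\<forall>\<alpha>. 512 * c0 * \<delta> / (1 + 512 * c0 * \<delta>) < \<alpha> \<longrightarrow> \<alpha> \<le> 1/2 \<longrightarrow>
          (\<forall>I. I \<noteq> {} \<longrightarrow>
            mean_posterior n L \<Pi>0 (C_star w L B \<delta> \<inter> S_set w L B H I)
              \<le> post_bound c1 c2 n J0 \<delta> \<alpha> (E_inf w L B H I) (emeasure (count_space UNIV) I)
                  (emeasure \<Pi>0 (A_event \<Pi>0 H I) / emeasure \<Pi>0 (A_tilde_event w L B \<Pi>0 H \<delta> I))))"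
proof -
  define \<sigma> where "\<sigma> = regularity s"
  have \<sigma>: "0 < \<sigma>" "\<sigma> < 1" "\<sigma> \<le> s" using regularity[of s] s by (auto simp: \<sigma>_def)
  have "S \<ge> 1" using s by (cases S) auto
  with cdv_basis_wavelets[OF basis] obtain M where "wavelets l0 w M" by blast
  then interpret W: wavelets l0 w M .
  obtain D where D: "D \<ge> 1" and DL: "\<And>L. L \<in> Sigma_class l0 w R s \<Longrightarrow> continuous_on {0..1} L \<and>
      (\<forall>x\<in>{0..1}. 1 / D \<le> exp (L x) \<and> exp (L x) \<le> D) \<and> holder \<sigma> D (\<lambda>x. exp (L x))"
    using W.density_bounds[OF \<sigma> R] by blast
  define K where "K = curv_const M D \<sigma> (rate_const s)"
  have geo2: "geo2 \<sigma> \<ge> 0" using geo_pos[of \<sigma>] geo_pos[of "1 - \<sigma>"] \<sigma> unfolding geo2_def by (simp add: less_imp_le)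
  have K6: "K \<ge> 6"
    unfolding K_def curv_const_def using D W.M geo2 rate_const_nonneg[OF s(1)] geo_pos[of "1/2"] by simp
  show ?thesis
  \<comment> \<open>\<open>c0\<close> is the curvature constant \<open>K\<close>, and the choice of
    \<open>\<delta>0\<close> yields \<open>\<delta> \<le> 1/100\<close> and
    \<open>K * \<delta> \<le> 1/20\<close>, the latter meaning \<open>bb \<ge> 9/20\<close>.\<close>
  proof (rule exI[of _ "2 / (\<sigma> / 2 * ln 2)"], rule conjI, use \<sigma> in simp, rule exI[of _ "sample_const s K3"], rule conjI,
      simp add: sample_const_def less_max_iff_disj, rule exI[of _ 1], rule conjI, simp, intro allI impI,
      rule exI[of _ K], rule conjI, use K6 in simp, rule exI[of _ 21], rule conjI, simp, rule exI[of _ "1/50"], rule conjI, simp,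
      rule exI[of _ "min (1/100) (1 / (20 * K))"], rule conjI, use K6 in simp, intro allI impI)
    fix K0 K1 K2 :: real and L :: "real \<Rightarrow> real" and J0 :: nat and e :: "nat \<Rightarrow> nat \<times> nat" and n :: nat and \<delta> \<Gamma> \<gamma> \<xi> :: real and jn :: int
      and \<Pi>0 :: "(nat \<Rightarrow> real \<Rightarrow> real) measure" and B :: "nat \<Rightarrow> (nat \<times> nat) set" and H :: "nat set \<Rightarrow> nat \<Rightarrow> real" and \<alpha> :: real and I :: "nat set"
    assume K012: "K0 \<ge> 2 / (\<sigma> / 2 * ln 2)" "K1 \<ge> sample_const s K3" "K2 \<ge> 1"
      and L: "L \<in> Sigma_class l0 w R s" and van: "\<forall>(j, k) \<in> wav_index l0. j > J0 \<longrightarrow> ip (\<lambda>_. 1) (w (j, k)) = 0"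
      and lex: "lex_enum l0 J0 e" and B: "B = block l0 J0 e" and pos: "0 < \<delta>" "\<delta> \<le> 1" "\<Gamma> > 0" "\<gamma> > 0" "\<xi> > 1"
      and jn: "is_jn \<Gamma> \<gamma> n s jn" and H: "H = threshold \<Gamma> \<gamma> \<xi> n s jn (level J0 e)"
      and A: "assumption_A K0 K1 K2 K3 K4 J0 n \<delta> \<Gamma> \<gamma> \<xi>" and prior: "is_prior w L B \<Pi>0" and indep: "indep_blocks w L B \<Pi>0"
      and ne: "\<forall>I. I \<noteq> {} \<longrightarrow> emeasure \<Pi>0 (A_tilde_event w L B \<Pi>0 H \<delta> I) > 0 \<and> E_inf w L B H I > 0"
      and \<delta>: "\<delta> \<le> min (1/100) (1 / (20 * K))" and \<alpha>: "512 * K * \<delta> / (1 + 512 * K * \<delta>) < \<alpha>" "\<alpha> \<le> 1/2" and I: "I \<noteq> {}"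
    note DLL = DL[OF L]
    interpret prior_model l0 w M L D \<sigma> J0 e \<Pi>0
    proof unfold_locales
      show "(LINT x|unit_leb. exp (L x)) = 1" using L by (simp add: Sigma_class_def)
      show "ip (\<lambda>_. 1) (w v) = 0" if "v \<in> wav_index l0" "J0 < fst v" for v using van that by (cases v) auto
      show "is_prior w L (block l0 J0 e) \<Pi>0" "indep_blocks w L (block l0 J0 e) \<Pi>0" using prior indep by (simp_all add: B)
    qed (use \<sigma> D DLL lex in auto)
    \<comment> \<open>From \<open>\<alpha> \<le> 1/2\<close> follows \<open>z < 1\<close>, and then
      \<open>z / (1 + z) \<ge> z / 2\<close>; so the hypothesis on \<open>\<alpha>\<close> gives
      \<open>256 * K * \<delta> < \<alpha>\<close>, half of the 512 being lost here.\<close>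
    define z where "z = 512 * K * \<delta>"
    have z: "z > 0" using K6 pos by (simp add: z_def)
    have "z / (1 + z) < 1/2" using \<alpha> unfolding z_def by linarith
    then have z1: "z < 1" using z by (simp add: divide_less_eq)
    have "z / 2 \<le> z / (1 + z)" using z z1 by (intro divide_left_mono) auto
    then have az: "z / 2 < \<alpha>" using \<alpha>(1) unfolding z_def by linarith
    have a0: "0 < \<alpha>" "256 * K * \<delta> \<le> \<alpha>" using az z by (auto simp: z_def)
    have Kd: "K * \<delta> \<le> 1/20"
    proof -
      have "\<delta> \<le> 1 / (20 * K)" using \<delta> by simp
      then show ?thesis using K6 by (simp add: field_simps)
    qed
    note neI = ne[rule_format, OF I]
    show "mean_posterior n L \<Pi>0 (C_star w L B \<delta> \<inter> S_set w L B H I)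
            \<le> post_bound 21 (1/50) n J0 \<delta> \<alpha> (E_inf w L B H I) (emeasure (count_space UNIV) I)
                (emeasure \<Pi>0 (A_event \<Pi>0 H I) / emeasure \<Pi>0 (A_tilde_event w L B \<Pi>0 H \<delta> I))"
    proof (cases "finite I")
      case True
      show ?thesis unfolding B H
        by (rule finite_case[OF s(1) \<sigma>_def K(1) K012 A jn pos(1,3,4,5) _ _ _ _ True I a0(1) \<alpha>(2)])
           (use \<delta> Kd neI a0 in \<open>auto simp: K_def B H\<close>)
    next
      case False
      show ?thesis
      proof (cases "emeasure \<Pi>0 (A_event \<Pi>0 H I) = 0")
        case True
        show ?thesis unfolding B posterior_null[OF disjI1[OF True]] by simp
      next
        case nz: False
        have "emeasure \<Pi>0 (A_event \<Pi>0 H I) / emeasure \<Pi>0 (A_tilde_event w L B \<Pi>0 H \<delta> I) \<noteq> 0"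
          using nz by (simp add: \<Pi>.emeasure_eq_measure)
        from post_bound_infinite[OF this, of 21 \<alpha>] \<alpha>(2) show ?thesis using False by simp
      qed
    qed
  qed
qed

end
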